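(* Let $k$ be a field of characteristic zero and let $R$ be a commutative affine $k$-algebra equipped with a $k$-linear derivation $\delta$. If the $\delta$-rational prime $\delta$-ideals of $(R,\delta)$ are all $\delta$-locally-closed, then the rational prime ideals of $R[x;\delta]$ are all locally closed. In particular, if the $\delta$-DME holds for $(R,\delta)$ then the DME holds for $R[x;\delta]$.
   Context: An affine $k$-algebra is a finitely generated commutative $k$-algebra that is an integral domain. $R[x;\delta]$ is the ring extension of $R$ that is a free left $R$-module with basis $\{x^n:n\ge 0\}$ and in which $xr=rx+\delta(r)$ for all $r\in R$. A $\delta$-ideal is an ideal $I$ with $\delta(I)\subseteq I$. For a prime $\delta$-ideal $P$ of $R$: $P$ is $\delta$-primitive if there is a maximal ideal $\mathfrak m$ of $R$ such that $P$ is maximal among the prime $\delta$-ideals contained in $\mathfrak m$; $P$ is $\delta$-locally-closed if the intersection of all prime $\delta$-ideals of $R$ that properly contain $P$ is a proper extension of $P$; $P$ is $\delta$-rational if the field of constants $\operatorname{Frac}(R/P)^\delta$ is contained in $k^{\mathrm{alg}}$. The $\delta$-DME holds for $(R,\delta)$ if these three properties are equivalent for every prime $\delta$-ideal of $R$. For a two-sided prime ideal $P$ of a noetherian associative $k$-algebra $A$: $P$ is primitive if it is the annihilator of a simple left $A$-module; $P$ is locally closed if the intersection of all prime ideals of $A$ properly containing $P$ is a proper extension of $P$; $P$ is rational if the centre of the Goldie quotient ring $\operatorname{Frac}(A/P)$ is an algebraic field extension of $k$. The DME (Dixmier-Moeglin equivalence) holds for $A$ if these three properties are equivalent for every prime ideal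 of $A$. (Empty intersections are the whole ring.) *)

theory Defs
  imports "HOL-Algebra.Algebra"
begin

section \<open>Associative algebras\<close>

text \<open>The library locale \<^locale>\<open>algebra\<close> covers commutative algebras only.\<close>

locale assoc_algebra = module K A + ring A
  for K and A (structure) +
  assumes smult_mult_left:
      "\<lbrakk>c \<in> carrier K; a \<in> carrier A; b \<in> carrier A\<rbrakk>
        \<Longrightarrow> (c \<odot> a) \<otimes> b = c \<odot> (a \<otimes> b)"
    and smult_mult_right:
      "\<lbrakk>c \<in> carrier K; a \<in> carrier A; b \<in> carrier A\<rbrakk>
        \<Longrightarrow> a \<otimes> (c \<odot> b) = c \<odot> (a \<otimes> b)"

definition char_zero :: "('k, 'm) ring_scheme \<Rightarrow> bool" where
  "char_zero K \<longleftrightarrow> (\<forall>n::nat. n > 0 \<longrightarrow> add_pow K n \<one>\<^bsub>K\<^esub> \<noteq> \<zero>\<^bsub>K\<^esub>)"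

definition scalars :: "('k, 'm) ring_scheme \<Rightarrow> ('k, 'a, 'n) module_scheme \<Rightarrow> 'a set" where
  "scalars K A = (\<lambda>c. c \<odot>\<^bsub>A\<^esub> \<one>\<^bsub>A\<^esub>) ` carrier K"

definition affine_algebra :: "('k, 'm) ring_scheme \<Rightarrow> ('k, 'a, 'n) module_scheme \<Rightarrow> bool" where
  "affine_algebra K R \<longleftrightarrow> algebra K R \<and> domain R \<and>
     (\<exists>S. finite S \<and> S \<subseteq> carrier R \<and> generate_ring R (scalars K R \<union> S) = carrier R)"

definition derivation ::
  "('k, 'm) ring_scheme \<Rightarrow> ('k, 'a, 'n) module_scheme \<Rightarrow> ('a \<Rightarrow> 'a) \<Rightarrow> bool" where
  "derivation K R \<delta> \<longleftrightarrow> \<delta> \<in> carrier R \<rightarrow> carrier R \<and>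
     (\<forall>a \<in> carrier R. \<forall>b \<in> carrier R. \<delta> (a \<oplus>\<^bsub>R\<^esub> b) = \<delta> a \<oplus>\<^bsub>R\<^esub> \<delta> b) \<and>
     (\<forall>a \<in> carrier R. \<forall>b \<in> carrier R. \<delta> (a \<otimes>\<^bsub>R\<^esub> b) = a \<otimes>\<^bsub>R\<^esub> \<delta> b \<oplus>\<^bsub>R\<^esub> \<delta> a \<otimes>\<^bsub>R\<^esub> b) \<and>
     (\<forall>c \<in> carrier K. \<forall>a \<in> carrier R. \<delta> (c \<odot>\<^bsub>R\<^esub> a) = c \<odot>\<^bsub>R\<^esub> \<delta> a)"

text \<open>
  \<open>A\<close> is a realisation of \<open>R[x;\<delta>]\<close>, with \<open>\<iota>\<close> the inclusion of \<open>R\<close>. The set \<^term>\<open>up R\<close>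
  consists of the finitely supported sequences in \<open>R\<close>, so the bijectivity condition says
  that the powers of \<open>x\<close> form a basis of \<open>A\<close> as a left \<open>R\<close>-module; in particular \<open>\<iota>\<close> is
  injective. These conditions determine \<open>A\<close> up to isomorphism; a realisation is constructed
  below in \<open>ore_extension_exists\<close>.
\<close>

definition ore_extension ::
  "('k, 'm) ring_scheme \<Rightarrow> ('k, 'a, 'n) module_scheme \<Rightarrow> ('a \<Rightarrow> 'a) \<Rightarrow>
   ('k, 'b, 'p) module_scheme \<Rightarrow> ('a \<Rightarrow> 'b) \<Rightarrow> 'b \<Rightarrow> bool" where
  "ore_extension K R \<delta> A \<iota> x \<longleftrightarrow>
     assoc_algebra K A \<and> \<iota> \<in> ring_hom R A \<and>
     (\<forall>c \<in> carrier K. \<forall>r \<in> carrier R. \<iota> (c \<odot>\<^bsub>R\<^esub> r) = c \<odot>\<^bsub>A\<^esub> \<iota> r) \<and>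
     x \<in> carrier A \<and>
     bij_betw (\<lambda>f. \<Oplus>\<^bsub>A\<^esub>n \<in> {n. f n \<noteq> \<zero>\<^bsub>R\<^esub>}. \<iota> (f n) \<otimes>\<^bsub>A\<^esub> x [^]\<^bsub>A\<^esub> n) (up R) (carrier A) \<and>
     (\<forall>r \<in> carrier R. x \<otimes>\<^bsub>A\<^esub> \<iota> r = \<iota> r \<otimes>\<^bsub>A\<^esub> x \<oplus>\<^bsub>A\<^esub> \<iota> (\<delta> r))"


subsection \<open>Existence\<close>

text \<open>
  A realisation on the finitely supported sequences: \<open>skew_shift\<close> is left multiplication by
  \<open>x\<close>, that is \<open>x (r x\<^sup>n) = r x\<^sup>n\<^sup>+\<^sup>1 + \<delta> r x\<^sup>n\<close>.
\<close>

definition skew_shift :: "('a, 'n) ring_scheme \<Rightarrow> ('a \<Rightarrow> 'a) \<Rightarrow> (nat \<Rightarrow> 'a) \<Rightarrow> nat \<Rightarrow> 'a" where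
  "skew_shift R \<delta> p = (\<lambda>n. \<delta> (p n) \<oplus>\<^bsub>R\<^esub> (if n = 0 then \<zero>\<^bsub>R\<^esub> else p (n - 1)))"

definition skew_poly ::
  "('k, 'a, 'n) module_scheme \<Rightarrow> ('a \<Rightarrow> 'a) \<Rightarrow> ('k, nat \<Rightarrow> 'a) module" where
  "skew_poly R \<delta> = \<lparr>
     carrier = up R,
     monoid.mult = (\<lambda>p q n. \<Oplus>\<^bsub>R\<^esub>i \<in> {i. p i \<noteq> \<zero>\<^bsub>R\<^esub>}. p i \<otimes>\<^bsub>R\<^esub> (skew_shift R \<delta> ^^ i) q n),
     one = (\<lambda>n. if n = 0 then \<one>\<^bsub>R\<^esub> else \<zero>\<^bsub>R\<^esub>),
     ring.zero = (\<lambda>n. \<zero>\<^bsub>R\<^esub>),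
     ring.add = (\<lambda>p q n. p n \<oplus>\<^bsub>R\<^esub> q n),
     smult = (\<lambda>c p n. c \<odot>\<^bsub>R\<^esub> p n)\<rparr>"

locale diff_algebra = M?: cring R + algebra K R
  for K :: "('k, 'm) ring_scheme" and R :: "('k, 'a, 'n) module_scheme" (structure) +
  fixes \<delta> :: "'a \<Rightarrow> 'a"
  assumes deriv: "derivation K R \<delta>"
begin

abbreviation "D \<equiv> skew_shift R \<delta>"
abbreviation "Q \<equiv> skew_poly R \<delta>"

lemma d_closed [simp, intro]: "a \<in> carrier R \<Longrightarrow> \<delta> a \<in> carrier R"
  and d_add: "a \<in> carrier R \<Longrightarrow> b \<in> carrier R \<Longrightarrow> \<delta> (a \<oplus> b) = \<delta> a \<oplus> \<delta> b"
  and d_mult: "a \<in> carrier R \<Longrightarrow> b \<in> carrier R \<Longrightarrow> \<delta> (a \<otimes> b) = a \<otimes> \<delta> b \<oplus> \<delta> a \<otimes> b"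
  and d_smult: "c \<in> carrier K \<Longrightarrow> a \<in> carrier R \<Longrightarrow> \<delta> (c \<odot> a) = c \<odot> \<delta> a"
  using deriv unfolding derivation_def by auto

lemma d_zero [simp]: "\<delta> \<zero> = \<zero>"
  by (metis M.add.r_cancel_one M.r_zero M.zero_closed d_add d_closed)

lemma d_one [simp]: "\<delta> \<one> = \<zero>"
  by (metis M.add.r_cancel_one M.one_closed M.r_one M.l_one d_mult d_closed)

lemma D_closed [simp, intro]: "p \<in> up R \<Longrightarrow> D p \<in> up R"
proof -
  assume p: "p \<in> up R"
  then obtain n where "bound \<zero> n p" by auto
  then have "bound \<zero> (Suc n) (D p)" using p
    by (auto simp: skew_shift_def bound_def)
  moreover have "D p n \<in> carrier R" for n
    using p by (auto simp: skew_shift_def mem_upD)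
  ultimately show ?thesis by auto
qed

lemma Di_closed [simp, intro]: "p \<in> up R \<Longrightarrow> (D ^^ i) p \<in> up R"
  by (induction i) auto

lemma Di_val [simp, intro]: "p \<in> up R \<Longrightarrow> (D ^^ i) p n \<in> carrier R"
  by (meson Di_closed mem_upD)

lemma up_lincomb:
  "p \<in> up R \<Longrightarrow> q \<in> up R \<Longrightarrow> (\<lambda>n. p n \<oplus> q n) \<in> up R"
  "a \<in> carrier R \<Longrightarrow> p \<in> up R \<Longrightarrow> (\<lambda>n. a \<otimes> p n) \<in> up R"
  using M.up_add_closed M.up_smult_closed by auto

lemma D_add: "p \<in> up R \<Longrightarrow> q \<in> up R \<Longrightarrow> D (\<lambda>n. p n \<oplus> q n) = (\<lambda>n. D p n \<oplus> D q n)"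
  by (auto simp: skew_shift_def fun_eq_iff d_add mem_upD M.a_ac)

lemma D_scale: "a \<in> carrier R \<Longrightarrow> p \<in> up R \<Longrightarrow>
    D (\<lambda>n. a \<otimes> p n) = (\<lambda>n. a \<otimes> D p n \<oplus> \<delta> a \<otimes> p n)"
  by (auto simp: skew_shift_def fun_eq_iff d_mult mem_upD M.a_ac M.r_distr)

lemma Di_add: "p \<in> up R \<Longrightarrow> q \<in> up R \<Longrightarrow>
    (D ^^ i) (\<lambda>n. p n \<oplus> q n) = (\<lambda>n. (D ^^ i) p n \<oplus> (D ^^ i) q n)"
  by (induction i) (simp_all add: D_add)

definition act :: "nat \<Rightarrow> (nat \<Rightarrow> 'a) \<Rightarrow> (nat \<Rightarrow> 'a) \<Rightarrow> nat \<Rightarrow> 'a" where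
  "act N p q = (\<lambda>n. \<Oplus>i \<in> {..<N}. p i \<otimes> (D ^^ i) q n)"

lemma act_0: "act 0 p q = (\<lambda>n. \<zero>)" by (simp add: act_def)

lemma act_Suc: "p \<in> UNIV \<rightarrow> carrier R \<Longrightarrow> q \<in> up R \<Longrightarrow>
    act (Suc N) p q = (\<lambda>n. act N p q n \<oplus> p N \<otimes> (D ^^ N) q n)"
  unfolding act_def lessThan_Suc
  by (rule ext, subst M.finsum_insert) (auto simp: Pi_def M.a_comm intro!: M.m_closed M.finsum_closed)

lemma zero_up: "(\<lambda>n. \<zero>) \<in> up R" by auto

lemma act_closed: "p \<in> UNIV \<rightarrow> carrier R \<Longrightarrow> q \<in> up R \<Longrightarrow> act N p q \<in> up R"
  by (induction N) (auto simp: act_0 act_Suc zero_up intro!: up_lincomb)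

lemma mult_act:
  assumes "p \<in> up R" "q \<in> up R" "\<And>i. i \<ge> N \<Longrightarrow> p i = \<zero>"
  shows "p \<otimes>\<^bsub>Q\<^esub> q = act N p q"
proof -
  have "{i. p i \<noteq> \<zero>} \<subseteq> {..<N}" using assms(3) by (auto simp: not_less[symmetric])
  then show ?thesis
    unfolding skew_poly_def act_def using assms(1,2)
    by (auto simp: fun_eq_iff Pi_def intro!: M.add.finprod_mono_neutral_cong_left)
qed

lemma up_bound: "p \<in> up R \<Longrightarrow> \<exists>N. \<forall>i \<ge> N. p i = \<zero>"
proof -
  assume "p \<in> up R"
  then obtain n where "bound \<zero> n p" by auto
  then have "\<forall>i \<ge> Suc n. p i = \<zero>" by (auto simp: bound_def)
  then show ?thesis by blast
qed

lemma up_bound2: "p \<in> up R \<Longrightarrow> q \<in> up R \<Longrightarrow> \<exists>N. \<forall>i \<ge> N. p i = \<zero> \<and> q i = \<zero>"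
proof -
  assume "p \<in> up R" "q \<in> up R"
  then obtain m n where "\<forall>i \<ge> m. p i = \<zero>" "\<forall>i \<ge> n. q i = \<zero>" using up_bound by metis
  then have "\<forall>i \<ge> max m n. p i = \<zero> \<and> q i = \<zero>" by simp
  then show ?thesis by blast
qed

lemma up_fun: "p \<in> up R \<Longrightarrow> p \<in> UNIV \<rightarrow> carrier R" by auto

lemma act_add_left:
  assumes "p \<in> up R" "p' \<in> up R" "q \<in> up R"
  shows "act N (\<lambda>n. p n \<oplus> p' n) q = (\<lambda>n. act N p q n \<oplus> act N p' q n)"
  using assms
proof (induction N)
  case 0 then show ?case by (simp add: act_0)
next
  case (Suc N)
  have c: "act N p q n \<in> carrier R" "act N p' q n \<in> carrier R" for n
    using Suc.prems by (meson act_closed mem_upD up_fun)+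
  show ?case
    using Suc c by (simp add: act_Suc up_fun mem_upD M.l_distr M.a_ac Pi_def fun_eq_iff)
qed

lemma act_scale_left:
  assumes "a \<in> carrier R" "p \<in> up R" "q \<in> up R"
  shows "act N (\<lambda>n. a \<otimes> p n) q = (\<lambda>n. a \<otimes> act N p q n)"
  using assms
proof (induction N)
  case 0 then show ?case by (simp add: act_0)
next
  case (Suc N)
  have c: "act N p q n \<in> carrier R" for n
    using Suc.prems by (meson act_closed mem_upD up_fun)
  show ?case
    using Suc c by (simp add: act_Suc up_fun mem_upD M.r_distr M.m_assoc Pi_def fun_eq_iff)
qed

lemma act_add_right:
  assumes "p \<in> up R" "q \<in> up R" "q' \<in> up R"
  shows "act N p (\<lambda>n. q n \<oplus> q' n) = (\<lambda>n. act N p q n \<oplus> act N p q' n)"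
  using assms
proof (induction N)
  case 0 then show ?case by (simp add: act_0)
next
  case (Suc N)
  have c: "act N p q n \<in> carrier R" "act N p q' n \<in> carrier R" for n
    using Suc.prems by (meson act_closed mem_upD up_fun)+
  show ?case
    using Suc c
    by (simp add: act_Suc up_lincomb up_fun mem_upD Di_add M.r_distr M.a_ac fun_eq_iff)
qed

lemma D_act:
  assumes "p \<in> up R" "q \<in> up R"
  shows "act (Suc N) (D p) q = (\<lambda>n. D (act N p q) n \<oplus> \<delta> (p N) \<otimes> (D ^^ N) q n)"
proof (induction N)
  case 0
  show ?case using assms
    by (simp add: act_Suc act_0 up_fun fun_eq_iff) (simp add: skew_shift_def mem_upD)
next
  case (Suc N)
  have pN: "p k \<in> carrier R" for k using assms by (simp add: mem_upD)
  have a: "act N p q \<in> up R" using assms by (simp add: act_closed up_fun)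
  have c: "D (act N p q) n \<in> carrier R" for n using D_closed[OF a] by (simp add: mem_upD)
  have e: "(D ^^ i) q n \<in> carrier R" "D ((D ^^ i) q) n \<in> carrier R" for i n
    using assms(2) D_closed[OF Di_closed[OF assms(2)]] by (auto simp: mem_upD)
  have DS: "D p (Suc N) = \<delta> (p (Suc N)) \<oplus> p N" by (simp add: skew_shift_def)
  have "D (act (Suc N) p q)
      = (\<lambda>n. D (act N p q) n \<oplus> (p N \<otimes> D ((D ^^ N) q) n \<oplus> \<delta> (p N) \<otimes> (D ^^ N) q n))"
    using assms a pN by (simp add: act_Suc up_fun D_add D_scale up_lincomb)
  moreover have "act (Suc (Suc N)) (D p) q
      = (\<lambda>n. act (Suc N) (D p) q n \<oplus> D p (Suc N) \<otimes> (D ^^ Suc N) q n)"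
    using assms by (intro act_Suc) (auto intro!: up_fun)
  ultimately show ?case
    unfolding Suc DS using c e pN by (simp add: fun_eq_iff M.l_distr M.a_ac)
qed

lemma mult_closed: "p \<in> up R \<Longrightarrow> q \<in> up R \<Longrightarrow> p \<otimes>\<^bsub>Q\<^esub> q \<in> up R"
  by (metis act_closed mult_act up_bound up_fun)

lemma D_mult: 
  assumes "p \<in> up R" "q \<in> up R"
  shows "D p \<otimes>\<^bsub>Q\<^esub> q = D (p \<otimes>\<^bsub>Q\<^esub> q)"
proof -
  obtain N where N: "\<forall>i \<ge> N. p i = \<zero>" using assms up_bound by blast
  have "D p i = \<zero>" if "i \<ge> Suc N" for i
    using N that by (auto simp: skew_shift_def)
  then have "D p \<otimes>\<^bsub>Q\<^esub> q = act (Suc N) (D p) q" using assms by (intro mult_act) auto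
  also have "\<dots> = D (act N p q)"
    using N assms by (simp add: D_act fun_eq_iff mem_upD[OF D_closed[OF act_closed]] up_fun)
  also have "\<dots> = D (p \<otimes>\<^bsub>Q\<^esub> q)" using N assms by (simp add: mult_act[of _ _ N])
  finally show ?thesis .
qed

lemma Di_mult: "p \<in> up R \<Longrightarrow> q \<in> up R \<Longrightarrow> (D ^^ i) p \<otimes>\<^bsub>Q\<^esub> q = (D ^^ i) (p \<otimes>\<^bsub>Q\<^esub> q)"
  by (induction i) (simp_all add: D_mult)

lemma mult_add_left:
  assumes "p \<in> up R" "p' \<in> up R" "q \<in> up R"
  shows "(\<lambda>n. p n \<oplus> p' n) \<otimes>\<^bsub>Q\<^esub> q = (\<lambda>n. (p \<otimes>\<^bsub>Q\<^esub> q) n \<oplus> (p' \<otimes>\<^bsub>Q\<^esub> q) n)"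
proof -
  obtain N where N: "\<forall>i \<ge> N. p i = \<zero> \<and> p' i = \<zero>" using assms up_bound2 by blast
  then show ?thesis
    using assms by (simp add: mult_act[of _ _ N] up_lincomb act_add_left)
qed

lemma mult_add_right:
  assumes "p \<in> up R" "q \<in> up R" "q' \<in> up R"
  shows "p \<otimes>\<^bsub>Q\<^esub> (\<lambda>n. q n \<oplus> q' n) = (\<lambda>n. (p \<otimes>\<^bsub>Q\<^esub> q) n \<oplus> (p \<otimes>\<^bsub>Q\<^esub> q') n)"
proof -
  obtain N where N: "\<forall>i \<ge> N. p i = \<zero>" using assms up_bound by blast
  then show ?thesis
    using assms by (simp add: mult_act[of _ _ N] up_lincomb act_add_right)
qed

lemma mult_scale_left:
  assumes "a \<in> carrier R" "p \<in> up R" "q \<in> up R"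
  shows "(\<lambda>n. a \<otimes> p n) \<otimes>\<^bsub>Q\<^esub> q = (\<lambda>n. a \<otimes> (p \<otimes>\<^bsub>Q\<^esub> q) n)"
proof -
  obtain N where N: "\<forall>i \<ge> N. p i = \<zero>" using assms up_bound by blast
  then show ?thesis
    using assms by (simp add: mult_act[of _ _ N] up_lincomb act_scale_left)
qed

lemma zero_mult: "(\<lambda>n. \<zero>) \<otimes>\<^bsub>Q\<^esub> q = (\<lambda>n. \<zero>)"
  by (simp add: skew_poly_def)

lemma act_assoc:
  assumes "p \<in> up R" "q \<in> up R" "r \<in> up R"
  shows "act N p q \<otimes>\<^bsub>Q\<^esub> r = act N p (q \<otimes>\<^bsub>Q\<^esub> r)"
proof (induction N)
  case 0
  show ?case by (simp add: act_0 zero_mult)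
next
  case (Suc N)
  then show ?case using assms
    by (simp add: act_Suc up_fun mult_closed mult_add_left mult_scale_left act_closed up_lincomb
        mem_upD Di_mult)
qed

lemma mult_assoc:
  assumes "p \<in> up R" "q \<in> up R" "r \<in> up R"
  shows "(p \<otimes>\<^bsub>Q\<^esub> q) \<otimes>\<^bsub>Q\<^esub> r = p \<otimes>\<^bsub>Q\<^esub> (q \<otimes>\<^bsub>Q\<^esub> r)"
proof -
  obtain N where N: "\<forall>i \<ge> N. p i = \<zero>" using assms up_bound by blast
  then have "p \<otimes>\<^bsub>Q\<^esub> q = act N p q" "p \<otimes>\<^bsub>Q\<^esub> (q \<otimes>\<^bsub>Q\<^esub> r) = act N p (q \<otimes>\<^bsub>Q\<^esub> r)"
    using assms by (simp_all add: mult_act mult_closed)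
  then show ?thesis using act_assoc[OF assms] by simp
qed

definition mon :: "'a \<Rightarrow> nat \<Rightarrow> nat \<Rightarrow> 'a" where
  "mon a i = (\<lambda>n. if n = i then a else \<zero>)"

lemma mon_closed [simp, intro]: "a \<in> carrier R \<Longrightarrow> mon a i \<in> up R"
  unfolding mon_def by (intro mem_upI) (auto intro!: exI[of _ i])

lemma mon_mult:
  assumes "a \<in> carrier R" "q \<in> up R"
  shows "mon a i \<otimes>\<^bsub>Q\<^esub> q = (\<lambda>n. a \<otimes> (D ^^ i) q n)"
proof (cases "a = \<zero>")
  case True
  then show ?thesis using assms by (simp add: mon_def zero_mult fun_eq_iff)
next
  case False
  then have "{j. mon a i j \<noteq> \<zero>} = {i}" by (auto simp: mon_def)
  then show ?thesis using assms by (simp add: skew_poly_def fun_eq_iff) (simp add: mon_def)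
qed

lemma D_mon_one: "D (mon \<one> i) = mon \<one> (Suc i)"
  by (auto simp: skew_shift_def mon_def fun_eq_iff)

lemma Di_mon_one: "(D ^^ i) (mon \<one> 0) = mon \<one> i"
  by (induction i) (simp_all add: D_mon_one)

lemma one_mon: "\<one>\<^bsub>Q\<^esub> = mon \<one> 0" by (simp add: skew_poly_def mon_def)

lemma ring_Q: "ring Q"
proof (rule ringI)
  show "abelian_group Q"
  proof (rule abelian_groupI)
    fix p assume p: "p \<in> carrier Q"
    show "\<exists>q \<in> carrier Q. q \<oplus>\<^bsub>Q\<^esub> p = \<zero>\<^bsub>Q\<^esub>"
      using p M.up_a_inv_closed[of p]
      by (intro bexI[of _ "\<lambda>i. \<ominus> p i"]) (auto simp: skew_poly_def M.l_neg mem_upD)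
  qed (auto simp: skew_poly_def up_lincomb zero_up mem_upD M.a_ac fun_eq_iff)
  show "monoid Q"
  proof (rule monoidI)
    fix p q assume "p \<in> carrier Q" "q \<in> carrier Q"
    then show "p \<otimes>\<^bsub>Q\<^esub> q \<in> carrier Q"
      using mult_closed by (simp add: skew_poly_def)
  next
    show "\<one>\<^bsub>Q\<^esub> \<in> carrier Q" unfolding one_mon by (simp add: skew_poly_def)
  next
    fix p q r assume "p \<in> carrier Q" "q \<in> carrier Q" "r \<in> carrier Q"
    then show "p \<otimes>\<^bsub>Q\<^esub> q \<otimes>\<^bsub>Q\<^esub> r = p \<otimes>\<^bsub>Q\<^esub> (q \<otimes>\<^bsub>Q\<^esub> r)"
      by (intro mult_assoc) (simp_all add: skew_poly_def)
  next
    fix p assume "p \<in> carrier Q"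
    then have p: "p \<in> up R" by (simp add: skew_poly_def)
    then show "\<one>\<^bsub>Q\<^esub> \<otimes>\<^bsub>Q\<^esub> p = p" unfolding one_mon by (simp add: mon_mult mem_upD)
    have e: "act N p (mon \<one> 0) = (\<lambda>n. if n < N then p n else \<zero>)" for N
    proof (induction N)
      case 0 then show ?case by (simp add: act_0)
    next
      case (Suc N)
      have "act (Suc N) p (mon \<one> 0) = (\<lambda>n. (if n < N then p n else \<zero>) \<oplus> p N \<otimes> mon \<one> N n)"
        using p by (simp add: act_Suc up_fun Di_mon_one Suc)
      also have "\<dots> = (\<lambda>n. if n < Suc N then p n else \<zero>)"
      proof
        fix n
        show "(if n < N then p n else \<zero>) \<oplus> p N \<otimes> mon \<one> N n = (if n < Suc N then p n else \<zero>)"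
          using mem_upD[OF p] by (cases n N rule: linorder_cases) (simp_all add: mon_def)
      qed
      finally show ?case .
    qed
    obtain N where N: "\<forall>i \<ge> N. p i = \<zero>" using p up_bound by blast
    then show "p \<otimes>\<^bsub>Q\<^esub> \<one>\<^bsub>Q\<^esub> = p" unfolding one_mon
      using p by (auto simp: mult_act[of _ _ N] e fun_eq_iff)
  qed
  fix p q r assume "p \<in> carrier Q" "q \<in> carrier Q" "r \<in> carrier Q"
  then have c: "p \<in> up R" "q \<in> up R" "r \<in> up R" by (simp_all add: skew_poly_def)
  have a: "u \<oplus>\<^bsub>Q\<^esub> v = (\<lambda>n. u n \<oplus> v n)" for u v by (simp add: skew_poly_def)
  show "(p \<oplus>\<^bsub>Q\<^esub> q) \<otimes>\<^bsub>Q\<^esub> r = p \<otimes>\<^bsub>Q\<^esub> r \<oplus>\<^bsub>Q\<^esub> q \<otimes>\<^bsub>Q\<^esub> r"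
    unfolding a using c by (rule mult_add_left)
  show "r \<otimes>\<^bsub>Q\<^esub> (p \<oplus>\<^bsub>Q\<^esub> q) = r \<otimes>\<^bsub>Q\<^esub> p \<oplus>\<^bsub>Q\<^esub> r \<otimes>\<^bsub>Q\<^esub> q"
    unfolding a using c by (intro mult_add_right)
qed

lemma smult_right:
  assumes "c \<in> carrier K" "a \<in> carrier R" "b \<in> carrier R"
  shows "a \<otimes> (c \<odot> b) = c \<odot> (a \<otimes> b)"
proof -
  have "a \<otimes> (c \<odot> b) = (c \<odot> b) \<otimes> a" using assms by (intro M.m_comm) auto
  also have "\<dots> = c \<odot> (b \<otimes> a)" using assms by (intro smult_assoc2)
  also have "b \<otimes> a = a \<otimes> b" using assms by (intro M.m_comm)
  finally show ?thesis .
qed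

lemma D_smult:
  assumes "c \<in> carrier K" "p \<in> up R"
  shows "D (\<lambda>n. c \<odot> p n) = (\<lambda>n. c \<odot> D p n)"
  using assms by (auto simp: skew_shift_def fun_eq_iff d_smult mem_upD smult_r_distr)

lemma up_smult: "c \<in> carrier K \<Longrightarrow> p \<in> up R \<Longrightarrow> (\<lambda>n. c \<odot> p n) \<in> up R"
  using up_lincomb(2)[of "c \<odot> \<one>" p] by (simp add: mem_upD smult_assoc2)

lemma Di_smult:
  assumes "c \<in> carrier K" "p \<in> up R"
  shows "(D ^^ i) (\<lambda>n. c \<odot> p n) = (\<lambda>n. c \<odot> (D ^^ i) p n)"
  using assms by (induction i) (simp_all add: D_smult)

lemma assoc_algebra_Q: "assoc_algebra K Q"
proof -
  interpret Q: ring Q by (rule ring_Q)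
  have ag: "abelian_group Q" by (rule Q.is_abelian_group)
  have s: "c \<odot>\<^bsub>Q\<^esub> p = (\<lambda>n. c \<odot> p n)" for c p by (simp add: skew_poly_def)
  have car: "carrier Q = up R" by (simp add: skew_poly_def)
  have m: "module K Q"
    using ag by (intro moduleI)
     (auto simp: skew_poly_def R_cring up_smult mem_upD smult_l_distr smult_r_distr smult_assoc1 fun_eq_iff)
  have r: "p \<otimes>\<^bsub>Q\<^esub> (\<lambda>n. c \<odot> q n) = (\<lambda>n. c \<odot> (p \<otimes>\<^bsub>Q\<^esub> q) n)"
    if c: "c \<in> carrier K" and p: "p \<in> up R" and q: "q \<in> up R" for c p q
  proof -
    obtain N where N: "\<forall>i \<ge> N. p i = \<zero>" using p up_bound by blast
    have "act N p (\<lambda>n. c \<odot> q n) = (\<lambda>n. c \<odot> act N p q n)" for N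
    proof (induction N)
      case 0 then show ?case using c by (simp add: act_0)
    next
      case (Suc N)
      have "act N p q n \<in> carrier R" for n using p q by (meson act_closed mem_upD up_fun)
      with Suc p q c show ?case
        by (simp add: act_Suc up_fun up_smult Di_smult mem_upD smult_r_distr smult_right)
    qed
    then show ?thesis using N p q c by (simp add: mult_act[of _ _ N] up_smult)
  qed
  have l: "(\<lambda>n. c \<odot> p n) \<otimes>\<^bsub>Q\<^esub> q = (\<lambda>n. c \<odot> (p \<otimes>\<^bsub>Q\<^esub> q) n)"
    if c: "c \<in> carrier K" and p: "p \<in> up R" and q: "q \<in> up R" for c p q
    using mult_scale_left[of "c \<odot> \<one>" p q] that mult_closed[OF p q]
    by (simp add: mem_upD smult_assoc2)
  have "assoc_algebra_axioms K Q"
    unfolding assoc_algebra_axioms_def s car by (intro conjI allI impI l r)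
  then show ?thesis
    using m ring_Q by (simp add: assoc_algebra_def)
qed

lemma Q_finsum:
  assumes "finite I" "\<And>i. i \<in> I \<Longrightarrow> g i \<in> up R"
  shows "finsum Q g I = (\<lambda>n. \<Oplus>i \<in> I. g i n)"
proof -
  interpret Q: ring Q by (rule ring_Q)
  have car: "carrier Q = up R" by (simp add: skew_poly_def)
  have z: "\<zero>\<^bsub>Q\<^esub> = (\<lambda>n. \<zero>)" by (simp add: skew_poly_def)
  have a: "u \<oplus>\<^bsub>Q\<^esub> v = (\<lambda>n. u n \<oplus> v n)" for u v by (simp add: skew_poly_def)
  show ?thesis using assms
  proof (induction rule: finite_induct)
    case empty then show ?case by (simp add: z)
  next
    case (insert j J)
    have "finsum Q g (insert j J) = g j \<oplus>\<^bsub>Q\<^esub> finsum Q g J"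
      using insert by (intro Q.finsum_insert) (auto simp: car)
    also have "\<dots> = (\<lambda>n. \<Oplus>i \<in> insert j J. g i n)"
      using insert by (auto simp: a fun_eq_iff Pi_def mem_upD)
    finally show ?case .
  qed
qed

theorem ore_extension_skew_poly: "ore_extension K R \<delta> Q (\<lambda>r. mon r 0) (mon \<one> 1)"
proof -
  interpret Q: ring Q by (rule ring_Q)
  have car: "carrier Q = up R" by (simp add: skew_poly_def)
  have a: "u \<oplus>\<^bsub>Q\<^esub> v = (\<lambda>n. u n \<oplus> v n)" for u v by (simp add: skew_poly_def)
  have s: "c \<odot>\<^bsub>Q\<^esub> p = (\<lambda>n. c \<odot> p n)" for c p by (simp add: skew_poly_def)
  have pow: "mon \<one> 1 [^]\<^bsub>Q\<^esub> n = mon \<one> n" for n :: nat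
  proof (induction n)
    case 0 then show ?case by (simp add: one_mon)
  next
    case (Suc n)
    have "(D ^^ n) (mon \<one> (Suc 0)) = mon \<one> (Suc n)" for n
      by (induction n) (simp_all add: D_mon_one)
    then have "mon \<one> n \<otimes>\<^bsub>Q\<^esub> mon \<one> 1 = (\<lambda>m. \<one> \<otimes> mon \<one> (Suc n) m)"
      by (simp add: mon_mult)
    also have "\<dots> = mon \<one> (Suc n)" by (auto simp: mon_def)
    finally show ?case using Suc by simp
  qed
  have hom: "(\<lambda>r. mon r 0) \<in> ring_hom R Q"
    by (intro ring_hom_memI) (auto simp: car mon_mult a one_mon, auto simp: mon_def)
  have sc: "mon (c \<odot> r) 0 = c \<odot>\<^bsub>Q\<^esub> mon r 0" if "c \<in> carrier K" for c r
    using that by (auto simp: s mon_def)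
  have id: "(\<Oplus>\<^bsub>Q\<^esub>n \<in> {n. f n \<noteq> \<zero>}. mon (f n) 0 \<otimes>\<^bsub>Q\<^esub> mon \<one> 1 [^]\<^bsub>Q\<^esub> n) = f"
    if f: "f \<in> up R" for f
  proof -
    obtain N where N: "\<forall>i \<ge> N. f i = \<zero>" using f up_bound by blast
    then have fin: "finite {n. f n \<noteq> \<zero>}"
      by (metis (mono_tags, lifting) finite_nat_set_iff_bounded mem_Collect_eq not_le_imp_less)
    have e: "mon (f n) 0 \<otimes>\<^bsub>Q\<^esub> mon \<one> 1 [^]\<^bsub>Q\<^esub> n = mon (f n) n" for n
      unfolding pow using f by (auto simp: mon_mult mem_upD fun_eq_iff) (auto simp: mon_def mem_upD)
    have "(\<Oplus>i \<in> {n. f n \<noteq> \<zero>}. mon (f i) i n) = f n" for n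
    proof (cases "f n = \<zero>")
      case True
      then have "(\<Oplus>i \<in> {n. f n \<noteq> \<zero>}. mon (f i) i n) = (\<Oplus>i \<in> {n. f n \<noteq> \<zero>}. \<zero>)"
        by (intro M.finsum_cong') (auto simp: mon_def)
      with True show ?thesis by simp
    next
      case False
      then show ?thesis
        using M.finsum_singleton[of n "{n. f n \<noteq> \<zero>}" f] fin f by (auto simp: mon_def)
    qed
    then show ?thesis
      unfolding e using fin f by (simp add: Q_finsum mem_upD)
  qed
  have bij: "bij_betw (\<lambda>f. \<Oplus>\<^bsub>Q\<^esub>n \<in> {n. f n \<noteq> \<zero>}. mon (f n) 0 \<otimes>\<^bsub>Q\<^esub> mon \<one> 1 [^]\<^bsub>Q\<^esub> n)
      (up R) (carrier Q)" (is "bij_betw ?h _ _")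
  proof -
    have "bij_betw ?h (up R) (up R) = bij_betw (\<lambda>f. f) (up R) (up R)"
      by (rule bij_betw_cong) (rule id)
    moreover have "bij_betw (\<lambda>f. f) (up R) (up R)" by (simp add: bij_betw_def)
    ultimately show ?thesis unfolding car by blast
  qed
  have com: "mon \<one> 1 \<otimes>\<^bsub>Q\<^esub> mon r 0 = mon r 0 \<otimes>\<^bsub>Q\<^esub> mon \<one> 1 \<oplus>\<^bsub>Q\<^esub> mon (\<delta> r) 0"
    if "r \<in> carrier R" for r
    using that D_closed[OF mon_closed[OF that, of 0]]
    by (simp add: mon_mult a mem_upD fun_eq_iff) (simp add: skew_shift_def mon_def)
  show ?thesis
    unfolding ore_extension_def using assoc_algebra_Q hom sc bij com by (simp add: car)
qed

end

lemma ore_extension_exists: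
  fixes R :: "('k, 'a, 'n) module_scheme"
  assumes "algebra K R" and "derivation K R \<delta>"
  shows "\<exists>(A :: ('k, nat \<Rightarrow> 'a) module) \<iota> x. ore_extension K R \<delta> A \<iota> x"
proof -
  have "diff_algebra K R \<delta>"
    using assms
    by (simp add: diff_algebra_def diff_algebra_axioms_def algebra.M_cring[of K R])
  then show ?thesis
    using diff_algebra.ore_extension_skew_poly by blast
qed


section \<open>Classical quotient rings\<close>

definition regular_elems :: "('a, 'm) ring_scheme \<Rightarrow> 'a set" where
  "regular_elems B = {s \<in> carrier B. \<forall>b \<in> carrier B.
     (s \<otimes>\<^bsub>B\<^esub> b = \<zero>\<^bsub>B\<^esub> \<longrightarrow> b = \<zero>\<^bsub>B\<^esub>) \<and> (b \<otimes>\<^bsub>B\<^esub> s = \<zero>\<^bsub>B\<^esub> \<longrightarrow> b = \<zero>\<^bsub>B\<^esub>)}"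

text \<open>
  \<open>left_frac B s a\<close> is the left fraction \<open>s\<^sup>-\<^sup>1 a\<close>, as a class of pairs (denominator, numerator):
  two left fractions are equal iff they agree after passing to a common regular denominator.
\<close>

definition left_frac :: "('a, 'm) ring_scheme \<Rightarrow> 'a \<Rightarrow> 'a \<Rightarrow> ('a \<times> 'a) set" where
  "left_frac B s a = {(t, b). t \<in> regular_elems B \<and> b \<in> carrier B \<and>
     (\<exists>u \<in> carrier B. \<exists>v \<in> carrier B.
        u \<otimes>\<^bsub>B\<^esub> s = v \<otimes>\<^bsub>B\<^esub> t \<and> u \<otimes>\<^bsub>B\<^esub> s \<in> regular_elems B \<and> u \<otimes>\<^bsub>B\<^esub> a = v \<otimes>\<^bsub>B\<^esub> b)}"

text \<open>
  The ring of left fractions of \<open>B\<close> with respect to all regular elements. By Goldie's theorem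
  the left Ore condition holds if \<open>B\<close> is prime noetherian, and then this is the Goldie quotient
  ring of \<open>B\<close> (for noetherian \<open>B\<close> it agrees with the ring of right fractions); for a
  commutative domain it is the field of fractions.
  If \<open>u s = v t\<close> is regular then \<open>s\<^sup>-\<^sup>1 a + t\<^sup>-\<^sup>1 b = (u s)\<^sup>-\<^sup>1 (u a + v b)\<close>; if \<open>u\<close> is regular and
  \<open>u a = v t\<close> then \<open>s\<^sup>-\<^sup>1 a t\<^sup>-\<^sup>1 b = (u s)\<^sup>-\<^sup>1 v b\<close>. Under the Ore condition these fractions depend
  neither on the representatives nor on \<open>u\<close> and \<open>v\<close>, so that the unions below are unions of a
  single class.
\<close>

definition Frac :: "('a, 'm) ring_scheme \<Rightarrow> ('a \<times> 'a) set ring" where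
  "Frac B = \<lparr>
     carrier = {left_frac B s a | s a. s \<in> regular_elems B \<and> a \<in> carrier B},
     monoid.mult = (\<lambda>p q. \<Union>{left_frac B (u \<otimes>\<^bsub>B\<^esub> s) (v \<otimes>\<^bsub>B\<^esub> b) | s a t b u v.
        (s, a) \<in> p \<and> (t, b) \<in> q \<and> u \<in> regular_elems B \<and> v \<in> carrier B \<and>
        u \<otimes>\<^bsub>B\<^esub> a = v \<otimes>\<^bsub>B\<^esub> t}),
     one = left_frac B \<one>\<^bsub>B\<^esub> \<one>\<^bsub>B\<^esub>,
     ring.zero = left_frac B \<one>\<^bsub>B\<^esub> \<zero>\<^bsub>B\<^esub>,
     ring.add = (\<lambda>p q. \<Union>{left_frac B (u \<otimes>\<^bsub>B\<^esub> s) (u \<otimes>\<^bsub>B\<^esub> a \<oplus>\<^bsub>B\<^esub> v \<otimes>\<^bsub>B\<^esub> b) | s a t b u v.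
        (s, a) \<in> p \<and> (t, b) \<in> q \<and> u \<in> carrier B \<and> v \<in> carrier B \<and>
        u \<otimes>\<^bsub>B\<^esub> s = v \<otimes>\<^bsub>B\<^esub> t \<and> u \<otimes>\<^bsub>B\<^esub> s \<in> regular_elems B})\<rparr>"

text \<open>The image of the base field in \<open>Frac (A / P)\<close>.\<close>

definition frac_scalars ::
  "('k, 'm) ring_scheme \<Rightarrow> ('k, 'a, 'n) module_scheme \<Rightarrow> 'a set \<Rightarrow> ('a set \<times> 'a set) set set" where
  "frac_scalars K A P = (\<lambda>a. left_frac (A Quot P) \<one>\<^bsub>A Quot P\<^esub> (P +>\<^bsub>A\<^esub> a)) ` scalars K A"


section \<open>The Dixmier-Moeglin equivalence\<close>

text \<open>The library locale \<^locale>\<open>primeideal\<close> is about commutative rings.\<close>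

definition prime_ideal :: "('a, 'm) ring_scheme \<Rightarrow> 'a set \<Rightarrow> bool" where
  "prime_ideal A P \<longleftrightarrow> ideal P A \<and> P \<noteq> carrier A \<and>
     (\<forall>I J. ideal I A \<and> ideal J A \<and> I \<cdot>\<^bsub>A\<^esub> J \<subseteq> P \<longrightarrow> I \<subseteq> P \<or> J \<subseteq> P)"

text \<open>The library locale \<^locale>\<open>module\<close> requires commutative scalars.\<close>

locale left_module = A?: ring A + M?: abelian_group M
  for A :: "('a, 'm) ring_scheme" and M :: "('a, 'b, 'n) module_scheme" +
  assumes lsmult_closed:
      "\<lbrakk>a \<in> carrier A; m \<in> carrier M\<rbrakk> \<Longrightarrow> a \<odot>\<^bsub>M\<^esub> m \<in> carrier M"
    and lsmult_l_distr:
      "\<lbrakk>a \<in> carrier A; b \<in> carrier A; m \<in> carrier M\<rbrakk>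
        \<Longrightarrow> (a \<oplus>\<^bsub>A\<^esub> b) \<odot>\<^bsub>M\<^esub> m = a \<odot>\<^bsub>M\<^esub> m \<oplus>\<^bsub>M\<^esub> b \<odot>\<^bsub>M\<^esub> m"
    and lsmult_r_distr:
      "\<lbrakk>a \<in> carrier A; m \<in> carrier M; n \<in> carrier M\<rbrakk>
        \<Longrightarrow> a \<odot>\<^bsub>M\<^esub> (m \<oplus>\<^bsub>M\<^esub> n) = a \<odot>\<^bsub>M\<^esub> m \<oplus>\<^bsub>M\<^esub> a \<odot>\<^bsub>M\<^esub> n"
    and lsmult_assoc:
      "\<lbrakk>a \<in> carrier A; b \<in> carrier A; m \<in> carrier M\<rbrakk>
        \<Longrightarrow> (a \<otimes>\<^bsub>A\<^esub> b) \<odot>\<^bsub>M\<^esub> m = a \<odot>\<^bsub>M\<^esub> (b \<odot>\<^bsub>M\<^esub> m)"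
    and lsmult_one:
      "m \<in> carrier M \<Longrightarrow> \<one>\<^bsub>A\<^esub> \<odot>\<^bsub>M\<^esub> m = m"

definition simple_left_module ::
  "('a, 'm) ring_scheme \<Rightarrow> ('a, 'b, 'n) module_scheme \<Rightarrow> bool" where
  "simple_left_module A M \<longleftrightarrow> left_module A M \<and> carrier M \<noteq> {\<zero>\<^bsub>M\<^esub>} \<and>
     (\<forall>N. submodule N A M \<longrightarrow> N = {\<zero>\<^bsub>M\<^esub>} \<or> N = carrier M)"

definition annihilator ::
  "('a, 'm) ring_scheme \<Rightarrow> ('a, 'b, 'n) module_scheme \<Rightarrow> 'a set" where
  "annihilator A M = {a \<in> carrier A. \<forall>m \<in> carrier M. a \<odot>\<^bsub>M\<^esub> m = \<zero>\<^bsub>M\<^esub>}"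

text \<open>
  Letting the elements of \<open>M\<close> have type \<^typ>\<open>'a set\<close> loses nothing: every simple left module is
  isomorphic to \<open>A / L\<close> for a maximal left ideal \<open>L\<close>, whose elements are cosets in \<open>A\<close>.
\<close>

definition primitive_ideal :: "('a, 'm) ring_scheme \<Rightarrow> 'a set \<Rightarrow> bool" where
  "primitive_ideal A P \<longleftrightarrow>
     (\<exists>M :: ('a, 'a set) module. simple_left_module A M \<and> P = annihilator A M)"

definition locally_closed :: "('a, 'm) ring_scheme \<Rightarrow> 'a set \<Rightarrow> bool" where
  "locally_closed A P \<longleftrightarrow> P \<subset> carrier A \<inter> \<Inter>{Q. prime_ideal A Q \<and> P \<subset> Q}"

definition ring_centre :: "('a, 'm) ring_scheme \<Rightarrow> 'a set" where
  "ring_centre Q = {z \<in> carrier Q. \<forall>q \<in> carrier Q. z \<otimes>\<^bsub>Q\<^esub> q = q \<otimes>\<^bsub>Q\<^esub> z}"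

definition rational ::
  "('k, 'm) ring_scheme \<Rightarrow> ('k, 'a, 'n) module_scheme \<Rightarrow> 'a set \<Rightarrow> bool" where
  "rational K A P \<longleftrightarrow>
     subfield (ring_centre (Frac (A Quot P))) (Frac (A Quot P)) \<and>
     (\<forall>z \<in> ring_centre (Frac (A Quot P)).
        ring.algebraic (Frac (A Quot P)) (frac_scalars K A P) z)"

definition DME :: "('k, 'm) ring_scheme \<Rightarrow> ('k, 'a, 'n) module_scheme \<Rightarrow> bool" where
  "DME K A \<longleftrightarrow> (\<forall>P. prime_ideal A P \<longrightarrow>
     (primitive_ideal A P \<longleftrightarrow> locally_closed A P) \<and> (locally_closed A P \<longleftrightarrow> rational K A P))"


section \<open>The differential Dixmier-Moeglin equivalence\<close>

definition prime_diff_ideal :: "('a, 'm) ring_scheme \<Rightarrow> ('a \<Rightarrow> 'a) \<Rightarrow> 'a set \<Rightarrow> bool" where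
  "prime_diff_ideal R \<delta> P \<longleftrightarrow> primeideal P R \<and> \<delta> ` P \<subseteq> P"

definition diff_primitive :: "('a, 'm) ring_scheme \<Rightarrow> ('a \<Rightarrow> 'a) \<Rightarrow> 'a set \<Rightarrow> bool" where
  "diff_primitive R \<delta> P \<longleftrightarrow> (\<exists>\<mm>. maximalideal \<mm> R \<and> P \<subseteq> \<mm> \<and>
     (\<forall>Q. prime_diff_ideal R \<delta> Q \<and> Q \<subseteq> \<mm> \<and> P \<subseteq> Q \<longrightarrow> Q = P))"

definition diff_locally_closed :: "('a, 'm) ring_scheme \<Rightarrow> ('a \<Rightarrow> 'a) \<Rightarrow> 'a set \<Rightarrow> bool" where
  "diff_locally_closed R \<delta> P \<longleftrightarrow>
     P \<subset> carrier R \<inter> \<Inter>{Q. prime_diff_ideal R \<delta> Q \<and> P \<subset> Q}"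

text \<open>The derivation induced by \<open>\<delta>\<close> on \<open>R / P\<close>: the coset of \<open>r\<close> is sent to that of \<open>\<delta> r\<close>.\<close>

definition quot_derivation ::
  "('a, 'm) ring_scheme \<Rightarrow> 'a set \<Rightarrow> ('a \<Rightarrow> 'a) \<Rightarrow> 'a set \<Rightarrow> 'a set" where
  "quot_derivation R P \<delta> C = (\<Union>r \<in> C. P +>\<^bsub>R\<^esub> \<delta> r)"

text \<open>Quotient rule on the field of fractions of a commutative domain.\<close>

definition frac_derivation ::
  "('a, 'm) ring_scheme \<Rightarrow> ('a \<Rightarrow> 'a) \<Rightarrow> ('a \<times> 'a) set \<Rightarrow> ('a \<times> 'a) set" where
  "frac_derivation B d q =
     (\<Union>(s, a) \<in> q. left_frac B (s \<otimes>\<^bsub>B\<^esub> s) (s \<otimes>\<^bsub>B\<^esub> d a \<ominus>\<^bsub>B\<^esub> d s \<otimes>\<^bsub>B\<^esub> a))"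

definition frac_constants ::
  "('a, 'm) ring_scheme \<Rightarrow> ('a \<Rightarrow> 'a) \<Rightarrow> 'a set \<Rightarrow> ('a set \<times> 'a set) set set" where
  "frac_constants R \<delta> P = {q \<in> carrier (Frac (R Quot P)).
     frac_derivation (R Quot P) (quot_derivation R P \<delta>) q = \<zero>\<^bsub>Frac (R Quot P)\<^esub>}"

text \<open>A subfield of \<open>Frac (R / P)\<close> is contained in \<open>k\<^sup>a\<^sup>l\<^sup>g\<close> iff its elements are algebraic over \<open>k\<close>.\<close>

definition diff_rational ::
  "('k, 'm) ring_scheme \<Rightarrow> ('k, 'a, 'n) module_scheme \<Rightarrow> ('a \<Rightarrow> 'a) \<Rightarrow> 'a set \<Rightarrow> bool" where
  "diff_rational K R \<delta> P \<longleftrightarrow>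
     frac_constants R \<delta> P \<subseteq>
       {q \<in> carrier (Frac (R Quot P)). ring.algebraic (Frac (R Quot P)) (frac_scalars K R P) q}"

definition diff_DME ::
  "('k, 'm) ring_scheme \<Rightarrow> ('k, 'a, 'n) module_scheme \<Rightarrow> ('a \<Rightarrow> 'a) \<Rightarrow> bool" where
  "diff_DME K R \<delta> \<longleftrightarrow> (\<forall>P. prime_diff_ideal R \<delta> P \<longrightarrow>
     (diff_primitive R \<delta> P \<longleftrightarrow> diff_locally_closed R \<delta> P) \<and>
     (diff_locally_closed R \<delta> P \<longleftrightarrow> diff_rational K R \<delta> P))"

end

theory Submission
  imports Defs
begin

text \<open>
  Write \<open>A = R[x;\<delta>]\<close>. Every prime \<open>P\<close> of \<open>A\<close> contracts to a prime \<open>\<delta>\<close>-ideal of \<open>R\<close>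
  (\<open>contr_prime\<close>): a product of \<open>\<delta>\<close>-ideals of \<open>R\<close> extends to a product of ideals of \<open>A\<close>, and
  in a noetherian ring containing the rationals a \<open>\<delta>\<close>-ideal that is prime with respect to
  \<open>\<delta>\<close>-ideals is prime (\<open>delta_prime_imp_prime\<close>). The proof then splits according to whether
  \<open>\<delta>\<close> acts as zero on \<open>R / (P \<inter> R)\<close>.

  If \<open>\<delta> R \<subseteq> P\<close> then \<open>A / P\<close> is a commutative affine domain. By the Nullstellensatz each of
  the three properties of \<open>P\<close> says that \<open>A / P\<close> is a field (locale \<open>comm_quotient\<close>), so they
  are equivalent.

  If \<open>\<delta> b \<notin> P\<close> for some \<open>b\<close>, put \<open>Q = P \<inter> R\<close>. The commutator with \<open>b\<close> sends an element of
  \<open>A / Q A\<close> with leading term \<open>r x\<^sup>n\<^sup>+\<^sup>1\<close> to one with leading term \<open>(n + 1) r (\<delta> b) x\<^sup>n\<close>, which is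
  nonzero in characteristic zero. Hence every nonzero ideal of \<open>A / Q A\<close> meets \<open>R / Q\<close>
  (\<open>ideal_meets_R\<close>), so that \<open>P = Q A\<close> (\<open>noncomm_case\<close>), and each property of \<open>P\<close> becomes the
  corresponding property of \<open>Q\<close>. Primes above \<open>Q A\<close> and prime \<open>\<delta>\<close>-ideals above \<open>Q\<close> control
  each other, which settles local closedness (\<open>ext_locally_closed_iff\<close>). The domain \<open>A / Q A\<close> is an
  Ore domain, and the centre of its division ring of fractions is the field of constants of the field of
  fractions of \<open>R / Q\<close> (\<open>centre_eq_constants\<close>), which settles rationality
  (\<open>ext_rational_iff\<close>). If \<open>Q\<close> is \<open>\<delta>\<close>-primitive because of a maximal ideal \<open>\<mm>\<close>, a maximal
  left ideal above \<open>A \<mm>\<close> shows that \<open>Q A\<close> is primitive (\<open>diff_primitive_imp_primitive\<close>).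

  The remaining implication is about a simple module \<open>M\<close> with annihilator \<open>Q A\<close>. If some nonzero
  vector is killed by an element of \<open>R\<close> outside \<open>Q\<close>, then a maximal annihilator not contained in \<open>Q\<close>
  is a maximal ideal of \<open>R\<close> containing no \<open>\<delta>\<close>-ideal larger than \<open>Q\<close> (\<open>torsion_case\<close>).
  Otherwise fix \<open>u \<noteq> 0\<close> in \<open>M\<close>; a larger \<open>\<delta>\<close>-ideal \<open>H\<close> satisfies \<open>M = (H A) u\<close>. Either
  no relation on \<open>u\<close> has its leading coefficient outside \<open>Q\<close>, and then \<open>H = R\<close> (\<open>free_case\<close>),
  or one has leading coefficient \<open>f \<notin> Q\<close>, and then \<open>M\<close> becomes finitely generated over \<open>R\<close> after
  inverting \<open>f\<close>, so that Nakayama's lemma excludes that \<open>H\<close> lies in a maximal ideal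
  \<open>\<mm> \<supseteq> Q\<close> avoiding \<open>f\<close> (\<open>finite_case\<close>).
\<close>

section \<open>Differential operators of bounded degree\<close>

text \<open>
  The sums of \<open>w\<^sub>i x\<^sup>i\<close> over \<open>i < n\<close> with all
  \<open>w\<^sub>i\<close> in \<open>W\<close>. The coefficients need not be unique and
  \<open>x\<close> need not commute with them, so that the same filtration serves for
  \<open>R[x;\<delta>]\<close>, for its quotients, for the extensions \<open>I A\<close> of
  ideals of \<open>R\<close>, for a commutative ring extension \<open>S[a]\<close> and for the
  graph of a homomorphism on \<open>S[a]\<close>.
\<close>

primrec poly_span :: "('b, 'n) ring_scheme \<Rightarrow> 'b set \<Rightarrow> 'b \<Rightarrow> nat \<Rightarrow> 'b set" where
  "poly_span A W x 0 = {\<zero>\<^bsub>A\<^esub>}"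
| "poly_span A W x (Suc n) =
     {w \<otimes>\<^bsub>A\<^esub> x [^]\<^bsub>A\<^esub> n \<oplus>\<^bsub>A\<^esub> y | w y. w \<in> W \<and> y \<in> poly_span A W x n}"

context ring
begin

lemma poly_span_SucI: "w \<in> W \<Longrightarrow> y \<in> poly_span R W x n \<Longrightarrow> w \<otimes> x [^] n \<oplus> y \<in> poly_span R W x (Suc n)"
  by auto

lemma poly_span_closed:
  "W \<subseteq> carrier R \<Longrightarrow> x \<in> carrier R \<Longrightarrow> poly_span R W x n \<subseteq> carrier R"
proof (induction n)
  case (Suc n)
  then show ?case by (auto simp: subset_iff)
qed simp

lemma poly_span_in:
  "y \<in> poly_span R W x n \<Longrightarrow> W \<subseteq> carrier R \<Longrightarrow> x \<in> carrier R \<Longrightarrow> y \<in> carrier R"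
  using poly_span_closed by blast

lemma poly_span_mono_set: "W \<subseteq> W' \<Longrightarrow> poly_span R W x n \<subseteq> poly_span R W' x n"
proof (induction n)
  case (Suc n)
  then show ?case by (fastforce simp: subset_iff)
qed simp

lemma poly_span_1: "W \<subseteq> carrier R \<Longrightarrow> poly_span R W x (Suc 0) = W"
  by (force intro: exI[of _ "\<zero>"] simp: subset_iff)

context
  fixes W x
  assumes W: "additive_subgroup W R" and x: "x \<in> carrier R"
begin

lemma W_sub: "W \<subseteq> carrier R"
  by (rule additive_subgroup.a_subset[OF W])

lemma poly_span_zero: "\<zero> \<in> poly_span R W x n"
proof (induction n)
  case (Suc n)
  have "\<zero> \<otimes> x [^] n \<oplus> \<zero> \<in> poly_span R W x (Suc n)"
    using Suc additive_subgroup.zero_closed[OF W] by (intro poly_span_SucI)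
  then show ?case using x by simp
qed simp

lemma poly_span_Suc_mono: "poly_span R W x n \<subseteq> poly_span R W x (Suc n)"
proof
  fix y assume y: "y \<in> poly_span R W x n"
  then have "\<zero> \<otimes> x [^] n \<oplus> y \<in> poly_span R W x (Suc n)"
    using additive_subgroup.zero_closed[OF W] by (intro poly_span_SucI)
  then show "y \<in> poly_span R W x (Suc n)"
    using x poly_span_in[OF y W_sub] by simp
qed

lemma poly_span_mono: "n \<le> m \<Longrightarrow> poly_span R W x n \<subseteq> poly_span R W x m"
  by (rule lift_Suc_mono_le[of "poly_span R W x"]) (use poly_span_Suc_mono in auto)

lemma poly_span_monom: "w \<in> W \<Longrightarrow> w \<otimes> x [^] n \<in> poly_span R W x (Suc n)"
  using poly_span_SucI[OF _ poly_span_zero, of w n] W_sub x by (auto simp: subset_iff)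

lemma poly_span_add:
  "u \<in> poly_span R W x n \<Longrightarrow> v \<in> poly_span R W x n \<Longrightarrow> u \<oplus> v \<in> poly_span R W x n"
proof (induction n arbitrary: u v)
  case (Suc n)
  obtain w y where 1: "w \<in> W" "y \<in> poly_span R W x n" "u = w \<otimes> x [^] n \<oplus> y"
    using Suc.prems by (auto)
  obtain w' y' where 2: "w' \<in> W" "y' \<in> poly_span R W x n" "v = w' \<otimes> x [^] n \<oplus> y'"
    using Suc.prems by (auto)
  have c: "w \<in> carrier R" "w' \<in> carrier R" "y \<in> carrier R" "y' \<in> carrier R" "x [^] n \<in> carrier R"
    using 1 2 W_sub x poly_span_in by auto
  have "u \<oplus> v = (w \<oplus> w') \<otimes> x [^] n \<oplus> (y \<oplus> y')"
    unfolding 1 2 using c by algebra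
  then show ?case
    using Suc.IH[OF 1(2) 2(2)] additive_subgroup.a_closed[OF W 1(1) 2(1)] poly_span_SucI by metis
qed auto

lemma poly_span_neg: "u \<in> poly_span R W x n \<Longrightarrow> \<ominus> u \<in> poly_span R W x n"
proof (induction n arbitrary: u)
  case (Suc n)
  obtain w y where 1: "w \<in> W" "y \<in> poly_span R W x n" "u = w \<otimes> x [^] n \<oplus> y"
    using Suc.prems by (auto)
  have c: "w \<in> carrier R" "y \<in> carrier R" "x [^] n \<in> carrier R"
    using 1 W_sub x poly_span_in by auto
  have "\<ominus> u = (\<ominus> w) \<otimes> x [^] n \<oplus> (\<ominus> y)"
    unfolding 1 using c by algebra
  then show ?case
    using Suc.IH[OF 1(2)] 1(1) poly_span_SucI additive_subgroup.a_inv_closed[OF W] by metis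
qed auto

lemma poly_span_minus:
  "u \<in> poly_span R W x n \<Longrightarrow> v \<in> poly_span R W x n \<Longrightarrow> u \<ominus> v \<in> poly_span R W x n"
  unfolding a_minus_def by (intro poly_span_add poly_span_neg)

lemma poly_span_lmult:
  assumes "v \<in> carrier R" "\<And>w. w \<in> V \<Longrightarrow> v \<otimes> w \<in> W" "V \<subseteq> carrier R"
  shows "u \<in> poly_span R V x n \<Longrightarrow> v \<otimes> u \<in> poly_span R W x n"
proof (induction n arbitrary: u)
  case (Suc n)
  obtain w y where 1: "w \<in> V" "y \<in> poly_span R V x n" "u = w \<otimes> x [^] n \<oplus> y"
    using Suc.prems by (auto)
  have c: "w \<in> carrier R" "y \<in> carrier R" "x [^] n \<in> carrier R"
    using 1 assms(3) x poly_span_in by auto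
  have "v \<otimes> u = (v \<otimes> w) \<otimes> x [^] n \<oplus> v \<otimes> y"
    unfolding 1 using c assms(1) by algebra
  then show ?case
    using Suc.IH[OF 1(2)] assms(2)[OF 1(1)] poly_span_SucI by metis
qed (use assms in auto)

end

end

text \<open>
  The commutation rule alone, without freeness and generation, so that the degree arguments also
  apply to quotients of \<open>R[x;\<delta>]\<close> and, with \<open>\<delta> = 0\<close>, to
  polynomial expressions in a commutative ring.
\<close>

locale skew_pre = R: cring R + A?: ring A
  for R :: "('a, 'n) ring_scheme" and A :: "('b, 'p) ring_scheme" (structure) +
  fixes \<delta> :: "'a \<Rightarrow> 'a" and \<iota> :: "'a \<Rightarrow> 'b" and x :: 'b
  assumes d_closed [simp, intro]: "a \<in> carrier R \<Longrightarrow> \<delta> a \<in> carrier R"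
    and d_add: "a \<in> carrier R \<Longrightarrow> b \<in> carrier R \<Longrightarrow> \<delta> (a \<oplus>\<^bsub>R\<^esub> b) = \<delta> a \<oplus>\<^bsub>R\<^esub> \<delta> b"
    and d_mult: "a \<in> carrier R \<Longrightarrow> b \<in> carrier R \<Longrightarrow>
       \<delta> (a \<otimes>\<^bsub>R\<^esub> b) = a \<otimes>\<^bsub>R\<^esub> \<delta> b \<oplus>\<^bsub>R\<^esub> \<delta> a \<otimes>\<^bsub>R\<^esub> b"
    and hom: "\<iota> \<in> ring_hom R A"
    and x_closed [simp, intro]: "x \<in> carrier A"
    and x_comm: "r \<in> carrier R \<Longrightarrow> x \<otimes> \<iota> r = \<iota> r \<otimes> x \<oplus> \<iota> (\<delta> r)"
begin

abbreviation "pspan I n \<equiv> poly_span A (\<iota> ` I) x n"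
abbreviation "spanR n \<equiv> pspan (carrier R) n"

sublocale \<iota>: ring_hom_ring R A \<iota>
  by (intro ring_hom_ringI2 R.ring_axioms A.ring_axioms hom)

lemma d_zero [simp]: "\<delta> \<zero>\<^bsub>R\<^esub> = \<zero>\<^bsub>R\<^esub>"
  by (metis R.add.r_cancel_one R.r_zero R.zero_closed d_add d_closed)

lemma d_neg: "a \<in> carrier R \<Longrightarrow> \<delta> (\<ominus>\<^bsub>R\<^esub> a) = \<ominus>\<^bsub>R\<^esub> \<delta> a"
  by (metis R.a_inv_closed R.minus_equality R.r_neg R.l_neg d_add d_closed d_zero)

lemma d_nat: "a \<in> carrier R \<Longrightarrow> \<delta> (add_pow R (n::nat) a) = add_pow R n (\<delta> a)"
  by (induction n) (auto simp: d_add)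

lemma img_subgroup: "additive_subgroup I R \<Longrightarrow> additive_subgroup (\<iota> ` I) A"
  using \<iota>.img_is_add_subgroup[of I] by (simp add: additive_subgroup_def)

lemma spanR_subgroup: "additive_subgroup (\<iota> ` carrier R) A"
  by (intro img_subgroup additive_subgroup.intro R.add.subgroup_self)

lemma sub_carrier: "additive_subgroup I R \<Longrightarrow> \<iota> ` I \<subseteq> carrier A"
  by (metis additive_subgroup.a_subset img_subgroup)

lemma spanR_closed [dest]: "y \<in> spanR n \<Longrightarrow> y \<in> carrier A"
  using poly_span_in[of y "\<iota> ` carrier R" x n] by (simp add: image_subsetI)

lemmas spanR_zero = poly_span_zero[OF spanR_subgroup x_closed]
lemmas spanR_add = poly_span_add[OF spanR_subgroup x_closed]
lemmas spanR_neg = poly_span_neg[OF spanR_subgroup x_closed]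
lemmas spanR_minus = poly_span_minus[OF spanR_subgroup x_closed]
lemmas spanR_mono = poly_span_mono[OF spanR_subgroup x_closed]
lemmas spanR_monom = poly_span_monom[OF spanR_subgroup x_closed, OF imageI]

lemma span_in_spanR: "I \<subseteq> carrier R \<Longrightarrow> pspan I n \<subseteq> spanR n"
  by (intro poly_span_mono_set image_mono)

lemma ideal_subgroup: "ideal I R \<Longrightarrow> additive_subgroup I R"
  by (rule ideal.axioms(1))

lemma span_ideal_lmult:
  assumes I: "ideal I R" and r: "r \<in> carrier R" and u: "u \<in> pspan I n"
  shows "\<iota> r \<otimes> u \<in> pspan I n"
proof (rule poly_span_lmult[OF img_subgroup[OF ideal_subgroup[OF I]] x_closed, of _ "\<iota> ` I"])
  show "\<iota> r \<otimes> w \<in> \<iota> ` I" if "w \<in> \<iota> ` I" for w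
    using that r ideal.I_l_closed[OF I] ideal.Icarr[OF I] by (auto simp flip: \<iota>.hom_mult)
qed (use sub_carrier[OF ideal_subgroup[OF I]] r u in auto)

lemma span_ideal_coeff:
  assumes I: "ideal I R" and r: "r \<in> I" and u: "u \<in> spanR n"
  shows "\<iota> r \<otimes> u \<in> pspan I n"
proof (rule poly_span_lmult[OF img_subgroup[OF ideal_subgroup[OF I]] x_closed, of _ "\<iota> ` carrier R"])
  show "\<iota> r \<otimes> w \<in> \<iota> ` I" if "w \<in> \<iota> ` carrier R" for w
    using that r ideal.I_r_closed[OF I] ideal.Icarr[OF I] by (auto simp flip: \<iota>.hom_mult)
qed (use sub_carrier[OF ideal_subgroup[OF I]] r u ideal.Icarr[OF I] in auto)

lemma spanR_lmult: "r \<in> carrier R \<Longrightarrow> u \<in> spanR n \<Longrightarrow> \<iota> r \<otimes> u \<in> spanR n"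
  using span_ideal_lmult[OF R.oneideal] by blast

lemma span_x_mult:
  assumes I: "ideal I R" and d: "\<delta> ` I \<subseteq> I"
  shows "u \<in> pspan I n \<Longrightarrow> x \<otimes> u \<in> pspan I (Suc n)"
proof (induction n arbitrary: u)
  case 0
  then have "x \<otimes> u = \<zero>" by simp
  then show ?case using poly_span_zero[OF img_subgroup[OF ideal_subgroup[OF I]] x_closed, of "Suc 0"] by metis
next
  case (Suc n)
  then obtain r y where 1: "r \<in> I" "y \<in> pspan I n" "u = \<iota> r \<otimes> x [^] n \<oplus> y" by auto
  have rc: "r \<in> carrier R" using 1 ideal.Icarr[OF I] by auto
  have yc: "y \<in> carrier A" using 1 span_in_spanR[of I n] I ideal.Icarr[OF I] by blast
  have *: "\<iota> (\<delta> r) \<otimes> x [^] n \<in> pspan I (Suc n)"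
    using poly_span_monom[OF img_subgroup[OF ideal_subgroup[OF I]] x_closed] 1 d by auto
  have "x \<otimes> u = (x \<otimes> \<iota> r) \<otimes> x [^] n \<oplus> x \<otimes> y" unfolding 1 using rc yc by (simp add: r_distr m_assoc)
  also have "\<dots> = \<iota> r \<otimes> (x \<otimes> x [^] n) \<oplus> (\<iota> (\<delta> r) \<otimes> x [^] n \<oplus> x \<otimes> y)"
    using rc yc by (simp add: x_comm l_distr m_assoc a_assoc)
  also have "x \<otimes> x [^] n = x [^] (Suc n)" by (metis x_closed A.nat_pow_Suc2)
  finally show ?case
    using poly_span_SucI[of "\<iota> r" "\<iota> ` I" _ x "Suc n"] 1(1)
      poly_span_add[OF img_subgroup[OF ideal_subgroup[OF I]] x_closed * Suc.IH[OF 1(2)]] by auto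
qed

lemma spanR_x: "u \<in> spanR n \<Longrightarrow> x \<otimes> u \<in> spanR (Suc n)"
  using span_x_mult[OF R.oneideal] by blast

lemma span_pow_mult:
  assumes I: "ideal I R" and d: "\<delta> ` I \<subseteq> I" and u: "u \<in> pspan I n"
  shows "x [^] (k::nat) \<otimes> u \<in> pspan I (k + n)"
proof (induction k)
  case 0
  have "u \<in> carrier A" using u span_in_spanR[of I n] ideal.Icarr[OF I] by blast
  then show ?case using u by simp
next
  case (Suc k)
  have "u \<in> carrier A" using u span_in_spanR[of I n] ideal.Icarr[OF I] by blast
  then have "x [^] Suc k \<otimes> u = x \<otimes> (x [^] k \<otimes> u)" by (metis x_closed A.nat_pow_Suc2 m_assoc nat_pow_closed)
  then show ?case using span_x_mult[OF I d Suc] by simp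
qed

text \<open>
  The right ideal \<open>I A\<close>; if \<open>I\<close> is a \<open>\<delta>\<close>-ideal and
  \<open>A\<close> is generated by \<open>R\<close> and \<open>x\<close>, it is two-sided and
  equal to \<open>A I\<close>.
\<close>

definition "ext I = (\<Union>n. pspan I n)"

lemma span_mult:
  assumes I: "ideal I R" and d: "\<delta> ` I \<subseteq> I" and u: "u \<in> pspan I n" and v: "v \<in> spanR m"
  shows "v \<otimes> u \<in> pspan I (m + n)"
  using v
proof (induction m arbitrary: v)
  case 0
  have "u \<in> carrier A" using u span_in_spanR[of I n] ideal.Icarr[OF I] by blast
  then show ?case using 0 poly_span_zero[OF img_subgroup[OF ideal_subgroup[OF I]] x_closed] by simp
next
  case (Suc m)
  then obtain r y where 1: "r \<in> carrier R" "y \<in> spanR m" "v = \<iota> r \<otimes> x [^] m \<oplus> y" by auto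
  have c: "u \<in> carrier A" "y \<in> carrier A"
    using 1 u span_in_spanR[of I n] ideal.Icarr[OF I] by blast+
  have "v \<otimes> u = \<iota> r \<otimes> (x [^] m \<otimes> u) \<oplus> y \<otimes> u"
    unfolding 1 using 1 c by (simp add: l_distr m_assoc)
  moreover have "\<iota> r \<otimes> (x [^] m \<otimes> u) \<in> pspan I (m + n)"
    using span_pow_mult[OF I d u] 1 span_ideal_lmult[OF I] by blast
  ultimately show ?case
    using poly_span_add[OF img_subgroup[OF ideal_subgroup[OF I]] x_closed]
      poly_span_mono[OF img_subgroup[OF ideal_subgroup[OF I]] x_closed, of "m + n" "Suc m + n"]
      Suc.IH[OF 1(2)] by auto
qed

lemma spanR_mult: "u \<in> spanR n \<Longrightarrow> v \<in> spanR m \<Longrightarrow> v \<otimes> u \<in> spanR (m + n)"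
  by (rule span_mult[OF R.oneideal]) auto

lemma span_rmult:
  assumes I: "ideal I R" and u: "u \<in> pspan I n" and v: "v \<in> spanR m"
  shows "u \<otimes> v \<in> pspan I (n + m)"
  using u
proof (induction n arbitrary: u)
  case 0
  then show ?case using poly_span_zero[OF img_subgroup[OF ideal_subgroup[OF I]] x_closed] v by auto
next
  case (Suc n)
  then obtain r y where 1: "r \<in> I" "y \<in> pspan I n" "u = \<iota> r \<otimes> x [^] n \<oplus> y" by auto
  have c: "v \<in> carrier A" "y \<in> carrier A" "r \<in> carrier R"
    using 1 v span_in_spanR[of I n] ideal.Icarr[OF I] by blast+
  have "u \<otimes> v = \<iota> r \<otimes> (x [^] n \<otimes> v) \<oplus> y \<otimes> v"
    unfolding 1 using c by (simp add: l_distr m_assoc)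
  moreover have "\<iota> r \<otimes> (x [^] n \<otimes> v) \<in> pspan I (n + m)"
    using span_pow_mult[OF R.oneideal _ v] 1 span_ideal_coeff[OF I] by auto
  ultimately show ?case
    using poly_span_add[OF img_subgroup[OF ideal_subgroup[OF I]] x_closed]
      poly_span_mono[OF img_subgroup[OF ideal_subgroup[OF I]] x_closed, of "n + m" "Suc n + m"]
      Suc.IH[OF 1(2)] by auto
qed

lemma ext_mem: "ideal I R \<Longrightarrow> r \<in> I \<Longrightarrow> \<iota> r \<in> ext I"
proof -
  assume I: "ideal I R" and r: "r \<in> I"
  have "\<iota> r \<otimes> x [^] (0::nat) \<in> pspan I (Suc 0)"
    using poly_span_monom[OF img_subgroup[OF ideal_subgroup[OF I]] x_closed] r by blast
  then have "\<iota> r \<in> pspan I (Suc 0)" using r ideal.Icarr[OF I] by simp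
  then show ?thesis unfolding ext_def by blast
qed

lemma ext_minimal:
  assumes J: "ideal J A" and I: "\<iota> ` I \<subseteq> J"
  shows "ext I \<subseteq> J"
proof -
  have "pspan I n \<subseteq> J" for n
    using I by (induction n) (auto intro!: additive_subgroup.a_closed[OF ideal.axioms(1)[OF J]]
        additive_subgroup.zero_closed[OF ideal.axioms(1)[OF J]] ideal.I_r_closed[OF J])
  then show ?thesis by (auto simp: ext_def)
qed

text \<open>
  The second coefficient is recorded because commutators are governed by it; in characteristic
  zero the factor \<open>n + 1\<close> is harmless.
\<close>

lemma pow_comm:
  assumes r: "r \<in> carrier R"
  shows "\<exists>y \<in> spanR n. x [^] Suc n \<otimes> \<iota> r = \<iota> r \<otimes> x [^] Suc n \<oplus> (\<iota> (add_pow R (Suc n) (\<delta> r)) \<otimes> x [^] n \<oplus> y)"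
proof (induction n)
  case 0
  show ?case using r by (auto intro!: bexI[of _ \<zero>] simp: x_comm)
next
  case (Suc n)
  let ?k = "add_pow R (Suc n) (\<delta> r)"
  have k: "?k \<in> carrier R" using r by (intro R.add.nat_pow_closed d_closed)
  obtain y where y: "y \<in> spanR n"
    and e: "x [^] Suc n \<otimes> \<iota> r = \<iota> r \<otimes> x [^] Suc n \<oplus> (\<iota> ?k \<otimes> x [^] n \<oplus> y)" using Suc by blast
  have yc: "y \<in> carrier A" using y by blast
  have xs: "x \<otimes> x [^] m = x [^] Suc m" for m :: nat by (metis x_closed A.nat_pow_Suc2)
  have "x [^] Suc (Suc n) \<otimes> \<iota> r = x \<otimes> (x [^] Suc n \<otimes> \<iota> r)"
    unfolding xs[symmetric] using r by (intro m_assoc) auto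
  also have "\<dots> = (x \<otimes> \<iota> r) \<otimes> x [^] Suc n \<oplus> ((x \<otimes> \<iota> ?k) \<otimes> x [^] n \<oplus> x \<otimes> y)"
    unfolding e using r yc k by (simp add: r_distr m_assoc del: R.add.nat_pow_Suc A.nat_pow_Suc)
  also have "\<dots> = \<iota> r \<otimes> (x \<otimes> x [^] Suc n) \<oplus> (\<iota> (\<delta> r) \<otimes> x [^] Suc n \<oplus> \<iota> ?k \<otimes> (x \<otimes> x [^] n)
      \<oplus> (\<iota> (\<delta> ?k) \<otimes> x [^] n \<oplus> x \<otimes> y))"
    using r yc k by (simp add: x_comm l_distr m_assoc a_assoc del: R.add.nat_pow_Suc A.nat_pow_Suc)
  also have "\<iota> (\<delta> r) \<otimes> x [^] Suc n \<oplus> \<iota> ?k \<otimes> (x \<otimes> x [^] n) = \<iota> (add_pow R (Suc (Suc n)) (\<delta> r)) \<otimes> x [^] Suc n"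
  proof -
    have "add_pow R (Suc (Suc n)) (\<delta> r) = \<delta> r \<oplus>\<^bsub>R\<^esub> ?k"
      by (subst R.add.nat_pow_Suc) (use r k in \<open>simp only: R.a_comm d_closed\<close>)
    then show ?thesis unfolding xs using r k by (simp add: l_distr del: R.add.nat_pow_Suc A.nat_pow_Suc)
  qed
  finally have "x [^] Suc (Suc n) \<otimes> \<iota> r = \<iota> r \<otimes> x [^] Suc (Suc n) \<oplus>
      (\<iota> (add_pow R (Suc (Suc n)) (\<delta> r)) \<otimes> x [^] Suc n \<oplus> (\<iota> (\<delta> ?k) \<otimes> x [^] n \<oplus> x \<otimes> y))"
    unfolding xs .
  moreover have "\<iota> (\<delta> ?k) \<otimes> x [^] n \<oplus> x \<otimes> y \<in> spanR (Suc n)"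
    using k spanR_x[OF y] spanR_monom by (intro spanR_add) auto
  ultimately show ?case by blast
qed

lemma pow_comm1:
  assumes r: "r \<in> carrier R"
  shows "\<exists>y \<in> spanR n. x [^] n \<otimes> \<iota> r = \<iota> r \<otimes> x [^] n \<oplus> y"
proof (cases n)
  case 0
  then show ?thesis using r by (auto intro!: bexI[of _ \<zero>])
next
  case (Suc m)
  obtain y where y: "y \<in> spanR m"
    "x [^] n \<otimes> \<iota> r = \<iota> r \<otimes> x [^] n \<oplus> (\<iota> (add_pow R n (\<delta> r)) \<otimes> x [^] m \<oplus> y)"
    using pow_comm[OF r, of m] unfolding Suc by blast
  moreover have "\<iota> (add_pow R n (\<delta> r)) \<otimes> x [^] m \<oplus> y \<in> spanR n"
    unfolding Suc
  proof (rule spanR_add)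
    show "\<iota> (add_pow R (Suc m) (\<delta> r)) \<otimes> x [^] m \<in> spanR (Suc m)"
      using r by (intro spanR_monom R.add.nat_pow_closed d_closed)
    show "y \<in> spanR (Suc m)" using spanR_mono[of m "Suc m"] y(1) by (meson le_SucI order_refl subsetD)
  qed
  ultimately show ?thesis by blast
qed

text \<open>
  Since \<open>R\<close> is commutative, the leading terms of \<open>u r\<close> and \<open>r
  u\<close> agree.
\<close>

lemma commutator_drops_degree:
  assumes r: "r \<in> carrier R" and u: "u \<in> spanR n"
  shows "u \<otimes> \<iota> r \<ominus> \<iota> r \<otimes> u \<in> spanR (n - 1)"
  using u
proof (induction n arbitrary: u)
  case 0
  then show ?case using r by (simp add: a_minus_def)
next
  case (Suc n)
  then obtain s y where 1: "s \<in> carrier R" "y \<in> spanR n" "u = \<iota> s \<otimes> x [^] n \<oplus> y" by auto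
  obtain z where z: "z \<in> spanR n" "x [^] n \<otimes> \<iota> r = \<iota> r \<otimes> x [^] n \<oplus> z"
    using pow_comm1[OF r] by blast
  have c: "y \<in> carrier A" "z \<in> carrier A" using 1 z by auto
  have sr: "\<iota> s \<otimes> (\<iota> r \<otimes> x [^] n) = \<iota> r \<otimes> (\<iota> s \<otimes> x [^] n)"
    using r 1 by (simp add: R.m_comm flip: m_assoc \<iota>.hom_mult)
  have "u \<otimes> \<iota> r \<ominus> \<iota> r \<otimes> u = \<iota> s \<otimes> (\<iota> r \<otimes> x [^] n) \<oplus> \<iota> s \<otimes> z \<oplus> y \<otimes> \<iota> r \<ominus> (\<iota> r \<otimes> (\<iota> s \<otimes> x [^] n) \<oplus> \<iota> r \<otimes> y)"
    unfolding 1 using r 1 c by (simp add: l_distr r_distr m_assoc z(2))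
  also have "\<dots> = \<iota> s \<otimes> z \<oplus> (y \<otimes> \<iota> r \<ominus> \<iota> r \<otimes> y)"
    unfolding sr using r 1(1) c by (simp add: a_minus_def minus_add a_ac r_neg r_neg1 r_neg2)
  also have "\<dots> \<in> spanR n"
    using Suc.IH[OF 1(2)] spanR_mono[of "n - 1" n] spanR_lmult[OF 1(1) z(1)] by (intro spanR_add) auto
  finally show ?case by simp
qed

text \<open>
  The inductions on the degree that use characteristic zero rest on this formula: a commutator
  with \<open>r\<close> lowers the degree by exactly one as long as the new leading coefficient
  stays outside the prime ideal in question.
\<close>

lemma commutator_lead:
  assumes r: "r \<in> carrier R" and s: "s \<in> carrier R" and y: "y \<in> spanR (Suc n)"
  shows "\<exists>z \<in> spanR n. (\<iota> s \<otimes> x [^] Suc n \<oplus> y) \<otimes> \<iota> r \<ominus> \<iota> r \<otimes> (\<iota> s \<otimes> x [^] Suc n \<oplus> y) =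
     \<iota> (s \<otimes>\<^bsub>R\<^esub> (add_pow R (Suc n) (\<delta> r))) \<otimes> x [^] n \<oplus> z"
proof -
  obtain z where z: "z \<in> spanR n"
    "x [^] Suc n \<otimes> \<iota> r = \<iota> r \<otimes> x [^] Suc n \<oplus> (\<iota> (add_pow R (Suc n) (\<delta> r)) \<otimes> x [^] n \<oplus> z)"
    using pow_comm[OF r] by blast
  define Z where "Z = x [^] Suc n"
  define k where "k = add_pow R (Suc n) (\<delta> r)"
  have c: "y \<in> carrier A" "z \<in> carrier A" "Z \<in> carrier A" "k \<in> carrier R"
    using y z r unfolding Z_def k_def by (auto simp del: nat_pow_Suc R.add.nat_pow_Suc)
  have z2: "Z \<otimes> \<iota> r = \<iota> r \<otimes> Z \<oplus> (\<iota> k \<otimes> x [^] n \<oplus> z)" using z unfolding Z_def k_def by simp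
  have sr: "\<iota> s \<otimes> (\<iota> r \<otimes> Z) = \<iota> r \<otimes> (\<iota> s \<otimes> Z)"
    using r s c by (simp add: R.m_comm flip: m_assoc \<iota>.hom_mult)
  have "(\<iota> s \<otimes> Z \<oplus> y) \<otimes> \<iota> r \<ominus> \<iota> r \<otimes> (\<iota> s \<otimes> Z \<oplus> y)
      = \<iota> s \<otimes> (\<iota> r \<otimes> Z) \<oplus> \<iota> s \<otimes> (\<iota> k \<otimes> x [^] n \<oplus> z) \<oplus> y \<otimes> \<iota> r \<ominus> (\<iota> r \<otimes> (\<iota> s \<otimes> Z) \<oplus> \<iota> r \<otimes> y)"
    using r s c by (simp add: l_distr r_distr m_assoc z2)
  also have "\<dots> = \<iota> s \<otimes> (\<iota> k \<otimes> x [^] n) \<oplus> (\<iota> s \<otimes> z \<oplus> (y \<otimes> \<iota> r \<ominus> \<iota> r \<otimes> y))"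
    unfolding sr using r s c by (simp add: a_minus_def minus_add a_ac r_neg r_neg1 r_neg2 r_distr)
  also have "\<iota> s \<otimes> (\<iota> k \<otimes> x [^] n) = \<iota> (s \<otimes>\<^bsub>R\<^esub> k) \<otimes> x [^] n"
    using s c by (simp add: m_assoc)
  finally show ?thesis
    unfolding Z_def k_def using commutator_drops_degree[OF r y] spanR_lmult[OF s z(1)] spanR_add by auto
qed

lemma spanR_subring: "subring (\<Union>n. spanR n) A"
proof (rule A.subringI)
  show "(\<Union>n. spanR n) \<subseteq> carrier A" by auto
  have "\<iota> \<one>\<^bsub>R\<^esub> \<otimes> x [^] (0::nat) \<in> spanR (Suc 0)" by (intro spanR_monom) auto
  then have "\<one> \<in> spanR (Suc 0)" by (simp del: poly_span.simps)
  then show "\<one> \<in> (\<Union>n. spanR n)" by blast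
  show "\<ominus> h \<in> (\<Union>n. spanR n)" if "h \<in> (\<Union>n. spanR n)" for h using that spanR_neg by blast
  fix u v assume "u \<in> (\<Union>n. spanR n)" "v \<in> (\<Union>n. spanR n)"
  then obtain n m where u: "u \<in> spanR n" and v: "v \<in> spanR m" by blast
  show "u \<otimes> v \<in> (\<Union>n. spanR n)" using spanR_mult[OF v u] by blast
  have "u \<in> spanR (max n m)" "v \<in> spanR (max n m)"
    using u v spanR_mono by (meson max.cobounded1 max.cobounded2 subsetD)+
  then show "u \<oplus> v \<in> (\<Union>n. spanR n)" using spanR_add by blast
qed

end

locale skew_gen = skew_pre R A \<delta> \<iota> x
  for R :: "('a, 'n) ring_scheme" and A :: "('b, 'p) ring_scheme" (structure) and \<delta> \<iota> x +
  assumes gen: "carrier A = (\<Union>n. poly_span A (\<iota> ` carrier R) x n)"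
begin

lemma ext_ideal:
  assumes I: "ideal I R" and d: "\<delta> ` I \<subseteq> I"
  shows "ideal (ext I) A"
proof (rule idealI)
  note sg = img_subgroup[OF ideal_subgroup[OF I]]
  show "subgroup (ext I) (add_monoid A)"
  proof (rule A.add.subgroupI)
    show "ext I \<subseteq> carrier A"
      using span_in_spanR[of I] ideal.Icarr[OF I] by (auto simp: ext_def)
    show "ext I \<noteq> {}" using poly_span_zero[OF sg x_closed] by (auto simp: ext_def)
    fix a b assume a: "a \<in> ext I" and b: "b \<in> ext I"
    then obtain n m where "a \<in> pspan I n" "b \<in> pspan I m" by (auto simp: ext_def)
    then have "a \<in> pspan I (max n m)" "b \<in> pspan I (max n m)"
      using poly_span_mono[OF sg x_closed] by (meson max.cobounded1 max.cobounded2 subsetD)+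
    then show "a \<oplus> b \<in> ext I" using poly_span_add[OF sg x_closed] unfolding ext_def by blast
  next
    fix a assume a: "a \<in> ext I"
    then show "\<ominus> a \<in> ext I"
      using poly_span_neg[OF sg x_closed] unfolding ext_def by auto
  qed
  fix a y assume a: "a \<in> ext I" and y: "y \<in> carrier A"
  obtain n m where nm: "a \<in> pspan I n" "y \<in> spanR m" using a y gen by (auto simp: ext_def)
  show "y \<otimes> a \<in> ext I" using span_mult[OF I d nm] by (auto simp: ext_def)
  show "a \<otimes> y \<in> ext I" using span_rmult[OF I nm] by (auto simp: ext_def)
qed (rule A.ring_axioms)

end

section \<open>Algebraic elements under injective homomorphisms\<close>

lemma eval_map_hom:
  assumes "ring F" "ring G" "\<phi> \<in> ring_hom F G" "set p \<subseteq> carrier F" "z \<in> carrier F"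
  shows "ring.eval G (map \<phi> p) (\<phi> z) = \<phi> (ring.eval F p z)"
proof -
  interpret F: ring F by fact
  interpret G: ring G by fact
  interpret h: ring_hom_ring F G \<phi> by (intro ring_hom_ringI2 assms F.ring_axioms G.ring_axioms)
  show ?thesis
    using assms(4) by (induction p) (use assms(5) in \<open>auto simp: h.hom_nat_pow F.eval_in_carrier\<close>)
qed

lemma polynomial_iff: "polynomial\<^bsub>R\<^esub> S p \<longleftrightarrow> p = [] \<or> (set p \<subseteq> S \<and> lead_coeff p \<noteq> \<zero>\<^bsub>R\<^esub>)"
  by (auto simp: polynomial_def)

lemma univ_poly_carrier': "carrier (univ_poly R S) = {p. polynomial\<^bsub>R\<^esub> S p}"
  by (simp add: univ_poly_def)

text \<open>
  Being algebraic depends only on which evaluations of polynomials coincide, and an injective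
  homomorphism does not change that. This is how algebraicity over the base field is compared in
  \<open>R / P\<close>, in its field of fractions and in the fractions of \<open>A / P\<close>.
\<close>

lemma algebraic_transport:
  assumes "ring F" "ring G" "\<phi> \<in> ring_hom F G" "inj_on \<phi> (carrier F)" "S \<subseteq> carrier F" "z \<in> carrier F"
  shows "ring.algebraic G (\<phi> ` S) (\<phi> z) \<longleftrightarrow> ring.algebraic F S z"
proof -
  interpret F: ring F by fact
  interpret G: ring G by fact
  interpret h: ring_hom_ring F G \<phi> by (intro ring_hom_ringI2 assms F.ring_axioms G.ring_axioms)
  have z: "\<phi> c = \<zero>\<^bsub>G\<^esub> \<longleftrightarrow> c = \<zero>\<^bsub>F\<^esub>" if "c \<in> carrier F" for c
    using inj_onD[OF assms(4), of c "\<zero>\<^bsub>F\<^esub>"] that by auto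
  have c: "set p \<subseteq> carrier F" if "polynomial\<^bsub>F\<^esub> S p" for p
    using that assms(5) by (auto simp: polynomial_iff)
  have img: "{p. polynomial\<^bsub>G\<^esub> (\<phi> ` S) p} = map \<phi> ` {p. polynomial\<^bsub>F\<^esub> S p}" (is "?L = ?R")
  proof (intro equalityI subsetI)
    fix q assume q: "q \<in> ?L"
    then have "q \<in> lists (\<phi> ` S)" by (auto simp: polynomial_iff)
    then obtain p where p: "q = map \<phi> p" "set p \<subseteq> S" unfolding lists_image by auto
    with q z assms(5) show "q \<in> ?R"
      by (auto simp: polynomial_iff hd_map intro!: imageI)
  qed (use z assms(5) in \<open>auto simp: polynomial_iff hd_map subset_iff\<close>)
  have inj: "inj_on (map \<phi>) {p. polynomial\<^bsub>F\<^esub> S p}"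
  proof (rule inj_onI)
    fix p q assume "p \<in> {p. polynomial\<^bsub>F\<^esub> S p}" "q \<in> {p. polynomial\<^bsub>F\<^esub> S p}" and e: "map \<phi> p = map \<phi> q"
    then have "inj_on \<phi> (set p \<union> set q)" using c inj_on_subset[OF assms(4)] by simp
    then show "p = q" using e inj_on_map_eq_map by blast
  qed
  have ev: "ring.eval G (map \<phi> p) (\<phi> z) = \<phi> (ring.eval F p z)" if "polynomial\<^bsub>F\<^esub> S p" for p
    using that c by (intro eval_map_hom assms) auto
  have "G.transcendental (\<phi> ` S) (\<phi> z) \<longleftrightarrow>
      inj_on ((\<lambda>q. G.eval q (\<phi> z)) \<circ> map \<phi>) {p. polynomial\<^bsub>F\<^esub> S p}"
    unfolding G.transcendental_def univ_poly_carrier' img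
    by (rule comp_inj_on_iff[OF inj])
  also have "\<dots> \<longleftrightarrow> inj_on (\<phi> \<circ> (\<lambda>p. F.eval p z)) {p. polynomial\<^bsub>F\<^esub> S p}"
    by (rule inj_on_cong) (use ev in auto)
  also have "\<dots> \<longleftrightarrow> F.transcendental S z"
  proof -
    have "(\<lambda>p. F.eval p z) ` {p. polynomial\<^bsub>F\<^esub> S p} \<subseteq> carrier F"
      using c assms(6) by (auto intro: F.eval_in_carrier)
    then have "inj_on \<phi> ((\<lambda>p. F.eval p z) ` {p. polynomial\<^bsub>F\<^esub> S p})"
      using assms(4) inj_on_subset by blast
    then show ?thesis
      unfolding F.transcendental_def univ_poly_carrier'
      by (meson comp_inj_on inj_on_imageI2)
  qed
  finally show ?thesis by blast
qed

section \<open>The division ring of fractions of an Ore domain\<close>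

locale ore_domain = ring B for B (structure) +
  assumes one_neq_zero [simp]: "\<one> \<noteq> \<zero>"
    and no_zero_div: "a \<in> carrier B \<Longrightarrow> b \<in> carrier B \<Longrightarrow> a \<otimes> b = \<zero> \<Longrightarrow> a = \<zero> \<or> b = \<zero>"
    and ore: "a \<in> carrier B \<Longrightarrow> b \<in> carrier B \<Longrightarrow> b \<noteq> \<zero> \<Longrightarrow>
       \<exists>u \<in> carrier B. \<exists>v \<in> carrier B. u \<noteq> \<zero> \<and> u \<otimes> a = v \<otimes> b"
begin

abbreviation "lf \<equiv> left_frac B"
abbreviation "F \<equiv> Frac B"

lemma mult_zero_iff: "a \<in> carrier B \<Longrightarrow> b \<in> carrier B \<Longrightarrow> a \<otimes> b = \<zero> \<longleftrightarrow> a = \<zero> \<or> b = \<zero>"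
  using no_zero_div by auto

lemma l_cancel:
  assumes "a \<in> carrier B" "b \<in> carrier B" "c \<in> carrier B" "a \<noteq> \<zero>" "a \<otimes> b = a \<otimes> c"
  shows "b = c"
proof -
  have "a \<otimes> (b \<ominus> c) = \<zero>" using assms by (simp add: a_minus_def r_distr r_minus r_neg)
  then have "b \<ominus> c = \<zero>" using assms mult_zero_iff by auto
  then show ?thesis using assms by simp
qed

lemma r_cancel:
  assumes "a \<in> carrier B" "b \<in> carrier B" "c \<in> carrier B" "a \<noteq> \<zero>" "b \<otimes> a = c \<otimes> a"
  shows "b = c"
proof -
  have "(b \<ominus> c) \<otimes> a = \<zero>" using assms by (simp add: a_minus_def l_distr l_minus r_neg)
  then have "b \<ominus> c = \<zero>" using assms mult_zero_iff by auto
  then show ?thesis using assms by simp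
qed

lemma regular_eq: "regular_elems B = carrier B - {\<zero>}"
proof -
  have "\<zero> \<notin> regular_elems B" by (auto simp: regular_elems_def intro!: bexI[of _ \<one>])
  moreover have "s \<in> regular_elems B" if "s \<in> carrier B - {\<zero>}" for s
    using that no_zero_div unfolding regular_elems_def by blast
  moreover have "regular_elems B \<subseteq> carrier B" unfolding regular_elems_def by blast
  ultimately show ?thesis by blast
qed

lemma common_mult:
  assumes "s \<in> carrier B" "t \<in> carrier B" "s \<noteq> \<zero>" "t \<noteq> \<zero>"
  obtains u v where "u \<in> carrier B" "v \<in> carrier B" "u \<noteq> \<zero>" "v \<noteq> \<zero>" "u \<otimes> s = v \<otimes> t" "u \<otimes> s \<noteq> \<zero>"
proof -
  obtain u v where "u \<in> carrier B" "v \<in> carrier B" "u \<noteq> \<zero>" "u \<otimes> s = v \<otimes> t"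
    using ore[of s t] assms by blast
  moreover from this have "u \<otimes> s \<noteq> \<zero>" using assms mult_zero_iff by auto
  moreover from calculation have "v \<noteq> \<zero>" using assms by auto
  ultimately show ?thesis using that by blast
qed

lemma mem_lf:
  "(t, b) \<in> lf s a \<longleftrightarrow> t \<in> carrier B \<and> t \<noteq> \<zero> \<and> b \<in> carrier B \<and>
     (\<exists>u \<in> carrier B. \<exists>v \<in> carrier B. u \<otimes> s = v \<otimes> t \<and> u \<otimes> s \<in> carrier B \<and> u \<otimes> s \<noteq> \<zero> \<and> u \<otimes> a = v \<otimes> b)"
  unfolding left_frac_def regular_eq by auto

lemma mem_lfI:
  assumes "u \<in> carrier B" "v \<in> carrier B" "u \<otimes> s = v \<otimes> t" "u \<otimes> a = v \<otimes> b" "u \<otimes> s \<noteq> \<zero>"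
    and "s \<in> carrier B" "t \<in> carrier B" "t \<noteq> \<zero>" "b \<in> carrier B"
  shows "(t, b) \<in> lf s a"
  unfolding mem_lf using assms m_closed by blast

text \<open>
  Membership in a left fraction provides one common multiple of the two denominators that
  identifies the numerators; here every common multiple does. Two common multiples again have a
  common multiple, and a domain allows cancellation. The independence of all operations from
  representatives follows from this.
\<close>

lemma mem_lf_all:
  assumes st: "(t, b) \<in> lf s a" and s: "s \<in> carrier B" "a \<in> carrier B"
    and u': "u' \<in> carrier B" "v' \<in> carrier B" "u' \<otimes> s = v' \<otimes> t"
  shows "u' \<otimes> a = v' \<otimes> b"
proof -
  obtain u v where t: "t \<in> carrier B" "t \<noteq> \<zero>" "b \<in> carrier B" and
    u: "u \<in> carrier B" "v \<in> carrier B" "u \<otimes> s = v \<otimes> t" "u \<otimes> s \<noteq> \<zero>" "u \<otimes> a = v \<otimes> b"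
    using st mem_lf by auto
  show ?thesis
  proof (cases "u' = \<zero>")
    case True
    then have "v' = \<zero>" using u' s t mult_zero_iff[of v' t] by auto
    then show ?thesis using True s t by simp
  next
    case False
    have "u \<noteq> \<zero>" using u s by auto
    then obtain w w' where w: "w \<in> carrier B" "w' \<in> carrier B" "w' \<noteq> \<zero>" "w \<otimes> u = w' \<otimes> u'"
      using common_mult[of u u'] False u u' by metis
    have "(w' \<otimes> v') \<otimes> t = (w \<otimes> v) \<otimes> t"
      using w u u' s t by (metis m_assoc)
    then have *: "w' \<otimes> v' = w \<otimes> v" using r_cancel[of t] t w u u' by auto
    have "w' \<otimes> (u' \<otimes> a) = w' \<otimes> (v' \<otimes> b)"
      using * w u u' s t by (metis m_assoc)
    then show ?thesis using l_cancel[of w'] w u' s t by auto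
  qed
qed

lemma lf_mono:
  assumes "(t, b) \<in> lf s a" "s \<in> carrier B" "s \<noteq> \<zero>" "a \<in> carrier B"
  shows "lf t b \<subseteq> lf s a"
proof clarify
  fix r c assume rc: "(r, c) \<in> lf t b"
  have t: "t \<in> carrier B" "t \<noteq> \<zero>" "b \<in> carrier B" and r: "r \<in> carrier B" "r \<noteq> \<zero>" "c \<in> carrier B"
    using assms(1) rc mem_lf by auto
  obtain u v where u: "u \<in> carrier B" "v \<in> carrier B" "u \<otimes> s = v \<otimes> r" "u \<otimes> s \<noteq> \<zero>"
    using common_mult[OF assms(2) r(1) assms(3) r(2)] by metis
  have "u \<noteq> \<zero>" using u assms by auto
  obtain w z where w: "w \<in> carrier B" "z \<in> carrier B" "w \<noteq> \<zero>" "w \<otimes> (u \<otimes> s) = z \<otimes> t"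
    using common_mult[of "u \<otimes> s" t] u t assms by (metis m_closed)
  have 1: "w \<otimes> u \<otimes> a = z \<otimes> b"
    using mem_lf_all[OF assms(1,2,4), of "w \<otimes> u" z] w u assms by (simp add: m_assoc)
  have "z \<otimes> b = w \<otimes> v \<otimes> c"
    using mem_lf_all[OF rc t(1,3), of z "w \<otimes> v"] w u assms r by (simp add: m_assoc)
  then have "w \<otimes> (u \<otimes> a) = w \<otimes> (v \<otimes> c)" using 1 w u r assms by (simp add: m_assoc)
  then have "u \<otimes> a = v \<otimes> c" using l_cancel[of w] w u r assms by auto
  then show "(r, c) \<in> lf s a" using r u assms unfolding mem_lf by blast
qed

lemma lf_self: "s \<in> carrier B \<Longrightarrow> s \<noteq> \<zero> \<Longrightarrow> a \<in> carrier B \<Longrightarrow> (s, a) \<in> lf s a"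
  unfolding mem_lf by (auto intro!: bexI[of _ \<one>])

lemma lf_sym: "(t, b) \<in> lf s a \<Longrightarrow> s \<in> carrier B \<Longrightarrow> s \<noteq> \<zero> \<Longrightarrow> a \<in> carrier B \<Longrightarrow> (s, a) \<in> lf t b"
proof -
  assume tb: "(t, b) \<in> lf s a" and s: "s \<in> carrier B" "s \<noteq> \<zero>" "a \<in> carrier B"
  then obtain u v where "u \<in> carrier B" "v \<in> carrier B" "u \<otimes> s = v \<otimes> t" "u \<otimes> s \<noteq> \<zero>" "u \<otimes> a = v \<otimes> b"
    "t \<in> carrier B" unfolding mem_lf by blast
  then show ?thesis using s by (intro mem_lfI[of v u]) auto
qed

lemma lf_eqI: "(t, b) \<in> lf s a \<Longrightarrow> s \<in> carrier B \<Longrightarrow> s \<noteq> \<zero> \<Longrightarrow> a \<in> carrier B \<Longrightarrow> lf s a = lf t b"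
  by (metis equalityI lf_mono lf_sym mem_lf)

lemma lf_expand:
  assumes "s \<in> carrier B" "s \<noteq> \<zero>" "a \<in> carrier B" "u \<in> carrier B" "u \<noteq> \<zero>"
  shows "lf (u \<otimes> s) (u \<otimes> a) = lf s a"
proof -
  have "(s, a) \<in> lf (u \<otimes> s) (u \<otimes> a)"
    using assms mult_zero_iff by (intro mem_lfI[of \<one> u]) auto
  then show ?thesis using lf_eqI[of s a "u \<otimes> s" "u \<otimes> a"] assms mult_zero_iff by auto
qed

lemma lf_eq_iff:
  assumes "s \<in> carrier B" "s \<noteq> \<zero>" "a \<in> carrier B" "b \<in> carrier B"
  shows "lf s a = lf s b \<longleftrightarrow> a = b"
proof
  assume "lf s a = lf s b"
  then have "(s, b) \<in> lf s a" using lf_self assms by auto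
  from mem_lf_all[OF this assms(1,3), of \<one> \<one>] show "a = b" using assms by simp
qed simp

lemma carrier_F: "carrier F = {lf s a | s a. s \<in> carrier B \<and> s \<noteq> \<zero> \<and> a \<in> carrier B}"
  unfolding Frac_def regular_eq by auto

lemma F_cases:
  assumes "p \<in> carrier F"
  obtains s a where "s \<in> carrier B" "s \<noteq> \<zero>" "a \<in> carrier B" "p = lf s a"
  using assms unfolding carrier_F by auto

lemma lf_closed [simp, intro]: "s \<in> carrier B \<Longrightarrow> s \<noteq> \<zero> \<Longrightarrow> a \<in> carrier B \<Longrightarrow> lf s a \<in> carrier F"
  unfolding carrier_F by auto

text \<open>
  A numerator that is a multiple of the next denominator turns the product of fractions into a
  cancellation.
\<close>

lemma lf_through:
  assumes "p \<in> carrier F" "t \<in> carrier B" "t \<noteq> \<zero>"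
  obtains s v where "s \<in> carrier B" "s \<noteq> \<zero>" "v \<in> carrier B" "p = lf s (v \<otimes> t)"
proof -
  obtain s a where s: "s \<in> carrier B" "s \<noteq> \<zero>" "a \<in> carrier B" "p = lf s a" using F_cases assms by metis
  obtain u v where u: "u \<in> carrier B" "v \<in> carrier B" "u \<noteq> \<zero>" "u \<otimes> a = v \<otimes> t"
    using ore[of a t] s assms by metis
  have "p = lf (u \<otimes> s) (v \<otimes> t)" using lf_expand[of s a u] s u by simp
  then show ?thesis using that[of "u \<otimes> s" v] s u mult_zero_iff by auto
qed

lemma lf_common:
  assumes "p \<in> carrier F" "q \<in> carrier F"
  obtains s a b where "s \<in> carrier B" "s \<noteq> \<zero>" "a \<in> carrier B" "b \<in> carrier B" "p = lf s a" "q = lf s b"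
proof -
  obtain s a where s: "s \<in> carrier B" "s \<noteq> \<zero>" "a \<in> carrier B" "p = lf s a" using F_cases assms by metis
  obtain t b where t: "t \<in> carrier B" "t \<noteq> \<zero>" "b \<in> carrier B" "q = lf t b" using F_cases assms by metis
  obtain u v where u: "u \<in> carrier B" "v \<in> carrier B" "u \<noteq> \<zero>" "v \<noteq> \<zero>" "u \<otimes> s = v \<otimes> t" "u \<otimes> s \<noteq> \<zero>"
    using common_mult[of s t] s t by metis
  have "p = lf (u \<otimes> s) (u \<otimes> a)" "q = lf (u \<otimes> s) (v \<otimes> b)"
    using lf_expand[of s a u] lf_expand[of t b v] s t u by auto
  then show ?thesis using that[of "u \<otimes> s" "u \<otimes> a" "v \<otimes> b"] s t u by auto
qed

lemma lf_common3:
  assumes "p \<in> carrier F" "q \<in> carrier F" "r \<in> carrier F"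
  obtains s a b c where "s \<in> carrier B" "s \<noteq> \<zero>" "a \<in> carrier B" "b \<in> carrier B" "c \<in> carrier B"
    "p = lf s a" "q = lf s b" "r = lf s c"
proof -
  obtain s a b where s: "s \<in> carrier B" "s \<noteq> \<zero>" "a \<in> carrier B" "b \<in> carrier B" "p = lf s a" "q = lf s b"
    using lf_common assms by metis
  obtain t c where t: "t \<in> carrier B" "t \<noteq> \<zero>" "c \<in> carrier B" "r = lf t c" using F_cases assms by metis
  obtain u v where u: "u \<in> carrier B" "v \<in> carrier B" "u \<noteq> \<zero>" "v \<noteq> \<zero>" "u \<otimes> s = v \<otimes> t" "u \<otimes> s \<noteq> \<zero>"
    using common_mult[of s t] s t by metis
  have "p = lf (u \<otimes> s) (u \<otimes> a)" "q = lf (u \<otimes> s) (u \<otimes> b)" "r = lf (u \<otimes> s) (v \<otimes> c)"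
    using lf_expand[of s a u] lf_expand[of s b u] lf_expand[of t c v] s t u by auto
  then show ?thesis using that[of "u \<otimes> s" "u \<otimes> a" "u \<otimes> b" "v \<otimes> c"] s t u by auto
qed

lemma Union_eq_single: "(\<And>c. c \<in> S \<Longrightarrow> c = d) \<Longrightarrow> d \<in> S \<Longrightarrow> \<Union>S = d"
  by blast

text \<open>
  The product is defined as a union over all representatives; all members of the union coincide.
\<close>

lemma lf_mult:
  assumes s: "s \<in> carrier B" "s \<noteq> \<zero>" and t: "t \<in> carrier B" "t \<noteq> \<zero>" and v: "v \<in> carrier B" and b: "b \<in> carrier B"
  shows "lf s (v \<otimes> t) \<otimes>\<^bsub>F\<^esub> lf t b = lf s (v \<otimes> b)"
proof -
  let ?S = "{lf (u' \<otimes> s') (v' \<otimes> b') | s' a' t' b' u' v'. (s', a') \<in> lf s (v \<otimes> t) \<and> (t', b') \<in> lf t b \<and>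
     u' \<in> regular_elems B \<and> v' \<in> carrier B \<and> u' \<otimes> a' = v' \<otimes> t'}"
  have "\<Union>?S = lf s (v \<otimes> b)"
  proof (rule Union_eq_single)
    have "\<one> \<in> regular_elems B" unfolding regular_eq by simp
    moreover have "(s, v \<otimes> t) \<in> lf s (v \<otimes> t)" "(t, b) \<in> lf t b" using assms by (auto intro!: lf_self)
    moreover have "\<one> \<otimes> (v \<otimes> t) = v \<otimes> t" "lf s (v \<otimes> b) = lf (\<one> \<otimes> s) (v \<otimes> b)" using assms by simp_all
    ultimately show "lf s (v \<otimes> b) \<in> ?S" using v by blast
  next
    fix c assume "c \<in> ?S"
    then obtain s' a' t' b' u' v' where c: "c = lf (u' \<otimes> s') (v' \<otimes> b')" and
      1: "(s', a') \<in> lf s (v \<otimes> t)" and 2: "(t', b') \<in> lf t b" and 3: "u' \<in> carrier B" "u' \<noteq> \<zero>" "v' \<in> carrier B"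
      "u' \<otimes> a' = v' \<otimes> t'" unfolding regular_eq by auto
    have s': "s' \<in> carrier B" "s' \<noteq> \<zero>" "a' \<in> carrier B" using 1 mem_lf by auto
    have t': "t' \<in> carrier B" "t' \<noteq> \<zero>" "b' \<in> carrier B" using 2 mem_lf by auto
    have us: "u' \<otimes> s' \<in> carrier B" "u' \<otimes> s' \<noteq> \<zero>" using 3 s' mult_zero_iff by auto
    obtain \<alpha> \<beta> where ab: "\<alpha> \<in> carrier B" "\<beta> \<in> carrier B" "\<alpha> \<otimes> s = \<beta> \<otimes> (u' \<otimes> s')" "\<alpha> \<otimes> s \<noteq> \<zero>"
      using common_mult[OF s(1) us(1) s(2) us(2)] by metis
    have "\<alpha> \<otimes> (v \<otimes> t) = \<beta> \<otimes> u' \<otimes> a'"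
      using mem_lf_all[OF 1, of \<alpha> "\<beta> \<otimes> u'"] ab s s' 3 v t by (simp add: m_assoc)
    also have "\<dots> = \<beta> \<otimes> v' \<otimes> t'" using 3 ab s' t' by (simp add: m_assoc)
    finally have "\<alpha> \<otimes> v \<otimes> b = \<beta> \<otimes> v' \<otimes> b'"
      using mem_lf_all[OF 2 t(1) b, of "\<alpha> \<otimes> v" "\<beta> \<otimes> v'"] ab 3 v t by (simp add: m_assoc)
    then have "(u' \<otimes> s', v' \<otimes> b') \<in> lf s (v \<otimes> b)"
      using us ab 3 t' s' v b s by (intro mem_lfI[of \<alpha> \<beta>]) (auto simp: m_assoc)
    then show "c = lf s (v \<otimes> b)" unfolding c using lf_eqI s v b by auto
  qed
  then show ?thesis by (simp add: Frac_def)
qed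

lemma lf_add:
  assumes s: "s \<in> carrier B" "s \<noteq> \<zero>" and a: "a \<in> carrier B" and b: "b \<in> carrier B"
  shows "lf s a \<oplus>\<^bsub>F\<^esub> lf s b = lf s (a \<oplus> b)"
proof -
  let ?S = "{lf (u' \<otimes> s') (u' \<otimes> a' \<oplus> v' \<otimes> b') | s' a' t' b' u' v'. (s', a') \<in> lf s a \<and> (t', b') \<in> lf s b \<and>
     u' \<in> carrier B \<and> v' \<in> carrier B \<and> u' \<otimes> s' = v' \<otimes> t' \<and> u' \<otimes> s' \<in> regular_elems B}"
  have "\<Union>?S = lf s (a \<oplus> b)"
  proof (rule Union_eq_single)
    have "\<one> \<otimes> s \<in> regular_elems B" unfolding regular_eq using s by simp
    moreover have "(s, a) \<in> lf s a" "(s, b) \<in> lf s b" using assms by (auto intro!: lf_self)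
    moreover have "lf s (a \<oplus> b) = lf (\<one> \<otimes> s) (\<one> \<otimes> a \<oplus> \<one> \<otimes> b)" using assms by simp_all
    ultimately show "lf s (a \<oplus> b) \<in> ?S" by blast
  next
    fix c assume "c \<in> ?S"
    then obtain s' a' t' b' u' v' where c: "c = lf (u' \<otimes> s') (u' \<otimes> a' \<oplus> v' \<otimes> b')" and
      1: "(s', a') \<in> lf s a" and 2: "(t', b') \<in> lf s b" and 3: "u' \<in> carrier B" "v' \<in> carrier B"
      "u' \<otimes> s' = v' \<otimes> t'" "u' \<otimes> s' \<noteq> \<zero>" unfolding regular_eq by auto
    have s': "s' \<in> carrier B" "s' \<noteq> \<zero>" "a' \<in> carrier B" using 1 mem_lf by auto
    have t': "t' \<in> carrier B" "t' \<noteq> \<zero>" "b' \<in> carrier B" using 2 mem_lf by auto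
    have us: "u' \<otimes> s' \<in> carrier B" "u' \<otimes> s' \<noteq> \<zero>" using 3 s' m_closed by blast+
    obtain \<alpha> \<beta> where ab: "\<alpha> \<in> carrier B" "\<beta> \<in> carrier B" "\<alpha> \<otimes> s = \<beta> \<otimes> (u' \<otimes> s')" "\<alpha> \<otimes> s \<noteq> \<zero>"
      using common_mult[OF s(1) us(1) s(2) us(2)] by metis
    have "\<alpha> \<otimes> a = \<beta> \<otimes> u' \<otimes> a'"
      using mem_lf_all[OF 1, of \<alpha> "\<beta> \<otimes> u'"] ab s s' 3 a by (simp add: m_assoc)
    moreover have "\<alpha> \<otimes> b = \<beta> \<otimes> v' \<otimes> b'"
      using mem_lf_all[OF 2, of \<alpha> "\<beta> \<otimes> v'"] ab s s' t' 3 b by (simp add: m_assoc)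
    ultimately have "\<alpha> \<otimes> (a \<oplus> b) = \<beta> \<otimes> (u' \<otimes> a' \<oplus> v' \<otimes> b')"
      using ab a b s' t' 3 by (simp add: r_distr m_assoc)
    then have "(u' \<otimes> s', u' \<otimes> a' \<oplus> v' \<otimes> b') \<in> lf s (a \<oplus> b)"
      using us ab 3 t' s' a b s by (intro mem_lfI[of \<alpha> \<beta>]) auto
    then show "c = lf s (a \<oplus> b)" unfolding c using lf_eqI s a b by auto
  qed
  then show ?thesis by (simp add: Frac_def)
qed

lemma one_F: "\<one>\<^bsub>F\<^esub> = lf \<one> \<one>" and zero_F: "\<zero>\<^bsub>F\<^esub> = lf \<one> \<zero>"
  by (simp_all add: Frac_def)

lemma lf_zero: "s \<in> carrier B \<Longrightarrow> s \<noteq> \<zero> \<Longrightarrow> lf s \<zero> = \<zero>\<^bsub>F\<^esub>"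
  using lf_expand[of \<one> \<zero> s] by (simp add: zero_F)

lemma lf_one: "s \<in> carrier B \<Longrightarrow> s \<noteq> \<zero> \<Longrightarrow> lf s s = \<one>\<^bsub>F\<^esub>"
  using lf_expand[of \<one> \<one> s] by (simp add: one_F)

lemma ring_F: "ring F"
proof (rule ringI)
  show "abelian_group F"
  proof (rule abelian_groupI)
    fix p q assume p: "p \<in> carrier F" and q: "q \<in> carrier F"
    obtain s a b where s: "s \<in> carrier B" "s \<noteq> \<zero>" "a \<in> carrier B" "b \<in> carrier B" "p = lf s a" "q = lf s b"
      using lf_common[OF p q] by metis
    show "p \<oplus>\<^bsub>F\<^esub> q \<in> carrier F" using s by (simp add: lf_add)
    show "p \<oplus>\<^bsub>F\<^esub> q = q \<oplus>\<^bsub>F\<^esub> p" using s by (simp add: lf_add a_comm)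
    fix r assume r: "r \<in> carrier F"
    obtain s a b c where s: "s \<in> carrier B" "s \<noteq> \<zero>" "a \<in> carrier B" "b \<in> carrier B" "c \<in> carrier B"
      "p = lf s a" "q = lf s b" "r = lf s c"
      using lf_common3[OF p q r] by metis
    show "p \<oplus>\<^bsub>F\<^esub> q \<oplus>\<^bsub>F\<^esub> r = p \<oplus>\<^bsub>F\<^esub> (q \<oplus>\<^bsub>F\<^esub> r)"
      using s by (simp add: lf_add a_assoc)
  next
    show "\<zero>\<^bsub>F\<^esub> \<in> carrier F" unfolding zero_F by auto
    fix p assume p: "p \<in> carrier F"
    then obtain s a where s: "s \<in> carrier B" "s \<noteq> \<zero>" "a \<in> carrier B" "p = lf s a" using F_cases by metis
    show "\<zero>\<^bsub>F\<^esub> \<oplus>\<^bsub>F\<^esub> p = p" using lf_add[OF s(1,2) zero_closed s(3)] s by (simp add: lf_zero)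
    show "\<exists>q \<in> carrier F. q \<oplus>\<^bsub>F\<^esub> p = \<zero>\<^bsub>F\<^esub>"
      using s by (intro bexI[of _ "lf s (\<ominus> a)"]) (auto simp: lf_add l_neg lf_zero)
  qed
  show "monoid F"
  proof (rule monoidI)
    fix p q assume p: "p \<in> carrier F" and q: "q \<in> carrier F"
    obtain t b where t: "t \<in> carrier B" "t \<noteq> \<zero>" "b \<in> carrier B" "q = lf t b" using F_cases q by metis
    obtain s v where s: "s \<in> carrier B" "s \<noteq> \<zero>" "v \<in> carrier B" "p = lf s (v \<otimes> t)"
      using lf_through[OF p t(1,2)] by metis
    show "p \<otimes>\<^bsub>F\<^esub> q \<in> carrier F" using s t by (simp add: lf_mult)
  next
    show "\<one>\<^bsub>F\<^esub> \<in> carrier F" unfolding one_F by auto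
    fix p q r assume p: "p \<in> carrier F" and q: "q \<in> carrier F" and r: "r \<in> carrier F"
    obtain w c where w: "w \<in> carrier B" "w \<noteq> \<zero>" "c \<in> carrier B" "r = lf w c" using F_cases r by metis
    obtain t b where t: "t \<in> carrier B" "t \<noteq> \<zero>" "b \<in> carrier B" "q = lf t (b \<otimes> w)"
      using lf_through[OF q w(1,2)] by metis
    obtain s v where s: "s \<in> carrier B" "s \<noteq> \<zero>" "v \<in> carrier B" "p = lf s (v \<otimes> t)"
      using lf_through[OF p t(1,2)] by metis
    show "p \<otimes>\<^bsub>F\<^esub> q \<otimes>\<^bsub>F\<^esub> r = p \<otimes>\<^bsub>F\<^esub> (q \<otimes>\<^bsub>F\<^esub> r)"
      using s t w lf_mult[of s t v "b \<otimes> w"] lf_mult[of s w "v \<otimes> b" c] lf_mult[of t w b c] lf_mult[of s t v "b \<otimes> c"]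
      by (simp add: m_assoc)
  next
    fix p assume p: "p \<in> carrier F"
    then obtain s a where s: "s \<in> carrier B" "s \<noteq> \<zero>" "a \<in> carrier B" "p = lf s a" using F_cases by metis
    show "\<one>\<^bsub>F\<^esub> \<otimes>\<^bsub>F\<^esub> p = p"
      using lf_mult[of s s \<one> a] s by (simp add: lf_one)
    show "p \<otimes>\<^bsub>F\<^esub> \<one>\<^bsub>F\<^esub> = p"
      using lf_mult[of s \<one> a \<one>] s by (simp add: one_F)
  qed
  fix p q r assume p: "p \<in> carrier F" and q: "q \<in> carrier F" and r: "r \<in> carrier F"
  {
    obtain w c where w: "w \<in> carrier B" "w \<noteq> \<zero>" "c \<in> carrier B" "r = lf w c" using F_cases r by metis
    obtain t a b where t: "t \<in> carrier B" "t \<noteq> \<zero>" "a \<in> carrier B" "b \<in> carrier B" "p = lf t a" "q = lf t b"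
      using lf_common[OF p q] by metis
    obtain u a' where u: "u \<in> carrier B" "u \<noteq> \<zero>" "a' \<in> carrier B" "u \<otimes> a = a' \<otimes> w" using ore[of a w] t w by metis
    obtain u1 b' where u1: "u1 \<in> carrier B" "u1 \<noteq> \<zero>" "b' \<in> carrier B" "u1 \<otimes> (u \<otimes> b) = b' \<otimes> w"
      using ore[of "u \<otimes> b" w] t w u by (metis m_closed)
    let ?s = "u1 \<otimes> u \<otimes> t"
    have s: "?s \<in> carrier B" "?s \<noteq> \<zero>" using u u1 t mult_zero_iff by auto
    have "p = lf ?s (u1 \<otimes> u \<otimes> a)" "q = lf ?s (u1 \<otimes> u \<otimes> b)"
      using lf_expand[of t a "u1 \<otimes> u"] lf_expand[of t b "u1 \<otimes> u"] t u u1 mult_zero_iff by auto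
    then have pq: "p = lf ?s (u1 \<otimes> a' \<otimes> w)" "q = lf ?s (b' \<otimes> w)"
      using u u1 t w by (auto simp: m_assoc)
    show "(p \<oplus>\<^bsub>F\<^esub> q) \<otimes>\<^bsub>F\<^esub> r = p \<otimes>\<^bsub>F\<^esub> r \<oplus>\<^bsub>F\<^esub> q \<otimes>\<^bsub>F\<^esub> r"
      unfolding pq w(4) using s u u1 w lf_mult[of ?s w "u1 \<otimes> a' \<oplus> b'" c]
      by (simp add: lf_add lf_mult l_distr)
  next
    obtain t b c where t: "t \<in> carrier B" "t \<noteq> \<zero>" "b \<in> carrier B" "c \<in> carrier B" "p = lf t b" "q = lf t c"
      using lf_common[OF p q] by metis
    obtain s v where s: "s \<in> carrier B" "s \<noteq> \<zero>" "v \<in> carrier B" "r = lf s (v \<otimes> t)"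
      using lf_through[OF r t(1,2)] by metis
    show "r \<otimes>\<^bsub>F\<^esub> (p \<oplus>\<^bsub>F\<^esub> q) = r \<otimes>\<^bsub>F\<^esub> p \<oplus>\<^bsub>F\<^esub> r \<otimes>\<^bsub>F\<^esub> q"
      using s t by (simp add: lf_add lf_mult r_distr)
  }
qed

sublocale F: ring F by (rule ring_F)

abbreviation "emb b \<equiv> lf \<one> b"

lemma emb_hom: "emb \<in> ring_hom B F"
proof (rule ring_hom_memI)
  show "emb (a \<otimes> b) = emb a \<otimes>\<^bsub>F\<^esub> emb b" if "a \<in> carrier B" "b \<in> carrier B" for a b
    using lf_mult[of \<one> \<one> a b] that by simp
qed (auto simp: lf_add one_F)

sublocale emb: ring_hom_ring B F emb
  by (intro ring_hom_ringI2 emb_hom ring_axioms ring_F)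

lemma emb_inj: "inj_on emb (carrier B)"
  by (rule inj_onI) (simp add: lf_eq_iff)

lemma emb_lf: "s \<in> carrier B \<Longrightarrow> s \<noteq> \<zero> \<Longrightarrow> a \<in> carrier B \<Longrightarrow> emb s \<otimes>\<^bsub>F\<^esub> lf s a = emb a"
  using lf_mult[of \<one> s \<one> a] by simp

lemma lf_zero_iff: "s \<in> carrier B \<Longrightarrow> s \<noteq> \<zero> \<Longrightarrow> a \<in> carrier B \<Longrightarrow> lf s a = \<zero>\<^bsub>F\<^esub> \<longleftrightarrow> a = \<zero>"
  using lf_eq_iff[of s a \<zero>] lf_zero[of s] by simp

lemma F_inverse: "s \<in> carrier B \<Longrightarrow> s \<noteq> \<zero> \<Longrightarrow> a \<in> carrier B \<Longrightarrow> a \<noteq> \<zero> \<Longrightarrow> lf s a \<otimes>\<^bsub>F\<^esub> lf a s = \<one>\<^bsub>F\<^esub>"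
  using lf_mult[of s a \<one> s] by (simp add: lf_one)

lemma F_units: "p \<in> carrier F \<Longrightarrow> p \<noteq> \<zero>\<^bsub>F\<^esub> \<Longrightarrow> p \<in> Units F"
proof -
  assume p: "p \<in> carrier F" "p \<noteq> \<zero>\<^bsub>F\<^esub>"
  then obtain s a where s: "s \<in> carrier B" "s \<noteq> \<zero>" "a \<in> carrier B" "p = lf s a" using F_cases by metis
  then have "a \<noteq> \<zero>" using p lf_zero by auto
  then show ?thesis using F_inverse[of s a] F_inverse[of a s] s unfolding Units_def by auto
qed

lemma F_lcancel:
  assumes "p \<in> carrier F" "p \<noteq> \<zero>\<^bsub>F\<^esub>" "y \<in> carrier F" "z \<in> carrier F" "p \<otimes>\<^bsub>F\<^esub> y = p \<otimes>\<^bsub>F\<^esub> z"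
  shows "y = z"
  using assms F.Units_l_cancel F_units by blast

lemma F_one_neq_zero: "\<one>\<^bsub>F\<^esub> \<noteq> \<zero>\<^bsub>F\<^esub>"
  unfolding one_F using lf_zero_iff[of \<one> \<one>] by simp

lemma emb_zero_iff: "a \<in> carrier B \<Longrightarrow> emb a = \<zero>\<^bsub>F\<^esub> \<longleftrightarrow> a = \<zero>"
  by (simp add: lf_zero_iff)

text \<open>What commutes with a nonzero element also commutes with its inverse.\<close>

lemma centralI:
  assumes z: "z \<in> carrier F" and c: "\<And>b. b \<in> carrier B \<Longrightarrow> z \<otimes>\<^bsub>F\<^esub> emb b = emb b \<otimes>\<^bsub>F\<^esub> z"
  shows "z \<in> ring_centre F"
proof -
  have "z \<otimes>\<^bsub>F\<^esub> q = q \<otimes>\<^bsub>F\<^esub> z" if q: "q \<in> carrier F" for q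
  proof -
    obtain s a where s: "s \<in> carrier B" "s \<noteq> \<zero>" "a \<in> carrier B" "q = lf s a" using F_cases q by metis
    have "emb s \<otimes>\<^bsub>F\<^esub> (z \<otimes>\<^bsub>F\<^esub> q) = (emb s \<otimes>\<^bsub>F\<^esub> z) \<otimes>\<^bsub>F\<^esub> q" using s z q by (simp add: F.m_assoc)
    also have "\<dots> = z \<otimes>\<^bsub>F\<^esub> (emb s \<otimes>\<^bsub>F\<^esub> q)" unfolding c[OF s(1), symmetric] using s z q by (intro F.m_assoc) auto
    also have "\<dots> = emb a \<otimes>\<^bsub>F\<^esub> z" using s c emb_lf by simp
    also have "\<dots> = emb s \<otimes>\<^bsub>F\<^esub> q \<otimes>\<^bsub>F\<^esub> z" using s emb_lf by simp
    finally have "emb s \<otimes>\<^bsub>F\<^esub> (z \<otimes>\<^bsub>F\<^esub> q) = emb s \<otimes>\<^bsub>F\<^esub> (q \<otimes>\<^bsub>F\<^esub> z)" using s z q by (simp add: F.m_assoc)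
    then show ?thesis
      by (rule F_lcancel[rotated 4]) (use s z q emb_zero_iff in \<open>simp_all\<close>)
  qed
  then show ?thesis using z by (auto simp: ring_centre_def)
qed

lemma centre_subfield: "subfield (ring_centre F) F"
proof (rule F.subfieldI)
  let ?Z = "ring_centre F"
  show "subcring ?Z F"
  proof (rule F.subcringI)
    show "subring ?Z F"
    proof (rule F.subringI)
      fix h assume "h \<in> ?Z"
      then show "\<ominus>\<^bsub>F\<^esub> h \<in> ?Z" by (auto simp: ring_centre_def F.l_minus F.r_minus)
    next
      fix h k assume hk: "h \<in> ?Z" "k \<in> ?Z"
      then have c: "h \<in> carrier F" "k \<in> carrier F" and
        e: "\<And>q. q \<in> carrier F \<Longrightarrow> h \<otimes>\<^bsub>F\<^esub> q = q \<otimes>\<^bsub>F\<^esub> h" "\<And>q. q \<in> carrier F \<Longrightarrow> k \<otimes>\<^bsub>F\<^esub> q = q \<otimes>\<^bsub>F\<^esub> k"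
        by (auto simp: ring_centre_def)
      have "h \<otimes>\<^bsub>F\<^esub> k \<otimes>\<^bsub>F\<^esub> q = q \<otimes>\<^bsub>F\<^esub> (h \<otimes>\<^bsub>F\<^esub> k)" if q: "q \<in> carrier F" for q
      proof -
        have "h \<otimes>\<^bsub>F\<^esub> k \<otimes>\<^bsub>F\<^esub> q = (h \<otimes>\<^bsub>F\<^esub> q) \<otimes>\<^bsub>F\<^esub> k" using c q e(2)[OF q] by (simp add: F.m_assoc)
        then show ?thesis using c q e(1)[OF q] by (simp add: F.m_assoc)
      qed
      then show "h \<otimes>\<^bsub>F\<^esub> k \<in> ?Z" using c by (simp add: ring_centre_def)
      show "h \<oplus>\<^bsub>F\<^esub> k \<in> ?Z" using c e by (simp add: ring_centre_def F.l_distr F.r_distr)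
    qed (simp_all add: ring_centre_def subset_iff)
    show "h \<otimes>\<^bsub>F\<^esub> k = k \<otimes>\<^bsub>F\<^esub> h" if "h \<in> ?Z" "k \<in> ?Z" for h k
      using that unfolding ring_centre_def by blast
  qed
  show "Units (F\<lparr>carrier := ?Z\<rparr>) = ?Z - {\<zero>\<^bsub>F\<^esub>}"
  proof (intro equalityI subsetI)
    fix z assume "z \<in> Units (F\<lparr>carrier := ?Z\<rparr>)"
    then show "z \<in> ?Z - {\<zero>\<^bsub>F\<^esub>}" using F_one_neq_zero by (auto simp: Units_def ring_centre_def)
  next
    fix z assume z: "z \<in> ?Z - {\<zero>\<^bsub>F\<^esub>}"
    then have zc: "z \<in> carrier F" "z \<in> Units F" using F_units by (auto simp: ring_centre_def)
    let ?i = "inv\<^bsub>F\<^esub> z"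
    have i: "?i \<in> carrier F" "?i \<otimes>\<^bsub>F\<^esub> z = \<one>\<^bsub>F\<^esub>" "z \<otimes>\<^bsub>F\<^esub> ?i = \<one>\<^bsub>F\<^esub>" using zc by auto
    have "?i \<otimes>\<^bsub>F\<^esub> q = q \<otimes>\<^bsub>F\<^esub> ?i" if q: "q \<in> carrier F" for q
    proof -
      have zq: "z \<otimes>\<^bsub>F\<^esub> q = q \<otimes>\<^bsub>F\<^esub> z" using z q by (simp add: ring_centre_def)
      have "z \<otimes>\<^bsub>F\<^esub> (?i \<otimes>\<^bsub>F\<^esub> q) = (z \<otimes>\<^bsub>F\<^esub> ?i) \<otimes>\<^bsub>F\<^esub> q"
        by (rule F.m_assoc[symmetric]) (use zc q i(1) in auto)
      also have "\<dots> = q \<otimes>\<^bsub>F\<^esub> (z \<otimes>\<^bsub>F\<^esub> ?i)" using q i(3) by simp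
      also have "\<dots> = (q \<otimes>\<^bsub>F\<^esub> z) \<otimes>\<^bsub>F\<^esub> ?i"
        by (rule F.m_assoc[symmetric]) (use zc q i(1) in auto)
      also have "\<dots> = z \<otimes>\<^bsub>F\<^esub> (q \<otimes>\<^bsub>F\<^esub> ?i)" unfolding zq[symmetric]
        by (rule F.m_assoc) (use zc q i(1) in auto)
      finally show ?thesis
        by (rule F_lcancel[rotated 4]) (use z zc q i in \<open>simp_all\<close>)
    qed
    then have "?i \<in> ?Z" using i by (auto simp: ring_centre_def)
    then show "z \<in> Units (F\<lparr>carrier := ?Z\<rparr>)" using z i by (auto simp: Units_def)
  qed
qed

end

lemma (in domain) ore_domain: "ore_domain R"
proof (unfold_locales)
  fix a b assume "a \<in> carrier R" "b \<in> carrier R" "b \<noteq> \<zero>"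
  then show "\<exists>u \<in> carrier R. \<exists>v \<in> carrier R. u \<noteq> \<zero> \<and> u \<otimes> a = v \<otimes> b"
    using m_comm by blast
qed (use integral in auto)

text \<open>
  A union over representatives again; for an injective homomorphism it is a union of equal
  classes.
\<close>

definition frac_map :: "('a \<Rightarrow> 'b) \<Rightarrow> ('b, 'n) ring_scheme \<Rightarrow> ('a \<times> 'a) set \<Rightarrow> ('b \<times> 'b) set" where
  "frac_map j C q = (\<Union>(s, a) \<in> q. left_frac C (j s) (j a))"

locale ore_hom = B: ore_domain B + C: ore_domain C for B :: "('a, 'm) ring_scheme" and C :: "('b, 'n) ring_scheme" +
  fixes j
  assumes j_hom: "j \<in> ring_hom B C" and j_inj: "inj_on j (carrier B)"
begin

sublocale j: ring_hom_ring B C j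
  by (intro ring_hom_ringI2 j_hom B.ring_axioms C.ring_axioms)

lemma j_zero_iff: "a \<in> carrier B \<Longrightarrow> j a = \<zero>\<^bsub>C\<^esub> \<longleftrightarrow> a = \<zero>\<^bsub>B\<^esub>"
  using inj_onD[OF j_inj, of a "\<zero>\<^bsub>B\<^esub>"] by auto

lemma frac_map_lf:
  assumes s: "s \<in> carrier B" "s \<noteq> \<zero>\<^bsub>B\<^esub>" "a \<in> carrier B"
  shows "frac_map j C (B.lf s a) = C.lf (j s) (j a)"
proof -
  have "C.lf (j t) (j b) = C.lf (j s) (j a)" if tb: "(t, b) \<in> B.lf s a" for t b
  proof -
    obtain u v where t: "t \<in> carrier B" "t \<noteq> \<zero>\<^bsub>B\<^esub>" "b \<in> carrier B" and
      u: "u \<in> carrier B" "v \<in> carrier B" "u \<otimes>\<^bsub>B\<^esub> s = v \<otimes>\<^bsub>B\<^esub> t" "u \<otimes>\<^bsub>B\<^esub> s \<noteq> \<zero>\<^bsub>B\<^esub>" "u \<otimes>\<^bsub>B\<^esub> a = v \<otimes>\<^bsub>B\<^esub> b"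
      using tb B.mem_lf by auto
    have "j u \<otimes>\<^bsub>C\<^esub> j s = j v \<otimes>\<^bsub>C\<^esub> j t" "j u \<otimes>\<^bsub>C\<^esub> j a = j v \<otimes>\<^bsub>C\<^esub> j b" "j u \<otimes>\<^bsub>C\<^esub> j s \<noteq> \<zero>\<^bsub>C\<^esub>"
      using u s t j_zero_iff[of "u \<otimes>\<^bsub>B\<^esub> s"] by (simp_all flip: j.hom_mult)
    then have "(j t, j b) \<in> C.lf (j s) (j a)"
      using s t u j_zero_iff by (intro C.mem_lfI[of "j u" "j v"]) auto
    then show ?thesis using C.lf_eqI s j_zero_iff by auto
  qed
  then have "\<And>c. c \<in> (\<lambda>(t, b). C.lf (j t) (j b)) ` B.lf s a \<Longrightarrow> c = C.lf (j s) (j a)" by auto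
  moreover have "C.lf (j s) (j a) \<in> (\<lambda>(t, b). C.lf (j t) (j b)) ` B.lf s a" using B.lf_self[OF s] by force
  ultimately show ?thesis unfolding frac_map_def by (rule B.Union_eq_single)
qed

lemma frac_map_hom: "frac_map j C \<in> ring_hom B.F C.F"
proof (rule ring_hom_memI)
  show "frac_map j C p \<in> carrier C.F" if "p \<in> carrier B.F" for p
    using that by (elim B.F_cases) (auto simp: frac_map_lf j_zero_iff)
  show "frac_map j C (p \<otimes>\<^bsub>B.F\<^esub> q) = frac_map j C p \<otimes>\<^bsub>C.F\<^esub> frac_map j C q"
    if p: "p \<in> carrier B.F" and q: "q \<in> carrier B.F" for p q
  proof -
    obtain t b where t: "t \<in> carrier B" "t \<noteq> \<zero>\<^bsub>B\<^esub>" "b \<in> carrier B" "q = B.lf t b" using B.F_cases q by metis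
    obtain s v where s: "s \<in> carrier B" "s \<noteq> \<zero>\<^bsub>B\<^esub>" "v \<in> carrier B" "p = B.lf s (v \<otimes>\<^bsub>B\<^esub> t)"
      using B.lf_through[OF p t(1,2)] by metis
    show ?thesis using s t by (simp add: B.lf_mult C.lf_mult frac_map_lf j_zero_iff)
  qed
  show "frac_map j C (p \<oplus>\<^bsub>B.F\<^esub> q) = frac_map j C p \<oplus>\<^bsub>C.F\<^esub> frac_map j C q"
    if p: "p \<in> carrier B.F" and q: "q \<in> carrier B.F" for p q
  proof -
    obtain s a b where s: "s \<in> carrier B" "s \<noteq> \<zero>\<^bsub>B\<^esub>" "a \<in> carrier B" "b \<in> carrier B" "p = B.lf s a" "q = B.lf s b"
      using B.lf_common[OF p q] by metis
    show ?thesis using s by (simp add: B.lf_add C.lf_add frac_map_lf j_zero_iff)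
  qed
  show "frac_map j C \<one>\<^bsub>B.F\<^esub> = \<one>\<^bsub>C.F\<^esub>" unfolding B.one_F C.one_F by (subst frac_map_lf) auto
qed

lemma frac_map_inj: "inj_on (frac_map j C) (carrier B.F)"
proof (rule inj_onI)
  fix p q assume p: "p \<in> carrier B.F" and q: "q \<in> carrier B.F" and e: "frac_map j C p = frac_map j C q"
  obtain s a b where s: "s \<in> carrier B" "s \<noteq> \<zero>\<^bsub>B\<^esub>" "a \<in> carrier B" "b \<in> carrier B" "p = B.lf s a" "q = B.lf s b"
    using B.lf_common[OF p q] by metis
  have "j a = j b" using e s C.lf_eq_iff[of "j s" "j a" "j b"] by (simp add: frac_map_lf j_zero_iff)
  then show "p = q" using s inj_onD[OF j_inj] by auto
qed

end

section \<open>Hilbert's basis theorem\<close>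

definition acc_ideals :: "('a, 'n) ring_scheme \<Rightarrow> bool" where
  "acc_ideals R \<longleftrightarrow> (\<forall>f :: nat \<Rightarrow> 'a set. (\<forall>n. ideal (f n) R) \<and> (\<forall>n. f n \<subseteq> f (Suc n)) \<longrightarrow>
     (\<exists>N. \<forall>n \<ge> N. f n = f N))"

lemma acc_ideals_maximal:
  assumes acc: "acc_ideals R" and F: "\<And>I. I \<in> \<F> \<Longrightarrow> ideal I R" "I0 \<in> \<F>"
  shows "\<exists>M \<in> \<F>. \<forall>I \<in> \<F>. M \<subseteq> I \<longrightarrow> I = M"
proof (rule ccontr)
  assume "\<not> ?thesis"
  then have step: "\<And>M. M \<in> \<F> \<Longrightarrow> \<exists>I. I \<in> \<F> \<and> M \<subset> I" by blast
  have "\<exists>f. \<forall>n::nat. f n \<in> \<F> \<and> f n \<subset> f (Suc n)"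
    by (rule dependent_nat_choice) (use step F(2) in auto)
  then obtain f where f: "\<And>n::nat. f n \<in> \<F>" "\<And>n. f n \<subset> f (Suc n)" by blast
  then obtain N where "\<forall>n \<ge> N. f n = f N" using acc F(1) unfolding acc_ideals_def by (metis psubset_imp_subset)
  then show False using f(2)[of N] by (metis le_SucI order_refl psubset_eq)
qed

lemma (in field) acc_ideals_field: "acc_ideals R"
  unfolding acc_ideals_def
proof clarify
  fix f :: "nat \<Rightarrow> 'a set" assume f: "\<forall>n. ideal (f n) R" "\<forall>n. f n \<subseteq> f (Suc n)"
  have mono: "f n \<subseteq> f m" if "n \<le> m" for n m using f(2) that by (rule_tac lift_Suc_mono_le[of f]) auto
  have two: "f n = {\<zero>} \<or> f n = carrier R" for n using f(1) all_ideals by blast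
  show "\<exists>N. \<forall>n \<ge> N. f n = f N"
  proof (cases "\<exists>N. f N = carrier R")
    case True
    then obtain N where "f N = carrier R" by blast
    then have "\<forall>n \<ge> N. f n = f N" using mono two by (metis subset_antisym additive_subgroup.a_subset f(1) ideal.axioms(1))
    then show ?thesis by blast
  next
    case False
    then show ?thesis using two by metis
  qed
qed

context skew_gen
begin

text \<open>
  The leading coefficients of the elements of degree \<open>n\<close> in \<open>J\<close>,
  together with zero.
\<close>

definition "lead J n = {r \<in> carrier R. \<exists>y \<in> spanR n. \<iota> r \<otimes> x [^] n \<oplus> y \<in> J}"

lemma lead_ideal:
  assumes J: "ideal J A"
  shows "ideal (lead J n) R"
proof (rule idealI[OF R.ring_axioms])
  interpret J: ideal J A by fact
  have lm: "r \<otimes>\<^bsub>R\<^esub> s \<in> lead J n" if rs: "s \<in> lead J n" "r \<in> carrier R" for r s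
  proof -
    obtain y where y: "s \<in> carrier R" "y \<in> spanR n" "\<iota> s \<otimes> x [^] n \<oplus> y \<in> J" using rs by (auto simp: lead_def)
    have "\<iota> r \<otimes> (\<iota> s \<otimes> x [^] n \<oplus> y) \<in> J" using y rs by (intro J.I_l_closed) auto
    also have "\<iota> r \<otimes> (\<iota> s \<otimes> x [^] n \<oplus> y) = \<iota> (r \<otimes>\<^bsub>R\<^esub> s) \<otimes> x [^] n \<oplus> \<iota> r \<otimes> y"
      using y(1) spanR_closed[OF y(2)] rs by (simp add: r_distr m_assoc)
    finally show ?thesis using y rs spanR_lmult unfolding lead_def by blast
  qed
  show "subgroup (lead J n) (add_monoid R)"
  proof (rule R.add.subgroupI)
    show "lead J n \<subseteq> carrier R" by (auto simp: lead_def)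
    have "\<zero>\<^bsub>R\<^esub> \<in> lead J n" unfolding lead_def using spanR_zero J.zero_closed by (auto intro!: bexI[of _ \<zero>])
    then show "lead J n \<noteq> {}" by blast
    show "\<ominus>\<^bsub>R\<^esub> a \<in> lead J n" if "a \<in> lead J n" for a
      using lm[OF that, of "\<ominus>\<^bsub>R\<^esub> \<one>\<^bsub>R\<^esub>"] that by (auto simp: lead_def R.l_minus)
    show "a \<oplus>\<^bsub>R\<^esub> b \<in> lead J n" if ab: "a \<in> lead J n" "b \<in> lead J n" for a b
    proof -
      obtain y z where y: "a \<in> carrier R" "y \<in> spanR n" "\<iota> a \<otimes> x [^] n \<oplus> y \<in> J"
        and z: "b \<in> carrier R" "z \<in> spanR n" "\<iota> b \<otimes> x [^] n \<oplus> z \<in> J" using ab by (auto simp: lead_def)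
      have "\<iota> a \<otimes> x [^] n \<oplus> y \<oplus> (\<iota> b \<otimes> x [^] n \<oplus> z) \<in> J" by (rule J.a_closed[OF y(3) z(3)])
      also have "\<iota> a \<otimes> x [^] n \<oplus> y \<oplus> (\<iota> b \<otimes> x [^] n \<oplus> z) = \<iota> (a \<oplus>\<^bsub>R\<^esub> b) \<otimes> x [^] n \<oplus> (y \<oplus> z)"
        using y(1) z(1) spanR_closed[OF y(2)] spanR_closed[OF z(2)] by (simp add: l_distr a_ac)
      finally show ?thesis using y z spanR_add unfolding lead_def by blast
    qed
  qed
  show "r \<otimes>\<^bsub>R\<^esub> s \<in> lead J n" if "s \<in> lead J n" "r \<in> carrier R" for r s using lm that by blast
  show "s \<otimes>\<^bsub>R\<^esub> r \<in> lead J n" if "s \<in> lead J n" "r \<in> carrier R" for r s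
    using lm[OF that] that R.m_comm[of s r] by (auto simp: lead_def)
qed

lemma lead_Suc:
  assumes J: "ideal J A"
  shows "lead J n \<subseteq> lead J (Suc n)"
proof
  interpret J: ideal J A by fact
  fix r assume "r \<in> lead J n"
  then obtain y where y: "r \<in> carrier R" "y \<in> spanR n" "\<iota> r \<otimes> x [^] n \<oplus> y \<in> J" by (auto simp: lead_def)
  have yc: "y \<in> carrier A" using y by blast
  have "x \<otimes> (\<iota> r \<otimes> x [^] n \<oplus> y) \<in> J" using y by (intro J.I_l_closed) auto
  also have "x \<otimes> (\<iota> r \<otimes> x [^] n \<oplus> y) = (x \<otimes> \<iota> r) \<otimes> x [^] n \<oplus> x \<otimes> y" using y(1) yc by (simp add: r_distr m_assoc)
  also have "\<dots> = \<iota> r \<otimes> (x \<otimes> x [^] n) \<oplus> (\<iota> (\<delta> r) \<otimes> x [^] n \<oplus> x \<otimes> y)"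
    using y(1) yc by (simp add: x_comm l_distr m_assoc a_assoc)
  also have "x \<otimes> x [^] n = x [^] (Suc n)" by (metis x_closed A.nat_pow_Suc2)
  finally have "\<iota> r \<otimes> x [^] (Suc n) \<oplus> (\<iota> (\<delta> r) \<otimes> x [^] n \<oplus> x \<otimes> y) \<in> J" .
  moreover have "\<iota> (\<delta> r) \<otimes> x [^] n \<oplus> x \<otimes> y \<in> spanR (Suc n)"
    using y spanR_x spanR_monom by (intro spanR_add) auto
  ultimately show "r \<in> lead J (Suc n)" using y(1) unfolding lead_def by blast
qed

text \<open>
  Subtracting an element of the smaller ideal with the same leading coefficient lowers the
  degree.
\<close>

lemma lead_eq_imp_eq:
  assumes J: "ideal J A" and J': "ideal J' A" and sub: "J \<subseteq> J'" and le: "\<And>n. lead J' n \<subseteq> lead J n"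
  shows "J' = J"
proof -
  interpret J: ideal J A by fact
  interpret J': ideal J' A by fact
  have "u \<in> J" if "u \<in> spanR n" "u \<in> J'" for u n
    using that
  proof (induction n arbitrary: u)
    case 0
    then show ?case using J.zero_closed by simp
  next
    case (Suc n)
    then obtain r y where 1: "r \<in> carrier R" "y \<in> spanR n" "u = \<iota> r \<otimes> x [^] n \<oplus> y" by auto
    then have "r \<in> lead J n" using le Suc.prems unfolding lead_def by blast
    then obtain y' where y': "y' \<in> spanR n" "\<iota> r \<otimes> x [^] n \<oplus> y' \<in> J" unfolding lead_def by blast
    have c: "y \<in> carrier A" "y' \<in> carrier A" using 1 y' by auto
    have "u \<ominus> (\<iota> r \<otimes> x [^] n \<oplus> y') \<in> J'"
      unfolding a_minus_def by (rule J'.a_closed[OF Suc.prems(2) J'.a_inv_closed]) (use y' sub in auto)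
    also have "u \<ominus> (\<iota> r \<otimes> x [^] n \<oplus> y') = y \<ominus> y'"
      unfolding 1 using 1(1) c by (simp add: a_minus_def minus_add a_ac r_neg r_neg1 r_neg2)
    finally have "y \<ominus> y' \<in> J" using Suc.IH[of "y \<ominus> y'"] spanR_minus 1 y' by blast
    then have "(\<iota> r \<otimes> x [^] n \<oplus> y') \<oplus> (y \<ominus> y') \<in> J" by (rule J.a_closed[OF y'(2)])
    also have "(\<iota> r \<otimes> x [^] n \<oplus> y') \<oplus> (y \<ominus> y') = \<iota> r \<otimes> x [^] n \<oplus> (y \<oplus> (y' \<oplus> \<ominus> y'))"
      using 1(1) c by (simp add: a_minus_def a_ac)
    also have "\<dots> = u" unfolding 1 using c by (simp add: r_neg)
    finally show ?case .
  qed
  then have "J' \<subseteq> J" using gen J'.a_subset by blast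
  then show ?thesis using sub by blast
qed

text \<open>
  Along an ascending chain \<open>J m\<close> the ideals \<open>lead (J m) n\<close> increase in
  both \<open>m\<close> and \<open>n\<close>. A maximal one among all of them, at \<open>(M,
  N)\<close>, is attained at every later pair; for each of the finitely many degrees below
  \<open>N\<close> the chain in \<open>m\<close> stabilises by itself.
\<close>

lemma hilbert_basis:
  assumes acc: "acc_ideals R"
  shows "acc_ideals A"
  unfolding acc_ideals_def
proof clarify
  fix J :: "nat \<Rightarrow> 'b set" assume J: "\<forall>n. ideal (J n) A" "\<forall>n. J n \<subseteq> J (Suc n)"
  have mono: "J n \<subseteq> J m" if "n \<le> m" for n m using J(2) that by (rule_tac lift_Suc_mono_le[of J]) auto
  have L: "ideal (lead (J m) n) R" for m n using lead_ideal J by blast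
  have Lm: "lead (J m) n \<subseteq> lead (J m') n'" if "m \<le> m'" "n \<le> n'" for m m' n n'
  proof -
    have "lead (J m) n \<subseteq> lead (J m) n'" using that(2) lead_Suc J(1) by (rule_tac lift_Suc_mono_le[of "lead (J m)"]) auto
    also have "\<dots> \<subseteq> lead (J m') n'" using mono[OF that(1)] by (auto simp: lead_def)
    finally show ?thesis .
  qed
  obtain M N where MN: "\<And>m n. lead (J M) N \<subseteq> lead (J m) n \<Longrightarrow> lead (J m) n = lead (J M) N"
  proof -
    have "\<exists>I \<in> {lead (J m) n | m n. True}. \<forall>I' \<in> {lead (J m) n | m n. True}. I \<subseteq> I' \<longrightarrow> I' = I"
      by (rule acc_ideals_maximal[OF acc]) (use L in auto)
    then obtain M N where "\<forall>I' \<in> {lead (J m) n | m n. True}. lead (J M) N \<subseteq> I' \<longrightarrow> I' = lead (J M) N" by blast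
    then show ?thesis by (intro that[of M N]) blast
  qed
  have "\<exists>K. \<forall>m \<ge> K. lead (J m) n = lead (J K) n" for n
  proof -
    have "(\<forall>m. ideal (lead (J m) n) R) \<and> (\<forall>m. lead (J m) n \<subseteq> lead (J (Suc m)) n)" using L Lm by auto
    then show ?thesis using acc unfolding acc_ideals_def by (elim allE[of _ "\<lambda>m. lead (J m) n"]) blast
  qed
  then obtain K where K: "\<And>n m. m \<ge> K n \<Longrightarrow> lead (J m) n = lead (J (K n)) n" by metis
  define M' where "M' = Max (insert M (K ` {..<N}))"
  have M': "M \<le> M'" "\<And>n. n < N \<Longrightarrow> K n \<le> M'" unfolding M'_def by auto
  have "J m = J M'" if m: "m \<ge> M'" for m
  proof (rule lead_eq_imp_eq)
    show "lead (J m) n \<subseteq> lead (J M') n" for n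
    proof (cases "n < N")
      case True
      then show ?thesis using K M' m by (metis order.trans order_refl)
    next
      case False
      then show ?thesis using MN[of m n] MN[of M' n] Lm[of M m N n] Lm[of M M' N n] M' m by simp
    qed
  qed (use J mono m in auto)
  then show "\<exists>N. \<forall>n \<ge> N. J n = J N" by blast
qed

end

lemma (in ring) hom_subring_id: "subring S R \<Longrightarrow> id \<in> ring_hom (R\<lparr>carrier := S\<rparr>) R"
  using subringE(1)[of S R] by (auto intro!: ring_hom_memI)

lemma (in cring) skew_pre_poly:
  assumes S: "subring S R" and a: "a \<in> carrier R"
  shows "skew_pre (R\<lparr>carrier := S\<rparr>) R (\<lambda>_. \<zero>) id a"
proof -
  interpret S: cring "R\<lparr>carrier := S\<rparr>"
    using subring_is_ring[OF S] subcring_iff subcringI'[OF S] subringE(1)[OF S] by blast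
  show ?thesis
    using subringE[OF S] a hom_subring_id[OF S]
    by unfold_locales (auto simp: m_comm subset_iff)
qed

lemma (in cring) generate_ring_insert:
  assumes S: "H \<subseteq> carrier R" and a: "a \<in> carrier R"
  shows "generate_ring R (insert a H) = (\<Union>n. poly_span R (generate_ring R H) a n)"
proof -
  let ?S = "generate_ring R H"
  have Ss: "subring ?S R" using generate_ring_is_subring[OF S] .
  have ax: "\<one> \<otimes> a [^] (Suc 0) \<oplus> \<zero> = a" using a by simp
  note sk = skew_pre_poly[OF Ss a]
  have iS: "id ` carrier (R\<lparr>carrier := ?S\<rparr>) = ?S" by simp
  have sub: "subring (\<Union>n. poly_span R ?S a n) R" using skew_pre.spanR_subring[OF sk] unfolding iS .
  have Gs: "subring (generate_ring R (insert a H)) R" using S a by (intro generate_ring_is_subring) auto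
  have S1: "?S = poly_span R ?S a (Suc 0)" by (rule poly_span_1[symmetric]) (rule subringE(1)[OF Ss])
  have a_in: "a \<in> poly_span R ?S a (Suc (Suc 0))"
  proof -
    have "\<one> \<otimes> a [^] (Suc 0) \<oplus> \<zero> \<in> poly_span R ?S a (Suc (Suc 0))"
      using subringE(3)[OF Ss] skew_pre.spanR_zero[OF sk, unfolded iS] by (intro poly_span_SucI)
    then show ?thesis unfolding ax .
  qed
  show ?thesis
  proof
    have "H \<subseteq> ?S" by (auto intro: generate_ring.incl)
    then have "insert a H \<subseteq> (\<Union>n. poly_span R ?S a n)" using S1 a_in by blast
    then show "generate_ring R (insert a H) \<subseteq> (\<Union>n. poly_span R ?S a n)"
      using generate_ring_min_subring1[OF _ sub] S a by auto
    have SG: "?S \<subseteq> generate_ring R (insert a H)" using S a by (intro mono_generate_ring) auto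
    have ag: "a [^] n \<in> generate_ring R (insert a H)" for n :: nat
      by (induction n) (auto intro: generate_ring.intros)
    have "poly_span R ?S a n \<subseteq> generate_ring R (insert a H)" for n
    proof (induction n)
      case 0
      then show ?case using zero_in_generate by simp
    next
      case (Suc n)
      show ?case
      proof
        fix u assume "u \<in> poly_span R ?S a (Suc n)"
        then obtain w y where "w \<in> ?S" "y \<in> poly_span R ?S a n" "u = w \<otimes> a [^] n \<oplus> y" by auto
        then show "u \<in> generate_ring R (insert a H)" using Suc SG ag by (auto intro!: generate_ring.eng_add generate_ring.eng_mult)
      qed
    qed
    then show "(\<Union>n. poly_span R ?S a n) \<subseteq> generate_ring R (insert a H)" by blast
  qed
qed

lemma (in ring) poly_span_consistent:
  "subring S R \<Longrightarrow> poly_span (R\<lparr>carrier := S\<rparr>) W a n = poly_span R W a n"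
  by (induction n) (simp_all add: nat_pow_def)

text \<open>
  Adjoining one generator is an instance of \<open>hilbert_basis\<close> with zero derivation.
\<close>

lemma (in cring) acc_ideals_generate_ring:
  assumes k: "subfield k R" and T: "finite T" "T \<subseteq> carrier R"
  shows "acc_ideals (R\<lparr>carrier := generate_ring R (k \<union> T)\<rparr>)"
  using T
proof (induction T)
  case empty
  have "generate_ring R k = k"
    using generate_ringI[of k k] subfieldE(1,3)[OF k] by auto
  then show ?case using field.acc_ideals_field[OF subfield_iff(2)[OF k]] by simp
next
  case (insert a T)
  let ?S = "generate_ring R (k \<union> T)" and ?U = "generate_ring R (insert a (k \<union> T))"
  have c: "k \<union> T \<subseteq> carrier R" "a \<in> carrier R" using insert subfieldE(3)[OF k] by auto
  have S: "subring ?S R" and U: "subring ?U R" using c by (auto intro!: generate_ring_is_subring)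
  have SU: "?S \<subseteq> ?U" using c by (intro mono_generate_ring) auto
  have aU: "a \<in> ?U" by (auto intro: generate_ring.incl)
  interpret U: cring "R\<lparr>carrier := ?U\<rparr>"
    using subcring_iff subcringI'[OF U] subringE(1)[OF U] by blast
  have "skew_pre (R\<lparr>carrier := ?U, carrier := ?S\<rparr>) (R\<lparr>carrier := ?U\<rparr>) (\<lambda>_. \<zero>\<^bsub>R\<lparr>carrier := ?U\<rparr>\<^esub>) id a"
    using U.skew_pre_poly[of ?S a] SU aU ring_incl_imp_subring subring_is_ring[OF S]
      U.ring_incl_imp_subring[of ?S] by auto
  then have "skew_pre (R\<lparr>carrier := ?S\<rparr>) (R\<lparr>carrier := ?U\<rparr>) (\<lambda>_. \<zero>) id a" by simp
  then have "skew_gen (R\<lparr>carrier := ?S\<rparr>) (R\<lparr>carrier := ?U\<rparr>) (\<lambda>_. \<zero>) id a"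
    using generate_ring_insert[OF c] poly_span_consistent[OF U]
    by (intro skew_gen.intro skew_gen_axioms.intro) simp_all
  then show ?case using skew_gen.hilbert_basis insert by (metis Un_insert_right insert_subset)
qed

section \<open>Algebraic dependence over a subring\<close>

lemma (in ring) poly_span_eval:
  "u \<in> poly_span R W x n \<Longrightarrow> \<exists>q. set q \<subseteq> W \<and> length q = n \<and> u = eval q x"
proof (induction n arbitrary: u)
  case (Suc n)
  then obtain w y where 1: "w \<in> W" "y \<in> poly_span R W x n" "u = w \<otimes> x [^] n \<oplus> y" by auto
  then obtain q where "set q \<subseteq> W" "length q = n" "y = eval q x" using Suc.IH by blast
  then show ?case using 1 by (intro exI[of _ "w # q"]) auto
qed simp

locale poly_ext = domain R for R (structure) +
  fixes S a
  assumes S: "subring S R" and a [simp]: "a \<in> carrier R"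
begin

abbreviation "sp n \<equiv> poly_span R S a n"

lemma S_subgroup: "additive_subgroup S R"
  using S by (simp add: subring_def additive_subgroup_def)

lemma S_closed: "s \<in> S \<Longrightarrow> s \<in> carrier R" using subringE(1)[OF S] by blast

lemma sp_mult: "u \<in> sp n \<Longrightarrow> v \<in> sp m \<Longrightarrow> v \<otimes> u \<in> sp (m + n)"
  using skew_pre.spanR_mult[OF skew_pre_poly[OF S a], of u n v m] by simp

lemmas sp_zero = poly_span_zero[OF S_subgroup a]
lemmas sp_add = poly_span_add[OF S_subgroup a]
lemmas sp_neg = poly_span_neg[OF S_subgroup a]
lemmas sp_minus = poly_span_minus[OF S_subgroup a]
lemmas sp_monom = poly_span_monom[OF S_subgroup a]

lemma sp_mono: "n \<le> m \<Longrightarrow> u \<in> sp n \<Longrightarrow> u \<in> sp m"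
  using poly_span_mono[OF S_subgroup a] by blast

lemma sp_closed: "u \<in> sp n \<Longrightarrow> u \<in> carrier R"
  using poly_span_in S_closed a by blast

lemma sp_1: "sp (Suc 0) = S"
  by (rule poly_span_1[OF subringE(1)[OF S]])

lemma sp_smult: "s \<in> S \<Longrightarrow> u \<in> sp n \<Longrightarrow> s \<otimes> u \<in> sp n"
  by (rule poly_span_lmult[OF S_subgroup a, of _ S]) (use S_closed subringE(6)[OF S] in auto)

lemma sp_pow_mult: "u \<in> sp n \<Longrightarrow> a [^] (k::nat) \<otimes> u \<in> sp (k + n)"
  using skew_pre.span_pow_mult[OF skew_pre_poly[OF S a], of S u n k]
    ring.oneideal[OF subring_is_ring[OF S]] subringE(2)[OF S] by auto

text \<open>
  No element of \<open>S[a]\<close> of degree \<open>d\<close> vanishes unless its leading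
  coefficient does; this holds for every \<open>d\<close> exactly if \<open>a\<close> is
  transcendental over \<open>S\<close>.
\<close>

definition "indep d \<longleftrightarrow> (\<forall>c \<in> S. c \<otimes> a [^] d \<in> sp d \<longrightarrow> c = \<zero>)"

lemma sp_lead:
  assumes "u \<in> sp n" "u \<noteq> \<zero>"
  obtains m s y where "m < n" "s \<in> S" "s \<noteq> \<zero>" "y \<in> sp m" "u = s \<otimes> a [^] m \<oplus> y"
  using assms
proof (induction n arbitrary: thesis)
  case 0
  then show ?case by simp
next
  case (Suc n)
  then obtain s y where 1: "s \<in> S" "y \<in> sp n" "u = s \<otimes> a [^] n \<oplus> y" by auto
  show ?case
  proof (cases "s = \<zero>")
    case True
    then have "u = y" using 1 sp_closed by simp
    then show ?thesis using Suc.IH[OF _ _ Suc.prems(3)] 1 Suc.prems(1) less_SucI by metis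
  next
    case False
    then show ?thesis using Suc.prems(1)[of n s y] 1 by blast
  qed
qed

text \<open>
  The divisor is not monic, so the dividend is first multiplied by a nonzero element of
  \<open>S\<close>.
\<close>

lemma pseudo_division:
  assumes s: "s \<in> S" "s \<noteq> \<zero>" and y: "y \<in> sp e" and w: "w \<in> sp m"
  shows "\<exists>t \<in> S. t \<noteq> \<zero> \<and> (\<exists>q \<in> sp (m - e). t \<otimes> w \<ominus> q \<otimes> (s \<otimes> a [^] e \<oplus> y) \<in> sp e)"
  using w
proof (induction m arbitrary: w)
  case 0
  then have "\<one> \<otimes> w \<ominus> \<zero> \<otimes> (s \<otimes> a [^] e \<oplus> y) = \<zero>" using s y S_closed sp_closed by (simp add: a_minus_def)
  then show ?case using sp_zero subringE(3)[OF S] by (metis zero_not_one)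
next
  case (Suc m)
  have sc: "s \<in> carrier R" "y \<in> carrier R" "w \<in> carrier R" using s y Suc.prems S_closed sp_closed by blast+
  let ?u = "s \<otimes> a [^] e \<oplus> y"
  show ?case
  proof (cases "m < e")
    case True
    then have "w \<in> sp e" using Suc.prems sp_mono[of "Suc m" e] by simp
    moreover have "\<one> \<otimes> w \<ominus> \<zero> \<otimes> ?u = w" using sc by (simp add: a_minus_def)
    ultimately show ?thesis using sp_zero subringE(3)[OF S] by (metis zero_not_one)
  next
    case False
    obtain r w' where 1: "r \<in> S" "w' \<in> sp m" "w = r \<otimes> a [^] m \<oplus> w'" using Suc.prems by auto
    have c: "r \<in> carrier R" "w' \<in> carrier R" using 1 sp_closed S_closed by auto
    let ?k = "m - e"
    have am: "a [^] m = a [^] ?k \<otimes> a [^] e" using False by (simp add: nat_pow_mult)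
    define v where "v = s \<otimes> w' \<ominus> r \<otimes> (a [^] ?k \<otimes> y)"
    have v: "v \<in> sp m" unfolding v_def
      using sp_smult[OF s(1) 1(2)] sp_smult[OF 1(1) sp_pow_mult[OF y, of ?k]] False by (intro sp_minus) auto
    have v_eq: "v = s \<otimes> w \<ominus> r \<otimes> a [^] ?k \<otimes> ?u"
      unfolding v_def 1 am using c sc nat_pow_closed[OF a, of ?k] nat_pow_closed[OF a, of e] by algebra
    obtain t q where t: "t \<in> S" "t \<noteq> \<zero>" "q \<in> sp ?k" "t \<otimes> v \<ominus> q \<otimes> ?u \<in> sp e" using Suc.IH[OF v] by blast
    have tc: "t \<in> carrier R" "q \<in> carrier R" using t sp_closed S_closed by auto
    have e: "t \<otimes> v \<ominus> q \<otimes> ?u = (t \<otimes> s) \<otimes> w \<ominus> ((t \<otimes> r) \<otimes> a [^] ?k \<oplus> q) \<otimes> ?u"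
      unfolding v_eq using tc c sc nat_pow_closed[OF a, of ?k] nat_pow_closed[OF a, of e] by algebra
    have "(t \<otimes> r) \<otimes> a [^] ?k \<oplus> q \<in> sp (Suc m - e)"
      using poly_span_SucI[of "t \<otimes> r" S q] t 1 subringE(6)[OF S] False by (simp add: Suc_diff_le)
    moreover have "t \<otimes> s \<in> S" using t s subringE(6)[OF S] by blast
    moreover have "t \<otimes> s \<noteq> \<zero>" using t s S_closed integral by metis
    ultimately show ?thesis using t(4) unfolding e by blast
  qed
qed

text \<open>
  Among the nonzero multiples of \<open>f\<close> take one, \<open>u\<close>, of least degree
  \<open>e\<close>. If \<open>e\<close> were positive, division of the minimal relation of
  \<open>a\<close> by \<open>u\<close> would give a multiple \<open>g u\<close> of smaller
  degree. It is nonzero because \<open>g\<close> has degree below \<open>d\<close> and a nonzero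
  leading coefficient, so that minimality of \<open>d\<close> excludes \<open>g = 0\<close>.
\<close>

lemma algebraic_multiple:
  assumes c: "c \<in> S" "c \<noteq> \<zero>" and rel: "c \<otimes> a [^] d \<in> sp d" and ind: "\<And>m. m < d \<Longrightarrow> indep m"
    and f: "f \<in> sp N" "f \<noteq> \<zero>"
  shows "\<exists>M. \<exists>h \<in> sp M. h \<otimes> f \<in> S \<and> h \<otimes> f \<noteq> \<zero>"
proof -
  have fc: "f \<in> carrier R" using f sp_closed by blast
  have cc: "c \<in> carrier R" using c S_closed by blast
  define P where "P n \<longleftrightarrow> (\<exists>M. \<exists>h \<in> sp M. h \<otimes> f \<in> sp n \<and> h \<otimes> f \<noteq> \<zero>)" for n
  have "\<one> \<otimes> f = f" "\<one> \<in> sp (Suc 0)" using fc sp_1 subringE(3)[OF S] by auto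
  then have "P N" unfolding P_def using f by metis
  define n where "n = (LEAST n. P n)"
  have Pn: "P n" unfolding n_def using \<open>P N\<close> by (rule LeastI)
  have min: "\<not> P m" if "m < n" for m using that unfolding n_def by (rule not_less_Least)
  obtain M h where h: "h \<in> sp M" "h \<otimes> f \<in> sp n" "h \<otimes> f \<noteq> \<zero>" using Pn P_def by blast
  have mult: False if "q \<in> sp K" "q \<otimes> (h \<otimes> f) \<in> sp m" "q \<otimes> (h \<otimes> f) \<noteq> \<zero>" "m < n" for q K m
  proof -
    have "q \<otimes> h \<in> sp (K + M)" by (rule sp_mult[OF h(1) that(1)])
    moreover have "q \<otimes> h \<otimes> f = q \<otimes> (h \<otimes> f)" using fc sp_closed h that by (intro m_assoc) auto
    ultimately show False using min[OF that(4)] that unfolding P_def by metis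
  qed
  have n0: "n \<noteq> 0" using h(2,3) by (cases "n = 0") simp_all
  define e where "e = n - 1"
  have ne: "n = Suc e" using n0 e_def by simp
  show ?thesis
  proof (cases "e = 0")
    case True
    then show ?thesis using h sp_1 ne by auto
  next
    case False
    obtain s y where 1: "s \<in> S" "y \<in> sp e" "h \<otimes> f = s \<otimes> a [^] e \<oplus> y" using h unfolding ne by auto
    have c1: "s \<in> carrier R" "y \<in> carrier R" using 1 S_closed sp_closed by auto
    have s0: "s \<noteq> \<zero>"
    proof
      assume "s = \<zero>"
      then have "h \<otimes> f \<in> sp e" using 1 c1 by simp
      then show False using min[of e] h ne unfolding P_def by blast
    qed
    define u where "u = h \<otimes> f"
    have uc: "u \<in> carrier R" "u \<noteq> \<zero>" unfolding u_def using h fc sp_closed by auto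
    have u_eq: "u = s \<otimes> a [^] e \<oplus> y" using 1 u_def by simp
    define z where "z = c \<otimes> a [^] d"
    have z: "z \<in> sp d" "z \<in> carrier R" using rel z_def sp_closed by auto
    show ?thesis
    proof (cases "d \<le> e")
      case True
      then have ae: "a [^] e = a [^] (e - d) \<otimes> a [^] d" by (simp add: nat_pow_mult)
      have "c \<otimes> u = s \<otimes> (a [^] (e - d) \<otimes> z) \<oplus> c \<otimes> y"
        unfolding u_eq ae z_def using c1 cc nat_pow_closed[OF a, of "e - d"] nat_pow_closed[OF a, of d] by algebra
      also have "\<dots> \<in> sp e"
        using sp_smult[OF 1(1) sp_pow_mult[OF z(1), of "e - d"]] sp_smult[OF c(1) 1(2)] True by (intro sp_add) auto
      finally have "c \<otimes> u \<in> sp e" .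
      moreover have "c \<otimes> u \<noteq> \<zero>" using integral uc cc c by blast
      ultimately have False using mult[of c "Suc 0" e] c sp_1 ne unfolding u_def by blast
      then show ?thesis ..
    next
      case F2: False
      define k where "k = d - e"
      have ad: "a [^] d = a [^] k \<otimes> a [^] e" "k + e = d" "k < d" unfolding k_def using F2 False by (auto simp: nat_pow_mult)
      define w where "w = s \<otimes> z \<oplus> c \<otimes> (a [^] k \<otimes> y)"
      have w: "w \<in> sp d" unfolding w_def
        using sp_smult[OF 1(1) z(1)] sp_smult[OF c(1) sp_pow_mult[OF 1(2), of k]] ad by (intro sp_add) auto
      have w_eq: "w = c \<otimes> a [^] k \<otimes> u"
        unfolding w_def u_eq z_def ad(1) using c1 cc nat_pow_closed[OF a, of k] nat_pow_closed[OF a, of e] by algebra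
      obtain t q where t: "t \<in> S" "t \<noteq> \<zero>" "q \<in> sp k" "t \<otimes> w \<ominus> q \<otimes> u \<in> sp e"
        using pseudo_division[OF 1(1) s0 1(2) w] unfolding k_def u_eq by blast
      have tc: "t \<in> carrier R" "q \<in> carrier R" using t sp_closed S_closed by auto
      define g where "g = t \<otimes> c \<otimes> a [^] k \<ominus> q"
      have gu: "g \<otimes> u = t \<otimes> w \<ominus> q \<otimes> u"
        unfolding g_def w_eq using tc cc uc nat_pow_closed[OF a, of k] by algebra
      have tcS: "t \<otimes> c \<in> S" using t c subringE(6)[OF S] by blast
      have tc0: "t \<otimes> c \<noteq> \<zero>" using t c S_closed integral by metis
      have gsp: "g \<in> sp (Suc k)" unfolding g_def
        using sp_monom[OF tcS, of k] sp_mono[OF _ t(3), of "Suc k"] by (intro sp_minus) auto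
      have "g \<noteq> \<zero>"
      proof
        assume "g = \<zero>"
        then have "t \<otimes> c \<otimes> a [^] k = q" unfolding g_def using tc cc r_right_minus_eq[of "t \<otimes> c \<otimes> a [^] k" q] by simp
        then show False using ind[OF ad(3)] t(3) tcS tc0 unfolding indep_def by blast
      qed
      then have "g \<otimes> u \<noteq> \<zero>" using integral uc sp_closed[OF gsp] by blast
      then have False using mult[OF gsp, of e] gu t(4) ne unfolding u_def by simp
      then show ?thesis ..
    qed
  qed
qed

end

section \<open>Extending homomorphisms into an algebraically closed field\<close>

lemma RDirProd_simps:
  "(p, q) \<otimes>\<^bsub>RDirProd R L\<^esub> (p', q') = (p \<otimes>\<^bsub>R\<^esub> p', q \<otimes>\<^bsub>L\<^esub> q')"
  "(p, q) \<oplus>\<^bsub>RDirProd R L\<^esub> (p', q') = (p \<oplus>\<^bsub>R\<^esub> p', q \<oplus>\<^bsub>L\<^esub> q')"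
  "\<one>\<^bsub>RDirProd R L\<^esub> = (\<one>\<^bsub>R\<^esub>, \<one>\<^bsub>L\<^esub>)" "\<zero>\<^bsub>RDirProd R L\<^esub> = (\<zero>\<^bsub>R\<^esub>, \<zero>\<^bsub>L\<^esub>)"
  by (simp_all add: RDirProd_def DirProd_def monoid.defs)

lemma RDirProd_pow: "(p, q) [^]\<^bsub>RDirProd R L\<^esub> (n::nat) = (p [^]\<^bsub>R\<^esub> n, q [^]\<^bsub>L\<^esub> n)"
  by (induction n) (simp_all add: RDirProd_simps nat_pow_def)

locale hom_ext = poly_ext R S a + L: field L for R (structure) and S a and L +
  fixes \<phi> \<xi>
  assumes phi: "\<phi> \<in> ring_hom (R\<lparr>carrier := S\<rparr>) L" and xi: "\<xi> \<in> carrier L"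
begin

text \<open>
  The extension of \<open>\<phi>\<close> that sends \<open>a\<close> to \<open>\<xi>\<close> is
  constructed as its graph: the subring of \<open>R \<times> L\<close> generated by the pairs
  \<open>(s, \<phi> s)\<close> and \<open>(a, \<xi>)\<close>. It exists as soon as the graph is
  single-valued.
\<close>

abbreviation "E \<equiv> RDirProd R L"
abbreviation "G n \<equiv> poly_span E ((\<lambda>s. (s, \<phi> s)) ` S) (a, \<xi>) n"

lemma E_ring: "ring E" by (intro RDirProd_ring local.ring_axioms L.ring_axioms)

lemma phi_closed: "s \<in> S \<Longrightarrow> \<phi> s \<in> carrier L"
  using ring_hom_closed[OF phi] by simp

lemma S_ring: "ring (R\<lparr>carrier := S\<rparr>)" by (rule subring_is_ring[OF S])

lemma phi_zero: "\<phi> \<zero> = \<zero>\<^bsub>L\<^esub>"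
  using ring_hom_zero[OF phi S_ring L.ring_axioms] by simp

lemma skew: "skew_pre (R\<lparr>carrier := S\<rparr>) E (\<lambda>_. \<zero>) (\<lambda>s. (s, \<phi> s)) (a, \<xi>)"
proof (intro skew_pre.intro skew_pre_axioms.intro)
  show "cring (R\<lparr>carrier := S\<rparr>)" using subcring_iff subcringI'[OF S] subringE(1)[OF S] by blast
  show "ring E" by (rule E_ring)
  show "(\<lambda>s. (s, \<phi> s)) \<in> ring_hom (R\<lparr>carrier := S\<rparr>) E"
    using ring_hom_memE[OF phi] S_closed
    by (auto intro!: ring_hom_memI simp: RDirProd_simps RDirProd_carrier)
  fix r assume "r \<in> carrier (R\<lparr>carrier := S\<rparr>)"
  then have "r \<in> carrier R" "\<phi> r \<in> carrier L" using S_closed phi_closed by auto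
  then show "(a, \<xi>) \<otimes>\<^bsub>E\<^esub> (r, \<phi> r) = (r, \<phi> r) \<otimes>\<^bsub>E\<^esub> (a, \<xi>) \<oplus>\<^bsub>E\<^esub> (\<zero>, \<phi> \<zero>)"
    using xi by (simp add: RDirProd_simps phi_zero m_comm L.m_comm)
qed (use subringE[OF S] xi S_closed in \<open>auto simp: RDirProd_carrier\<close>)

lemmas G_add = skew_pre.spanR_add[OF skew, simplified]
lemmas G_neg = skew_pre.spanR_neg[OF skew, simplified]
lemmas G_smult = skew_pre.spanR_lmult[OF skew, simplified]
lemmas G_subring = skew_pre.spanR_subring[OF skew, simplified]

lemma G_SucE:
  assumes "u \<in> G (Suc n)"
  obtains s y z where "s \<in> S" "(y, z) \<in> G n" "u = (s \<otimes> a [^] n \<oplus> y, \<phi> s \<otimes>\<^bsub>L\<^esub> \<xi> [^]\<^bsub>L\<^esub> n \<oplus>\<^bsub>L\<^esub> z)"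
  using assms by (auto simp: RDirProd_pow RDirProd_simps)

lemma G_SucI: "s \<in> S \<Longrightarrow> (y, z) \<in> G n \<Longrightarrow> (s \<otimes> a [^] n \<oplus> y, \<phi> s \<otimes>\<^bsub>L\<^esub> \<xi> [^]\<^bsub>L\<^esub> n \<oplus>\<^bsub>L\<^esub> z) \<in> G (Suc n)"
  using ring.poly_span_SucI[OF E_ring, of "(s, \<phi> s)" "(\<lambda>s. (s, \<phi> s)) ` S" "(y, z)" "(a, \<xi>)" n]
  by (simp add: RDirProd_pow RDirProd_simps)

lemma G_fst: "(u, v) \<in> G n \<Longrightarrow> u \<in> sp n \<and> v \<in> carrier L"
proof (induction n arbitrary: u v)
  case 0
  then show ?case by (simp add: RDirProd_simps)
next
  case (Suc n)
  then show ?case using phi_closed xi by (elim G_SucE) auto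
qed

lemma G_eval: "set q \<subseteq> S \<Longrightarrow> (eval q a, L.eval (map \<phi> q) \<xi>) \<in> G (length q)"
proof (induction q)
  case Nil
  then show ?case by (simp add: RDirProd_simps)
next
  case (Cons s q)
  then show ?case using G_SucI[of s "eval q a" "L.eval (map \<phi> q) \<xi>" "length q"] by simp
qed

lemma G_lift: "u \<in> sp n \<Longrightarrow> \<exists>v. (u, v) \<in> G n"
  using poly_span_eval[of u S a n] G_eval by blast

text \<open>
  In a degree without relations of \<open>a\<close> the leading coefficient of the pair is zero.
  In any other degree the pair can be reduced by a relation that holds for \<open>a\<close> and,
  after applying \<open>\<phi>\<close>, for \<open>\<xi>\<close>; the reduction multiplies the
  second component by \<open>\<phi> c\<close>, which is nonzero.
\<close>

lemma G_welldef:
  assumes rel: "\<And>n. \<not> indep n \<Longrightarrow> \<exists>c q. c \<in> S \<and> \<phi> c \<noteq> \<zero>\<^bsub>L\<^esub> \<and> set q \<subseteq> S \<and> length q \<le> n \<and>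
      eval (c # q) a = \<zero> \<and> L.eval (map \<phi> (c # q)) \<xi> = \<zero>\<^bsub>L\<^esub>"
  shows "(\<zero>, v) \<in> G n \<Longrightarrow> v = \<zero>\<^bsub>L\<^esub>"
proof (induction n arbitrary: v)
  case 0
  then show ?case by (simp add: RDirProd_simps)
next
  case (Suc n)
  obtain s y z where 1: "s \<in> S" "(y, z) \<in> G n" "\<zero> = s \<otimes> a [^] n \<oplus> y"
    "v = \<phi> s \<otimes>\<^bsub>L\<^esub> \<xi> [^]\<^bsub>L\<^esub> n \<oplus>\<^bsub>L\<^esub> z"
    by (rule G_SucE[OF Suc.prems]) (use that in simp)
  have y: "y \<in> sp n" "y \<in> carrier R" "z \<in> carrier L" "s \<in> carrier R" "\<phi> s \<in> carrier L"
    using G_fst[OF 1(2)] sp_closed 1 S_closed phi_closed by auto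
  show ?case
  proof (cases "indep n")
    case True
    have "s \<otimes> a [^] n = \<ominus> y" using 1(3) y by (metis a m_closed minus_equality nat_pow_closed)
    then have "s = \<zero>" using True 1(1) sp_neg[OF y(1)] unfolding indep_def by metis
    then have "y = \<zero>" "v = z" using 1 y xi by (auto simp: phi_zero)
    then show ?thesis using Suc.IH 1(2) by blast
  next
    case False
    obtain c q where c: "c \<in> S" "\<phi> c \<noteq> \<zero>\<^bsub>L\<^esub>" "set q \<subseteq> S" "length q \<le> n"
      "eval (c # q) a = \<zero>" "L.eval (map \<phi> (c # q)) \<xi> = \<zero>\<^bsub>L\<^esub>" using rel[OF False] by blast
    define m where "m = length q"
    define k where "k = n - m"
    have n: "n = k + m" using c(4) unfolding m_def k_def by simp
    define p where "p = eval q a"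
    define p' where "p' = L.eval (map \<phi> q) \<xi>"
    have p: "(p, p') \<in> G m" unfolding m_def p_def p'_def by (rule G_eval[OF c(3)])
    have cc: "c \<in> carrier R" "\<phi> c \<in> carrier L" "p \<in> carrier R" "p' \<in> carrier L"
      using c(1) S_closed phi_closed G_fst[OF p] sp_closed by auto
    have e1: "c \<otimes> a [^] m \<oplus> p = \<zero>" and e2: "\<phi> c \<otimes>\<^bsub>L\<^esub> \<xi> [^]\<^bsub>L\<^esub> m \<oplus>\<^bsub>L\<^esub> p' = \<zero>\<^bsub>L\<^esub>"
      using c(5,6) unfolding p_def p'_def m_def by auto
    \<comment> \<open>\<open>c\<close> times the given pair, minus \<open>s a\<^sup>k\<close> times the relation, is a pair of lower degree\<close>
    have "(c, \<phi> c) \<otimes>\<^bsub>E\<^esub> (y, z) \<in> G n" using G_smult[OF c(1) 1(2)] .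
    then have g1: "(c \<otimes> y, \<phi> c \<otimes>\<^bsub>L\<^esub> z) \<in> G n" by (simp add: RDirProd_simps)
    have ak: "(a [^] k, \<xi> [^]\<^bsub>L\<^esub> k) \<otimes>\<^bsub>E\<^esub> (p, p') \<in> G n"
      using skew_pre.span_pow_mult[OF skew, of "S" "(p, p')" m k] p n
      by (simp add: RDirProd_pow ring.oneideal[OF S_ring, simplified] subringE(2)[OF S] image_subset_iff)
    have "(s, \<phi> s) \<otimes>\<^bsub>E\<^esub> ((a [^] k, \<xi> [^]\<^bsub>L\<^esub> k) \<otimes>\<^bsub>E\<^esub> (p, p')) \<in> G n" using G_smult[OF 1(1) ak] .
    then have "\<ominus>\<^bsub>E\<^esub> (s \<otimes> (a [^] k \<otimes> p), \<phi> s \<otimes>\<^bsub>L\<^esub> (\<xi> [^]\<^bsub>L\<^esub> k \<otimes>\<^bsub>L\<^esub> p')) \<in> G n"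
      by (intro G_neg) (simp add: RDirProd_simps)
    moreover have "\<ominus>\<^bsub>E\<^esub> (s \<otimes> (a [^] k \<otimes> p), \<phi> s \<otimes>\<^bsub>L\<^esub> (\<xi> [^]\<^bsub>L\<^esub> k \<otimes>\<^bsub>L\<^esub> p')) =
       (\<ominus> (s \<otimes> (a [^] k \<otimes> p)), \<ominus>\<^bsub>L\<^esub> (\<phi> s \<otimes>\<^bsub>L\<^esub> (\<xi> [^]\<^bsub>L\<^esub> k \<otimes>\<^bsub>L\<^esub> p')))"
      using y cc xi by (intro abelian_group.minus_equality[OF ring.is_abelian_group[OF E_ring]])
       (auto simp: RDirProd_simps RDirProd_carrier l_neg L.l_neg)
    ultimately have "(\<ominus> (s \<otimes> (a [^] k \<otimes> p)), \<ominus>\<^bsub>L\<^esub> (\<phi> s \<otimes>\<^bsub>L\<^esub> (\<xi> [^]\<^bsub>L\<^esub> k \<otimes>\<^bsub>L\<^esub> p'))) \<oplus>\<^bsub>E\<^esub> (c \<otimes> y, \<phi> c \<otimes>\<^bsub>L\<^esub> z) \<in> G n"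
      using g1 by (intro G_add) auto
    then have g: "(\<ominus> (s \<otimes> (a [^] k \<otimes> p)) \<oplus> c \<otimes> y, \<ominus>\<^bsub>L\<^esub> (\<phi> s \<otimes>\<^bsub>L\<^esub> (\<xi> [^]\<^bsub>L\<^esub> k \<otimes>\<^bsub>L\<^esub> p')) \<oplus>\<^bsub>L\<^esub> \<phi> c \<otimes>\<^bsub>L\<^esub> z) \<in> G n"
      by (simp add: RDirProd_simps)
    have "\<ominus> (s \<otimes> (a [^] k \<otimes> p)) \<oplus> c \<otimes> y = c \<otimes> (s \<otimes> (a [^] k \<otimes> a [^] m) \<oplus> y)
        \<ominus> s \<otimes> a [^] k \<otimes> (c \<otimes> a [^] m \<oplus> p)"
      using y cc nat_pow_closed[OF a, of k] nat_pow_closed[OF a, of m] by algebra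
    also have "s \<otimes> (a [^] k \<otimes> a [^] m) \<oplus> y = \<zero>" using 1(3) unfolding n by (simp add: nat_pow_mult)
    also have "c \<otimes> \<zero> \<ominus> s \<otimes> a [^] k \<otimes> (c \<otimes> a [^] m \<oplus> p) = \<zero>" unfolding e1 using y cc by (simp add: a_minus_def)
    finally have z1: "\<ominus> (s \<otimes> (a [^] k \<otimes> p)) \<oplus> c \<otimes> y = \<zero>" .
    have "\<ominus>\<^bsub>L\<^esub> (\<phi> s \<otimes>\<^bsub>L\<^esub> (\<xi> [^]\<^bsub>L\<^esub> k \<otimes>\<^bsub>L\<^esub> p')) \<oplus>\<^bsub>L\<^esub> \<phi> c \<otimes>\<^bsub>L\<^esub> z
        = \<phi> c \<otimes>\<^bsub>L\<^esub> (\<phi> s \<otimes>\<^bsub>L\<^esub> (\<xi> [^]\<^bsub>L\<^esub> k \<otimes>\<^bsub>L\<^esub> \<xi> [^]\<^bsub>L\<^esub> m) \<oplus>\<^bsub>L\<^esub> z)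
        \<ominus>\<^bsub>L\<^esub> \<phi> s \<otimes>\<^bsub>L\<^esub> \<xi> [^]\<^bsub>L\<^esub> k \<otimes>\<^bsub>L\<^esub> (\<phi> c \<otimes>\<^bsub>L\<^esub> \<xi> [^]\<^bsub>L\<^esub> m \<oplus>\<^bsub>L\<^esub> p')"
      using y cc L.nat_pow_closed[OF xi, of k] L.nat_pow_closed[OF xi, of m] by algebra
    also have "\<dots> = \<phi> c \<otimes>\<^bsub>L\<^esub> v" unfolding e2 1(4) using y cc xi by (simp add: L.nat_pow_mult n a_minus_def)
    finally have z2: "\<ominus>\<^bsub>L\<^esub> (\<phi> s \<otimes>\<^bsub>L\<^esub> (\<xi> [^]\<^bsub>L\<^esub> k \<otimes>\<^bsub>L\<^esub> p')) \<oplus>\<^bsub>L\<^esub> \<phi> c \<otimes>\<^bsub>L\<^esub> z = \<phi> c \<otimes>\<^bsub>L\<^esub> v" .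
    have "\<phi> c \<otimes>\<^bsub>L\<^esub> v = \<zero>\<^bsub>L\<^esub>" using Suc.IH g unfolding z1 z2 by blast
    moreover have "v \<in> carrier L" unfolding 1(4) using y xi by auto
    ultimately show ?thesis using L.integral c(2) cc by blast
  qed
qed

lemma hom_extends:
  assumes rel: "\<And>n. \<not> indep n \<Longrightarrow> \<exists>c q. c \<in> S \<and> \<phi> c \<noteq> \<zero>\<^bsub>L\<^esub> \<and> set q \<subseteq> S \<and> length q \<le> n \<and>
      eval (c # q) a = \<zero> \<and> L.eval (map \<phi> (c # q)) \<xi> = \<zero>\<^bsub>L\<^esub>"
  shows "\<exists>\<psi> \<in> ring_hom (R\<lparr>carrier := (\<Union>n. sp n)\<rparr>) L. (\<forall>s \<in> S. \<psi> s = \<phi> s) \<and>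
     (\<forall>q. set q \<subseteq> S \<longrightarrow> \<psi> (eval q a) = L.eval (map \<phi> q) \<xi>)"
proof -
  have wd: "v = \<zero>\<^bsub>L\<^esub>" if "(\<zero>, v) \<in> G n" for v n using G_welldef[OF rel that] .
  define \<Gamma> where "\<Gamma> = (\<Union>n. G n)"
  interpret \<Gamma>: subring \<Gamma> E unfolding \<Gamma>_def by (rule G_subring)
  have uniq: "v = v'" if "(u, v) \<in> \<Gamma>" "(u, v') \<in> \<Gamma>" for u v v'
  proof -
    have c: "u \<in> carrier R" "v \<in> carrier L" "v' \<in> carrier L" using that G_fst sp_closed unfolding \<Gamma>_def by blast+
    have "\<ominus>\<^bsub>E\<^esub> (u, v') = (\<ominus> u, \<ominus>\<^bsub>L\<^esub> v')"
      using c by (intro abelian_group.minus_equality[OF ring.is_abelian_group[OF E_ring]])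
       (auto simp: RDirProd_simps RDirProd_carrier l_neg L.l_neg)
    moreover have "\<ominus>\<^bsub>E\<^esub> (u, v') \<in> \<Gamma>" using subringE(5)[OF \<Gamma>.subring_axioms] that by blast
    ultimately have "(u, v) \<oplus>\<^bsub>E\<^esub> (\<ominus> u, \<ominus>\<^bsub>L\<^esub> v') \<in> \<Gamma>"
      using subringE(7)[OF \<Gamma>.subring_axioms that(1)] by metis
    then have "(\<zero>, v \<oplus>\<^bsub>L\<^esub> \<ominus>\<^bsub>L\<^esub> v') \<in> \<Gamma>" using c by (simp add: RDirProd_simps r_neg)
    then have "v \<ominus>\<^bsub>L\<^esub> v' = \<zero>\<^bsub>L\<^esub>" using wd unfolding \<Gamma>_def a_minus_def by blast
    then show ?thesis using c by simp
  qed
  define \<psi> where "\<psi> u = (THE v. (u, v) \<in> \<Gamma>)" for u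
  have psi: "\<psi> u = v" if "(u, v) \<in> \<Gamma>" for u v unfolding \<psi>_def using that uniq by blast
  have ex: "(u, \<psi> u) \<in> \<Gamma>" if "u \<in> (\<Union>n. sp n)" for u
    using that G_lift psi unfolding \<Gamma>_def by blast
  have ev: "\<psi> (eval q a) = L.eval (map \<phi> q) \<xi>" if "set q \<subseteq> S" for q
    using psi G_eval[OF that] unfolding \<Gamma>_def by blast
  have "\<psi> s = \<phi> s" if "s \<in> S" for s
    using ev[of "[s]"] that S_closed phi_closed by simp
  moreover have "\<psi> \<in> ring_hom (R\<lparr>carrier := (\<Union>n. sp n)\<rparr>) L"
  proof (rule ring_hom_memI)
    fix u v assume u: "u \<in> carrier (R\<lparr>carrier := (\<Union>n. sp n)\<rparr>)"
    then have u': "(u, \<psi> u) \<in> \<Gamma>" using ex by simp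
    then show "\<psi> u \<in> carrier L" using G_fst unfolding \<Gamma>_def by blast
    assume "v \<in> carrier (R\<lparr>carrier := (\<Union>n. sp n)\<rparr>)"
    then have v': "(v, \<psi> v) \<in> \<Gamma>" using ex by simp
    show "\<psi> (u \<otimes>\<^bsub>R\<lparr>carrier := (\<Union>n. sp n)\<rparr>\<^esub> v) = \<psi> u \<otimes>\<^bsub>L\<^esub> \<psi> v"
      using subringE(6)[OF \<Gamma>.subring_axioms u' v'] psi by (simp add: RDirProd_simps)
    show "\<psi> (u \<oplus>\<^bsub>R\<lparr>carrier := (\<Union>n. sp n)\<rparr>\<^esub> v) = \<psi> u \<oplus>\<^bsub>L\<^esub> \<psi> v"
      using subringE(7)[OF \<Gamma>.subring_axioms u' v'] psi by (simp add: RDirProd_simps)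
  next
    show "\<psi> \<one>\<^bsub>R\<lparr>carrier := (\<Union>n. sp n)\<rparr>\<^esub> = \<one>\<^bsub>L\<^esub>"
      using subringE(3)[OF \<Gamma>.subring_axioms] psi by (simp add: RDirProd_simps)
  qed
  ultimately show ?thesis using ev by blast
qed

end

lemma (in algebraically_closed) root_exists:
  assumes q: "set q \<subseteq> carrier L" "q \<noteq> []" and c: "c \<in> carrier L" "c \<noteq> \<zero>"
  obtains \<xi> where "\<xi> \<in> carrier L" "eval (c # q) \<xi> = \<zero>"
proof -
  have p: "c # q \<in> carrier (poly_ring L)"
    using q c by (auto simp: univ_poly_carrier[symmetric] polynomial_def)
  have "size (roots (c # q)) > 0"
    using roots_over_carrier[OF p] q(2) unfolding splitted_def by (cases q) auto
  then obtain \<xi> where "\<xi> \<in># roots (c # q)" by (metis size_empty less_irrefl multiset_nonemptyE)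
  then show ?thesis using that roots_mem_iff_is_root[OF p] unfolding is_root_def by blast
qed

text \<open>
  If \<open>a\<close> is transcendental over \<open>S\<close>, let \<open>g\<close> be the
  leading coefficient of \<open>f\<close>: as long as \<open>\<phi> g \<noteq> 0\<close> the
  image of \<open>a\<close> can be chosen such that \<open>f\<close> is sent to \<open>1\<close>
  (or \<open>f = g\<close>). If \<open>a\<close> is algebraic, let \<open>c\<close> be the
  leading coefficient of a minimal relation and \<open>h f\<close> a nonzero multiple of
  \<open>f\<close> in \<open>S\<close>, and \<open>g = c h f\<close>: then the image of the
  relation has a root, and \<open>f\<close> is not sent to \<open>0\<close> because \<open>h
  f\<close> is not.
\<close>

lemma (in poly_ext) hom_extension_step:
  assumes L: "algebraically_closed L" and f: "f \<in> sp N" "f \<noteq> \<zero>"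
  shows "\<exists>g \<in> S. g \<noteq> \<zero> \<and> (\<forall>\<phi> \<in> ring_hom (R\<lparr>carrier := S\<rparr>) L. \<phi> g \<noteq> \<zero>\<^bsub>L\<^esub> \<longrightarrow>
     (\<exists>\<psi> \<in> ring_hom (R\<lparr>carrier := (\<Union>n. sp n)\<rparr>) L. \<psi> f \<noteq> \<zero>\<^bsub>L\<^esub> \<and> (\<forall>s \<in> S. \<psi> s = \<phi> s)))"
proof -
  interpret L: algebraically_closed L by fact
  have pc: "\<phi> s \<in> carrier L" if "\<phi> \<in> ring_hom (R\<lparr>carrier := S\<rparr>) L" "s \<in> S" for \<phi> s
    using ring_hom_closed[OF that(1)] that(2) by simp
  have hx: "hom_ext R S a L \<phi> \<xi>" if "\<phi> \<in> ring_hom (R\<lparr>carrier := S\<rparr>) L" "\<xi> \<in> carrier L" for \<phi> \<xi>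
    by (intro hom_ext.intro hom_ext_axioms.intro poly_ext_axioms L.field_axioms that)
  show ?thesis
  proof (cases "\<forall>d. indep d")
    case True
    obtain m s y where 1: "s \<in> S" "s \<noteq> \<zero>" "y \<in> sp m" "f = s \<otimes> a [^] m \<oplus> y" using sp_lead[OF f] by metis
    have c: "s \<in> carrier R" "y \<in> carrier R" using 1 S_closed sp_closed by auto
    have "\<exists>\<psi> \<in> ring_hom (R\<lparr>carrier := (\<Union>n. sp n)\<rparr>) L. \<psi> f \<noteq> \<zero>\<^bsub>L\<^esub> \<and> (\<forall>s \<in> S. \<psi> s = \<phi> s)"
      if phi: "\<phi> \<in> ring_hom (R\<lparr>carrier := S\<rparr>) L" and nz: "\<phi> s \<noteq> \<zero>\<^bsub>L\<^esub>" for \<phi>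
    proof (cases m)
      case 0
      interpret hom_ext R S a L \<phi> "\<zero>\<^bsub>L\<^esub>" by (rule hx[OF phi L.zero_closed])
      obtain \<psi> where psi: "\<psi> \<in> ring_hom (R\<lparr>carrier := (\<Union>n. sp n)\<rparr>) L" "\<forall>s \<in> S. \<psi> s = \<phi> s"
        using hom_extends True by metis
      have "f = s" using 1 0 c by simp
      then show ?thesis using psi nz 1 by metis
    next
      case (Suc k)
      \<comment> \<open>\<open>\<xi>\<close> is chosen as a root of the equation \<open>f = 1\<close>, which has positive degree \<open>m\<close>\<close>
      have "\<one> \<in> sp m" using sp_1 sp_mono[of "Suc 0" m] subringE(3)[OF S] Suc by auto
      then obtain q where q: "set q \<subseteq> S" "length q = m" "y \<ominus> \<one> = eval q a"
        using poly_span_eval[OF sp_minus[OF 1(3), of \<one>]] by blast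
      obtain \<xi> where root: "\<xi> \<in> carrier L" "L.eval (\<phi> s # map \<phi> q) \<xi> = \<zero>\<^bsub>L\<^esub>"
        using L.root_exists[of "map \<phi> q" "\<phi> s"] q pc[OF phi] 1 nz Suc by (metis (no_types, lifting) image_subset_iff length_map list.set_map list.size(3) nat.distinct(1) subset_iff)
      interpret hom_ext R S a L \<phi> \<xi> by (rule hx[OF phi root(1)])
      obtain \<psi> where psi: "\<psi> \<in> ring_hom (R\<lparr>carrier := (\<Union>n. sp n)\<rparr>) L" "\<forall>s \<in> S. \<psi> s = \<phi> s"
        "\<forall>q. set q \<subseteq> S \<longrightarrow> \<psi> (eval q a) = L.eval (map \<phi> q) \<xi>"
        using hom_extends True by metis
      have e: "f \<ominus> \<one> = eval (s # q) a" using q 1 c by (simp add: a_minus_def a_assoc)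
      have "\<psi> (eval (s # q) a) = L.eval (map \<phi> (s # q)) \<xi>" using psi(3) q(1) 1(1) by (metis insert_subset list.simps(15))
      then have z: "\<psi> (f \<ominus> \<one>) = \<zero>\<^bsub>L\<^esub>" using root(2) unfolding e by simp
      have fm: "f \<ominus> \<one> \<in> (\<Union>n. sp n)" "\<one> \<in> (\<Union>n. sp n)"
        using \<open>\<one> \<in> sp m\<close> f(1) sp_minus[of f "max N m" \<one>] sp_mono[OF _ f(1), of "max N m"] sp_mono[OF _ \<open>\<one> \<in> sp m\<close>, of "max N m"] by auto
      have "(f \<ominus> \<one>) \<oplus> \<one> = f" using f sp_closed by (simp add: a_minus_def a_assoc l_neg)
      then have "\<psi> f = \<psi> (f \<ominus> \<one>) \<oplus>\<^bsub>L\<^esub> \<psi> \<one>" using ring_hom_add[OF psi(1), of "f \<ominus> \<one>" \<one>] fm by simp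
      also have "\<dots> = \<one>\<^bsub>L\<^esub>" unfolding z using ring_hom_one[OF psi(1)] by simp
      finally show ?thesis using psi by (intro bexI[of _ \<psi>]) auto
    qed
    then show ?thesis using 1 by blast
  next
    case False
    define d where "d = (LEAST d. \<not> indep d)"
    have nd: "\<not> indep d" unfolding d_def using False LeastI_ex[of "\<lambda>d. \<not> indep d"] by blast
    have ind: "indep m" if "m < d" for m using not_less_Least[of m "\<lambda>d. \<not> indep d"] that unfolding d_def by blast
    obtain c where c: "c \<in> S" "c \<noteq> \<zero>" "c \<otimes> a [^] d \<in> sp d" using nd unfolding indep_def by blast
    have cc: "c \<in> carrier R" using c S_closed by blast
    obtain M h where h: "h \<in> sp M" "h \<otimes> f \<in> S" "h \<otimes> f \<noteq> \<zero>"
      using algebraic_multiple[OF c(1,2,3) ind f] by blast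
    obtain q where q: "set q \<subseteq> S" "length q = d" "\<ominus> (c \<otimes> a [^] d) = eval q a"
      using poly_span_eval[OF sp_neg[OF c(3)]] by blast
    have d0: "q \<noteq> []"
    proof
      assume "q = []"
      then have "c \<otimes> a [^] (0::nat) \<in> sp 0" using c(3) q(2) by simp
      then show False using c cc by simp
    qed
    have rel: "eval (c # q) a = \<zero>" using q cc by (simp flip: q(3) add: r_neg)
    have "\<exists>\<psi> \<in> ring_hom (R\<lparr>carrier := (\<Union>n. sp n)\<rparr>) L. \<psi> f \<noteq> \<zero>\<^bsub>L\<^esub> \<and> (\<forall>s \<in> S. \<psi> s = \<phi> s)"
      if phi: "\<phi> \<in> ring_hom (R\<lparr>carrier := S\<rparr>) L" and nz: "\<phi> (c \<otimes> (h \<otimes> f)) \<noteq> \<zero>\<^bsub>L\<^esub>" for \<phi>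
    proof -
      have "\<phi> (c \<otimes> (h \<otimes> f)) = \<phi> c \<otimes>\<^bsub>L\<^esub> \<phi> (h \<otimes> f)" using ring_hom_mult[OF phi, of c "h \<otimes> f"] c h by simp
      then have nz': "\<phi> c \<noteq> \<zero>\<^bsub>L\<^esub>" "\<phi> (h \<otimes> f) \<noteq> \<zero>\<^bsub>L\<^esub>" using nz pc[OF phi] c h by auto
      obtain \<xi> where root: "\<xi> \<in> carrier L" "L.eval (\<phi> c # map \<phi> q) \<xi> = \<zero>\<^bsub>L\<^esub>"
        using L.root_exists[of "map \<phi> q" "\<phi> c"] q pc[OF phi] c(1) nz' d0 by (metis (no_types, lifting) image_subset_iff list.set_map map_is_Nil_conv subset_iff)
      interpret hom_ext R S a L \<phi> \<xi> by (rule hx[OF phi root(1)])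
      have "\<exists>c q. c \<in> S \<and> \<phi> c \<noteq> \<zero>\<^bsub>L\<^esub> \<and> set q \<subseteq> S \<and> length q \<le> n \<and>
          eval (c # q) a = \<zero> \<and> L.eval (map \<phi> (c # q)) \<xi> = \<zero>\<^bsub>L\<^esub>" if "\<not> indep n" for n
        using that ind[of n] q c(1) nz' root(2) rel by (intro exI[of _ c] exI[of _ q]) (auto simp: not_less[symmetric])
      then obtain \<psi> where psi: "\<psi> \<in> ring_hom (R\<lparr>carrier := (\<Union>n. sp n)\<rparr>) L" "\<forall>s \<in> S. \<psi> s = \<phi> s"
        using hom_extends by metis
      have "\<psi> (h \<otimes> f) = \<psi> h \<otimes>\<^bsub>L\<^esub> \<psi> f" using ring_hom_mult[OF psi(1), of h f] h f by auto
      moreover have "\<psi> h \<in> carrier L" using ring_hom_closed[OF psi(1), of h] h by auto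
      ultimately have "\<psi> f \<noteq> \<zero>\<^bsub>L\<^esub>" using nz' psi(2) h(2) by auto
      then show ?thesis using psi by blast
    qed
    moreover have "c \<otimes> (h \<otimes> f) \<in> S" using c h subringE(6)[OF S] by blast
    moreover have "c \<otimes> (h \<otimes> f) \<noteq> \<zero>" using integral[of c "h \<otimes> f"] c h S_closed by blast
    ultimately show ?thesis by blast
  qed
qed

text \<open>
  The element \<open>g\<close> of \<open>hom_extension_step\<close> replaces \<open>f\<close>
  when a generator is removed; in the end \<open>f\<close> is a nonzero element of the field
  \<open>k\<close> and cannot be sent to zero.
\<close>

lemma (in domain) hom_to_closed_field:
  assumes k: "subfield k R" and L: "algebraically_closed L" and phi: "\<phi> \<in> ring_hom (R\<lparr>carrier := k\<rparr>) L"
    and T: "finite T" "T \<subseteq> carrier R" and f: "f \<in> generate_ring R (k \<union> T)" "f \<noteq> \<zero>"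
  shows "\<exists>\<psi> \<in> ring_hom (R\<lparr>carrier := generate_ring R (k \<union> T)\<rparr>) L. \<psi> f \<noteq> \<zero>\<^bsub>L\<^esub> \<and> (\<forall>c \<in> k. \<psi> c = \<phi> c)"
  using T f
proof (induction T arbitrary: f)
  case empty
  interpret L: algebraically_closed L by fact
  have g: "generate_ring R k = k" using generate_ringI[of k k] subfieldE(1,3)[OF k] by auto
  have fk: "f \<in> k" using empty g by simp
  have i: "inv f \<in> k" "f \<otimes> inv f = \<one>" using subfield_m_inv[OF k, of f] fk empty by auto
  have "\<phi> f \<otimes>\<^bsub>L\<^esub> \<phi> (inv f) = \<one>\<^bsub>L\<^esub>"
    using ring_hom_mult[OF phi, of f "inv f"] ring_hom_one[OF phi] i fk by simp
  moreover have "\<phi> (inv f) \<in> carrier L" using ring_hom_closed[OF phi] i by simp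
  ultimately have "\<phi> f \<noteq> \<zero>\<^bsub>L\<^esub>" by auto
  then show ?case using phi g by auto
next
  case (insert a T)
  let ?S = "generate_ring R (k \<union> T)"
  have c: "k \<union> T \<subseteq> carrier R" "a \<in> carrier R" using insert subfieldE(3)[OF k] by auto
  interpret poly_ext R ?S a
    by (intro poly_ext.intro poly_ext_axioms.intro domain_axioms generate_ring_is_subring c)
  have U: "generate_ring R (k \<union> insert a T) = (\<Union>n. sp n)" using generate_ring_insert[OF c] by simp
  then obtain N where "f \<in> sp N" using insert by blast
  then obtain g where g: "g \<in> ?S" "g \<noteq> \<zero>" "\<forall>\<phi> \<in> ring_hom (R\<lparr>carrier := ?S\<rparr>) L. \<phi> g \<noteq> \<zero>\<^bsub>L\<^esub> \<longrightarrow>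
     (\<exists>\<psi> \<in> ring_hom (R\<lparr>carrier := (\<Union>n. sp n)\<rparr>) L. \<psi> f \<noteq> \<zero>\<^bsub>L\<^esub> \<and> (\<forall>s \<in> ?S. \<psi> s = \<phi> s))"
    using hom_extension_step[OF L _ insert.prems(3)] by blast
  obtain \<chi> where chi: "\<chi> \<in> ring_hom (R\<lparr>carrier := ?S\<rparr>) L" "\<chi> g \<noteq> \<zero>\<^bsub>L\<^esub>" "\<forall>c \<in> k. \<chi> c = \<phi> c"
    using insert.IH[of g] g insert.prems by blast
  obtain \<psi> where "\<psi> \<in> ring_hom (R\<lparr>carrier := (\<Union>n. sp n)\<rparr>) L" "\<psi> f \<noteq> \<zero>\<^bsub>L\<^esub>" "\<forall>s \<in> ?S. \<psi> s = \<chi> s"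
    using g(3) chi(1,2) by blast
  moreover have "k \<subseteq> ?S" by (auto intro: generate_ring.incl)
  ultimately show ?case using chi(3) unfolding U by (intro bexI[of _ \<psi>]) auto
qed

section \<open>The Nullstellensatz\<close>

text \<open>
  After cancelling powers of \<open>b\<close>, a polynomial relation of \<open>b\<close> has a
  nonzero constant coefficient, and dividing by it expresses \<open>1\<close> as a multiple of
  \<open>b\<close>.
\<close>

lemma (in domain) algebraic_inverse:
  assumes k: "subfield k R" and b: "b \<in> carrier R" "b \<noteq> \<zero>" and alg: "algebraic k b"
  shows "\<exists>q. set q \<subseteq> k \<and> b \<otimes> eval q b = \<one>"
proof -
  obtain p where p: "p \<in> carrier (k[X])" "p \<noteq> []" "eval p b = \<zero>"
    using algebraicE[OF subfieldE(1)[OF k] b(1)] alg by (auto simp: over_def)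
  have "\<exists>q. set q \<subseteq> k \<and> b \<otimes> eval q b = \<one>" if "set p \<subseteq> k" "p \<noteq> []" "lead_coeff p \<noteq> \<zero>" "eval p b = \<zero>" for p
    using that
  proof (induction p rule: rev_induct)
    case (snoc c q)
    have kc: "k \<subseteq> carrier R" by (rule subfieldE(3)[OF k])
    have q: "set q \<subseteq> k" "c \<in> k" "set q \<subseteq> carrier R" "c \<in> carrier R" using snoc kc by auto
    have ev: "eval (q @ [c]) b = eval q b \<otimes> b \<oplus> c" by (rule eval_append_aux) (use q b in auto)
    have qc: "eval q b \<in> carrier R" using eval_in_carrier q b by blast
    show ?case
    proof (cases "c = \<zero>")
      case True
      then have z: "eval q b = \<zero>" using ev snoc.prems(4) qc b integral by force
      have "q \<noteq> []" using snoc.prems(3) True by auto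
      then show ?thesis using snoc.IH z q snoc.prems(3) by simp
    next
      case False
      have i: "inv c \<in> k" "c \<otimes> inv c = \<one>" using subfield_m_inv[OF k, of c] q False by auto
      have ic: "inv c \<in> carrier R" using i kc by blast
      have "(\<ominus> (inv c)) \<in> k" using subringE(5)[OF subfieldE(1)[OF k]] i by blast
      then have S: "set (map (\<lambda>r. (\<ominus> (inv c)) \<otimes> r) q) \<subseteq> k" using q subringE(6)[OF subfieldE(1)[OF k]] by auto
      have em: "eval (map (\<lambda>r. d \<otimes> r) q) b = d \<otimes> eval q b" if "d \<in> carrier R" for d
        using q(3) that b by (induction q) (auto simp: r_distr m_assoc eval_in_carrier)
      have e0: "eval q b \<otimes> b = \<ominus> c" using ev snoc.prems(4) qc b q by (metis m_closed minus_equality)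
      have "b \<otimes> eval (map (\<lambda>r. (\<ominus> (inv c)) \<otimes> r) q) b = (\<ominus> (inv c)) \<otimes> (eval q b \<otimes> b)"
        using ic b qc by (simp add: em m_ac)
      also have "\<dots> = \<one>" unfolding e0 using ic q i by (simp add: l_minus r_minus m_comm)
      finally show ?thesis using S by blast
    qed
  qed simp
  from this[of p] show ?thesis using p by (auto simp: univ_poly_carrier[symmetric] polynomial_def)
qed

text \<open>
  For commutative \<open>R / m\<close> this says that the quotient is a field. It is phrased
  with elements of \<open>R\<close> so that it can be pulled back to a noncommutative ring from
  a commutative quotient.
\<close>

definition field_ideal :: "('a, 'n) ring_scheme \<Rightarrow> 'a set \<Rightarrow> bool" where
  "field_ideal R m \<longleftrightarrow> ideal m R \<and> \<one>\<^bsub>R\<^esub> \<notin> m \<and>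
     (\<forall>b \<in> carrier R - m. \<exists>e \<in> carrier R. \<one>\<^bsub>R\<^esub> \<ominus>\<^bsub>R\<^esub> b \<otimes>\<^bsub>R\<^esub> e \<in> m)"

lemma field_ideal_maximal:
  fixes R (structure)
  assumes "field_ideal R m" shows "maximalideal m R"
proof -
  interpret ideal m R using assms by (simp add: field_ideal_def)
  show ?thesis
  proof (rule maximalidealI)
    show "ideal m R" by (rule is_ideal)
    show "carrier R \<noteq> m" using assms unfolding field_ideal_def by (metis one_closed)
    fix J assume J: "ideal J R" "m \<subseteq> J" "J \<subseteq> carrier R"
    interpret J: ideal J R by fact
    show "J = m \<or> J = carrier R"
    proof (cases "J \<subseteq> m")
      case False
      then obtain b where b: "b \<in> J" "b \<notin> m" by blast
      then obtain e where e: "e \<in> carrier R" "\<one> \<ominus> b \<otimes> e \<in> m" using assms J unfolding field_ideal_def by blast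
      have bc: "b \<in> carrier R" using b J by blast
      have "(\<one> \<ominus> b \<otimes> e) \<oplus> b \<otimes> e \<in> J" using e b J J.I_r_closed by (intro J.a_closed) auto
      also have "(\<one> \<ominus> b \<otimes> e) \<oplus> b \<otimes> e = \<one>" using bc e by (simp add: a_minus_def a_assoc l_neg)
      finally show ?thesis using J.one_imp_carrier by blast
    qed (use J in auto)
  qed
qed

text \<open>
  Let \<open>\<psi>\<close> be a homomorphism to the algebraic closure of \<open>k\<close> that
  does not kill \<open>f\<close>. Its image consists of elements algebraic over
  \<open>k\<close>, hence is a field, and \<open>m\<close> is its kernel. If \<open>m =
  0\<close> then \<open>R\<close> itself embeds into the algebraic closure.
\<close>

theorem (in domain) nullstellensatz:
  assumes k: "subfield k R" and T: "finite T" "T \<subseteq> carrier R" and gen: "generate_ring R (k \<union> T) = carrier R"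
    and f: "f \<in> carrier R" "f \<noteq> \<zero>"
  obtains m where "field_ideal R m" "f \<notin> m" "m = {\<zero>} \<Longrightarrow> \<forall>b \<in> carrier R. algebraic k b"
proof -
  interpret k: field "R\<lparr>carrier := k\<rparr>" by (rule subfield_iff(2)[OF k])
  have kc: "k \<subseteq> carrier R" by (rule subfieldE(3)[OF k])
  obtain L :: "((('a list \<times> nat) multiset) \<Rightarrow> 'a) ring" where
    L: "algebraic_closure L (k.indexed_const ` k)" and ic: "k.indexed_const \<in> ring_hom (R\<lparr>carrier := k\<rparr>) L"
    using k.exists_closure by (metis partial_object.select_convs(1) partial_object.surjective partial_object.update_convs(1))
  interpret L: algebraic_closure L "k.indexed_const ` k" by fact
  obtain \<psi> where psi: "\<psi> \<in> ring_hom R L" "\<psi> f \<noteq> \<zero>\<^bsub>L\<^esub>" "\<forall>c \<in> k. \<psi> c = k.indexed_const c"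
    using hom_to_closed_field[OF k L.algebraically_closed_axioms ic T, of f] f gen by auto
  interpret \<psi>: ring_hom_ring R L \<psi> by (intro ring_hom_ringI2 local.ring_axioms L.ring_axioms psi)
  have img: "\<psi> ` k = k.indexed_const ` k" using psi(3) by auto
  define m where "m = a_kernel R L \<psi>"
  have mm: "b \<in> m \<longleftrightarrow> b \<in> carrier R \<and> \<psi> b = \<zero>\<^bsub>L\<^esub>" for b unfolding m_def a_kernel_def' by auto
  have alg: "L.algebraic (\<psi> ` k) (\<psi> b)" if "b \<in> carrier R" for b
    using L.algebraic_extension[of "\<psi> b"] that unfolding img over_def by simp
  have "field_ideal R m"
    unfolding field_ideal_def
  proof (intro conjI ballI)
    show "ideal m R" unfolding m_def by (rule \<psi>.kernel_is_ideal)
    show "\<one> \<notin> m" unfolding mm by simp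
    fix b assume b: "b \<in> carrier R - m"
    have sf: "subfield (\<psi> ` k) L" unfolding img by (rule L.subfield_axioms)
    obtain q where q: "set q \<subseteq> \<psi> ` k" "\<psi> b \<otimes>\<^bsub>L\<^esub> L.eval q (\<psi> b) = \<one>\<^bsub>L\<^esub>"
      using L.algebraic_inverse[OF sf _ _ alg, of b] b mm \<psi>.hom_closed by blast
    then have "q \<in> lists (\<psi> ` k)" by auto
    then obtain p where p: "q = map \<psi> p" "set p \<subseteq> k" unfolding lists_image by auto
    have ec: "eval p b \<in> carrier R" using b p kc by (intro eval_in_carrier) auto
    have "L.eval q (\<psi> b) = \<psi> (eval p b)"
      unfolding p using p kc b by (intro eval_map_hom local.ring_axioms L.ring_axioms psi) auto
    then have "\<psi> (\<one> \<ominus> b \<otimes> eval p b) = \<zero>\<^bsub>L\<^esub>" using q b ec by (simp add: a_minus_def L.r_neg)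
    then show "\<exists>e \<in> carrier R. \<one> \<ominus> b \<otimes> e \<in> m" unfolding mm using ec b by auto
  qed
  moreover have "f \<notin> m" unfolding mm using psi by simp
  moreover have "\<forall>b \<in> carrier R. algebraic k b" if "m = {\<zero>}"
  proof
    fix b assume b: "b \<in> carrier R"
    have "inj_on \<psi> (carrier R)" using that unfolding m_def by (rule \<psi>.trivial_ker_imp_inj)
    then show "algebraic k b"
      using algebraic_transport[OF local.ring_axioms L.ring_axioms psi(1) _ kc b] alg[OF b] by blast
  qed
  ultimately show ?thesis using that by blast
qed

lemma (in ideal) quot_minus:
  assumes "a \<in> carrier R" "b \<in> carrier R"
  shows "(I +> a) \<ominus>\<^bsub>R Quot I\<^esub> (I +> b) = I +> (a \<ominus> b)"
proof -
  interpret h: ring_hom_ring R "R Quot I" "(+>) I" by (rule rcos_ring_hom_ring)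
  show ?thesis using assms by (simp add: a_minus_def)
qed

lemma (in ideal) quot_carrier: "carrier (R Quot I) = (+>) I ` carrier R"
  unfolding FactRing_simps by auto

lemma (in ideal) quot_zero_iff:
  assumes "a \<in> carrier R" shows "I +> a = \<zero>\<^bsub>R Quot I\<^esub> \<longleftrightarrow> a \<in> I"
  using rcos_const_imp_mem[OF assms] a_rcos_zero[OF is_ideal] by (auto simp: FactRing_def)

lemma (in ring) generate_ring_image:
  assumes h: "h \<in> ring_hom R S" "ring S" and H: "H \<subseteq> carrier R"
  shows "h ` generate_ring R H = generate_ring S (h ` H)"
proof -
  interpret S: ring S by fact
  interpret h: ring_hom_ring R S h by (intro ring_hom_ringI2 ring_axioms S.ring_axioms h)
  have c: "g \<in> carrier R" if "g \<in> generate_ring R H" for g using generate_ring_in_carrier[OF H that] .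
  show ?thesis
  proof
    have "h g \<in> generate_ring S (h ` H)" if "g \<in> generate_ring R H" for g
      using that by (induction g rule: generate_ring.induct) (use c in \<open>auto intro: generate_ring.intros\<close>)
    then show "h ` generate_ring R H \<subseteq> generate_ring S (h ` H)" by blast
    have "subring (h ` generate_ring R H) S" by (intro h.img_is_subring generate_ring_is_subring H)
    moreover have "h ` H \<subseteq> h ` generate_ring R H" by (auto intro: generate_ring.incl)
    moreover have "h ` H \<subseteq> carrier S" using H by auto
    ultimately show "generate_ring S (h ` H) \<subseteq> h ` generate_ring R H"
      by (intro S.generate_ring_min_subring1)
  qed
qed

lemma scalars_subfield:
  assumes K: "field K" and R: "assoc_algebra K R" and nz: "\<one>\<^bsub>R\<^esub> \<noteq> \<zero>\<^bsub>R\<^esub>"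
  shows "subfield (scalars K R) R" and "(\<lambda>c. c \<odot>\<^bsub>R\<^esub> \<one>\<^bsub>R\<^esub>) \<in> ring_hom K R"
proof -
  interpret K: field K by fact
  interpret R: assoc_algebra K R by fact
  show h: "(\<lambda>c. c \<odot>\<^bsub>R\<^esub> \<one>\<^bsub>R\<^esub>) \<in> ring_hom K R"
    by (rule ring_hom_memI) (auto simp: R.smult_l_distr R.smult_mult_left R.smult_assoc1)
  interpret h: ring_hom_ring K R "\<lambda>c. c \<odot>\<^bsub>R\<^esub> \<one>\<^bsub>R\<^esub>"
    by (intro ring_hom_ringI2 K.ring_axioms R.ring_axioms h)
  show "subfield (scalars K R) R"
    using h.img_is_subfield(2)[OF K.carrier_is_subfield nz] unfolding scalars_def .
qed

lemma algebra_assoc_algebra: "algebra K R \<Longrightarrow> assoc_algebra K R"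
proof -
  assume "algebra K R"
  then interpret algebra K R .
  show ?thesis
  proof (intro assoc_algebra.intro assoc_algebra_axioms.intro)
    fix c a b assume c: "c \<in> carrier K" "a \<in> carrier R" "b \<in> carrier R"
    show "c \<odot>\<^bsub>R\<^esub> a \<otimes>\<^bsub>R\<^esub> b = c \<odot>\<^bsub>R\<^esub> (a \<otimes>\<^bsub>R\<^esub> b)" using c by (rule smult_assoc2)
    have "a \<otimes>\<^bsub>R\<^esub> (c \<odot>\<^bsub>R\<^esub> b) = (c \<odot>\<^bsub>R\<^esub> b) \<otimes>\<^bsub>R\<^esub> a" using c by (intro cring.cring_simprules(14)[OF M_cring]) auto
    also have "\<dots> = c \<odot>\<^bsub>R\<^esub> (b \<otimes>\<^bsub>R\<^esub> a)" using c by (intro smult_assoc2)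
    also have "b \<otimes>\<^bsub>R\<^esub> a = a \<otimes>\<^bsub>R\<^esub> b" using c by (intro cring.cring_simprules(14)[OF M_cring])
    finally show "a \<otimes>\<^bsub>R\<^esub> (c \<odot>\<^bsub>R\<^esub> b) = c \<odot>\<^bsub>R\<^esub> (a \<otimes>\<^bsub>R\<^esub> b)" .
  qed (unfold_locales)
qed

text \<open>The Nullstellensatz for \<open>A / P\<close>, pulled back to \<open>A\<close>.\<close>

lemma quotient_nullstellensatz:
  assumes K: "field K" and A: "assoc_algebra K A" and P: "ideal P A" and dom: "domain (A Quot P)"
    and T: "finite T" "T \<subseteq> carrier A" "generate_ring A (scalars K A \<union> T) = carrier A"
    and f: "f \<in> carrier A" "f \<notin> P"
  obtains m where "P \<subseteq> m" "field_ideal A m" "f \<notin> m"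
    "m = P \<Longrightarrow> \<forall>b \<in> carrier (A Quot P). ring.algebraic (A Quot P) ((+>\<^bsub>A\<^esub>) P ` scalars K A) b"
proof -
  interpret A: assoc_algebra K A by fact
  interpret P: ideal P A by fact
  interpret D: domain "A Quot P" by fact
  let ?\<pi> = "(+>\<^bsub>A\<^esub>) P"
  interpret \<pi>: ring_hom_ring A "A Quot P" ?\<pi> by (rule P.rcos_ring_hom_ring)
  have nz: "\<one>\<^bsub>A\<^esub> \<noteq> \<zero>\<^bsub>A\<^esub>" using D.zero_not_one \<pi>.hom_one \<pi>.hom_zero by metis
  have sf: "subfield (?\<pi> ` scalars K A) (A Quot P)"
    by (intro \<pi>.img_is_subfield(2) scalars_subfield(1)[OF K A nz]) simp
  have sc: "scalars K A \<subseteq> carrier A" unfolding scalars_def by auto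
  have "generate_ring (A Quot P) (?\<pi> ` (scalars K A \<union> T)) = carrier (A Quot P)"
    using A.generate_ring_image[OF P.rcos_ring_hom D.ring_axioms, of "scalars K A \<union> T"] T sc P.quot_carrier by simp
  then have gen: "generate_ring (A Quot P) (?\<pi> ` scalars K A \<union> ?\<pi> ` T) = carrier (A Quot P)" by (simp add: image_Un)
  have f': "?\<pi> f \<in> carrier (A Quot P)" "?\<pi> f \<noteq> \<zero>\<^bsub>A Quot P\<^esub>" using f P.quot_zero_iff by auto
  obtain n where n: "field_ideal (A Quot P) n" "?\<pi> f \<notin> n"
    "n = {\<zero>\<^bsub>A Quot P\<^esub>} \<Longrightarrow> \<forall>b \<in> carrier (A Quot P). D.algebraic (?\<pi> ` scalars K A) b"
    by (rule D.nullstellensatz[OF sf _ _ gen f']) (use T that in auto)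
  have ni: "ideal n (A Quot P)" using n by (simp add: field_ideal_def)
  interpret n: ideal n "A Quot P" by fact
  define m where "m = {a \<in> carrier A. ?\<pi> a \<in> n}"
  have "ideal m A" unfolding m_def by (rule \<pi>.ideal_vimage[OF ni])
  moreover have "\<one>\<^bsub>A\<^esub> \<notin> m" using n unfolding m_def field_ideal_def by auto
  moreover have "\<exists>e \<in> carrier A. \<one>\<^bsub>A\<^esub> \<ominus>\<^bsub>A\<^esub> b \<otimes>\<^bsub>A\<^esub> e \<in> m" if b: "b \<in> carrier A - m" for b
  proof -
    have "?\<pi> b \<in> carrier (A Quot P) - n" using b unfolding m_def by auto
    then obtain e where "e \<in> carrier (A Quot P)" "\<one>\<^bsub>A Quot P\<^esub> \<ominus>\<^bsub>A Quot P\<^esub> ?\<pi> b \<otimes>\<^bsub>A Quot P\<^esub> e \<in> n"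
      using n unfolding field_ideal_def by blast
    moreover then obtain d where "d \<in> carrier A" "e = ?\<pi> d" unfolding P.quot_carrier by blast
    ultimately show ?thesis using b P.quot_minus[of "\<one>\<^bsub>A\<^esub>" "b \<otimes>\<^bsub>A\<^esub> d"] unfolding m_def
      by (intro bexI[of _ d]) auto
  qed
  ultimately have "field_ideal A m" unfolding field_ideal_def by blast
  moreover have "P \<subseteq> m" unfolding m_def using P.quot_zero_iff n.zero_closed P.Icarr by (metis (no_types, lifting) mem_Collect_eq subsetI)
  moreover have "f \<notin> m" using n(2) unfolding m_def by blast
  moreover have "n = {\<zero>\<^bsub>A Quot P\<^esub>}" if "m = P"
  proof -
    have "c = \<zero>\<^bsub>A Quot P\<^esub>" if c: "c \<in> n" for c
    proof -
      obtain a where a: "a \<in> carrier A" "c = ?\<pi> a" using n.Icarr[OF c] unfolding P.quot_carrier by blast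
      then have "a \<in> P" using c \<open>m = P\<close> unfolding m_def by blast
      then show ?thesis using a P.quot_zero_iff by blast
    qed
    then show ?thesis using n.zero_closed by blast
  qed
  ultimately show ?thesis using that n(3) by blast
qed

section \<open>Quotients of a differential operator ring by an extended prime\<close>

text \<open>
  Positive integers are invertible, as in an algebra over a field of characteristic zero.
\<close>

definition nat_units :: "('a, 'n) ring_scheme \<Rightarrow> bool" where
  "nat_units R \<longleftrightarrow> (\<forall>n::nat. n > 0 \<longrightarrow> (\<exists>c \<in> carrier R. c \<otimes>\<^bsub>R\<^esub> add_pow R n \<one>\<^bsub>R\<^esub> = \<one>\<^bsub>R\<^esub>))"

lemma (in cring) nat_mult_mem:
  assumes "nat_units R" "ideal I R" "r \<in> carrier R" "(n::nat) > 0" "add_pow R n r \<in> I"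
  shows "r \<in> I"
proof -
  interpret I: ideal I R by fact
  obtain c where c: "c \<in> carrier R" "c \<otimes> add_pow R n \<one> = \<one>" using assms unfolding nat_units_def by blast
  have "add_pow R n r = r \<otimes> add_pow R n \<one>" using add_pow_rdistr[OF assms(3) one_closed, of n] assms by simp
  moreover have "c \<otimes> add_pow R n r \<in> I" using assms c by (intro I.I_l_closed)
  moreover have "c \<otimes> (r \<otimes> add_pow R n \<one>) = r \<otimes> (c \<otimes> add_pow R n \<one>)"
    using assms c by (intro m_lcomm) auto
  ultimately show ?thesis using c assms by simp
qed

lemma (in ring) add_l_cancelD:
  "p \<oplus> q = p \<oplus> r \<Longrightarrow> p \<in> carrier R \<Longrightarrow> q \<in> carrier R \<Longrightarrow> r \<in> carrier R \<Longrightarrow> q = r"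
  by simp

lemma (in ring) add_r_cancelD:
  "q \<oplus> p = r \<oplus> p \<Longrightarrow> p \<in> carrier R \<Longrightarrow> q \<in> carrier R \<Longrightarrow> r \<in> carrier R \<Longrightarrow> q = r"
  by simp

context skew_pre
begin

lemma spanR_xpow: "u \<in> spanR m \<Longrightarrow> u \<otimes> x [^] (n::nat) \<in> spanR (m + n)"
proof (induction m arbitrary: u)
  case 0
  then show ?case using spanR_zero by simp
next
  case (Suc m)
  then obtain r y where 1: "r \<in> carrier R" "y \<in> spanR m" "u = \<iota> r \<otimes> x [^] m \<oplus> y" by auto
  have "u \<otimes> x [^] n = \<iota> r \<otimes> x [^] (m + n) \<oplus> y \<otimes> x [^] n"
    unfolding 1 using 1(1) spanR_closed[OF 1(2)] by (simp add: l_distr m_assoc nat_pow_mult)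
  then show ?case using Suc.IH[OF 1(2)] 1(1) poly_span_SucI[of "\<iota> r" "\<iota> ` carrier R" "y \<otimes> x [^] n" x "m + n"] by simp
qed

lemma spanR_rmult: "u \<in> spanR m \<Longrightarrow> r \<in> carrier R \<Longrightarrow> u \<otimes> \<iota> r \<in> spanR m"
proof -
  assume u: "u \<in> spanR m" and r: "r \<in> carrier R"
  have "u \<otimes> \<iota> r = (u \<otimes> \<iota> r \<ominus> \<iota> r \<otimes> u) \<oplus> \<iota> r \<otimes> u"
    using spanR_closed[OF u] r by (simp add: a_minus_def a_assoc l_neg)
  moreover have "u \<otimes> \<iota> r \<ominus> \<iota> r \<otimes> u \<in> spanR m"
    using commutator_drops_degree[OF r u] spanR_mono[of "m - 1" m] by auto
  ultimately show ?thesis using spanR_add spanR_lmult[OF r u] by metis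
qed

lemma lead_mult:
  assumes r: "r \<in> carrier R" and s: "s \<in> carrier R" and y: "y \<in> spanR m" and z: "z \<in> spanR n"
  shows "\<exists>w \<in> spanR (m + n). (\<iota> r \<otimes> x [^] m \<oplus> y) \<otimes> (\<iota> s \<otimes> x [^] n \<oplus> z) = \<iota> (r \<otimes>\<^bsub>R\<^esub> s) \<otimes> x [^] (m + n) \<oplus> w"
proof -
  obtain y' where y': "y' \<in> spanR m" "x [^] m \<otimes> \<iota> s = \<iota> s \<otimes> x [^] m \<oplus> y'" using pow_comm1[OF s] by blast
  have c: "y \<in> carrier A" "z \<in> carrier A" "y' \<in> carrier A" using y z y' by auto
  have "(\<iota> r \<otimes> x [^] m \<oplus> y) \<otimes> (\<iota> s \<otimes> x [^] n \<oplus> z) =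
     \<iota> r \<otimes> (x [^] m \<otimes> \<iota> s) \<otimes> x [^] n \<oplus> (\<iota> r \<otimes> (x [^] m \<otimes> z) \<oplus> ((y \<otimes> \<iota> s) \<otimes> x [^] n \<oplus> y \<otimes> z))"
    using r s c by (simp add: l_distr r_distr m_assoc a_ac)
  also have "\<iota> r \<otimes> (x [^] m \<otimes> \<iota> s) \<otimes> x [^] n = \<iota> (r \<otimes>\<^bsub>R\<^esub> s) \<otimes> x [^] (m + n) \<oplus> \<iota> r \<otimes> (y' \<otimes> x [^] n)"
    unfolding y'(2) using r s c by (simp add: l_distr r_distr m_assoc nat_pow_mult)
  finally have "(\<iota> r \<otimes> x [^] m \<oplus> y) \<otimes> (\<iota> s \<otimes> x [^] n \<oplus> z) = \<iota> (r \<otimes>\<^bsub>R\<^esub> s) \<otimes> x [^] (m + n) \<oplus>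
     (\<iota> r \<otimes> (y' \<otimes> x [^] n) \<oplus> (\<iota> r \<otimes> (x [^] m \<otimes> z) \<oplus> ((y \<otimes> \<iota> s) \<otimes> x [^] n \<oplus> y \<otimes> z)))"
    using r s c by (simp add: a_assoc)
  moreover have "\<iota> r \<otimes> (y' \<otimes> x [^] n) \<oplus> (\<iota> r \<otimes> (x [^] m \<otimes> z) \<oplus> ((y \<otimes> \<iota> s) \<otimes> x [^] n \<oplus> y \<otimes> z)) \<in> spanR (m + n)"
    using r s spanR_xpow[OF y'(1)] spanR_xpow[OF spanR_rmult[OF y s]] spanR_mult[OF z y]
      span_pow_mult[OF R.oneideal _ z, of m]
    by (intro spanR_add spanR_lmult) auto
  ultimately show ?thesis by blast
qed

end

text \<open>
  This describes \<open>A = R[x;\<delta>] / R[x;\<delta>] Q\<close>: the coefficients of an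
  element of \<open>A\<close> are determined modulo \<open>Q\<close>.
\<close>

locale skew_prime = skew_gen R A \<delta> \<iota> x
  for R :: "('a, 'n) ring_scheme" and A :: "('b, 'p) ring_scheme" (structure) and \<delta> \<iota> x +
  fixes Q
  assumes Q_prime: "primeideal Q R" and Q_delta: "\<delta> ` Q \<subseteq> Q"
    and ker: "r \<in> Q \<Longrightarrow> \<iota> r = \<zero>"
    and uniq: "r \<in> carrier R \<Longrightarrow> y \<in> spanR n \<Longrightarrow> \<iota> r \<otimes> x [^] n \<oplus> y = \<zero> \<Longrightarrow> r \<in> Q"
begin

sublocale Q: primeideal Q R by (rule Q_prime)

lemma ker_iff: "r \<in> carrier R \<Longrightarrow> \<iota> r = \<zero> \<longleftrightarrow> r \<in> Q"
  using uniq[of r \<zero> 0] ker by auto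

lemma Q_mult: "r \<in> carrier R \<Longrightarrow> s \<in> carrier R \<Longrightarrow> r \<notin> Q \<Longrightarrow> s \<notin> Q \<Longrightarrow> r \<otimes>\<^bsub>R\<^esub> s \<notin> Q"
  using Q.I_prime by blast

lemma one_notin: "\<one>\<^bsub>R\<^esub> \<notin> Q"
  using Q.I_notcarr Q.one_imp_carrier by blast

lemma span_lead:
  assumes "u \<in> spanR n" "u \<noteq> \<zero>"
  obtains m r y where "m < n" "r \<in> carrier R" "r \<notin> Q" "y \<in> spanR m" "u = \<iota> r \<otimes> x [^] m \<oplus> y"
  using assms
proof (induction n arbitrary: thesis)
  case 0
  then show ?case by simp
next
  case (Suc n)
  then obtain r y where 1: "r \<in> carrier R" "y \<in> spanR n" "u = \<iota> r \<otimes> x [^] n \<oplus> y" by auto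
  show ?case
  proof (cases "r \<in> Q")
    case True
    then have "u = y" using 1 spanR_closed[OF 1(2)] by (simp add: ker)
    then show ?thesis using Suc.IH[OF _ _ Suc.prems(3)] 1 Suc.prems(1) less_SucI by metis
  next
    case False
    then show ?thesis using Suc.prems(1)[of n r y] 1 by blast
  qed
qed

lemma elem_lead:
  assumes "u \<in> carrier A" "u \<noteq> \<zero>"
  obtains m r y where "r \<in> carrier R" "r \<notin> Q" "y \<in> spanR m" "u = \<iota> r \<otimes> x [^] m \<oplus> y"
proof -
  obtain n where "u \<in> spanR n" using assms gen by auto
  then show ?thesis using span_lead[OF _ assms(2)] that by metis
qed

text \<open>
  The leading coefficient of a product is the product of the leading coefficients, and
  \<open>Q\<close> is prime.
\<close>

lemma A_integral:
  assumes "u \<in> carrier A" "v \<in> carrier A" "u \<otimes> v = \<zero>"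
  shows "u = \<zero> \<or> v = \<zero>"
proof (rule ccontr)
  assume "\<not> ?thesis"
  then obtain m r y n s z where u: "r \<in> carrier R" "r \<notin> Q" "y \<in> spanR m" "u = \<iota> r \<otimes> x [^] m \<oplus> y"
    and v: "s \<in> carrier R" "s \<notin> Q" "z \<in> spanR n" "v = \<iota> s \<otimes> x [^] n \<oplus> z"
    using elem_lead[OF assms(1)] elem_lead[OF assms(2)] by metis
  obtain w where "w \<in> spanR (m + n)" "u \<otimes> v = \<iota> (r \<otimes>\<^bsub>R\<^esub> s) \<otimes> x [^] (m + n) \<oplus> w"
    using lead_mult[OF u(1) v(1) u(3) v(3)] unfolding u(4) v(4) by blast
  then have "r \<otimes>\<^bsub>R\<^esub> s \<in> Q" using uniq[of "r \<otimes>\<^bsub>R\<^esub> s" w "m + n"] assms(3) u v by simp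
  then show False using Q_mult u v by blast
qed

lemma A_one: "\<one> \<noteq> \<zero>"
  using ker_iff[of "\<one>\<^bsub>R\<^esub>"] one_notin by simp

text \<open>
  Left division with remainder; the leading coefficient of the divisor need not be a unit, so
  the dividend is first multiplied by a nonzero element.
\<close>

lemma A_division:
  assumes t: "t \<in> carrier R" "t \<notin> Q" and z: "z \<in> spanR d" and a: "a \<in> spanR m"
  shows "\<exists>u \<in> carrier A. u \<noteq> \<zero> \<and> (\<exists>q \<in> carrier A. u \<otimes> a \<ominus> q \<otimes> (\<iota> t \<otimes> x [^] d \<oplus> z) \<in> spanR d)"
  using a
proof (induction m arbitrary: a)
  case 0
  have "\<one> \<otimes> a \<ominus> \<zero> \<otimes> (\<iota> t \<otimes> x [^] d \<oplus> z) = \<zero>" using 0 t spanR_closed[OF z] by (simp add: a_minus_def)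
  then show ?case using A_one spanR_zero by (metis one_closed zero_closed)
next
  case (Suc m)
  let ?b = "\<iota> t \<otimes> x [^] d \<oplus> z"
  have ac: "a \<in> carrier A" "z \<in> carrier A" using Suc.prems z by blast+
  show ?case
  proof (cases "m < d")
    case True
    have "a \<in> spanR d" by (rule subsetD[OF spanR_mono[OF Suc_leI[OF True]] Suc.prems])
    moreover have "\<one> \<otimes> a \<ominus> \<zero> \<otimes> ?b = a" using ac t by (simp add: a_minus_def)
    ultimately show ?thesis using A_one by (metis one_closed zero_closed)
  next
    case False
    obtain r a' where 1: "r \<in> carrier R" "a' \<in> spanR m" "a = \<iota> r \<otimes> x [^] m \<oplus> a'" using Suc.prems by auto
    define k where "k = m - d"
    have k: "k + d = m" using False k_def by simp
    obtain y where y: "y \<in> spanR k" "x [^] k \<otimes> \<iota> t = \<iota> t \<otimes> x [^] k \<oplus> y" using pow_comm1[OF t(1)] by blast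
    have c: "a' \<in> carrier A" "y \<in> carrier A" using 1(2) y(1) by blast+
    have xm: "x [^] m = x [^] k \<otimes> x [^] d" using k by (simp add: nat_pow_mult)
    define v where "v = \<iota> t \<otimes> a' \<ominus> \<iota> r \<otimes> (y \<otimes> x [^] d \<oplus> x [^] k \<otimes> z)"
    have v: "v \<in> spanR m" unfolding v_def
      using t(1) 1 spanR_xpow[OF y(1), of d] span_pow_mult[OF R.oneideal _ z, of k] k
      by (intro spanR_minus spanR_lmult spanR_add) auto
    have tr: "\<iota> t \<otimes> \<iota> r = \<iota> r \<otimes> \<iota> t" using t 1(1) by (simp add: R.m_comm flip: \<iota>.hom_mult)
    have "\<iota> r \<otimes> x [^] k \<otimes> ?b = \<iota> r \<otimes> (x [^] k \<otimes> \<iota> t) \<otimes> x [^] d \<oplus> \<iota> r \<otimes> (x [^] k \<otimes> z)"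
      using 1(1) t(1) c ac by (simp add: r_distr m_assoc)
    also have "\<dots> = \<iota> r \<otimes> \<iota> t \<otimes> x [^] m \<oplus> \<iota> r \<otimes> (y \<otimes> x [^] d \<oplus> x [^] k \<otimes> z)"
      unfolding y(2) xm using 1(1) t(1) c ac by (simp add: r_distr l_distr m_assoc a_assoc)
    finally have e1: "\<iota> r \<otimes> x [^] k \<otimes> ?b = \<iota> t \<otimes> \<iota> r \<otimes> x [^] m \<oplus> \<iota> r \<otimes> (y \<otimes> x [^] d \<oplus> x [^] k \<otimes> z)" unfolding tr .
    have v_eq: "v = \<iota> t \<otimes> a \<ominus> \<iota> r \<otimes> x [^] k \<otimes> ?b"
      unfolding e1 v_def 1(3) using 1(1) t(1) c ac
      by (simp add: r_distr m_assoc a_minus_def minus_add a_ac r_neg r_neg1 r_neg2)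
    obtain u q where u: "u \<in> carrier A" "u \<noteq> \<zero>" "q \<in> carrier A" "u \<otimes> v \<ominus> q \<otimes> ?b \<in> spanR d" using Suc.IH[OF v] by blast
    have "u \<otimes> v \<ominus> q \<otimes> ?b = u \<otimes> \<iota> t \<otimes> a \<ominus> (u \<otimes> (\<iota> r \<otimes> x [^] k) \<oplus> q) \<otimes> ?b"
    proof -
      have b: "?b \<in> carrier A" "\<iota> r \<otimes> x [^] k \<in> carrier A" "\<iota> t \<in> carrier A" using t 1 ac by auto
      show ?thesis unfolding v_eq using b u ac by algebra
    qed
    moreover have "u \<otimes> \<iota> t \<noteq> \<zero>" using A_integral[of u "\<iota> t"] u t ker_iff by auto
    moreover have "u \<otimes> \<iota> t \<in> carrier A" "u \<otimes> (\<iota> r \<otimes> x [^] k) \<oplus> q \<in> carrier A" using u t 1(1) by auto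
    ultimately show ?thesis using u(4) by metis
  qed
qed

text \<open>
  The Euclidean algorithm: dividing \<open>a\<close> by \<open>b\<close> leaves a remainder
  \<open>r\<close> of smaller degree than \<open>b\<close>, and a common left multiple of
  \<open>b\<close> and \<open>r\<close> yields one of \<open>a\<close> and \<open>b\<close>.
\<close>

lemma A_ore:
  "b \<in> spanR n \<Longrightarrow> b \<noteq> \<zero> \<Longrightarrow> a \<in> carrier A \<Longrightarrow> \<exists>u \<in> carrier A. \<exists>v \<in> carrier A. u \<noteq> \<zero> \<and> u \<otimes> a = v \<otimes> b"
proof (induction n arbitrary: a b rule: less_induct)
  case (less n)
  obtain d t z where b: "d < n" "t \<in> carrier R" "t \<notin> Q" "z \<in> spanR d" "b = \<iota> t \<otimes> x [^] d \<oplus> z"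
    using span_lead[OF less.prems(1,2)] by metis
  have bc: "b \<in> carrier A" using less.prems by blast
  obtain m where "a \<in> spanR m" using less.prems gen by blast
  then obtain u q where u: "u \<in> carrier A" "u \<noteq> \<zero>" "q \<in> carrier A" "u \<otimes> a \<ominus> q \<otimes> b \<in> spanR d"
    using A_division[OF b(2-4)] unfolding b(5) by blast
  define r where "r = u \<otimes> a \<ominus> q \<otimes> b"
  have rc: "r \<in> carrier A" using u less.prems bc unfolding r_def by auto
  have add_diff: "p = t \<oplus> (p \<ominus> t)" if "p \<in> carrier A" "t \<in> carrier A" for p t
    using that by algebra
  have ua: "u \<otimes> a = q \<otimes> b \<oplus> r" unfolding r_def using u less.prems bc by (intro add_diff) auto
  show ?case
  proof (cases "r = \<zero>")
    case True
    then show ?thesis using ua u bc by auto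
  next
    case False
    obtain u' v' where w: "u' \<in> carrier A" "v' \<in> carrier A" "u' \<noteq> \<zero>" "u' \<otimes> b = v' \<otimes> r"
      using less.IH[OF b(1) _ False bc] u(4) unfolding r_def by blast
    have "v' \<noteq> \<zero>" using w A_integral[OF w(1) bc] less.prems rc by auto
    then have "v' \<otimes> u \<noteq> \<zero>" using A_integral w u by blast
    moreover have "v' \<otimes> u \<otimes> a = (v' \<otimes> q \<oplus> u') \<otimes> b"
      using w u bc rc less.prems by (simp add: m_assoc ua r_distr l_distr)
    ultimately show ?thesis using w u by (metis a_closed m_closed)
  qed
qed

sublocale A: ore_domain A
proof
  show "\<one> \<noteq> \<zero>" by (rule A_one)
  show "\<exists>u \<in> carrier A. \<exists>v \<in> carrier A. u \<noteq> \<zero> \<and> u \<otimes> a = v \<otimes> b" if "a \<in> carrier A" "b \<in> carrier A" "b \<noteq> \<zero>" for a b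
    using A_ore that gen by blast
qed (use A_integral in blast)

context
  fixes b0
  assumes nat: "nat_units R" and b0: "b0 \<in> carrier R" "\<delta> b0 \<notin> Q"
begin

text \<open>
  By \<open>commutator_lead\<close> the new leading coefficient is a product of elements outside
  the prime \<open>Q\<close>.
\<close>

lemma commutator_nonzero:
  assumes r: "r \<in> carrier R" "r \<notin> Q" and y: "y \<in> spanR (Suc n)"
  shows "(\<iota> r \<otimes> x [^] Suc n \<oplus> y) \<otimes> \<iota> b0 \<ominus> \<iota> b0 \<otimes> (\<iota> r \<otimes> x [^] Suc n \<oplus> y) \<in> spanR (Suc n)" (is "?c \<in> _")
    and "(\<iota> r \<otimes> x [^] Suc n \<oplus> y) \<otimes> \<iota> b0 \<ominus> \<iota> b0 \<otimes> (\<iota> r \<otimes> x [^] Suc n \<oplus> y) \<noteq> \<zero>"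
proof -
  let ?s = "r \<otimes>\<^bsub>R\<^esub> (add_pow R (Suc n) (\<delta> b0))"
  obtain z where z: "z \<in> spanR n" "?c = \<iota> ?s \<otimes> x [^] n \<oplus> z"
    using commutator_lead[OF b0(1) r(1) y] by blast
  have d: "add_pow R (Suc n) (\<delta> b0) \<in> carrier R" using b0 by (intro R.add.nat_pow_closed d_closed)
  have s: "?s \<in> carrier R" using r d by blast
  show "?c \<in> spanR (Suc n)" unfolding z(2) using z(1) s by (intro poly_span_SucI) auto
  have "add_pow R (Suc n) (\<delta> b0) \<notin> Q" using R.nat_mult_mem[OF nat Q.is_ideal, of "\<delta> b0" "Suc n"] b0 by blast
  then have "?s \<notin> Q" using Q_mult r d by blast
  then show "?c \<noteq> \<zero>" unfolding z(2) using uniq[OF s z(1)] by blast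
qed

text \<open>
  Commutators with \<open>b0\<close> stay in the ideal, lower the degree and do not vanish,
  until the degree is zero.
\<close>

lemma ideal_meets_R:
  assumes J: "ideal J A" and u: "u \<in> J" "u \<noteq> \<zero>"
  shows "\<exists>r \<in> carrier R. r \<notin> Q \<and> \<iota> r \<in> J"
proof -
  interpret J: ideal J A by fact
  have "\<exists>r \<in> carrier R. r \<notin> Q \<and> \<iota> r \<in> J" if "u \<in> spanR n" "u \<in> J" "u \<noteq> \<zero>" for n u
    using that
  proof (induction n arbitrary: u rule: less_induct)
    case (less n)
    obtain m r y where 1: "m < n" "r \<in> carrier R" "r \<notin> Q" "y \<in> spanR m" "u = \<iota> r \<otimes> x [^] m \<oplus> y"
      using span_lead[OF less.prems(1,3)] by metis
    show ?case
    proof (cases m)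
      case 0
      then have "u = \<iota> r" using 1 by simp
      then show ?thesis using 1 less.prems by blast
    next
      case (Suc k)
      let ?c = "u \<otimes> \<iota> b0 \<ominus> \<iota> b0 \<otimes> u"
      have "?c \<in> J" unfolding a_minus_def using less.prems b0
        by (intro J.a_closed J.a_inv_closed J.I_l_closed J.I_r_closed) auto
      moreover have "?c \<in> spanR m" "?c \<noteq> \<zero>" using commutator_nonzero[OF 1(2,3), of y k] 1 Suc by auto
      ultimately show ?thesis using less.IH[OF 1(1)] by blast
    qed
  qed
  then show ?thesis using u J.Icarr gen by blast
qed

lemma centralizer_of_R:
  assumes u: "u \<in> carrier A" and c: "\<And>r. r \<in> carrier R \<Longrightarrow> u \<otimes> \<iota> r = \<iota> r \<otimes> u"
  shows "u \<in> \<iota> ` carrier R"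
proof (cases "u = \<zero>")
  case True
  then show ?thesis by (metis R.zero_closed \<iota>.hom_zero imageI)
next
  case False
  obtain m r y where 1: "r \<in> carrier R" "r \<notin> Q" "y \<in> spanR m" "u = \<iota> r \<otimes> x [^] m \<oplus> y"
    using elem_lead[OF u False] by metis
  show ?thesis
  proof (cases m)
    case 0
    then show ?thesis using 1 by simp
  next
    case (Suc k)
    have "u \<otimes> \<iota> b0 \<ominus> \<iota> b0 \<otimes> u = \<zero>" using c[OF b0(1)] u b0 by simp
    then show ?thesis using commutator_nonzero(2)[OF 1(1,2), of y k] 1 Suc by auto
  qed
qed

text \<open>
  The elements \<open>s\<close> of \<open>A\<close> with \<open>s z \<in> A\<close> form an
  ideal because \<open>z\<close> is central. It is nonzero, so it contains some \<open>s \<in>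
  R\<close> outside \<open>Q\<close>. Then \<open>a = s z\<close> commutes with
  \<open>R\<close>, hence lies in \<open>R\<close>, and \<open>x z = z x\<close> says that the
  quotient rule gives zero for \<open>z = s\<^sup>-\<^sup>1 a\<close>.
\<close>

lemma centre_is_constant:
  assumes z: "z \<in> ring_centre A.F"
  obtains s a where "s \<in> carrier R" "s \<notin> Q" "a \<in> carrier R" "z = A.lf (\<iota> s) (\<iota> a)"
    "s \<otimes>\<^bsub>R\<^esub> \<delta> a \<ominus>\<^bsub>R\<^esub> \<delta> s \<otimes>\<^bsub>R\<^esub> a \<in> Q"
proof -
  have zc: "z \<in> carrier A.F" and zcomm: "\<And>q. q \<in> carrier A.F \<Longrightarrow> z \<otimes>\<^bsub>A.F\<^esub> q = q \<otimes>\<^bsub>A.F\<^esub> z"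
    using z unfolding ring_centre_def by blast+
  define I where "I = {s \<in> carrier A. \<exists>c \<in> carrier A. A.emb s \<otimes>\<^bsub>A.F\<^esub> z = A.emb c}"
  have "ideal I A"
  proof (rule idealI[OF A.ring_axioms])
    show "subgroup I (add_monoid A)"
    proof (rule A.add.subgroupI)
      show "I \<subseteq> carrier A" unfolding I_def by blast
      have "\<zero> \<in> I" unfolding I_def using zc by (auto intro!: bexI[of _ \<zero>] simp: A.lf_zero)
      then show "I \<noteq> {}" by blast
      fix s assume "s \<in> I"
      then obtain c where c: "s \<in> carrier A" "c \<in> carrier A" "A.emb s \<otimes>\<^bsub>A.F\<^esub> z = A.emb c" unfolding I_def by blast
      have "A.emb (\<ominus> s) \<otimes>\<^bsub>A.F\<^esub> z = A.emb (\<ominus> c)" using c zc by (simp add: A.F.l_minus)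
      then show "\<ominus> s \<in> I" unfolding I_def using c by blast
      fix t assume "t \<in> I"
      then obtain d where d: "t \<in> carrier A" "d \<in> carrier A" "A.emb t \<otimes>\<^bsub>A.F\<^esub> z = A.emb d" unfolding I_def by blast
      have "A.emb (s \<oplus> t) \<otimes>\<^bsub>A.F\<^esub> z = A.emb (c \<oplus> d)" using c d zc by (simp add: A.F.l_distr)
      then show "s \<oplus> t \<in> I" unfolding I_def using c d by blast
    qed
    fix s t assume "s \<in> I" and t: "t \<in> carrier A"
    then obtain c where c: "s \<in> carrier A" "c \<in> carrier A" "A.emb s \<otimes>\<^bsub>A.F\<^esub> z = A.emb c" unfolding I_def by blast
    have "A.emb (t \<otimes> s) \<otimes>\<^bsub>A.F\<^esub> z = A.emb (t \<otimes> c)" using c t zc by (simp add: A.F.m_assoc)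
    then show "t \<otimes> s \<in> I" unfolding I_def using c t by blast
    have "A.emb (s \<otimes> t) \<otimes>\<^bsub>A.F\<^esub> z = A.emb s \<otimes>\<^bsub>A.F\<^esub> (z \<otimes>\<^bsub>A.F\<^esub> A.emb t)"
      using c t zc zcomm[of "A.emb t"] by (simp add: A.F.m_assoc)
    also have "\<dots> = A.emb (c \<otimes> t)" using c t zc by (simp flip: A.F.m_assoc)
    finally show "s \<otimes> t \<in> I" unfolding I_def using c t by blast
  qed
  moreover obtain s0 a0 where "s0 \<in> carrier A" "s0 \<noteq> \<zero>" "a0 \<in> carrier A" "z = A.lf s0 a0" using A.F_cases[OF zc] by metis
  moreover from this have "s0 \<in> I" unfolding I_def using A.emb_lf by blast
  ultimately obtain s where s: "s \<in> carrier R" "s \<notin> Q" "\<iota> s \<in> I" using ideal_meets_R by blast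
  obtain c where c: "c \<in> carrier A" "A.emb (\<iota> s) \<otimes>\<^bsub>A.F\<^esub> z = A.emb c" using s unfolding I_def by blast
  have is0: "\<iota> s \<noteq> \<zero>" "\<iota> s \<in> carrier A" using ker_iff s by auto
  have "c \<otimes> \<iota> b = \<iota> b \<otimes> c" if b: "b \<in> carrier R" for b
  proof -
    have sb: "\<iota> s \<otimes> \<iota> b = \<iota> b \<otimes> \<iota> s" using s b by (simp add: R.m_comm flip: \<iota>.hom_mult)
    have "A.emb (c \<otimes> \<iota> b) = A.emb (\<iota> s) \<otimes>\<^bsub>A.F\<^esub> (z \<otimes>\<^bsub>A.F\<^esub> A.emb (\<iota> b))"
      using c b s zc by (simp flip: A.F.m_assoc)
    also have "\<dots> = A.emb (\<iota> s \<otimes> \<iota> b) \<otimes>\<^bsub>A.F\<^esub> z" using zcomm[of "A.emb (\<iota> b)"] b s zc by (simp add: A.F.m_assoc)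
    also have "\<dots> = A.emb (\<iota> b \<otimes> c)" unfolding sb using b s zc c by (simp add: A.F.m_assoc)
    finally show ?thesis using inj_onD[OF A.emb_inj] b c by simp
  qed
  then obtain a where a: "a \<in> carrier R" "c = \<iota> a" using centralizer_of_R[OF c(1)] by blast
  have za: "A.emb (\<iota> s) \<otimes>\<^bsub>A.F\<^esub> z = A.emb (\<iota> a)" using c a by simp
  have "z = A.lf (\<iota> s) (\<iota> a)"
    by (rule A.F_lcancel[of "A.emb (\<iota> s)"]) (use za zc is0 a A.emb_zero_iff A.emb_lf in \<open>simp_all\<close>)
  moreover have "s \<otimes>\<^bsub>R\<^esub> \<delta> a \<ominus>\<^bsub>R\<^esub> \<delta> s \<otimes>\<^bsub>R\<^esub> a \<in> Q"
  proof -
    have cl: "A.emb (\<iota> (\<delta> s)) \<in> carrier A.F" "A.emb (\<iota> (\<delta> a)) \<in> carrier A.F" "A.emb (\<iota> a \<otimes> x) \<in> carrier A.F"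
      using s a by auto
    have "A.emb (\<iota> a \<otimes> x) \<oplus>\<^bsub>A.F\<^esub> A.emb (\<iota> (\<delta> a)) = A.emb (x \<otimes> \<iota> a)" using a s by (simp add: x_comm)
    also have "\<dots> = A.emb (x \<otimes> \<iota> s) \<otimes>\<^bsub>A.F\<^esub> z" using a s zc by (simp add: A.F.m_assoc za)
    also have "\<dots> = A.emb (\<iota> s) \<otimes>\<^bsub>A.F\<^esub> (A.emb x \<otimes>\<^bsub>A.F\<^esub> z) \<oplus>\<^bsub>A.F\<^esub> A.emb (\<iota> (\<delta> s)) \<otimes>\<^bsub>A.F\<^esub> z"
      using s zc by (simp add: x_comm A.F.l_distr A.F.m_assoc)
    also have "A.emb (\<iota> s) \<otimes>\<^bsub>A.F\<^esub> (A.emb x \<otimes>\<^bsub>A.F\<^esub> z) = A.emb (\<iota> a \<otimes> x)"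
      using zcomm[of "A.emb x", symmetric] s a zc by (simp add: za flip: A.F.m_assoc)
    finally have "A.emb (\<iota> (\<delta> a)) = A.emb (\<iota> (\<delta> s)) \<otimes>\<^bsub>A.F\<^esub> z"
      by (rule A.F.add_l_cancelD) (use cl zc in \<open>simp_all only: A.F.m_closed\<close>)
    then have "A.emb (\<iota> s) \<otimes>\<^bsub>A.F\<^esub> A.emb (\<iota> (\<delta> a)) = A.emb (\<iota> s \<otimes> \<iota> (\<delta> s)) \<otimes>\<^bsub>A.F\<^esub> z"
      using s zc by (simp add: A.F.m_assoc)
    also have "\<iota> s \<otimes> \<iota> (\<delta> s) = \<iota> (\<delta> s) \<otimes> \<iota> s" using s by (simp add: R.m_comm flip: \<iota>.hom_mult)
    also have "A.emb \<dots> \<otimes>\<^bsub>A.F\<^esub> z = A.emb (\<iota> (\<delta> s) \<otimes> \<iota> a)" using s a zc by (simp add: A.F.m_assoc za)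
    finally have "A.emb (\<iota> (s \<otimes>\<^bsub>R\<^esub> \<delta> a)) = A.emb (\<iota> (\<delta> s \<otimes>\<^bsub>R\<^esub> a))" using s a by simp
    then have "\<iota> (s \<otimes>\<^bsub>R\<^esub> \<delta> a) = \<iota> (\<delta> s \<otimes>\<^bsub>R\<^esub> a)" using inj_onD[OF A.emb_inj] s a by simp
    then have "\<iota> (s \<otimes>\<^bsub>R\<^esub> \<delta> a \<ominus>\<^bsub>R\<^esub> \<delta> s \<otimes>\<^bsub>R\<^esub> a) = \<zero>" using s a by (simp add: a_minus_def R.minus_eq r_neg del: \<iota>.hom_mult)
    then show ?thesis using ker_iff s a by simp
  qed
  ultimately show ?thesis using that s a by blast
qed

end

text \<open>
  A fraction of elements of \<open>R\<close> commutes with \<open>R\<close>; the vanishing of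
  its derivative is what makes it commute with \<open>x\<close>.
\<close>

lemma constant_is_central:
  assumes s: "s \<in> carrier R" "s \<notin> Q" and a: "a \<in> carrier R" and q: "s \<otimes>\<^bsub>R\<^esub> \<delta> a \<ominus>\<^bsub>R\<^esub> \<delta> s \<otimes>\<^bsub>R\<^esub> a \<in> Q"
  shows "A.lf (\<iota> s) (\<iota> a) \<in> ring_centre A.F"
proof (rule A.centralI)
  let ?z = "A.lf (\<iota> s) (\<iota> a)"
  have is0: "\<iota> s \<noteq> \<zero>" "\<iota> s \<in> carrier A" using ker_iff s by auto
  show zc: "?z \<in> carrier A.F" using is0 a by auto
  have za: "A.emb (\<iota> s) \<otimes>\<^bsub>A.F\<^esub> ?z = A.emb (\<iota> a)" using A.emb_lf is0 a by simp
  have cancel: "p = q" if "p \<in> carrier A.F" "q \<in> carrier A.F" "A.emb (\<iota> s) \<otimes>\<^bsub>A.F\<^esub> p = A.emb (\<iota> s) \<otimes>\<^bsub>A.F\<^esub> q" for p q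
    by (rule A.F_lcancel[of "A.emb (\<iota> s)"]) (use that is0 A.emb_zero_iff in simp_all)
  have R_comm: "\<iota> r \<otimes> \<iota> r' = \<iota> r' \<otimes> \<iota> r" if "r \<in> carrier R" "r' \<in> carrier R" for r r'
    using that by (simp add: R.m_comm flip: \<iota>.hom_mult)
  have zr: "?z \<otimes>\<^bsub>A.F\<^esub> A.emb (\<iota> r) = A.emb (\<iota> r) \<otimes>\<^bsub>A.F\<^esub> ?z" if r: "r \<in> carrier R" for r
  proof (rule cancel)
    have "A.emb (\<iota> s) \<otimes>\<^bsub>A.F\<^esub> (?z \<otimes>\<^bsub>A.F\<^esub> A.emb (\<iota> r)) = A.emb (\<iota> a \<otimes> \<iota> r)"
      using zc s a r by (simp add: za flip: A.F.m_assoc)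
    also have "\<dots> = A.emb (\<iota> r \<otimes> \<iota> s) \<otimes>\<^bsub>A.F\<^esub> ?z" using zc s a r by (simp add: R_comm[OF a r] za A.F.m_assoc)
    also have "\<dots> = A.emb (\<iota> s) \<otimes>\<^bsub>A.F\<^esub> (A.emb (\<iota> r) \<otimes>\<^bsub>A.F\<^esub> ?z)"
      using zc s a r by (simp add: R_comm[OF r s(1)] A.F.m_assoc)
    finally show "A.emb (\<iota> s) \<otimes>\<^bsub>A.F\<^esub> (?z \<otimes>\<^bsub>A.F\<^esub> A.emb (\<iota> r)) = A.emb (\<iota> s) \<otimes>\<^bsub>A.F\<^esub> (A.emb (\<iota> r) \<otimes>\<^bsub>A.F\<^esub> ?z)" .
  qed (use zc r in auto)
  have ds: "A.emb (\<iota> (\<delta> a)) = A.emb (\<iota> (\<delta> s)) \<otimes>\<^bsub>A.F\<^esub> ?z"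
  proof (rule cancel)
    have "\<iota> (s \<otimes>\<^bsub>R\<^esub> \<delta> a \<ominus>\<^bsub>R\<^esub> \<delta> s \<otimes>\<^bsub>R\<^esub> a) = \<zero>" using q by (rule ker)
    then have "\<iota> s \<otimes> \<iota> (\<delta> a) \<ominus> \<iota> (\<delta> s) \<otimes> \<iota> a = \<zero>" using s a by (simp add: a_minus_def R.minus_eq)
    then have e: "\<iota> s \<otimes> \<iota> (\<delta> a) = \<iota> (\<delta> s) \<otimes> \<iota> a" using s a by simp
    have "A.emb (\<iota> s) \<otimes>\<^bsub>A.F\<^esub> A.emb (\<iota> (\<delta> a)) = A.emb (\<iota> (\<delta> s) \<otimes> \<iota> a)" using s a by (simp flip: e)
    also have "\<dots> = A.emb (\<iota> (\<delta> s) \<otimes> \<iota> s) \<otimes>\<^bsub>A.F\<^esub> ?z" using s a zc by (simp add: za A.F.m_assoc)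
    also have "\<dots> = A.emb (\<iota> s) \<otimes>\<^bsub>A.F\<^esub> (A.emb (\<iota> (\<delta> s)) \<otimes>\<^bsub>A.F\<^esub> ?z)"
      using s zc by (simp add: R_comm[of "\<delta> s" s] A.F.m_assoc)
    finally show "A.emb (\<iota> s) \<otimes>\<^bsub>A.F\<^esub> A.emb (\<iota> (\<delta> a)) = A.emb (\<iota> s) \<otimes>\<^bsub>A.F\<^esub> (A.emb (\<iota> (\<delta> s)) \<otimes>\<^bsub>A.F\<^esub> ?z)" .
  qed (use zc s a in auto)
  have zx: "?z \<otimes>\<^bsub>A.F\<^esub> A.emb x = A.emb x \<otimes>\<^bsub>A.F\<^esub> ?z"
  proof (rule cancel)
    have "A.emb (\<iota> s) \<otimes>\<^bsub>A.F\<^esub> (A.emb x \<otimes>\<^bsub>A.F\<^esub> ?z) \<oplus>\<^bsub>A.F\<^esub> A.emb (\<iota> (\<delta> s)) \<otimes>\<^bsub>A.F\<^esub> ?z = A.emb (x \<otimes> \<iota> s) \<otimes>\<^bsub>A.F\<^esub> ?z"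
      using s zc by (simp add: x_comm A.F.l_distr A.F.m_assoc)
    also have "\<dots> = A.emb (x \<otimes> \<iota> a)" using s a zc by (simp add: A.F.m_assoc za)
    also have "\<dots> = A.emb (\<iota> a) \<otimes>\<^bsub>A.F\<^esub> A.emb x \<oplus>\<^bsub>A.F\<^esub> A.emb (\<iota> (\<delta> s)) \<otimes>\<^bsub>A.F\<^esub> ?z" using a by (simp add: x_comm ds)
    finally have "A.emb (\<iota> s) \<otimes>\<^bsub>A.F\<^esub> (A.emb x \<otimes>\<^bsub>A.F\<^esub> ?z) = A.emb (\<iota> a) \<otimes>\<^bsub>A.F\<^esub> A.emb x"
      by (rule A.F.add_r_cancelD) (use s a zc in simp_all)
    also have "\<dots> = A.emb (\<iota> s) \<otimes>\<^bsub>A.F\<^esub> (?z \<otimes>\<^bsub>A.F\<^esub> A.emb x)" using zc s by (simp add: za flip: A.F.m_assoc)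
    finally show "A.emb (\<iota> s) \<otimes>\<^bsub>A.F\<^esub> (?z \<otimes>\<^bsub>A.F\<^esub> A.emb x) = A.emb (\<iota> s) \<otimes>\<^bsub>A.F\<^esub> (A.emb x \<otimes>\<^bsub>A.F\<^esub> ?z)" by simp
  qed (use zc in auto)
  have zxn: "?z \<otimes>\<^bsub>A.F\<^esub> A.emb (x [^] (n::nat)) = A.emb (x [^] n) \<otimes>\<^bsub>A.F\<^esub> ?z" for n
  proof (induction n)
    case 0
    then show ?case using zc by (simp flip: A.one_F)
  next
    case (Suc n)
    have "?z \<otimes>\<^bsub>A.F\<^esub> A.emb (x [^] Suc n) = (?z \<otimes>\<^bsub>A.F\<^esub> A.emb (x [^] n)) \<otimes>\<^bsub>A.F\<^esub> A.emb x" using zc by (simp add: A.F.m_assoc)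
    also have "\<dots> = A.emb (x [^] n) \<otimes>\<^bsub>A.F\<^esub> (?z \<otimes>\<^bsub>A.F\<^esub> A.emb x)" unfolding Suc using zc by (intro A.F.m_assoc) auto
    also have "\<dots> = A.emb (x [^] Suc n) \<otimes>\<^bsub>A.F\<^esub> ?z" unfolding zx using zc by (simp add: A.F.m_assoc)
    finally show ?case .
  qed
  have "?z \<otimes>\<^bsub>A.F\<^esub> A.emb b = A.emb b \<otimes>\<^bsub>A.F\<^esub> ?z" if "b \<in> spanR n" for b n
    using that
  proof (induction n arbitrary: b)
    case 0
    then show ?case using zc by (simp add: A.lf_zero)
  next
    case (Suc n)
    then obtain r y where 1: "r \<in> carrier R" "y \<in> spanR n" "b = \<iota> r \<otimes> x [^] n \<oplus> y" by auto
    have yc: "y \<in> carrier A" using 1 by blast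
    have "?z \<otimes>\<^bsub>A.F\<^esub> A.emb b = (?z \<otimes>\<^bsub>A.F\<^esub> A.emb (\<iota> r)) \<otimes>\<^bsub>A.F\<^esub> A.emb (x [^] n) \<oplus>\<^bsub>A.F\<^esub> ?z \<otimes>\<^bsub>A.F\<^esub> A.emb y"
      unfolding 1 using zc 1(1) yc by (simp add: A.F.r_distr A.F.m_assoc)
    also have "\<dots> = A.emb (\<iota> r) \<otimes>\<^bsub>A.F\<^esub> (?z \<otimes>\<^bsub>A.F\<^esub> A.emb (x [^] n)) \<oplus>\<^bsub>A.F\<^esub> A.emb y \<otimes>\<^bsub>A.F\<^esub> ?z"
      unfolding zr[OF 1(1)] Suc.IH[OF 1(2)] using zc 1(1) yc by (simp add: A.F.m_assoc)
    also have "\<dots> = A.emb b \<otimes>\<^bsub>A.F\<^esub> ?z"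
      unfolding zxn 1(3) using zc 1(1) yc by (simp add: A.F.l_distr A.F.m_assoc)
    finally show ?case .
  qed
  then show "?z \<otimes>\<^bsub>A.F\<^esub> A.emb b = A.emb b \<otimes>\<^bsub>A.F\<^esub> ?z" if "b \<in> carrier A" for b using that gen by blast
qed

end

section \<open>The centre of the fractions and the field of constants\<close>

text \<open>
  If \<open>a / s = b / t\<close>, the numerators of the two derivatives given by the quotient
  rule vanish simultaneously.
\<close>

lemma (in domain) wronskian_invariant:
  assumes d: "\<And>a. a \<in> carrier R \<Longrightarrow> d a \<in> carrier R"
    and leib: "\<And>a b. a \<in> carrier R \<Longrightarrow> b \<in> carrier R \<Longrightarrow> d (a \<otimes> b) = a \<otimes> d b \<oplus> d a \<otimes> b"
    and s: "s \<in> carrier R" "s \<noteq> \<zero>" "a \<in> carrier R" and t: "t \<in> carrier R" "t \<noteq> \<zero>" "b \<in> carrier R"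
    and eq: "s \<otimes> b = t \<otimes> a" and w: "s \<otimes> d a = d s \<otimes> a"
  shows "t \<otimes> d b = d t \<otimes> b"
proof -
  have c: "d s \<in> carrier R" "d a \<in> carrier R" "d t \<in> carrier R" "d b \<in> carrier R" using d s t by auto
  have e: "s \<otimes> d b \<oplus> d s \<otimes> b = t \<otimes> d a \<oplus> d t \<otimes> a" using leib[of s b] leib[of t a] eq s t by simp
  have "(s \<otimes> s) \<otimes> (t \<otimes> d b) = s \<otimes> t \<otimes> ((s \<otimes> d b \<oplus> d s \<otimes> b) \<ominus> d s \<otimes> b)" using c s t by algebra
  also have "\<dots> = t \<otimes> t \<otimes> (s \<otimes> d a) \<oplus> s \<otimes> d t \<otimes> (t \<otimes> a) \<ominus> t \<otimes> d s \<otimes> (s \<otimes> b)"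
    unfolding e using c s t by algebra
  also have "\<dots> = t \<otimes> t \<otimes> (d s \<otimes> a) \<oplus> s \<otimes> d t \<otimes> (s \<otimes> b) \<ominus> t \<otimes> d s \<otimes> (t \<otimes> a)"
    unfolding w eq ..
  also have "\<dots> = (s \<otimes> s) \<otimes> (d t \<otimes> b)" using c s t by algebra
  finally show ?thesis using m_lcancel[of "s \<otimes> s" "t \<otimes> d b" "d t \<otimes> b"] s t c integral[of s s] by auto
qed

context skew_prime
begin

abbreviation "B \<equiv> R Quot Q"
abbreviation "dB \<equiv> quot_derivation R Q \<delta>"

lemma Q_kernel: "Q = a_kernel R A \<iota>"
  unfolding a_kernel_def' using ker ker_iff Q.Icarr by blast

text \<open>
  The embedding of \<open>R / Q\<close> into \<open>A\<close> that \<open>\<iota>\<close>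
  induces.
\<close>

definition "j U = the_elem (\<iota> ` U)"

lemma j_coset [simp]: "r \<in> carrier R \<Longrightarrow> j (Q +>\<^bsub>R\<^esub> r) = \<iota> r"
  unfolding j_def using \<iota>.the_elem_simp[of r] unfolding Q_kernel[symmetric] by simp

sublocale B: domain B by (rule Q.quotient_is_domain)
sublocale BO: ore_domain B by (rule B.ore_domain)

sublocale J: ore_hom B A j
proof
  show "j \<in> ring_hom B A" using \<iota>.the_elem_hom unfolding Q_kernel[symmetric] j_def .
  show "inj_on j (carrier B)"
    by (rule inj_onI) (use \<iota>.the_elem_inj[folded Q_kernel] in \<open>auto simp: j_def\<close>)
qed

lemma B_cases:
  assumes "U \<in> carrier B" obtains r where "r \<in> carrier R" "U = Q +>\<^bsub>R\<^esub> r"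
  using assms unfolding Q.quot_carrier by blast

sublocale pQ: ring_hom_ring R B "(+>\<^bsub>R\<^esub>) Q" by (rule Q.rcos_ring_hom_ring)

lemma coset_zero_iff: "r \<in> carrier R \<Longrightarrow> Q +>\<^bsub>R\<^esub> r = \<zero>\<^bsub>B\<^esub> \<longleftrightarrow> r \<in> Q"
  by (rule Q.quot_zero_iff)

lemma coset_eq_iff: "r \<in> carrier R \<Longrightarrow> s \<in> carrier R \<Longrightarrow> Q +>\<^bsub>R\<^esub> r = Q +>\<^bsub>R\<^esub> s \<longleftrightarrow> r \<ominus>\<^bsub>R\<^esub> s \<in> Q"
  using coset_zero_iff[of "r \<ominus>\<^bsub>R\<^esub> s"] Q.quot_minus[of r s] B.r_right_minus_eq[of "Q +>\<^bsub>R\<^esub> r" "Q +>\<^bsub>R\<^esub> s"] by auto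

lemma dB_coset [simp]: "r \<in> carrier R \<Longrightarrow> dB (Q +>\<^bsub>R\<^esub> r) = Q +>\<^bsub>R\<^esub> \<delta> r"
proof -
  assume r: "r \<in> carrier R"
  have "Q +>\<^bsub>R\<^esub> \<delta> r' = Q +>\<^bsub>R\<^esub> \<delta> r" if r': "r' \<in> Q +>\<^bsub>R\<^esub> r" for r'
  proof -
    obtain q where q: "q \<in> Q" "r' = q \<oplus>\<^bsub>R\<^esub> r" using r' by (auto simp: a_r_coset_def r_coset_def)
    have "\<delta> q \<in> Q" using q Q_delta by blast
    moreover have "\<delta> r' \<ominus>\<^bsub>R\<^esub> \<delta> r = \<delta> q" unfolding q using q r Q.Icarr by (simp add: d_add a_minus_def R.minus_eq R.a_assoc R.r_neg)
    ultimately show ?thesis using coset_eq_iff[of "\<delta> r'" "\<delta> r"] q r Q.Icarr by simp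
  qed
  moreover have "r \<in> Q +>\<^bsub>R\<^esub> r" using Q.a_rcos_self[OF r] .
  ultimately show ?thesis unfolding quot_derivation_def by blast
qed

lemma dB_closed: "U \<in> carrier B \<Longrightarrow> dB U \<in> carrier B"
  by (elim B_cases) auto

lemma dB_mult: "U \<in> carrier B \<Longrightarrow> Y \<in> carrier B \<Longrightarrow> dB (U \<otimes>\<^bsub>B\<^esub> Y) = U \<otimes>\<^bsub>B\<^esub> dB Y \<oplus>\<^bsub>B\<^esub> dB U \<otimes>\<^bsub>B\<^esub> Y"
  by (elim B_cases) (simp add: d_mult flip: pQ.hom_mult pQ.hom_add)

text \<open>
  The derivative of a fraction is a union over its representatives; by
  \<open>wronskian_invariant\<close> all of them give zero if one does.
\<close>

lemma frac_constants_iff: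
  assumes s: "s \<in> carrier B" "s \<noteq> \<zero>\<^bsub>B\<^esub>" "a \<in> carrier B"
  shows "left_frac B s a \<in> frac_constants R \<delta> Q \<longleftrightarrow> s \<otimes>\<^bsub>B\<^esub> dB a = dB s \<otimes>\<^bsub>B\<^esub> a"
proof -
  define W where "W t b = t \<otimes>\<^bsub>B\<^esub> dB b \<ominus>\<^bsub>B\<^esub> dB t \<otimes>\<^bsub>B\<^esub> b" for t b
  have Wc: "W t b \<in> carrier B" if "t \<in> carrier B" "b \<in> carrier B" for t b
    unfolding W_def using that dB_closed by auto
  have W0: "W t b = \<zero>\<^bsub>B\<^esub> \<longleftrightarrow> t \<otimes>\<^bsub>B\<^esub> dB b = dB t \<otimes>\<^bsub>B\<^esub> b" if "t \<in> carrier B" "b \<in> carrier B" for t b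
    unfolding W_def using that dB_closed by simp
  have fd: "frac_derivation B dB (left_frac B s a) = (\<Union>(t, b) \<in> left_frac B s a. left_frac B (t \<otimes>\<^bsub>B\<^esub> t) (W t b))"
    unfolding frac_derivation_def W_def ..
  have "frac_derivation B dB (left_frac B s a) = \<zero>\<^bsub>Frac B\<^esub> \<longleftrightarrow> s \<otimes>\<^bsub>B\<^esub> dB a = dB s \<otimes>\<^bsub>B\<^esub> a"
  proof
    assume h: "frac_derivation B dB (left_frac B s a) = \<zero>\<^bsub>Frac B\<^esub>"
    have ss: "s \<otimes>\<^bsub>B\<^esub> s \<in> carrier B" "s \<otimes>\<^bsub>B\<^esub> s \<noteq> \<zero>\<^bsub>B\<^esub>" using s B.integral by auto
    have "(s \<otimes>\<^bsub>B\<^esub> s, W s a) \<in> left_frac B (s \<otimes>\<^bsub>B\<^esub> s) (W s a)" by (rule BO.lf_self[OF ss Wc]) (use s in auto)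
    moreover have "(s, a) \<in> left_frac B s a" by (rule BO.lf_self[OF s])
    ultimately have "(s \<otimes>\<^bsub>B\<^esub> s, W s a) \<in> left_frac B \<one>\<^bsub>B\<^esub> \<zero>\<^bsub>B\<^esub>" using h unfolding fd BO.zero_F by blast
    then have "left_frac B (s \<otimes>\<^bsub>B\<^esub> s) (W s a) = \<zero>\<^bsub>Frac B\<^esub>"
      using BO.lf_eqI[of "s \<otimes>\<^bsub>B\<^esub> s" "W s a" "\<one>\<^bsub>B\<^esub>" "\<zero>\<^bsub>B\<^esub>"] unfolding BO.zero_F by simp
    then have "W s a = \<zero>\<^bsub>B\<^esub>" using BO.lf_zero_iff[OF ss Wc] s by simp
    then show "s \<otimes>\<^bsub>B\<^esub> dB a = dB s \<otimes>\<^bsub>B\<^esub> a" using W0 s by simp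
  next
    assume h: "s \<otimes>\<^bsub>B\<^esub> dB a = dB s \<otimes>\<^bsub>B\<^esub> a"
    have "left_frac B (t \<otimes>\<^bsub>B\<^esub> t) (W t b) = \<zero>\<^bsub>Frac B\<^esub>" if tb: "(t, b) \<in> left_frac B s a" for t b
    proof -
      obtain u v where t: "t \<in> carrier B" "t \<noteq> \<zero>\<^bsub>B\<^esub>" "b \<in> carrier B" and
        u: "u \<in> carrier B" "v \<in> carrier B" "u \<otimes>\<^bsub>B\<^esub> s = v \<otimes>\<^bsub>B\<^esub> t" "u \<otimes>\<^bsub>B\<^esub> s \<noteq> \<zero>\<^bsub>B\<^esub>" "u \<otimes>\<^bsub>B\<^esub> a = v \<otimes>\<^bsub>B\<^esub> b"
        using tb unfolding BO.mem_lf by blast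
      have v0: "v \<noteq> \<zero>\<^bsub>B\<^esub>" using u t by auto
      have "v \<otimes>\<^bsub>B\<^esub> (s \<otimes>\<^bsub>B\<^esub> b) = s \<otimes>\<^bsub>B\<^esub> (v \<otimes>\<^bsub>B\<^esub> b)" using u s t by (simp add: B.m_lcomm)
      also have "\<dots> = (u \<otimes>\<^bsub>B\<^esub> s) \<otimes>\<^bsub>B\<^esub> a" unfolding u(5)[symmetric] using u(1) s by (simp add: B.m_ac)
      also have "\<dots> = v \<otimes>\<^bsub>B\<^esub> (t \<otimes>\<^bsub>B\<^esub> a)" unfolding u(3) using u t s by (simp add: B.m_assoc)
      finally have "s \<otimes>\<^bsub>B\<^esub> b = t \<otimes>\<^bsub>B\<^esub> a" using BO.l_cancel[of v] u v0 s t by simp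
      then have "t \<otimes>\<^bsub>B\<^esub> dB b = dB t \<otimes>\<^bsub>B\<^esub> b"
        using B.wronskian_invariant[of dB s a t b] dB_closed dB_mult s t h by blast
      then have "W t b = \<zero>\<^bsub>B\<^esub>" using W0 t by simp
      then show ?thesis using BO.lf_zero[of "t \<otimes>\<^bsub>B\<^esub> t"] t B.integral[of t t] by auto
    qed
    then have "\<And>c. c \<in> (\<lambda>(t, b). left_frac B (t \<otimes>\<^bsub>B\<^esub> t) (W t b)) ` left_frac B s a \<Longrightarrow> c = \<zero>\<^bsub>Frac B\<^esub>" by auto
    moreover have "\<zero>\<^bsub>Frac B\<^esub> \<in> (\<lambda>(t, b). left_frac B (t \<otimes>\<^bsub>B\<^esub> t) (W t b)) ` left_frac B s a"
      using calculation BO.lf_self[OF s] by force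
    ultimately show "frac_derivation B dB (left_frac B s a) = \<zero>\<^bsub>Frac B\<^esub>" unfolding fd by (rule BO.Union_eq_single)
  qed
  moreover have "left_frac B s a \<in> carrier (Frac B)" using s by (rule BO.lf_closed)
  ultimately show ?thesis unfolding frac_constants_def by simp
qed

lemma frac_constants_coset:
  assumes "s \<in> carrier R" "s \<notin> Q" "a \<in> carrier R"
  shows "left_frac B (Q +>\<^bsub>R\<^esub> s) (Q +>\<^bsub>R\<^esub> a) \<in> frac_constants R \<delta> Q \<longleftrightarrow> s \<otimes>\<^bsub>R\<^esub> \<delta> a \<ominus>\<^bsub>R\<^esub> \<delta> s \<otimes>\<^bsub>R\<^esub> a \<in> Q"
  using assms by (subst frac_constants_iff) (auto simp: coset_zero_iff coset_eq_iff simp flip: pQ.hom_mult)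

lemma constants_in_centre: "frac_map j A ` frac_constants R \<delta> Q \<subseteq> ring_centre (Frac A)"
proof
  fix z assume "z \<in> frac_map j A ` frac_constants R \<delta> Q"
  then obtain q where q: "q \<in> frac_constants R \<delta> Q" "z = frac_map j A q" by blast
  then have "q \<in> carrier (Frac B)" by (simp add: frac_constants_def)
  then obtain S C where S: "S \<in> carrier B" "S \<noteq> \<zero>\<^bsub>B\<^esub>" "C \<in> carrier B" "q = left_frac B S C" using BO.F_cases by metis
  obtain s where s: "s \<in> carrier R" "S = Q +>\<^bsub>R\<^esub> s" using B_cases S by metis
  obtain a where a: "a \<in> carrier R" "C = Q +>\<^bsub>R\<^esub> a" using B_cases S by metis
  have sQ: "s \<notin> Q" using S s coset_zero_iff by blast
  have "s \<otimes>\<^bsub>R\<^esub> \<delta> a \<ominus>\<^bsub>R\<^esub> \<delta> s \<otimes>\<^bsub>R\<^esub> a \<in> Q" using frac_constants_coset[OF s(1) sQ a(1)] q S s a by simp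
  then have "left_frac A (\<iota> s) (\<iota> a) \<in> ring_centre (Frac A)" by (rule constant_is_central[OF s(1) sQ a(1)])
  moreover have "z = left_frac A (\<iota> s) (\<iota> a)" using J.frac_map_lf[OF S(1-3)] q S s a by simp
  ultimately show "z \<in> ring_centre (Frac A)" by simp
qed

lemma centre_eq_constants:
  assumes "nat_units R" "b0 \<in> carrier R" "\<delta> b0 \<notin> Q"
  shows "ring_centre (Frac A) = frac_map j A ` frac_constants R \<delta> Q"
proof
  show "ring_centre (Frac A) \<subseteq> frac_map j A ` frac_constants R \<delta> Q"
  proof
    fix z assume z: "z \<in> ring_centre (Frac A)"
    obtain s a where s: "s \<in> carrier R" "s \<notin> Q" "a \<in> carrier R" "z = left_frac A (\<iota> s) (\<iota> a)"
      "s \<otimes>\<^bsub>R\<^esub> \<delta> a \<ominus>\<^bsub>R\<^esub> \<delta> s \<otimes>\<^bsub>R\<^esub> a \<in> Q" using centre_is_constant[OF assms z] by metis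
    have "left_frac B (Q +>\<^bsub>R\<^esub> s) (Q +>\<^bsub>R\<^esub> a) \<in> frac_constants R \<delta> Q" using frac_constants_coset s by simp
    moreover have "z = frac_map j A (left_frac B (Q +>\<^bsub>R\<^esub> s) (Q +>\<^bsub>R\<^esub> a))"
      using s coset_zero_iff by (subst J.frac_map_lf) auto
    ultimately show "z \<in> frac_map j A ` frac_constants R \<delta> Q" by blast
  qed
qed (rule constants_in_centre)

lemma algebraic_frac_map:
  assumes S: "S \<subseteq> carrier R" and q: "q \<in> carrier (Frac B)"
  shows "ring.algebraic (Frac A) ((\<lambda>c. left_frac A \<one> (\<iota> c)) ` S) (frac_map j A q) \<longleftrightarrow>
     ring.algebraic (Frac B) ((\<lambda>c. left_frac B \<one>\<^bsub>B\<^esub> (Q +>\<^bsub>R\<^esub> c)) ` S) q"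
proof -
  have "(\<lambda>c. left_frac A \<one> (\<iota> c)) ` S = frac_map j A ` (\<lambda>c. left_frac B \<one>\<^bsub>B\<^esub> (Q +>\<^bsub>R\<^esub> c)) ` S"
    unfolding image_image using S by (intro image_cong) (auto simp: J.frac_map_lf subset_iff)
  moreover have "(\<lambda>c. left_frac B \<one>\<^bsub>B\<^esub> (Q +>\<^bsub>R\<^esub> c)) ` S \<subseteq> carrier (Frac B)"
    using S by (intro image_subsetI BO.lf_closed) auto
  ultimately show ?thesis
    using algebraic_transport[OF BO.ring_F A.ring_F J.frac_map_hom J.frac_map_inj _ q] by simp
qed

end

section \<open>Ideals that are prime with respect to differential ideals\<close>

context skew_pre
begin

fun dn :: "nat \<Rightarrow> 'a \<Rightarrow> 'a" where "dn 0 a = a" | "dn (Suc n) a = \<delta> (dn n a)"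

lemma dn_closed [simp]: "a \<in> carrier R \<Longrightarrow> dn n a \<in> carrier R" by (induction n) auto

lemma d_one [simp]: "\<delta> \<one>\<^bsub>R\<^esub> = \<zero>\<^bsub>R\<^esub>"
  by (metis R.add.r_cancel_one R.one_closed R.r_one R.l_one d_mult d_closed)

lemma d_power: "b \<in> carrier R \<Longrightarrow> b \<otimes>\<^bsub>R\<^esub> \<delta> (b [^]\<^bsub>R\<^esub> (n::nat)) = add_pow R n \<one>\<^bsub>R\<^esub> \<otimes>\<^bsub>R\<^esub> (b [^]\<^bsub>R\<^esub> n \<otimes>\<^bsub>R\<^esub> \<delta> b)"
proof (induction n)
  case (Suc n)
  have c: "b [^]\<^bsub>R\<^esub> n \<in> carrier R" "\<delta> b \<in> carrier R" "\<delta> (b [^]\<^bsub>R\<^esub> n) \<in> carrier R" "add_pow R n \<one>\<^bsub>R\<^esub> \<in> carrier R" using Suc by auto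
  have "b \<otimes>\<^bsub>R\<^esub> \<delta> (b [^]\<^bsub>R\<^esub> Suc n) = b \<otimes>\<^bsub>R\<^esub> b [^]\<^bsub>R\<^esub> n \<otimes>\<^bsub>R\<^esub> \<delta> b \<oplus>\<^bsub>R\<^esub> (b \<otimes>\<^bsub>R\<^esub> \<delta> (b [^]\<^bsub>R\<^esub> n)) \<otimes>\<^bsub>R\<^esub> b"
    using Suc.prems c by (simp add: d_mult R.r_distr R.m_assoc)
  also have "\<dots> = (add_pow R n \<one>\<^bsub>R\<^esub> \<oplus>\<^bsub>R\<^esub> \<one>\<^bsub>R\<^esub>) \<otimes>\<^bsub>R\<^esub> (b [^]\<^bsub>R\<^esub> n \<otimes>\<^bsub>R\<^esub> b \<otimes>\<^bsub>R\<^esub> \<delta> b)"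
    unfolding Suc.IH[OF Suc.prems] using c Suc.prems by algebra
  finally show ?case by simp
qed simp

definition colon :: "'a set \<Rightarrow> 'a \<Rightarrow> 'a set" where "colon Q a = {r \<in> carrier R. r \<otimes>\<^bsub>R\<^esub> a \<in> Q}"

lemma colon_ideal:
  assumes Q: "ideal Q R" and a: "a \<in> carrier R"
  shows "ideal (colon Q a) R"
proof (rule idealI[OF R.ring_axioms])
  interpret Q: ideal Q R by fact
  show "subgroup (colon Q a) (add_monoid R)"
  proof (rule R.add.subgroupI)
    have "\<zero>\<^bsub>R\<^esub> \<in> colon Q a" using a Q.zero_closed by (simp add: colon_def)
    then show "colon Q a \<noteq> {}" by blast
  qed (use a Q.a_closed Q.a_inv_closed in \<open>auto simp: colon_def R.l_distr R.l_minus\<close>)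
  fix r y assume r: "r \<in> colon Q a" and y: "y \<in> carrier R"
  then have "y \<otimes>\<^bsub>R\<^esub> (r \<otimes>\<^bsub>R\<^esub> a) \<in> Q" using Q.I_l_closed by (simp add: colon_def)
  then show "y \<otimes>\<^bsub>R\<^esub> r \<in> colon Q a" "r \<otimes>\<^bsub>R\<^esub> y \<in> colon Q a"
    using r y a by (auto simp: colon_def R.m_assoc R.m_comm[of r y])
qed

text \<open>
  The constant \<open>c\<close> stands for \<open>(-1)\<^sup>n n!\<close>, a unit with
  derivative zero. For the step from \<open>n\<close> to \<open>n + 1\<close> the congruence is
  differentiated and multiplied by \<open>b\<close>; the term with \<open>\<delta> a\<close> is
  eliminated with \<open>a (\<delta> b) + (\<delta> a) b \<in> Q\<close>.
\<close>

lemma leibniz_congruence: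
  assumes nat: "nat_units R" and Q: "ideal Q R" and d: "\<delta> ` Q \<subseteq> Q" and a: "a \<in> carrier R" and b: "b \<in> carrier R"
    and ab: "a \<otimes>\<^bsub>R\<^esub> b \<in> Q"
  shows "\<exists>c c'. c \<in> carrier R \<and> c' \<in> carrier R \<and> \<delta> c = \<zero>\<^bsub>R\<^esub> \<and> c' \<otimes>\<^bsub>R\<^esub> c = \<one>\<^bsub>R\<^esub> \<and>
     dn n a \<otimes>\<^bsub>R\<^esub> b [^]\<^bsub>R\<^esub> n \<ominus>\<^bsub>R\<^esub> c \<otimes>\<^bsub>R\<^esub> (a \<otimes>\<^bsub>R\<^esub> \<delta> b [^]\<^bsub>R\<^esub> n) \<in> Q"
proof (induction n)
  interpret Q: ideal Q R by fact
  case 0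
  have "a \<otimes>\<^bsub>R\<^esub> \<one>\<^bsub>R\<^esub> \<ominus>\<^bsub>R\<^esub> \<one>\<^bsub>R\<^esub> \<otimes>\<^bsub>R\<^esub> (a \<otimes>\<^bsub>R\<^esub> \<one>\<^bsub>R\<^esub>) \<in> Q" using a Q.zero_closed by (simp add: R.minus_eq R.r_neg)
  then show ?case by (intro exI[of _ "\<one>\<^bsub>R\<^esub>"]) simp
next
  interpret Q: ideal Q R by fact
  case (Suc n)
  obtain c c' where c: "c \<in> carrier R" "c' \<in> carrier R" "\<delta> c = \<zero>\<^bsub>R\<^esub>" "c' \<otimes>\<^bsub>R\<^esub> c = \<one>\<^bsub>R\<^esub>"
    and e: "dn n a \<otimes>\<^bsub>R\<^esub> b [^]\<^bsub>R\<^esub> n \<ominus>\<^bsub>R\<^esub> c \<otimes>\<^bsub>R\<^esub> (a \<otimes>\<^bsub>R\<^esub> \<delta> b [^]\<^bsub>R\<^esub> n) \<in> Q" using Suc by blast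
  define N where "N = add_pow R n \<one>\<^bsub>R\<^esub>"
  define an where "an = dn n a"
  define bn where "bn = b [^]\<^bsub>R\<^esub> n"
  define D where "D = \<delta> b [^]\<^bsub>R\<^esub> n"
  have cl: "N \<in> carrier R" "an \<in> carrier R" "bn \<in> carrier R" "D \<in> carrier R" "\<delta> an \<in> carrier R" "\<delta> bn \<in> carrier R"
    "\<delta> D \<in> carrier R" "\<delta> a \<in> carrier R" "\<delta> b \<in> carrier R"
    using a b unfolding N_def an_def bn_def D_def by auto
  have bp: "b \<otimes>\<^bsub>R\<^esub> \<delta> bn = N \<otimes>\<^bsub>R\<^esub> (bn \<otimes>\<^bsub>R\<^esub> \<delta> b)" unfolding bn_def N_def by (rule d_power[OF b])
  have e': "an \<otimes>\<^bsub>R\<^esub> bn \<ominus>\<^bsub>R\<^esub> c \<otimes>\<^bsub>R\<^esub> (a \<otimes>\<^bsub>R\<^esub> D) \<in> Q" (is "?e \<in> Q") using e unfolding an_def bn_def D_def .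
  have "\<delta> ?e \<in> Q" using d e' by blast
  moreover have "\<delta> ?e = an \<otimes>\<^bsub>R\<^esub> \<delta> bn \<oplus>\<^bsub>R\<^esub> \<delta> an \<otimes>\<^bsub>R\<^esub> bn \<ominus>\<^bsub>R\<^esub> c \<otimes>\<^bsub>R\<^esub> (a \<otimes>\<^bsub>R\<^esub> \<delta> D \<oplus>\<^bsub>R\<^esub> \<delta> a \<otimes>\<^bsub>R\<^esub> D)"
    using cl a b c unfolding R.minus_eq by (simp add: d_add d_neg d_mult)
  ultimately have de: "b \<otimes>\<^bsub>R\<^esub> (an \<otimes>\<^bsub>R\<^esub> \<delta> bn \<oplus>\<^bsub>R\<^esub> \<delta> an \<otimes>\<^bsub>R\<^esub> bn \<ominus>\<^bsub>R\<^esub> c \<otimes>\<^bsub>R\<^esub> (a \<otimes>\<^bsub>R\<^esub> \<delta> D \<oplus>\<^bsub>R\<^esub> \<delta> a \<otimes>\<^bsub>R\<^esub> D)) \<in> Q"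
    using Q.I_l_closed[OF _ b] by simp
  have dab: "a \<otimes>\<^bsub>R\<^esub> \<delta> b \<oplus>\<^bsub>R\<^esub> \<delta> a \<otimes>\<^bsub>R\<^esub> b \<in> Q" using d ab d_mult[OF a b] by (metis imageI subsetD)
  have "(b \<otimes>\<^bsub>R\<^esub> (an \<otimes>\<^bsub>R\<^esub> \<delta> bn \<oplus>\<^bsub>R\<^esub> \<delta> an \<otimes>\<^bsub>R\<^esub> bn \<ominus>\<^bsub>R\<^esub> c \<otimes>\<^bsub>R\<^esub> (a \<otimes>\<^bsub>R\<^esub> \<delta> D \<oplus>\<^bsub>R\<^esub> \<delta> a \<otimes>\<^bsub>R\<^esub> D)) \<oplus>\<^bsub>R\<^esub>
      (\<ominus>\<^bsub>R\<^esub> (N \<otimes>\<^bsub>R\<^esub> \<delta> b)) \<otimes>\<^bsub>R\<^esub> ?e) \<oplus>\<^bsub>R\<^esub> ((c \<otimes>\<^bsub>R\<^esub> D) \<otimes>\<^bsub>R\<^esub> (a \<otimes>\<^bsub>R\<^esub> \<delta> b \<oplus>\<^bsub>R\<^esub> \<delta> a \<otimes>\<^bsub>R\<^esub> b) \<oplus>\<^bsub>R\<^esub> (c \<otimes>\<^bsub>R\<^esub> \<delta> D) \<otimes>\<^bsub>R\<^esub> (a \<otimes>\<^bsub>R\<^esub> b)) \<in> Q"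
    using cl a b c by (intro Q.a_closed de Q.I_l_closed e' dab ab) auto
  also have "(b \<otimes>\<^bsub>R\<^esub> (an \<otimes>\<^bsub>R\<^esub> \<delta> bn \<oplus>\<^bsub>R\<^esub> \<delta> an \<otimes>\<^bsub>R\<^esub> bn \<ominus>\<^bsub>R\<^esub> c \<otimes>\<^bsub>R\<^esub> (a \<otimes>\<^bsub>R\<^esub> \<delta> D \<oplus>\<^bsub>R\<^esub> \<delta> a \<otimes>\<^bsub>R\<^esub> D)) \<oplus>\<^bsub>R\<^esub>
      (\<ominus>\<^bsub>R\<^esub> (N \<otimes>\<^bsub>R\<^esub> \<delta> b)) \<otimes>\<^bsub>R\<^esub> ?e) \<oplus>\<^bsub>R\<^esub> ((c \<otimes>\<^bsub>R\<^esub> D) \<otimes>\<^bsub>R\<^esub> (a \<otimes>\<^bsub>R\<^esub> \<delta> b \<oplus>\<^bsub>R\<^esub> \<delta> a \<otimes>\<^bsub>R\<^esub> b) \<oplus>\<^bsub>R\<^esub> (c \<otimes>\<^bsub>R\<^esub> \<delta> D) \<otimes>\<^bsub>R\<^esub> (a \<otimes>\<^bsub>R\<^esub> b))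
     = an \<otimes>\<^bsub>R\<^esub> (b \<otimes>\<^bsub>R\<^esub> \<delta> bn) \<ominus>\<^bsub>R\<^esub> an \<otimes>\<^bsub>R\<^esub> (N \<otimes>\<^bsub>R\<^esub> (bn \<otimes>\<^bsub>R\<^esub> \<delta> b)) \<oplus>\<^bsub>R\<^esub>
       (\<delta> an \<otimes>\<^bsub>R\<^esub> (bn \<otimes>\<^bsub>R\<^esub> b) \<ominus>\<^bsub>R\<^esub> (\<ominus>\<^bsub>R\<^esub> ((N \<oplus>\<^bsub>R\<^esub> \<one>\<^bsub>R\<^esub>) \<otimes>\<^bsub>R\<^esub> c)) \<otimes>\<^bsub>R\<^esub> (a \<otimes>\<^bsub>R\<^esub> (D \<otimes>\<^bsub>R\<^esub> \<delta> b)))"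
    using cl a b c by algebra
  also have "\<dots> = \<delta> an \<otimes>\<^bsub>R\<^esub> (bn \<otimes>\<^bsub>R\<^esub> b) \<ominus>\<^bsub>R\<^esub> (\<ominus>\<^bsub>R\<^esub> ((N \<oplus>\<^bsub>R\<^esub> \<one>\<^bsub>R\<^esub>) \<otimes>\<^bsub>R\<^esub> c)) \<otimes>\<^bsub>R\<^esub> (a \<otimes>\<^bsub>R\<^esub> (D \<otimes>\<^bsub>R\<^esub> \<delta> b))"
    unfolding bp using cl a b c by algebra
  finally have main: "dn (Suc n) a \<otimes>\<^bsub>R\<^esub> b [^]\<^bsub>R\<^esub> Suc n \<ominus>\<^bsub>R\<^esub> (\<ominus>\<^bsub>R\<^esub> ((N \<oplus>\<^bsub>R\<^esub> \<one>\<^bsub>R\<^esub>) \<otimes>\<^bsub>R\<^esub> c)) \<otimes>\<^bsub>R\<^esub> (a \<otimes>\<^bsub>R\<^esub> \<delta> b [^]\<^bsub>R\<^esub> Suc n) \<in> Q"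
    unfolding an_def bn_def D_def by simp
  obtain m where m: "m \<in> carrier R" "m \<otimes>\<^bsub>R\<^esub> (N \<oplus>\<^bsub>R\<^esub> \<one>\<^bsub>R\<^esub>) = \<one>\<^bsub>R\<^esub>"
    using nat unfolding nat_units_def N_def by (metis R.add.nat_pow_Suc zero_less_Suc)
  let ?c = "\<ominus>\<^bsub>R\<^esub> ((N \<oplus>\<^bsub>R\<^esub> \<one>\<^bsub>R\<^esub>) \<otimes>\<^bsub>R\<^esub> c)"
  have "\<delta> (N \<oplus>\<^bsub>R\<^esub> \<one>\<^bsub>R\<^esub>) = \<zero>\<^bsub>R\<^esub>" using cl unfolding N_def by (simp add: d_add d_nat)
  then have "\<delta> ?c = \<zero>\<^bsub>R\<^esub>" using cl c by (simp add: d_neg d_mult)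
  moreover have "(\<ominus>\<^bsub>R\<^esub> (c' \<otimes>\<^bsub>R\<^esub> m)) \<otimes>\<^bsub>R\<^esub> ?c = (c' \<otimes>\<^bsub>R\<^esub> c) \<otimes>\<^bsub>R\<^esub> (m \<otimes>\<^bsub>R\<^esub> (N \<oplus>\<^bsub>R\<^esub> \<one>\<^bsub>R\<^esub>))"
    using cl(1) c(1,2) m(1) by algebra
  then have "(\<ominus>\<^bsub>R\<^esub> (c' \<otimes>\<^bsub>R\<^esub> m)) \<otimes>\<^bsub>R\<^esub> ?c = \<one>\<^bsub>R\<^esub>" unfolding c(4) m(2) by simp
  moreover have "?c \<in> carrier R" "\<ominus>\<^bsub>R\<^esub> (c' \<otimes>\<^bsub>R\<^esub> m) \<in> carrier R" using cl c m by auto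
  ultimately show ?case using main by blast
qed

text \<open>
  A maximal colon ideal \<open>p = (Q : a)\<close> with \<open>a \<notin> Q\<close> is prime. It
  is also a \<open>\<delta>\<close>-ideal: for \<open>b \<in> p\<close> the chain \<open>(Q :
  b\<^sup>n)\<close> becomes stationary, at \<open>N\<close> say; as \<open>(\<delta>\<^sup>N a)
  b\<^sup>N\<^sup>+\<^sup>1 \<in> Q\<close> by the congruence, \<open>(\<delta>\<^sup>N a)
  b\<^sup>N\<close> is in \<open>Q\<close> already, and then the congruence puts
  \<open>(\<delta> b)\<^sup>N\<close> into \<open>p\<close>. So \<open>H = (Q : p)\<close> and
  \<open>p\<close> are \<open>\<delta>\<close>-ideals with product in \<open>Q\<close>. Since
  \<open>a \<in> H\<close> lies outside \<open>Q\<close>, this forces \<open>p = Q\<close>.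
\<close>

theorem delta_prime_imp_prime:
  assumes nat: "nat_units R" and acc: "acc_ideals R" and Q: "ideal Q R" and d: "\<delta> ` Q \<subseteq> Q" and one: "\<one>\<^bsub>R\<^esub> \<notin> Q"
    and dprime: "\<And>I J. ideal I R \<Longrightarrow> ideal J R \<Longrightarrow> \<delta> ` I \<subseteq> I \<Longrightarrow> \<delta> ` J \<subseteq> J \<Longrightarrow>
      (\<And>i j. i \<in> I \<Longrightarrow> j \<in> J \<Longrightarrow> i \<otimes>\<^bsub>R\<^esub> j \<in> Q) \<Longrightarrow> I \<subseteq> Q \<or> J \<subseteq> Q"
  shows "primeideal Q R"
proof -
  interpret Q: ideal Q R by fact
  have "\<exists>M \<in> {colon Q a | a. a \<in> carrier R \<and> a \<notin> Q}. \<forall>I \<in> {colon Q a | a. a \<in> carrier R \<and> a \<notin> Q}. M \<subseteq> I \<longrightarrow> I = M"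
  proof (rule acc_ideals_maximal[OF acc])
    show "colon Q \<one>\<^bsub>R\<^esub> \<in> {colon Q a | a. a \<in> carrier R \<and> a \<notin> Q}" using one by blast
  qed (use colon_ideal[OF Q] in blast)
  then obtain a where a: "a \<in> carrier R" "a \<notin> Q" and
    max: "\<And>a'. a' \<in> carrier R \<Longrightarrow> a' \<notin> Q \<Longrightarrow> colon Q a \<subseteq> colon Q a' \<Longrightarrow> colon Q a' = colon Q a" by blast
  define p where "p = colon Q a"
  interpret p: ideal p R unfolding p_def by (rule colon_ideal[OF Q a(1)])
  have p_mem: "b \<in> p \<longleftrightarrow> b \<in> carrier R \<and> b \<otimes>\<^bsub>R\<^esub> a \<in> Q" for b unfolding p_def colon_def by blast
  have one_p: "\<one>\<^bsub>R\<^esub> \<notin> p" using a p_mem by simp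
  have p_prime: "b \<in> p \<or> c \<in> p" if bc: "b \<in> carrier R" "c \<in> carrier R" "b \<otimes>\<^bsub>R\<^esub> c \<in> p" for b c
  proof (rule disjCI)
    assume "c \<notin> p"
    then have ca: "c \<otimes>\<^bsub>R\<^esub> a \<in> carrier R" "c \<otimes>\<^bsub>R\<^esub> a \<notin> Q" using p_mem bc a by auto
    have "colon Q a \<subseteq> colon Q (c \<otimes>\<^bsub>R\<^esub> a)"
      using a bc Q.I_l_closed by (auto simp: colon_def R.m_lcomm[of _ c a])
    then have "colon Q (c \<otimes>\<^bsub>R\<^esub> a) = p" using max[OF ca] p_def by simp
    moreover have "b \<in> colon Q (c \<otimes>\<^bsub>R\<^esub> a)" using bc a p_mem by (simp add: colon_def R.m_assoc)
    ultimately show "b \<in> p" by simp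
  qed
  have p_pow: "b \<in> p" if "b \<in> carrier R" "b [^]\<^bsub>R\<^esub> (n::nat) \<in> p" for b n
    using that
  proof (induction n)
    case (Suc n)
    then show ?case using p_prime[of "b [^]\<^bsub>R\<^esub> n" b] by auto
  qed (use one_p in simp)
  have p_delta: "\<delta> b \<in> p" if b: "b \<in> p" for b
  proof -
    have bR: "b \<in> carrier R" using b p_mem by blast
    then have bc: "b \<in> carrier R" "a \<otimes>\<^bsub>R\<^esub> b \<in> Q" using b p_mem R.m_comm[OF bR a(1)] by simp_all
    have "(\<forall>n :: nat. ideal (colon Q (b [^]\<^bsub>R\<^esub> n)) R) \<and> (\<forall>n. colon Q (b [^]\<^bsub>R\<^esub> n) \<subseteq> colon Q (b [^]\<^bsub>R\<^esub> Suc n))"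
    proof (intro conjI allI)
      show "ideal (colon Q (b [^]\<^bsub>R\<^esub> n)) R" for n :: nat using bc by (intro colon_ideal[OF Q]) simp
      show "colon Q (b [^]\<^bsub>R\<^esub> n) \<subseteq> colon Q (b [^]\<^bsub>R\<^esub> Suc n)" for n
        using bc Q.I_r_closed by (auto simp: colon_def simp flip: R.m_assoc)
    qed
    then obtain N where N: "colon Q (b [^]\<^bsub>R\<^esub> Suc N) = colon Q (b [^]\<^bsub>R\<^esub> N)"
      using acc unfolding acc_ideals_def by (elim allE[of _ "\<lambda>n. colon Q (b [^]\<^bsub>R\<^esub> (n::nat))"]) (metis le_SucI order_refl)
    obtain c c' where c: "c \<in> carrier R" "c' \<in> carrier R" "c' \<otimes>\<^bsub>R\<^esub> c = \<one>\<^bsub>R\<^esub>"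
      "dn N a \<otimes>\<^bsub>R\<^esub> b [^]\<^bsub>R\<^esub> N \<ominus>\<^bsub>R\<^esub> c \<otimes>\<^bsub>R\<^esub> (a \<otimes>\<^bsub>R\<^esub> \<delta> b [^]\<^bsub>R\<^esub> N) \<in> Q"
      using leibniz_congruence[OF nat Q d a(1) bc, of N] by blast
    define t where "t = dn N a \<otimes>\<^bsub>R\<^esub> b [^]\<^bsub>R\<^esub> N"
    define D where "D = \<delta> b [^]\<^bsub>R\<^esub> N"
    have cl: "t \<in> carrier R" "D \<in> carrier R" unfolding t_def D_def using a bc by auto
    have tw: "t \<ominus>\<^bsub>R\<^esub> c \<otimes>\<^bsub>R\<^esub> (a \<otimes>\<^bsub>R\<^esub> D) \<in> Q" using c(4) unfolding t_def D_def .
    have "(t \<ominus>\<^bsub>R\<^esub> c \<otimes>\<^bsub>R\<^esub> (a \<otimes>\<^bsub>R\<^esub> D)) \<otimes>\<^bsub>R\<^esub> b \<oplus>\<^bsub>R\<^esub> (c \<otimes>\<^bsub>R\<^esub> D) \<otimes>\<^bsub>R\<^esub> (a \<otimes>\<^bsub>R\<^esub> b) \<in> Q"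
      using tw bc cl c by (intro Q.a_closed Q.I_l_closed[OF bc(2)] Q.I_r_closed) auto
    also have "(t \<ominus>\<^bsub>R\<^esub> c \<otimes>\<^bsub>R\<^esub> (a \<otimes>\<^bsub>R\<^esub> D)) \<otimes>\<^bsub>R\<^esub> b \<oplus>\<^bsub>R\<^esub> (c \<otimes>\<^bsub>R\<^esub> D) \<otimes>\<^bsub>R\<^esub> (a \<otimes>\<^bsub>R\<^esub> b) = t \<otimes>\<^bsub>R\<^esub> b"
      using cl c a bc by algebra
    finally have "dn N a \<in> colon Q (b [^]\<^bsub>R\<^esub> Suc N)" using a bc unfolding t_def colon_def by (simp add: R.m_assoc)
    then have "dn N a \<in> colon Q (b [^]\<^bsub>R\<^esub> N)" by (simp only: N)
    then have "t \<in> Q" unfolding t_def colon_def by blast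
    then have "c' \<otimes>\<^bsub>R\<^esub> (t \<ominus>\<^bsub>R\<^esub> (t \<ominus>\<^bsub>R\<^esub> c \<otimes>\<^bsub>R\<^esub> (a \<otimes>\<^bsub>R\<^esub> D))) \<in> Q"
      unfolding R.minus_eq[of t "t \<ominus>\<^bsub>R\<^esub> c \<otimes>\<^bsub>R\<^esub> (a \<otimes>\<^bsub>R\<^esub> D)"] using tw c by (intro Q.I_l_closed Q.a_closed Q.a_inv_closed) auto
    also have "c' \<otimes>\<^bsub>R\<^esub> (t \<ominus>\<^bsub>R\<^esub> (t \<ominus>\<^bsub>R\<^esub> c \<otimes>\<^bsub>R\<^esub> (a \<otimes>\<^bsub>R\<^esub> D))) = (c' \<otimes>\<^bsub>R\<^esub> c) \<otimes>\<^bsub>R\<^esub> (D \<otimes>\<^bsub>R\<^esub> a)"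
      using cl c a by algebra
    finally have "D \<in> p" using c cl a p_mem by simp
    then show ?thesis unfolding D_def using p_pow bc by blast
  qed
  define H where "H = {r \<in> carrier R. \<forall>q \<in> p. r \<otimes>\<^bsub>R\<^esub> q \<in> Q}"
  have H_colon: "H = carrier R \<inter> (\<Inter>q \<in> p. colon Q q)" unfolding H_def colon_def by blast
  have H: "ideal H R"
  proof -
    have "ideal (\<Inter>(colon Q ` p)) R"
    proof (rule R.i_Intersect)
      show "colon Q ` p \<noteq> {}" using p.zero_closed by blast
    qed (use colon_ideal[OF Q] p.Icarr in auto)
    moreover have "H = \<Inter>(colon Q ` p)" unfolding H_colon colon_def using p.zero_closed by blast
    ultimately show ?thesis by simp
  qed
  have "\<delta> ` H \<subseteq> H"
  proof clarify
    fix r assume r: "r \<in> H"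
    have "\<delta> r \<otimes>\<^bsub>R\<^esub> q \<in> Q" if q: "q \<in> p" for q
    proof -
      have c: "r \<in> carrier R" "q \<in> carrier R" using r q p.Icarr unfolding H_def by auto
      have "\<delta> (r \<otimes>\<^bsub>R\<^esub> q) \<oplus>\<^bsub>R\<^esub> \<ominus>\<^bsub>R\<^esub> (r \<otimes>\<^bsub>R\<^esub> \<delta> q) \<in> Q"
        using r q d p_delta[OF q] unfolding H_def by (intro Q.a_closed Q.a_inv_closed) auto
      also have "\<delta> (r \<otimes>\<^bsub>R\<^esub> q) \<oplus>\<^bsub>R\<^esub> \<ominus>\<^bsub>R\<^esub> (r \<otimes>\<^bsub>R\<^esub> \<delta> q) = \<delta> r \<otimes>\<^bsub>R\<^esub> q"
        unfolding d_mult[OF c] using c d_closed[OF c(1)] d_closed[OF c(2)] by algebra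
      finally show ?thesis .
    qed
    then show "\<delta> r \<in> H" using r unfolding H_def by auto
  qed
  moreover have "\<delta> ` p \<subseteq> p" using p_delta by blast
  ultimately have "H \<subseteq> Q \<or> p \<subseteq> Q"
    using dprime[OF H p.is_ideal] unfolding H_def by blast
  moreover have "a \<otimes>\<^bsub>R\<^esub> q \<in> Q" if "q \<in> p" for q
    using that p_mem[of q] R.m_comm[OF a(1), of q] by metis
  then have "a \<in> H" using a unfolding H_def by blast
  ultimately have "p \<subseteq> Q" using a by blast
  moreover have "Q \<subseteq> p" using p_mem Q.Icarr Q.I_r_closed a by blast
  ultimately have pQ: "p = Q" by blast
  show ?thesis
  proof (rule primeidealI[OF Q R.cring_axioms])
    show "carrier R \<noteq> Q" using one by blast
  qed (use p_prime pQ in blast)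
qed

end

section \<open>Primes and primitive ideals of a noncommutative ring\<close>

text \<open>
  The product of the ideals \<open>J = {y. a A y \<subseteq> P}\<close> and \<open>I = {z. z A J
  \<subseteq> P}\<close> lies in \<open>P\<close>, and \<open>b \<in> J\<close>, \<open>a \<in>
  I\<close>.
\<close>

lemma (in ring) prime_ideal_elem:
  assumes P: "prime_ideal R P" and a: "a \<in> carrier R" and b: "b \<in> carrier R"
    and ab: "\<And>c. c \<in> carrier R \<Longrightarrow> a \<otimes> c \<otimes> b \<in> P"
  shows "a \<in> P \<or> b \<in> P"
proof -
  interpret P: ideal P R using P by (simp add: prime_ideal_def)
  define J where "J = {y \<in> carrier R. \<forall>c \<in> carrier R. a \<otimes> c \<otimes> y \<in> P}"
  define I where "I = {z \<in> carrier R. \<forall>c \<in> carrier R. \<forall>y \<in> J. z \<otimes> c \<otimes> y \<in> P}"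
  have Jc: "y \<in> carrier R" if "y \<in> J" for y using that unfolding J_def by blast
  have J: "ideal J R"
  proof (rule idealI[OF ring_axioms])
    show "subgroup J (add_monoid R)"
    proof (rule add.subgroupI)
      have "\<zero> \<in> J" using a P.zero_closed by (simp add: J_def)
      then show "J \<noteq> {}" by blast
    qed (use a P.a_closed P.a_inv_closed in \<open>auto simp: J_def r_distr r_minus\<close>)
    fix y d assume y: "y \<in> J" and d: "d \<in> carrier R"
    have "a \<otimes> c \<otimes> (d \<otimes> y) \<in> P" if c: "c \<in> carrier R" for c
    proof -
      have "a \<otimes> (c \<otimes> d) \<otimes> y \<in> P" using y c d unfolding J_def by blast
      then show ?thesis using a c d Jc[OF y] by (simp add: m_assoc)
    qed
    then show "d \<otimes> y \<in> J" using d Jc[OF y] unfolding J_def by blast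
    have "a \<otimes> c \<otimes> (y \<otimes> d) \<in> P" if c: "c \<in> carrier R" for c
    proof -
      have "a \<otimes> c \<otimes> y \<otimes> d \<in> P" using y c d P.I_r_closed unfolding J_def by blast
      then show ?thesis using a c d Jc[OF y] by (simp add: m_assoc)
    qed
    then show "y \<otimes> d \<in> J" using d Jc[OF y] unfolding J_def by blast
  qed
  interpret J: ideal J R by (rule J)
  have Ic: "z \<in> carrier R" if "z \<in> I" for z using that unfolding I_def by blast
  have I: "ideal I R"
  proof (rule idealI[OF ring_axioms])
    show "subgroup I (add_monoid R)"
    proof (rule add.subgroupI)
      have "\<zero> \<in> I" using P.zero_closed Jc by (simp add: I_def)
      then show "I \<noteq> {}" by blast
    qed (use P.a_closed P.a_inv_closed Jc in \<open>auto simp: I_def l_distr l_minus\<close>)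
    fix z d assume z: "z \<in> I" and d: "d \<in> carrier R"
    have "z \<otimes> d \<otimes> c \<otimes> y \<in> P" if c: "c \<in> carrier R" "y \<in> J" for c y
    proof -
      have "z \<otimes> (d \<otimes> c) \<otimes> y \<in> P" using z c d unfolding I_def by blast
      then show ?thesis using c d Ic[OF z] by (simp add: m_assoc)
    qed
    then show "z \<otimes> d \<in> I" using d Ic[OF z] unfolding I_def by blast
    have "d \<otimes> z \<otimes> c \<otimes> y \<in> P" if c: "c \<in> carrier R" "y \<in> J" for c y
    proof -
      have "d \<otimes> (z \<otimes> c \<otimes> y) \<in> P" using z c d P.I_l_closed unfolding I_def by blast
      then show ?thesis using c d Ic[OF z] Jc[OF c(2)] by (simp add: m_assoc)
    qed
    then show "d \<otimes> z \<in> I" using d Ic[OF z] unfolding I_def by blast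
  qed
  have "I \<cdot> J \<subseteq> P"
  proof
    fix s assume "s \<in> I \<cdot> J"
    then show "s \<in> P"
    proof (induction s rule: ideal_prod.induct)
      case (prod i j)
      then have "i \<otimes> \<one> \<otimes> j \<in> P" unfolding I_def by blast
      then show ?case using Ic[OF prod(1)] by simp
    qed (rule P.a_closed)
  qed
  then have "I \<subseteq> P \<or> J \<subseteq> P" using P I J unfolding prime_ideal_def by blast
  moreover have "b \<in> J" using b ab unfolding J_def by blast
  moreover have "a \<in> I" using a unfolding I_def J_def by blast
  ultimately show ?thesis by blast
qed

lemma (in ring) completely_prime_imp_prime:
  assumes P: "ideal P R" and one: "\<one> \<notin> P"
    and cp: "\<And>a b. a \<in> carrier R \<Longrightarrow> b \<in> carrier R \<Longrightarrow> a \<otimes> b \<in> P \<Longrightarrow> a \<in> P \<or> b \<in> P"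
  shows "prime_ideal R P"
  unfolding prime_ideal_def
proof (intro conjI allI impI)
  show "ideal P R" by (rule P)
  show "P \<noteq> carrier R" using one by blast
  fix I J assume h: "ideal I R \<and> ideal J R \<and> I \<cdot> J \<subseteq> P"
  show "I \<subseteq> P \<or> J \<subseteq> P"
  proof (rule ccontr)
    assume "\<not> ?thesis"
    then obtain i j where ij: "i \<in> I" "i \<notin> P" "j \<in> J" "j \<notin> P" by blast
    then have "i \<otimes> j \<in> P" using h ideal_prod.prod[of i I j J R] by blast
    moreover have "i \<in> carrier R" using ideal.Icarr[of I R i] ij h by simp
    moreover have "j \<in> carrier R" using ideal.Icarr[of J R j] ij h by simp
    ultimately show False using cp ij by blast
  qed
qed

definition left_ideal :: "('a, 'n) ring_scheme \<Rightarrow> 'a set \<Rightarrow> bool" where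
  "left_ideal A L \<longleftrightarrow> additive_subgroup L A \<and> (\<forall>a \<in> carrier A. \<forall>l \<in> L. a \<otimes>\<^bsub>A\<^esub> l \<in> L)"

definition max_left_ideal :: "('a, 'n) ring_scheme \<Rightarrow> 'a set \<Rightarrow> bool" where
  "max_left_ideal A L \<longleftrightarrow> left_ideal A L \<and> \<one>\<^bsub>A\<^esub> \<notin> L \<and>
     (\<forall>L'. left_ideal A L' \<and> L \<subseteq> L' \<and> \<one>\<^bsub>A\<^esub> \<notin> L' \<longrightarrow> L' = L)"

lemma (in ring) left_idealI:
  assumes "L \<subseteq> carrier R" "\<zero> \<in> L" "\<And>a b. a \<in> L \<Longrightarrow> b \<in> L \<Longrightarrow> a \<oplus> b \<in> L"
    "\<And>a l. a \<in> carrier R \<Longrightarrow> l \<in> L \<Longrightarrow> a \<otimes> l \<in> L"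
  shows "left_ideal R L"
proof -
  have "\<ominus> l \<in> L" if "l \<in> L" for l
  proof -
    have "(\<ominus> \<one>) \<otimes> l \<in> L" using that assms(4) by auto
    then show ?thesis using that assms(1) by (simp add: l_minus subset_iff)
  qed
  then show ?thesis unfolding left_ideal_def using assms
    by (intro conjI additive_subgroup.intro add.subgroupI) auto
qed

lemma (in ring) max_left_ideal_exists:
  assumes L: "left_ideal R L" "\<one> \<notin> L"
  obtains M where "max_left_ideal R M" "L \<subseteq> M"
proof -
  let ?S = "{L'. left_ideal R L' \<and> L \<subseteq> L' \<and> \<one> \<notin> L'}"
  have "\<exists>M \<in> ?S. \<forall>Z \<in> ?S. M \<subseteq> Z \<longrightarrow> Z = M"
  proof (rule subset_Zorn_nonempty)
    show "?S \<noteq> {}" using L by blast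
    fix C assume C: "C \<noteq> {}" "subset.chain ?S C"
    have mem: "left_ideal R Z" "L \<subseteq> Z" "\<one> \<notin> Z" if "Z \<in> C" for Z using that C unfolding subset.chain_def by auto
    have ag: "additive_subgroup Z R" if "Z \<in> C" for Z using mem(1)[OF that] unfolding left_ideal_def by blast
    have "left_ideal R (\<Union>C)"
    proof (rule left_idealI)
      show "\<Union>C \<subseteq> carrier R" using additive_subgroup.a_subset[OF ag] by blast
      show "\<zero> \<in> \<Union>C" using C(1) additive_subgroup.zero_closed[OF ag] by blast
      show "a \<oplus> b \<in> \<Union>C" if ab: "a \<in> \<Union>C" "b \<in> \<Union>C" for a b
      proof -
        obtain Z Z' where Z: "a \<in> Z" "Z \<in> C" "b \<in> Z'" "Z' \<in> C" using ab by blast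
        then have "Z \<subseteq> Z' \<or> Z' \<subseteq> Z" using C(2) unfolding subset.chain_def by blast
        then show ?thesis using Z additive_subgroup.a_closed[OF ag] by blast
      qed
      show "a \<otimes> l \<in> \<Union>C" if "a \<in> carrier R" "l \<in> \<Union>C" for a l using that mem(1) unfolding left_ideal_def by blast
    qed
    then show "\<Union>C \<in> ?S" using mem C(1) by blast
  qed
  then obtain M where "M \<in> ?S" "\<forall>Z \<in> ?S. M \<subseteq> Z \<longrightarrow> Z = M" by blast
  then have "max_left_ideal R M" "L \<subseteq> M" unfolding max_left_ideal_def by blast+
  then show ?thesis by (rule that)
qed

text \<open>The left module \<open>A / L\<close> on the set of cosets.\<close>

definition quot_module :: "('a, 'n) ring_scheme \<Rightarrow> 'a set \<Rightarrow> ('a, 'a set) module" where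
  "quot_module A L = \<lparr>carrier = a_rcosets\<^bsub>A\<^esub> L, monoid.mult = (\<lambda>_ _. undefined), one = undefined, ring.zero = L, ring.add = set_add A,
     smult = (\<lambda>a C. \<Union>c \<in> C. L +>\<^bsub>A\<^esub> (a \<otimes>\<^bsub>A\<^esub> c))\<rparr>"

text \<open>
  Submodules of \<open>A / L\<close> correspond to left ideals above \<open>L\<close>, so the
  module is simple; its annihilator is the given set.
\<close>

lemma (in ring) max_left_ideal_primitive:
  assumes L: "max_left_ideal R L"
  shows "primitive_ideal R {a \<in> carrier R. \<forall>m \<in> carrier R. a \<otimes> m \<in> L}"
proof -
  let ?M = "quot_module R L"
  have Ll: "a \<otimes> l \<in> L" if "a \<in> carrier R" "l \<in> L" for a l using L that unfolding max_left_ideal_def left_ideal_def by blast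
  interpret L: additive_subgroup L R using L unfolding max_left_ideal_def left_ideal_def by blast
  interpret L: abelian_subgroup L R
    by (rule abelian_subgroupI3[OF L.additive_subgroup_axioms abelian_group_axioms])
  have car: "carrier ?M = (\<lambda>a. L +> a) ` carrier R"
    unfolding quot_module_def A_RCOSETS_def RCOSETS_def a_r_coset_def by auto
  have add: "(L +> a) \<oplus>\<^bsub>?M\<^esub> (L +> b) = L +> (a \<oplus> b)" if "a \<in> carrier R" "b \<in> carrier R" for a b
    using L.a_rcos_sum[OF that] by (simp add: quot_module_def)
  have zero: "\<zero>\<^bsub>?M\<^esub> = L" by (simp add: quot_module_def)
  have eq0: "L +> a = L \<longleftrightarrow> a \<in> L" if "a \<in> carrier R" for a
    using L.a_rcos_const[of a] L.a_rcos_self[OF that] by metis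
  have sm: "a \<odot>\<^bsub>?M\<^esub> (L +> b) = L +> (a \<otimes> b)" if a: "a \<in> carrier R" and b: "b \<in> carrier R" for a b
  proof -
    have "L +> (a \<otimes> c) = L +> (a \<otimes> b)" if c: "c \<in> L +> b" for c
    proof -
      obtain l where l: "l \<in> L" "c = l \<oplus> b" using c by (auto simp: a_r_coset_def r_coset_def)
      have "a \<otimes> c = a \<otimes> l \<oplus> a \<otimes> b" using l a b L.a_Hcarr by (simp add: r_distr)
      then have "a \<otimes> c \<in> L +> (a \<otimes> b)" using Ll[OF a l(1)] by (auto simp: a_r_coset_def r_coset_def)
      then show ?thesis
        by (rule a_repr_independence[symmetric]) (use a b L.additive_subgroup_axioms in \<open>auto simp: additive_subgroup_def\<close>)
    qed
    moreover have "b \<in> L +> b" using b by (rule L.a_rcos_self)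
    ultimately have "(\<Union>c \<in> L +> b. L +> (a \<otimes> c)) = L +> (a \<otimes> b)" by blast
    then show ?thesis by (simp add: quot_module_def)
  qed
  have z0: "L = L +> \<zero>" using eq0[of \<zero>] L.zero_closed by simp
  have ab: "abelian_group ?M"
  proof (rule abelian_groupI)
    fix m assume "m \<in> carrier ?M"
    then obtain a where a: "a \<in> carrier R" "m = L +> a" unfolding car by blast
    show "\<zero>\<^bsub>?M\<^esub> \<oplus>\<^bsub>?M\<^esub> m = m" unfolding zero using a add[of \<zero> a] z0 by simp
    show "\<exists>n \<in> carrier ?M. n \<oplus>\<^bsub>?M\<^esub> m = \<zero>\<^bsub>?M\<^esub>"
      unfolding zero using a add[of "\<ominus> a" a] z0 by (intro bexI[of _ "L +> (\<ominus> a)"]) (auto simp: car l_neg)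
    fix n assume "n \<in> carrier ?M"
    then obtain b where b: "b \<in> carrier R" "n = L +> b" unfolding car by blast
    show "m \<oplus>\<^bsub>?M\<^esub> n \<in> carrier ?M" using a b by (auto simp: add car)
    show "m \<oplus>\<^bsub>?M\<^esub> n = n \<oplus>\<^bsub>?M\<^esub> m" using a b by (simp add: add a_comm)
    fix k assume "k \<in> carrier ?M"
    then obtain c where c: "c \<in> carrier R" "k = L +> c" unfolding car by blast
    show "m \<oplus>\<^bsub>?M\<^esub> n \<oplus>\<^bsub>?M\<^esub> k = m \<oplus>\<^bsub>?M\<^esub> (n \<oplus>\<^bsub>?M\<^esub> k)" using a b c by (simp add: add a_assoc)
  next
    show "\<zero>\<^bsub>?M\<^esub> \<in> carrier ?M" unfolding zero car using z0 by blast
  qed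
  have "left_module R ?M"
  proof (intro left_module.intro left_module_axioms.intro ring_axioms ab)
    fix a b m n assume a: "a \<in> carrier R" and m: "m \<in> carrier ?M"
    obtain m' where m': "m' \<in> carrier R" "m = L +> m'" using m unfolding car by blast
    show "a \<odot>\<^bsub>?M\<^esub> m \<in> carrier ?M" using m' a unfolding car by (auto simp: sm)
    {
      assume b: "b \<in> carrier R"
      show "(a \<oplus> b) \<odot>\<^bsub>?M\<^esub> m = a \<odot>\<^bsub>?M\<^esub> m \<oplus>\<^bsub>?M\<^esub> b \<odot>\<^bsub>?M\<^esub> m" using m' a b by (simp add: sm add l_distr)
      show "(a \<otimes> b) \<odot>\<^bsub>?M\<^esub> m = a \<odot>\<^bsub>?M\<^esub> (b \<odot>\<^bsub>?M\<^esub> m)" using m' a b by (simp add: sm m_assoc)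
    next
      assume n: "n \<in> carrier ?M"
      obtain n' where n': "n' \<in> carrier R" "n = L +> n'" using n unfolding car by blast
      show "a \<odot>\<^bsub>?M\<^esub> (m \<oplus>\<^bsub>?M\<^esub> n) = a \<odot>\<^bsub>?M\<^esub> m \<oplus>\<^bsub>?M\<^esub> a \<odot>\<^bsub>?M\<^esub> n" using m' n' a by (simp add: sm add r_distr)
    }
  next
    fix m assume m: "m \<in> carrier ?M"
    obtain m' where m': "m' \<in> carrier R" "m = L +> m'" using m unfolding car by blast
    show "\<one> \<odot>\<^bsub>?M\<^esub> m = m" using m' by (simp add: sm)
  qed
  moreover have "carrier ?M \<noteq> {\<zero>\<^bsub>?M\<^esub>}"
  proof -
    have "\<one> \<notin> L" using L unfolding max_left_ideal_def by blast
    then have "L +> \<one> \<noteq> L" "L +> \<one> \<in> carrier ?M" using eq0 unfolding car by auto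
    then show ?thesis unfolding zero by blast
  qed
  moreover have "N = {\<zero>\<^bsub>?M\<^esub>} \<or> N = carrier ?M" if N: "submodule N R ?M" for N
  proof -
    interpret N: submodule N R ?M by fact
    define L' where "L' = {a \<in> carrier R. L +> a \<in> N}"
    have Nc: "N \<subseteq> carrier ?M" using N.subset by simp
    have LL: "L \<subseteq> L'"
    proof
      fix l assume "l \<in> L"
      then have "l \<in> carrier R" "L +> l = L" using L.a_Hcarr eq0 by blast+
      then show "l \<in> L'" using N.one_closed unfolding L'_def by (simp add: zero)
    qed
    have "left_ideal R L'"
    proof (rule left_idealI)
      show "\<zero> \<in> L'" using LL L.zero_closed by blast
      show "a \<oplus> b \<in> L'" if "a \<in> L'" "b \<in> L'" for a b
        using that N.m_closed add unfolding L'_def by (auto simp flip: add)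
      show "a \<otimes> l \<in> L'" if "a \<in> carrier R" "l \<in> L'" for a l
        using that N.smult_closed[of a "L +> l"] unfolding L'_def by (auto simp: sm)
    qed (auto simp: L'_def)
    then have "L' = L \<or> \<one> \<in> L'" using L LL unfolding max_left_ideal_def by blast
    then show ?thesis
    proof
      assume "L' = L"
      then have "n = L" if "n \<in> N" for n
        using that Nc eq0 unfolding car L'_def by blast
      then have "N \<subseteq> {L}" by blast
      moreover have "L \<in> N" using N.one_closed by (simp add: zero)
      ultimately show ?thesis unfolding zero by blast
    next
      assume one: "\<one> \<in> L'"
      have "L +> a \<in> N" if "a \<in> carrier R" for a
        using N.smult_closed[of a "L +> \<one>"] one that unfolding L'_def by (simp add: sm)
      then have "carrier ?M \<subseteq> N" unfolding car by blast
      then show ?thesis using Nc by blast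
    qed
  qed
  ultimately have "simple_left_module R ?M" unfolding simple_left_module_def by blast
  moreover have "annihilator R ?M = {a \<in> carrier R. \<forall>m \<in> carrier R. a \<otimes> m \<in> L}"
  proof -
    have "a \<odot>\<^bsub>?M\<^esub> (L +> m) = L \<longleftrightarrow> a \<otimes> m \<in> L" if "a \<in> carrier R" "m \<in> carrier R" for a m
      using that eq0[of "a \<otimes> m"] by (simp add: sm)
    then show ?thesis unfolding annihilator_def car zero by auto
  qed
  ultimately show ?thesis unfolding primitive_ideal_def by metis
qed

text \<open>
  The largest two-sided ideal in \<open>L\<close> is prime: if \<open>J\<close> is not contained
  in \<open>L\<close> then \<open>J + L = A\<close> by maximality, and \<open>I = I J + I L
  \<subseteq> L\<close>.
\<close>

lemma (in ring) primitive_core: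
  assumes L: "max_left_ideal R L"
  defines "P \<equiv> {a \<in> carrier R. \<forall>m \<in> carrier R. a \<otimes> m \<in> L}"
  shows "prime_ideal R P" "P \<subseteq> L"
proof -
  have Ll: "a \<otimes> l \<in> L" if "a \<in> carrier R" "l \<in> L" for a l using L that unfolding max_left_ideal_def left_ideal_def by blast
  interpret L: additive_subgroup L R using L unfolding max_left_ideal_def left_ideal_def by blast
  show PL: "P \<subseteq> L"
  proof
    fix a assume "a \<in> P"
    then have "a \<in> carrier R" "a \<otimes> \<one> \<in> L" unfolding P_def by blast+
    then show "a \<in> L" by simp
  qed
  have P: "ideal P R"
  proof (rule idealI[OF ring_axioms])
    show "subgroup P (add_monoid R)"
    proof (rule add.subgroupI)
      have "\<zero> \<in> P" by (simp add: P_def)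
      then show "P \<noteq> {}" by blast
    qed (auto simp: P_def l_distr l_minus)
  qed (use Ll in \<open>auto simp: P_def m_assoc\<close>)
  show "prime_ideal R P"
    unfolding prime_ideal_def
  proof (intro conjI allI impI)
    show "ideal P R" by (rule P)
    show "P \<noteq> carrier R" using PL L unfolding max_left_ideal_def by blast
    fix I J assume h: "ideal I R \<and> ideal J R \<and> I \<cdot> J \<subseteq> P"
    interpret I: ideal I R using h by blast
    interpret J: ideal J R using h by blast
    show "I \<subseteq> P \<or> J \<subseteq> P"
    proof (cases "J \<subseteq> L")
      case True
      then have "J \<subseteq> P" unfolding P_def using J.I_r_closed J.Icarr by blast
      then show ?thesis ..
    next
      case False
      let ?S = "{j \<oplus> l | j l. j \<in> J \<and> l \<in> L}"
      have "left_ideal R ?S"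
      proof (rule left_idealI)
        show "?S \<subseteq> carrier R" using J.Icarr L.a_Hcarr by blast
        have "\<zero> \<oplus> \<zero> \<in> ?S" using J.zero_closed L.zero_closed by blast
        then show "\<zero> \<in> ?S" by simp
        show "a \<oplus> b \<in> ?S" if ab: "a \<in> ?S" "b \<in> ?S" for a b
        proof -
          obtain j l where 1: "j \<in> J" "l \<in> L" "a = j \<oplus> l" using ab(1) by blast
          obtain j' l' where 2: "j' \<in> J" "l' \<in> L" "b = j' \<oplus> l'" using ab(2) by blast
          note 1 = 1 2
          from 1 have "a \<oplus> b = (j \<oplus> j') \<oplus> (l \<oplus> l')" using J.Icarr L.a_Hcarr by (simp add: a_ac)
          then show ?thesis using 1 J.a_closed L.a_closed by blast
        qed
        show "a \<otimes> b \<in> ?S" if ab: "a \<in> carrier R" "b \<in> ?S" for a b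
        proof -
          obtain j l where 1: "j \<in> J" "l \<in> L" "b = j \<oplus> l" using ab by blast
          then have "a \<otimes> b = a \<otimes> j \<oplus> a \<otimes> l" using ab(1) J.Icarr L.a_Hcarr by (simp add: r_distr)
          then show ?thesis using 1 J.I_l_closed[OF _ ab(1)] Ll[OF ab(1)] by blast
        qed
      qed
      moreover have "L \<subseteq> ?S"
      proof
        fix l assume "l \<in> L"
        moreover then have "l = \<zero> \<oplus> l" using L.a_Hcarr by simp
        ultimately show "l \<in> ?S" using J.zero_closed by blast
      qed
      moreover have "?S \<noteq> L"
      proof
        assume e: "?S = L"
        have "j \<in> L" if "j \<in> J" for j
        proof -
          have "j \<oplus> \<zero> \<in> ?S" using that L.zero_closed by blast
          then show ?thesis unfolding e using J.Icarr[OF that] by simp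
        qed
        then show False using False by blast
      qed
      ultimately have "\<one> \<in> ?S" using L unfolding max_left_ideal_def by blast
      then obtain j l where jl: "j \<in> J" "l \<in> L" "\<one> = j \<oplus> l" by blast
      have "i \<in> L" if i: "i \<in> I" for i
      proof -
        have ic: "i \<in> carrier R" using i I.Icarr by blast
        have "i = i \<otimes> (j \<oplus> l)" using ic by (simp flip: jl(3))
        also have "\<dots> = i \<otimes> j \<oplus> i \<otimes> l" using ic jl J.Icarr L.a_Hcarr by (simp add: r_distr)
        also have "\<dots> \<in> L"
          using Ll[OF ic jl(2)] h ideal_prod.prod[OF i jl(1), of R] PL by (intro L.a_closed) auto
        finally show ?thesis .
      qed
      then have "I \<subseteq> P" unfolding P_def using I.I_r_closed I.Icarr by blast
      then show ?thesis ..
    qed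
  qed
qed

locale simple_module = left_module A M
  for A :: "('a, 'm) ring_scheme" (structure) and M :: "('a, 'b, 'n) module_scheme" +
  assumes simple: "simple_left_module A M"
begin

lemma smult_zero_left: "m \<in> carrier M \<Longrightarrow> \<zero> \<odot>\<^bsub>M\<^esub> m = \<zero>\<^bsub>M\<^esub>"
proof -
  assume m: "m \<in> carrier M"
  have "\<zero> \<odot>\<^bsub>M\<^esub> m \<oplus>\<^bsub>M\<^esub> \<zero> \<odot>\<^bsub>M\<^esub> m = \<zero> \<odot>\<^bsub>M\<^esub> m \<oplus>\<^bsub>M\<^esub> \<zero>\<^bsub>M\<^esub>"
    using lsmult_l_distr[of \<zero> \<zero> m] lsmult_closed[of \<zero> m] m by simp
  then show ?thesis using lsmult_closed[of \<zero> m] m by (simp del: M.r_zero)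
qed

lemma smult_zero_right: "a \<in> carrier A \<Longrightarrow> a \<odot>\<^bsub>M\<^esub> \<zero>\<^bsub>M\<^esub> = \<zero>\<^bsub>M\<^esub>"
proof -
  assume a: "a \<in> carrier A"
  have "a \<odot>\<^bsub>M\<^esub> \<zero>\<^bsub>M\<^esub> \<oplus>\<^bsub>M\<^esub> a \<odot>\<^bsub>M\<^esub> \<zero>\<^bsub>M\<^esub> = a \<odot>\<^bsub>M\<^esub> \<zero>\<^bsub>M\<^esub> \<oplus>\<^bsub>M\<^esub> \<zero>\<^bsub>M\<^esub>"
    using lsmult_r_distr[of a "\<zero>\<^bsub>M\<^esub>" "\<zero>\<^bsub>M\<^esub>"] lsmult_closed[of a "\<zero>\<^bsub>M\<^esub>"] a by simp
  then show ?thesis using lsmult_closed[of a "\<zero>\<^bsub>M\<^esub>"] a by (simp del: M.r_zero)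
qed

lemma smult_minus_left: "a \<in> carrier A \<Longrightarrow> m \<in> carrier M \<Longrightarrow> (\<ominus> a) \<odot>\<^bsub>M\<^esub> m = \<ominus>\<^bsub>M\<^esub> (a \<odot>\<^bsub>M\<^esub> m)"
  using lsmult_l_distr[of "\<ominus> a" a m] smult_zero_left[of m] lsmult_closed
  by (intro M.minus_equality[symmetric]) (auto simp: A.l_neg)

lemma submoduleI:
  assumes "N \<subseteq> carrier M" "\<zero>\<^bsub>M\<^esub> \<in> N" "\<And>a b. a \<in> N \<Longrightarrow> b \<in> N \<Longrightarrow> a \<oplus>\<^bsub>M\<^esub> b \<in> N"
    "\<And>a m. a \<in> carrier A \<Longrightarrow> m \<in> N \<Longrightarrow> a \<odot>\<^bsub>M\<^esub> m \<in> N"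
  shows "submodule N A M"
proof -
  have "\<ominus>\<^bsub>M\<^esub> m \<in> N" if m: "m \<in> N" for m
  proof -
    have "(\<ominus> \<one>) \<odot>\<^bsub>M\<^esub> m \<in> N" using m by (intro assms(4)) auto
    then show ?thesis using m assms(1) smult_minus_left[of \<one> m] lsmult_one[of m] by auto
  qed
  then show ?thesis using assms
    by (intro submodule.intro M.add.subgroupI submodule_axioms.intro) auto
qed

lemma simple_cases: "submodule N A M \<Longrightarrow> n \<in> N \<Longrightarrow> n \<noteq> \<zero>\<^bsub>M\<^esub> \<Longrightarrow> N = carrier M"
  using simple unfolding simple_left_module_def by blast

lemma cyclic:
  assumes u: "u \<in> carrier M" "u \<noteq> \<zero>\<^bsub>M\<^esub>" and m: "m \<in> carrier M"
  obtains a where "a \<in> carrier A" "m = a \<odot>\<^bsub>M\<^esub> u"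
proof -
  let ?N = "(\<lambda>a. a \<odot>\<^bsub>M\<^esub> u) ` carrier A"
  have "submodule ?N A M"
  proof (rule submoduleI)
    show "?N \<subseteq> carrier M" using u lsmult_closed by blast
    show "\<zero>\<^bsub>M\<^esub> \<in> ?N" using smult_zero_left[OF u(1)] by (metis A.zero_closed imageI)
    show "a \<oplus>\<^bsub>M\<^esub> b \<in> ?N" if "a \<in> ?N" "b \<in> ?N" for a b
      using that u by (auto simp flip: lsmult_l_distr)
    show "a \<odot>\<^bsub>M\<^esub> n \<in> ?N" if "a \<in> carrier A" "n \<in> ?N" for a n
      using that u by (auto simp flip: lsmult_assoc)
  qed
  moreover have "u \<in> ?N" using lsmult_one[OF u(1)] by (metis A.one_closed imageI)
  ultimately have "?N = carrier M" using simple_cases u by blast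
  then show ?thesis using that m by blast
qed

lemma nonzero_exists: "\<exists>u \<in> carrier M. u \<noteq> \<zero>\<^bsub>M\<^esub>"
  using simple M.zero_closed unfolding simple_left_module_def by blast

end

lemma simple_moduleI: "simple_left_module A M \<Longrightarrow> simple_module A M"
  by (simp add: simple_module_def simple_module_axioms_def simple_left_module_def)

section \<open>Commutative quotients\<close>

text \<open>
  The quotient \<open>A / P\<close> is a commutative affine domain. Each of the three properties
  of \<open>P\<close> is shown to hold exactly if \<open>A / P\<close> is a field.
\<close>

locale comm_quotient = assoc_algebra K A for K :: "('k, 'm) ring_scheme" and A :: "('k, 'b, 'n) module_scheme" (structure) +
  fixes T P
  assumes K: "field K"
    and T: "finite T" "T \<subseteq> carrier A" "generate_ring A (scalars K A \<union> T) = carrier A"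
    and P: "prime_ideal A P" and comm: "\<And>a b. a \<in> carrier A \<Longrightarrow> b \<in> carrier A \<Longrightarrow> a \<otimes> b \<ominus> b \<otimes> a \<in> P"
begin

sublocale P: ideal P A using P by (simp add: prime_ideal_def)

lemma one_notin: "\<one> \<notin> P" using P P.one_imp_carrier unfolding prime_ideal_def by blast

lemma swap: "ideal Q A \<Longrightarrow> P \<subseteq> Q \<Longrightarrow> a \<in> carrier A \<Longrightarrow> b \<in> carrier A \<Longrightarrow> a \<otimes> b \<in> Q \<longleftrightarrow> b \<otimes> a \<in> Q"
proof -
  have *: "b \<otimes> a \<in> Q" if Q: "ideal Q A" "P \<subseteq> Q" "a \<in> carrier A" "b \<in> carrier A" "a \<otimes> b \<in> Q" for a b
  proof -
    interpret Q: ideal Q A using Q by blast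
    have "(b \<otimes> a \<ominus> a \<otimes> b) \<oplus> a \<otimes> b \<in> Q" using Q comm by (intro Q.a_closed) auto
    then show ?thesis using Q by (simp add: a_minus_def a_assoc l_neg)
  qed
  then show "ideal Q A \<Longrightarrow> P \<subseteq> Q \<Longrightarrow> a \<in> carrier A \<Longrightarrow> b \<in> carrier A \<Longrightarrow> a \<otimes> b \<in> Q \<longleftrightarrow> b \<otimes> a \<in> Q" by blast
qed

lemma P_integral: "a \<in> carrier A \<Longrightarrow> b \<in> carrier A \<Longrightarrow> a \<otimes> b \<in> P \<Longrightarrow> a \<in> P \<or> b \<in> P"
proof (rule prime_ideal_elem[OF P])
  fix c assume c: "a \<in> carrier A" "b \<in> carrier A" "a \<otimes> b \<in> P" "c \<in> carrier A"
  have "b \<otimes> a \<in> P" using swap[OF P.is_ideal] c by blast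
  then have "b \<otimes> (a \<otimes> c) \<in> P" using P.I_r_closed c by (simp flip: m_assoc)
  then show "a \<otimes> c \<otimes> b \<in> P" using swap[OF P.is_ideal subset_refl, of b "a \<otimes> c"] c by blast
qed

abbreviation "B \<equiv> A Quot P"
abbreviation "\<pi> a \<equiv> P +> a"

sublocale \<pi>: ring_hom_ring A B "(+>) P" by (rule P.rcos_ring_hom_ring)

sublocale B: domain B
proof (intro domain.intro domain_axioms.intro cringI)
  show "abelian_group B" by (rule \<pi>.S.is_abelian_group)
  show "comm_monoid B"
  proof (rule \<pi>.S.monoid_comm_monoidI)
    fix s t assume "s \<in> carrier B" "t \<in> carrier B"
    then obtain a b where ab: "a \<in> carrier A" "s = \<pi> a" "b \<in> carrier A" "t = \<pi> b" unfolding P.quot_carrier by blast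
    have "\<pi> (a \<otimes> b) \<ominus>\<^bsub>B\<^esub> \<pi> (b \<otimes> a) = \<zero>\<^bsub>B\<^esub>"
      using P.quot_minus[of "a \<otimes> b" "b \<otimes> a"] P.quot_zero_iff[of "a \<otimes> b \<ominus> b \<otimes> a"] comm ab by auto
    then show "s \<otimes>\<^bsub>B\<^esub> t = t \<otimes>\<^bsub>B\<^esub> s" using ab by simp
  qed
  show "\<one>\<^bsub>B\<^esub> \<noteq> \<zero>\<^bsub>B\<^esub>" using P.quot_zero_iff[of \<one>] one_notin by simp
  fix s t assume st: "s \<in> carrier B" "t \<in> carrier B" "s \<otimes>\<^bsub>B\<^esub> t = \<zero>\<^bsub>B\<^esub>"
  then obtain a b where ab: "a \<in> carrier A" "s = \<pi> a" "b \<in> carrier A" "t = \<pi> b" unfolding P.quot_carrier by blast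
  then have "a \<otimes> b \<in> P" using st P.quot_zero_iff[of "a \<otimes> b"] by simp
  then show "s = \<zero>\<^bsub>B\<^esub> \<or> t = \<zero>\<^bsub>B\<^esub>" using P_integral ab P.quot_zero_iff by auto
qed (auto simp: \<pi>.S.l_distr)

sublocale BO: ore_domain B by (rule B.ore_domain)

lemma nullst:
  assumes f: "f \<in> carrier A" "f \<notin> P"
  obtains m where "P \<subseteq> m" "field_ideal A m" "f \<notin> m"
    "m = P \<Longrightarrow> \<forall>b \<in> carrier B. ring.algebraic B ((+>) P ` scalars K A) b"
  by (rule quotient_nullstellensatz[OF K assoc_algebra_axioms P.is_ideal B.domain_axioms T f]) (rule that)

lemma field_imp_no_larger:
  assumes F: "field_ideal A P" and Q: "ideal Q A" "P \<subset> Q" shows "Q = carrier A"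
  using field_ideal_maximal[OF F] Q ideal.Icarr[OF Q(1)] unfolding maximalideal_def maximalideal_axioms_def by blast

lemma field_imp_locally_closed: "field_ideal A P \<Longrightarrow> locally_closed A P"
proof -
  assume F: "field_ideal A P"
  have "{Q. prime_ideal A Q \<and> P \<subset> Q} = {}" using field_imp_no_larger[OF F] unfolding prime_ideal_def by blast
  then show ?thesis unfolding locally_closed_def using P.a_subset one_notin by auto
qed

text \<open>
  Let \<open>f \<notin> P\<close> lie in all larger primes. By the Nullstellensatz some \<open>m
  \<supseteq> P\<close> with \<open>A / m\<close> a field avoids \<open>f\<close>; it is prime,
  so it is \<open>P\<close>.
\<close>

lemma locally_closed_imp_field: "locally_closed A P \<Longrightarrow> field_ideal A P"
proof -
  assume "locally_closed A P"
  then obtain f where f0: "f \<in> carrier A \<inter> \<Inter>{Q. prime_ideal A Q \<and> P \<subset> Q} - P"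
    using psubset_imp_ex_mem unfolding locally_closed_def by blast
  then have f: "f \<in> carrier A" "f \<notin> P" and larger: "\<And>Q. prime_ideal A Q \<Longrightarrow> P \<subset> Q \<Longrightarrow> f \<in> Q" by simp_all
  obtain m where m: "P \<subseteq> m" "field_ideal A m" "f \<notin> m" using nullst[OF f] by metis
  interpret m: ideal m A using m by (simp add: field_ideal_def)
  have "prime_ideal A m"
  proof (rule completely_prime_imp_prime[OF m.is_ideal])
    show "\<one> \<notin> m" using m by (simp add: field_ideal_def)
    fix a b assume ab: "a \<in> carrier A" "b \<in> carrier A" "a \<otimes> b \<in> m"
    show "a \<in> m \<or> b \<in> m"
    proof (rule disjCI)
      assume "b \<notin> m"
      then obtain e where e: "e \<in> carrier A" "\<one> \<ominus> b \<otimes> e \<in> m" using m(2) ab unfolding field_ideal_def by blast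
      have "a \<otimes> (\<one> \<ominus> b \<otimes> e) \<oplus> (a \<otimes> b) \<otimes> e \<in> m" by (intro m.a_closed m.I_l_closed[OF e(2) ab(1)] m.I_r_closed[OF ab(3) e(1)])
      also have "a \<otimes> (\<one> \<ominus> b \<otimes> e) \<oplus> (a \<otimes> b) \<otimes> e = a"
        using e(1) ab(1,2) by (simp add: r_distr a_minus_def r_minus m_assoc a_assoc l_neg)
      finally show "a \<in> m" .
    qed
  qed
  then have "m = P" using larger[of m] m by (cases "m = P") auto
  then show ?thesis using m by blast
qed

lemma field_imp_primitive: "field_ideal A P \<Longrightarrow> primitive_ideal A P"
proof -
  assume F: "field_ideal A P"
  have "max_left_ideal A P"
    unfolding max_left_ideal_def
  proof (intro conjI allI impI one_notin)
    show "left_ideal A P" unfolding left_ideal_def using P.additive_subgroup_axioms P.I_l_closed by blast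
    fix L assume L: "left_ideal A L \<and> P \<subseteq> L \<and> \<one> \<notin> L"
    interpret L: additive_subgroup L A using L unfolding left_ideal_def by blast
    show "L = P"
    proof (rule ccontr)
      assume "L \<noteq> P"
      then obtain b where b: "b \<in> L" "b \<notin> P" using L by blast
      have bc: "b \<in> carrier A" using b L.a_Hcarr by blast
      obtain e where e: "e \<in> carrier A" "\<one> \<ominus> b \<otimes> e \<in> P" using F b bc unfolding field_ideal_def by blast
      have "e \<otimes> b \<in> L" using L e b unfolding left_ideal_def by blast
      moreover have "(\<one> \<ominus> b \<otimes> e) \<oplus> (b \<otimes> e \<ominus> e \<otimes> b) \<in> P" using e bc comm by (intro P.a_closed) auto
      ultimately have "((\<one> \<ominus> b \<otimes> e) \<oplus> (b \<otimes> e \<ominus> e \<otimes> b)) \<oplus> e \<otimes> b \<in> L" using L by (intro L.a_closed[OF _ \<open>e \<otimes> b \<in> L\<close>]) auto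
      also have "((\<one> \<ominus> b \<otimes> e) \<oplus> (b \<otimes> e \<ominus> e \<otimes> b)) \<oplus> e \<otimes> b = \<one>" using e bc by algebra
      finally show False using L by blast
    qed
  qed
  then have "primitive_ideal A {a \<in> carrier A. \<forall>m \<in> carrier A. a \<otimes> m \<in> P}" by (rule max_left_ideal_primitive)
  moreover have "{a \<in> carrier A. \<forall>m \<in> carrier A. a \<otimes> m \<in> P} = P"
  proof (intro equalityI subsetI)
    fix a assume "a \<in> {a \<in> carrier A. \<forall>m \<in> carrier A. a \<otimes> m \<in> P}"
    then have "a \<in> carrier A" "a \<otimes> \<one> \<in> P" by blast+
    then show "a \<in> P" by simp
  qed (use P.I_r_closed P.Icarr in auto)
  ultimately show ?thesis by simp
qed

text \<open>
  If \<open>a m \<noteq> 0\<close> then \<open>m = e a m\<close> for some \<open>e\<close>. As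
  \<open>1 - e a\<close> commutes with \<open>A\<close> modulo the annihilator \<open>P\<close>,
  it kills all of \<open>A m = M\<close> and thus lies in \<open>P\<close>.
\<close>

lemma primitive_imp_field: "primitive_ideal A P \<Longrightarrow> field_ideal A P"
proof -
  assume "primitive_ideal A P"
  then obtain M :: "('b, 'b set) module" where M: "simple_left_module A M" and PM: "P = annihilator A M"
    unfolding primitive_ideal_def by blast
  interpret M: simple_module A M by (rule simple_moduleI[OF M])
  have kill: "p \<odot>\<^bsub>M\<^esub> m = \<zero>\<^bsub>M\<^esub>" if "p \<in> P" "m \<in> carrier M" for p m using that unfolding PM annihilator_def by blast
  have "\<exists>e \<in> carrier A. \<one> \<ominus> a \<otimes> e \<in> P" if a: "a \<in> carrier A" "a \<notin> P" for a
  proof -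
    obtain m where m: "m \<in> carrier M" "a \<odot>\<^bsub>M\<^esub> m \<noteq> \<zero>\<^bsub>M\<^esub>" using a unfolding PM annihilator_def by blast
    have m0: "m \<noteq> \<zero>\<^bsub>M\<^esub>" using m M.smult_zero_right[OF a(1)] by blast
    obtain e where e: "e \<in> carrier A" "m = e \<odot>\<^bsub>M\<^esub> (a \<odot>\<^bsub>M\<^esub> m)"
      using M.cyclic[OF M.lsmult_closed[OF a(1) m(1)] m(2) m(1)] by metis
    have z: "(\<one> \<ominus> e \<otimes> a) \<odot>\<^bsub>M\<^esub> m = \<zero>\<^bsub>M\<^esub>"
    proof -
      have "(\<one> \<ominus> e \<otimes> a) \<odot>\<^bsub>M\<^esub> m = \<one> \<odot>\<^bsub>M\<^esub> m \<oplus>\<^bsub>M\<^esub> \<ominus>\<^bsub>M\<^esub> ((e \<otimes> a) \<odot>\<^bsub>M\<^esub> m)"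
        unfolding a_minus_def using e a m by (simp add: M.lsmult_l_distr M.smult_minus_left)
      also have "\<dots> = m \<oplus>\<^bsub>M\<^esub> \<ominus>\<^bsub>M\<^esub> m" using e a m by (simp add: M.lsmult_one M.lsmult_assoc)
      finally show ?thesis using m by (simp add: M.M.r_neg)
    qed
    have cl: "\<one> \<ominus> e \<otimes> a \<in> carrier A" using e a by auto
    have "(\<one> \<ominus> e \<otimes> a) \<odot>\<^bsub>M\<^esub> n = \<zero>\<^bsub>M\<^esub>" if n: "n \<in> carrier M" for n
    proof -
      obtain c where c: "c \<in> carrier A" "n = c \<odot>\<^bsub>M\<^esub> m" using M.cyclic[OF m(1) m0 n] by metis
      let ?d = "\<one> \<ominus> e \<otimes> a"
      have "?d \<odot>\<^bsub>M\<^esub> n = ((?d \<otimes> c \<ominus> c \<otimes> ?d) \<oplus> c \<otimes> ?d) \<odot>\<^bsub>M\<^esub> m"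
        using c m cl by (simp add: M.lsmult_assoc a_minus_def a_assoc l_neg)
      also have "\<dots> = (?d \<otimes> c \<ominus> c \<otimes> ?d) \<odot>\<^bsub>M\<^esub> m \<oplus>\<^bsub>M\<^esub> c \<odot>\<^bsub>M\<^esub> (?d \<odot>\<^bsub>M\<^esub> m)"
        using c m cl M.lsmult_l_distr[of "?d \<otimes> c \<ominus> c \<otimes> ?d" "c \<otimes> ?d" m] M.lsmult_assoc[of c ?d m] by auto
      also have "\<dots> = \<zero>\<^bsub>M\<^esub>" unfolding z kill[OF comm[OF cl c(1)] m(1)] using M.smult_zero_right[OF c(1)] by simp
      finally show ?thesis .
    qed
    then have "\<one> \<ominus> e \<otimes> a \<in> P" using cl unfolding PM annihilator_def by blast
    then have "(\<one> \<ominus> e \<otimes> a) \<oplus> (e \<otimes> a \<ominus> a \<otimes> e) \<in> P" using e a comm by (intro P.a_closed) auto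
    also have "(\<one> \<ominus> e \<otimes> a) \<oplus> (e \<otimes> a \<ominus> a \<otimes> e) = \<one> \<ominus> a \<otimes> e" using e a by algebra
    finally show ?thesis using e by blast
  qed
  then show ?thesis unfolding field_ideal_def using one_notin P.is_ideal by blast
qed

lemma frac_scalars_eq: "frac_scalars K A P = BO.emb ` (+>) P ` scalars K A"
  unfolding frac_scalars_def by (simp add: image_image)

lemma scalars_sub: "scalars K A \<subseteq> carrier A" unfolding scalars_def by auto

lemma algebraic_emb: "b \<in> carrier B \<Longrightarrow> ring.algebraic (Frac B) (frac_scalars K A P) (BO.emb b) \<longleftrightarrow> ring.algebraic B ((+>) P ` scalars K A) b"
  unfolding frac_scalars_eq
  by (rule algebraic_transport[OF \<pi>.S.ring_axioms BO.ring_F BO.emb_hom BO.emb_inj]) (use scalars_sub in auto)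

lemma scalars_quot_subfield: "subfield ((+>) P ` scalars K A) B"
proof -
  have "\<one> \<noteq> \<zero>" using one_notin P.zero_closed by metis
  then show ?thesis by (intro \<pi>.img_is_subfield(2) scalars_subfield(1)[OF K assoc_algebra_axioms]) auto
qed

text \<open>
  The field of fractions of \<open>A / P\<close> is its own centre, so all elements of \<open>A
  / P\<close> are algebraic and hence invertible.
\<close>

lemma rational_imp_field: "rational K A P \<Longrightarrow> field_ideal A P"
proof -
  assume r: "rational K A P"
  have "\<exists>e \<in> carrier A. \<one> \<ominus> a \<otimes> e \<in> P" if a: "a \<in> carrier A" "a \<notin> P" for a
  proof -
    have c: "\<pi> a \<in> carrier B" "\<pi> a \<noteq> \<zero>\<^bsub>B\<^esub>" using a P.quot_zero_iff by auto
    have "BO.emb (\<pi> a) \<in> ring_centre (Frac B)"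
    proof (rule BO.centralI)
      fix b assume b: "b \<in> carrier B"
      show "BO.emb (\<pi> a) \<otimes>\<^bsub>Frac B\<^esub> BO.emb b = BO.emb b \<otimes>\<^bsub>Frac B\<^esub> BO.emb (\<pi> a)"
        using b c B.m_comm[of b "\<pi> a"] by (simp flip: BO.emb.hom_mult)
    qed (use c in auto)
    then have "ring.algebraic B ((+>) P ` scalars K A) (\<pi> a)" using r algebraic_emb[OF c(1)] unfolding rational_def by blast
    then obtain q where q: "set q \<subseteq> (+>) P ` scalars K A" "\<pi> a \<otimes>\<^bsub>B\<^esub> ring.eval B q (\<pi> a) = \<one>\<^bsub>B\<^esub>"
      using B.algebraic_inverse[OF scalars_quot_subfield c] by blast
    have "set q \<subseteq> carrier B" using q(1) scalars_sub \<pi>.hom_closed by blast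
    then have "ring.eval B q (\<pi> a) \<in> carrier B" using c(1) by (rule \<pi>.S.eval_in_carrier)
    then obtain e where e: "e \<in> carrier A" "ring.eval B q (\<pi> a) = \<pi> e" unfolding P.quot_carrier by blast
    have "\<pi> (\<one> \<ominus> a \<otimes> e) = \<zero>\<^bsub>B\<^esub>" using q e a P.quot_minus[of \<one> "a \<otimes> e", symmetric] by (simp add: a_minus_def \<pi>.S.r_neg)
    then show ?thesis using P.quot_zero_iff[of "\<one> \<ominus> a \<otimes> e"] e a by auto
  qed
  then show ?thesis unfolding field_ideal_def using one_notin P.is_ideal by blast
qed

text \<open>
  The ideal that the Nullstellensatz provides above \<open>P\<close> is \<open>P\<close> itself,
  and \<open>A / P\<close> is algebraic.
\<close>

lemma field_imp_rational: "field_ideal A P \<Longrightarrow> rational K A P"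
proof -
  assume F: "field_ideal A P"
  obtain m where m: "P \<subseteq> m" "field_ideal A m" "m = P \<Longrightarrow> \<forall>b \<in> carrier B. ring.algebraic B ((+>) P ` scalars K A) b"
    using nullst[OF one_closed one_notin] by metis
  have "m = P"
  proof (rule ccontr)
    assume "m \<noteq> P"
    then have "m = carrier A" using field_imp_no_larger[OF F, of m] m unfolding field_ideal_def by blast
    then show False using m unfolding field_ideal_def by auto
  qed
  then have alg: "\<forall>b \<in> carrier B. ring.algebraic B ((+>) P ` scalars K A) b" using m by blast
  have "ring.algebraic (Frac B) (frac_scalars K A P) z" if z: "z \<in> ring_centre (Frac B)" for z
  proof -
    have "z \<in> carrier (Frac B)" using z unfolding ring_centre_def by blast
    then obtain S C where SC: "S \<in> carrier B" "S \<noteq> \<zero>\<^bsub>B\<^esub>" "C \<in> carrier B" "z = left_frac B S C" using BO.F_cases by metis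
    obtain s where s: "s \<in> carrier A" "S = \<pi> s" using SC unfolding P.quot_carrier by blast
    then obtain e where e: "e \<in> carrier A" "\<one> \<ominus> s \<otimes> e \<in> P" using F SC P.quot_zero_iff[of s] unfolding field_ideal_def by blast
    have "\<pi> \<one> \<ominus>\<^bsub>B\<^esub> \<pi> (s \<otimes> e) = \<zero>\<^bsub>B\<^esub>" using P.quot_minus[of \<one> "s \<otimes> e"] P.quot_zero_iff[of "\<one> \<ominus> s \<otimes> e"] e s by auto
    then have se: "\<pi> e \<otimes>\<^bsub>B\<^esub> S = \<one>\<^bsub>B\<^esub>" using e s B.m_comm[of "\<pi> e" S] by simp
    have "\<pi> e \<noteq> \<zero>\<^bsub>B\<^esub>" using se SC by auto
    then have "z = BO.emb (\<pi> e \<otimes>\<^bsub>B\<^esub> C)" using BO.lf_expand[of S C "\<pi> e"] SC e se by simp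
    then show ?thesis using algebraic_emb[of "\<pi> e \<otimes>\<^bsub>B\<^esub> C"] alg e SC by auto
  qed
  then show ?thesis unfolding rational_def using BO.centre_subfield by blast
qed

end

section \<open>Extension and contraction of prime ideals\<close>

context skew_gen
begin

lemma quotient_spanR:
  assumes P: "ideal P A"
  shows "poly_span (A Quot P) ((\<lambda>r. P +> \<iota> r) ` carrier R) (P +> x) n = (\<lambda>u. P +> u) ` spanR n"
proof -
  interpret P: ideal P A by fact
  interpret h: ring_hom_ring A "A Quot P" "(+>) P" by (rule P.rcos_ring_hom_ring)
  show ?thesis
  proof (induction n)
    case 0
    then show ?case using h.hom_zero by simp
  next
    case (Suc n)
    have e: "P +> (\<iota> r \<otimes> x [^] n \<oplus> y) = (P +> \<iota> r) \<otimes>\<^bsub>A Quot P\<^esub> (P +> x) [^]\<^bsub>A Quot P\<^esub> n \<oplus>\<^bsub>A Quot P\<^esub> (P +> y)"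
      if "r \<in> carrier R" "y \<in> spanR n" for r y
      using that spanR_closed[OF that(2)] by (simp add: h.hom_nat_pow)
    show ?case
    proof (intro equalityI subsetI)
      fix u assume "u \<in> poly_span (A Quot P) ((\<lambda>r. P +> \<iota> r) ` carrier R) (P +> x) (Suc n)"
      then obtain r y where ry: "r \<in> carrier R" "y \<in> spanR n"
        "u = (P +> \<iota> r) \<otimes>\<^bsub>A Quot P\<^esub> (P +> x) [^]\<^bsub>A Quot P\<^esub> n \<oplus>\<^bsub>A Quot P\<^esub> (P +> y)"
        unfolding poly_span.simps Suc by blast
      then have "u = P +> (\<iota> r \<otimes> x [^] n \<oplus> y)" using e by simp
      moreover have "\<iota> r \<otimes> x [^] n \<oplus> y \<in> spanR (Suc n)" using ry by (intro poly_span_SucI) auto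
      ultimately show "u \<in> (\<lambda>u. P +> u) ` spanR (Suc n)" by blast
    next
      fix u assume "u \<in> (\<lambda>u. P +> u) ` spanR (Suc n)"
      then obtain r y where "r \<in> carrier R" "y \<in> spanR n" "u = P +> (\<iota> r \<otimes> x [^] n \<oplus> y)" by auto
      then show "u \<in> poly_span (A Quot P) ((\<lambda>r. P +> \<iota> r) ` carrier R) (P +> x) (Suc n)"
        unfolding poly_span.simps Suc using e by blast
    qed
  qed
qed

lemma quotient_skew_gen:
  assumes P: "ideal P A"
  shows "skew_gen R (A Quot P) \<delta> (\<lambda>r. P +> \<iota> r) (P +> x)"
proof -
  interpret P: ideal P A by fact
  interpret h: ring_hom_ring A "A Quot P" "(+>) P" by (rule P.rcos_ring_hom_ring)
  show ?thesis
  proof (intro skew_gen.intro skew_pre.intro skew_pre_axioms.intro skew_gen_axioms.intro)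
    show "(\<lambda>r. P +> \<iota> r) \<in> ring_hom R (A Quot P)"
      by (rule ring_hom_memI) auto
    show "(P +> x) \<otimes>\<^bsub>A Quot P\<^esub> (P +> \<iota> r) = (P +> \<iota> r) \<otimes>\<^bsub>A Quot P\<^esub> (P +> x) \<oplus>\<^bsub>A Quot P\<^esub> (P +> \<iota> (\<delta> r))"
      if "r \<in> carrier R" for r
    proof -
      have "P +> (x \<otimes> \<iota> r) = P +> (\<iota> r \<otimes> x \<oplus> \<iota> (\<delta> r))" using x_comm that by simp
      then show ?thesis using that by (simp del: \<iota>.hom_add)
    qed
    show "carrier (A Quot P) = (\<Union>n. poly_span (A Quot P) ((\<lambda>r. P +> \<iota> r) ` carrier R) (P +> x) n)"
      unfolding quotient_spanR[OF P] P.quot_carrier gen by blast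
  qed (use R.cring_axioms h.S.ring_axioms d_add d_mult in auto)
qed

definition "contr P = {r \<in> carrier R. \<iota> r \<in> P}"

lemma contr_ideal: "ideal P A \<Longrightarrow> ideal (contr P) R"
  unfolding contr_def by (rule \<iota>.ideal_vimage)

lemma contr_delta: "ideal P A \<Longrightarrow> \<delta> ` contr P \<subseteq> contr P"
proof clarify
  fix r assume P: "ideal P A" and r: "r \<in> contr P"
  interpret P: ideal P A by fact
  have rc: "r \<in> carrier R" "\<iota> r \<in> P" using r unfolding contr_def by auto
  have "x \<otimes> \<iota> r \<ominus> \<iota> r \<otimes> x \<in> P" unfolding a_minus_def using rc
    by (intro P.a_closed P.a_inv_closed P.I_l_closed P.I_r_closed) auto
  also have "x \<otimes> \<iota> r \<ominus> \<iota> r \<otimes> x = \<iota> (\<delta> r)"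
    using rc(1) by (simp add: x_comm a_minus_def a_ac r_neg r_neg1 r_neg2)
  finally show "\<delta> r \<in> contr P" using rc unfolding contr_def by simp
qed

text \<open>
  Products \<open>i x\<^sup>n v\<close> with \<open>v \<in> J A\<close> lie in \<open>I J
  A\<close> because \<open>J A\<close> is a left ideal, \<open>J\<close> being a
  \<open>\<delta>\<close>-ideal.
\<close>

lemma ext_mult:
  assumes P: "ideal P A" and I: "ideal I R" and J: "ideal J R" "\<delta> ` J \<subseteq> J"
    and IJ: "\<And>i j. i \<in> I \<Longrightarrow> j \<in> J \<Longrightarrow> \<iota> (i \<otimes>\<^bsub>R\<^esub> j) \<in> P"
    and u: "u \<in> ext I" and v: "v \<in> ext J"
  shows "u \<otimes> v \<in> P"
proof -
  interpret P: ideal P A by fact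
  interpret J': ideal "ext J" A by (rule ext_ideal[OF J])
  have 1: "\<iota> i \<otimes> w \<in> P" if i: "i \<in> I" and w: "w \<in> pspan J n" for i w n
    using w
  proof (induction n arbitrary: w)
    case 0
    then show ?case using i ideal.Icarr[OF I] P.zero_closed by simp
  next
    case (Suc n)
    then obtain j y where 1: "j \<in> J" "y \<in> pspan J n" "w = \<iota> j \<otimes> x [^] n \<oplus> y" by auto
    have c: "i \<in> carrier R" "j \<in> carrier R" "y \<in> carrier A"
      using i 1 ideal.Icarr[OF I] ideal.Icarr[OF J(1)] span_in_spanR[of J n] by blast+
    have "\<iota> i \<otimes> w = \<iota> (i \<otimes>\<^bsub>R\<^esub> j) \<otimes> x [^] n \<oplus> \<iota> i \<otimes> y" unfolding 1 using c by (simp add: r_distr m_assoc)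
    also have "\<dots> \<in> P" by (rule P.a_closed[OF P.I_r_closed[OF IJ[OF i 1(1)]] Suc.IH[OF 1(2)]]) simp
    finally show ?case .
  qed
  have "u \<otimes> v \<in> P" if "u \<in> pspan I n" for u n
    using that
  proof (induction n arbitrary: u)
    case 0
    then show ?case using J'.Icarr[OF v] P.zero_closed by simp
  next
    case (Suc n)
    then obtain i y where 2: "i \<in> I" "y \<in> pspan I n" "u = \<iota> i \<otimes> x [^] n \<oplus> y" by auto
    have c: "i \<in> carrier R" "v \<in> carrier A" "y \<in> carrier A"
      using 2 ideal.Icarr[OF I] J'.Icarr[OF v] span_in_spanR[of I n] by blast+
    have "x [^] n \<otimes> v \<in> ext J" using J'.I_l_closed[OF v] by simp
    then have "\<iota> i \<otimes> (x [^] n \<otimes> v) \<in> P" using 1[OF 2(1)] unfolding ext_def by blast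
    moreover have "u \<otimes> v = \<iota> i \<otimes> (x [^] n \<otimes> v) \<oplus> y \<otimes> v" unfolding 2 using c by (simp add: l_distr m_assoc)
    ultimately show ?case using P.a_closed Suc.IH[OF 2(2)] by simp
  qed
  then show ?thesis using u unfolding ext_def by blast
qed

text \<open>
  By \<open>ext_mult\<close> the contraction is prime with respect to products of
  \<open>\<delta>\<close>-ideals.
\<close>

lemma contr_prime:
  assumes nat: "nat_units R" and acc: "acc_ideals R" and P: "prime_ideal A P"
  shows "primeideal (contr P) R"
proof (rule delta_prime_imp_prime[OF nat acc])
  have Pi: "ideal P A" using P by (simp add: prime_ideal_def)
  interpret P: ideal P A by (rule Pi)
  show "ideal (contr P) R" "\<delta> ` contr P \<subseteq> contr P" using contr_ideal contr_delta Pi by auto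
  have "\<one> \<notin> P" using P P.one_imp_carrier unfolding prime_ideal_def by blast
  then show "\<one>\<^bsub>R\<^esub> \<notin> contr P" by (simp add: contr_def)
  fix I J assume I: "ideal I R" "\<delta> ` I \<subseteq> I" and J: "ideal J R" "\<delta> ` J \<subseteq> J"
    and IJ: "\<And>i j. i \<in> I \<Longrightarrow> j \<in> J \<Longrightarrow> i \<otimes>\<^bsub>R\<^esub> j \<in> contr P"
  have "ext I \<cdot> ext J \<subseteq> P"
  proof
    fix s assume "s \<in> ext I \<cdot> ext J"
    then show "s \<in> P"
    proof (induction s rule: ideal_prod.induct)
      case (prod i j)
      show ?case by (rule ext_mult[OF Pi I(1) J _ prod]) (use IJ in \<open>auto simp: contr_def\<close>)
    qed (rule P.a_closed)
  qed
  then have "ext I \<subseteq> P \<or> ext J \<subseteq> P" using P ext_ideal[OF I] ext_ideal[OF J] unfolding prime_ideal_def by blast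
  then show "I \<subseteq> contr P \<or> J \<subseteq> contr P"
    using ext_mem[OF I(1)] ext_mem[OF J(1)] ideal.Icarr[OF I(1)] ideal.Icarr[OF J(1)] unfolding contr_def by blast
qed

lemma commutative_if_delta_zero:
  assumes z: "\<And>r. r \<in> carrier R \<Longrightarrow> \<iota> (\<delta> r) = \<zero>" and a: "a \<in> carrier A" and b: "b \<in> carrier A"
  shows "a \<otimes> b = b \<otimes> a"
proof -
  have "v \<otimes> \<iota> r = \<iota> r \<otimes> v" if r: "r \<in> carrier R" and v: "v \<in> spanR n" for r v n
    using v
  proof (induction n arbitrary: v)
    case 0
    then show ?case using r by simp
  next
    case (Suc n)
    then obtain s y where 1: "s \<in> carrier R" "y \<in> spanR n" "v = \<iota> s \<otimes> x [^] n \<oplus> y" by auto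
    have yc: "y \<in> carrier A" using 1 by blast
    have xn: "x [^] (k::nat) \<otimes> \<iota> r = \<iota> r \<otimes> x [^] k" for k
    proof (induction k)
      case (Suc k)
      have "x [^] Suc k \<otimes> \<iota> r = x [^] k \<otimes> (x \<otimes> \<iota> r)" using r by (simp add: m_assoc)
      also have "\<dots> = (x [^] k \<otimes> \<iota> r) \<otimes> x" using r z by (simp add: x_comm m_assoc)
      finally show ?case using r unfolding Suc by (simp add: m_assoc)
    qed (use r in simp)
    have "v \<otimes> \<iota> r = \<iota> s \<otimes> (x [^] n \<otimes> \<iota> r) \<oplus> y \<otimes> \<iota> r" unfolding 1 using r 1(1) yc by (simp add: l_distr m_assoc)
    also have "\<dots> = (\<iota> s \<otimes> \<iota> r) \<otimes> x [^] n \<oplus> \<iota> r \<otimes> y" unfolding xn Suc.IH[OF 1(2)] using r 1(1) by (simp add: m_assoc)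
    also have "\<iota> s \<otimes> \<iota> r = \<iota> r \<otimes> \<iota> s" using r 1(1) by (simp add: R.m_comm flip: \<iota>.hom_mult)
    finally show ?case unfolding 1 using r 1(1) yc by (simp add: r_distr m_assoc)
  qed
  then have cr: "b \<otimes> \<iota> r = \<iota> r \<otimes> b" if "r \<in> carrier R" for r using that b gen by blast
  have bx: "v \<otimes> x = x \<otimes> v" if v: "v \<in> spanR n" for v n
    using v
  proof (induction n arbitrary: v)
    case (Suc n)
    then obtain s y where 1: "s \<in> carrier R" "y \<in> spanR n" "v = \<iota> s \<otimes> x [^] n \<oplus> y" by auto
    have yc: "y \<in> carrier A" using 1 by blast
    have "v \<otimes> x = \<iota> s \<otimes> (x [^] n \<otimes> x) \<oplus> x \<otimes> y" unfolding 1 using 1(1) yc Suc.IH[OF 1(2)] by (simp add: l_distr m_assoc)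
    also have "x [^] n \<otimes> x = x \<otimes> x [^] n" by (metis x_closed nat_pow_Suc nat_pow_Suc2)
    also have "\<iota> s \<otimes> (x \<otimes> x [^] n) = x \<otimes> (\<iota> s \<otimes> x [^] n)" using 1(1) z by (simp add: x_comm flip: m_assoc)
    finally show ?case unfolding 1 using 1(1) yc by (simp add: r_distr)
  qed simp
  then have cx: "b \<otimes> x = x \<otimes> b" using b gen by blast
  have cxn: "b \<otimes> x [^] (n::nat) = x [^] n \<otimes> b" for n
  proof (induction n)
    case (Suc n)
    have "b \<otimes> x [^] Suc n = (b \<otimes> x [^] n) \<otimes> x" using b by (simp add: m_assoc)
    also have "\<dots> = x [^] n \<otimes> (b \<otimes> x)" unfolding Suc using b by (simp add: m_assoc)
    finally show ?case unfolding cx using b by (simp add: m_assoc)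
  qed (use b in simp)
  have "u \<otimes> b = b \<otimes> u" if "u \<in> spanR n" for u n
    using that
  proof (induction n arbitrary: u)
    case (Suc n)
    then obtain s y where 1: "s \<in> carrier R" "y \<in> spanR n" "u = \<iota> s \<otimes> x [^] n \<oplus> y" by auto
    have yc: "y \<in> carrier A" using 1 by blast
    have "u \<otimes> b = \<iota> s \<otimes> (x [^] n \<otimes> b) \<oplus> b \<otimes> y" unfolding 1 using 1(1) yc b Suc.IH[OF 1(2)] by (simp add: l_distr m_assoc)
    also have "\<dots> = (b \<otimes> \<iota> s) \<otimes> x [^] n \<oplus> b \<otimes> y" unfolding cxn[symmetric] cr[OF 1(1)] using 1(1) b by (simp add: m_assoc)
    finally show ?case unfolding 1 using 1(1) yc b by (simp add: r_distr m_assoc)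
  qed (use b in simp)
  then show ?thesis using a gen by blast
qed

end

text \<open>
  The ring \<open>R[x;\<delta>]\<close> over an affine algebra in characteristic zero, with the
  consequences of these assumptions that the proof uses; the freeness of the powers of
  \<open>x\<close> enters as uniqueness of the leading coefficient.
\<close>

locale affine_skew = skew_gen R A \<delta> \<iota> x
  for K :: "('k, 'm) ring_scheme" and R :: "('k, 'a, 'n) module_scheme" and A :: "('k, 'b, 'p) module_scheme" (structure)
    and \<delta> \<iota> x +
  fixes S
  assumes K: "field K" and R_alg: "assoc_algebra K R" and A_alg: "assoc_algebra K A"
    and scal: "\<iota> ` scalars K R = scalars K A"
    and uniq0: "\<And>r y n. r \<in> carrier R \<Longrightarrow> y \<in> spanR n \<Longrightarrow> \<iota> r \<otimes> x [^] (n::nat) \<oplus> y = \<zero> \<Longrightarrow> r = \<zero>\<^bsub>R\<^esub>"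
    and nat: "nat_units R" and acc: "acc_ideals R"
    and S: "finite S" "S \<subseteq> carrier R" "generate_ring R (scalars K R \<union> S) = carrier R"
begin

lemma scalars_R: "scalars K R \<subseteq> carrier R"
proof -
  interpret K: assoc_algebra K R by (rule R_alg)
  show ?thesis unfolding scalars_def by auto
qed

lemma scalars_A: "scalars K A \<subseteq> carrier A"
  using scalars_R by (auto simp flip: scal)

lemma gen_A: "generate_ring A (scalars K A \<union> insert x (\<iota> ` S)) = carrier A"
proof
  let ?G = "generate_ring A (scalars K A \<union> insert x (\<iota> ` S))"
  have H: "scalars K A \<union> insert x (\<iota> ` S) \<subseteq> carrier A" using scalars_A S by auto
  show "?G \<subseteq> carrier A" by (rule A.generate_ring_incl[OF H])
  have "\<iota> ` carrier R = generate_ring A (\<iota> ` (scalars K R \<union> S))"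
    unfolding S(3)[symmetric] using scalars_R S by (intro R.generate_ring_image hom A.ring_axioms) auto
  also have "\<dots> \<subseteq> ?G" using H by (intro A.mono_generate_ring) (auto simp: image_Un scal)
  finally have R: "\<iota> r \<in> ?G" if "r \<in> carrier R" for r using that by blast
  have xn: "x [^] n \<in> ?G" for n :: nat by (induction n) (auto intro: generate_ring.intros)
  have "spanR n \<subseteq> ?G" for n
  proof (induction n)
    case 0
    then show ?case using A.zero_in_generate by simp
  next
    case (Suc n)
    then show ?case using R xn by (auto intro!: generate_ring.eng_add generate_ring.eng_mult)
  qed
  then show "carrier A \<subseteq> ?G" using gen by blast
qed

lemma comm_case:
  assumes P: "prime_ideal A P" and d: "\<delta> ` carrier R \<subseteq> contr P"
  shows "comm_quotient K A (insert x (\<iota> ` S)) P"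
proof (intro comm_quotient.intro comm_quotient_axioms.intro A_alg K P gen_A)
  have Pi: "ideal P A" using P by (simp add: prime_ideal_def)
  interpret P: ideal P A by (rule Pi)
  interpret Q: skew_gen R "A Quot P" \<delta> "\<lambda>r. P +> \<iota> r" "P +> x" by (rule quotient_skew_gen[OF Pi])
  interpret h: ring_hom_ring A "A Quot P" "(+>) P" by (rule P.rcos_ring_hom_ring)
  fix a b assume ab: "a \<in> carrier A" "b \<in> carrier A"
  have "P +> \<iota> (\<delta> r) = \<zero>\<^bsub>A Quot P\<^esub>" if "r \<in> carrier R" for r
    using that d P.quot_zero_iff unfolding contr_def by auto
  then have "(P +> a) \<otimes>\<^bsub>A Quot P\<^esub> (P +> b) = (P +> b) \<otimes>\<^bsub>A Quot P\<^esub> (P +> a)"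
    using ab by (intro Q.commutative_if_delta_zero) auto
  then have "P +> (a \<otimes> b) = P +> (b \<otimes> a)" using ab by simp
  then have "P +> (a \<otimes> b \<ominus> b \<otimes> a) = \<zero>\<^bsub>A Quot P\<^esub>" using ab by (simp flip: P.quot_minus)
  then show "a \<otimes> b \<ominus> b \<otimes> a \<in> P" using ab P.quot_zero_iff by simp
qed (use S in auto)

text \<open>
  Uniqueness of coefficients: the coefficients of an element of \<open>Q A\<close> all lie in
  \<open>Q\<close>.
\<close>

lemma ext_lead:
  assumes Q: "ideal Q R" and r: "r \<in> carrier R" and y: "y \<in> spanR n" and e: "\<iota> r \<otimes> x [^] n \<oplus> y \<in> ext Q"
  shows "r \<in> Q"
proof -
  interpret Q: ideal Q R by (rule Q)
  have yc: "y \<in> carrier A" using y by blast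
  define u where "u = \<iota> r \<otimes> x [^] n \<oplus> y"
  have uc: "u \<in> carrier A" "u \<in> spanR (Suc n)" unfolding u_def using r y yc by auto
  have "r \<in> Q" if "u \<in> pspan Q N" for N
    using that
  proof (induction N)
    case 0
    then show ?case using uniq0[OF r y] Q.zero_closed u_def by simp
  next
    case (Suc N)
    obtain q v where qv: "q \<in> Q" "v \<in> pspan Q N" and ue: "u = \<iota> q \<otimes> x [^] N \<oplus> v" using Suc.prems by auto
    have v: "v \<in> spanR N" using qv span_in_spanR[of Q N] Q.a_subset by blast
    have c: "q \<in> carrier R" "v \<in> carrier A" using qv Q.Icarr v by auto
    consider "N > n" | "N = n" | "N < n" by linarith
    then show ?case
    proof cases
      case 1
      have "u \<in> spanR N" by (rule subsetD[OF spanR_mono[OF Suc_leI[OF 1]] uc(2)])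
      then have "v \<ominus> u \<in> spanR N" using v by (intro spanR_minus)
      moreover have "\<iota> q \<otimes> x [^] N \<oplus> (v \<ominus> u) = \<zero>"
      proof -
        have "\<iota> q \<otimes> x [^] N \<oplus> (v \<ominus> u) = (\<iota> q \<otimes> x [^] N \<oplus> v) \<ominus> u" using c uc by (simp add: a_minus_def a_assoc)
        then show ?thesis using ue uc by simp
      qed
      ultimately have "q = \<zero>\<^bsub>R\<^esub>" using uniq0 c by blast
      then have "u = v" using ue c by simp
      then show ?thesis using Suc.IH qv(2) by blast
    next
      case 2
      have "\<iota> (r \<ominus>\<^bsub>R\<^esub> q) \<otimes> x [^] n \<oplus> (y \<ominus> v) = \<zero>"
      proof -
        have "\<iota> (r \<ominus>\<^bsub>R\<^esub> q) \<otimes> x [^] n \<oplus> (y \<ominus> v) = u \<ominus> (\<iota> q \<otimes> x [^] n \<oplus> v)"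
          unfolding u_def R.minus_eq a_minus_def using r c yc by (simp add: l_distr l_minus minus_add a_ac)
        also have "\<dots> = \<zero>" using ue 2 uc by simp
        finally show ?thesis .
      qed
      moreover have "y \<ominus> v \<in> spanR n" using y v 2 by (intro spanR_minus) auto
      ultimately have "r \<ominus>\<^bsub>R\<^esub> q = \<zero>\<^bsub>R\<^esub>" using uniq0[of "r \<ominus>\<^bsub>R\<^esub> q"] r c by simp
      then have "r = q" using r c by simp
      then show ?thesis using qv(1) by simp
    next
      case 3
      have "u \<in> spanR (Suc N)" using Suc.prems span_in_spanR[of Q "Suc N"] Q.a_subset by blast
      then have "u \<in> spanR n" by (rule subsetD[OF spanR_mono[OF Suc_leI[OF 3]]])
      then have "y \<ominus> u \<in> spanR n" using y by (intro spanR_minus)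
      moreover have "\<iota> r \<otimes> x [^] n \<oplus> (y \<ominus> u) = \<zero>"
      proof -
        have "\<iota> r \<otimes> x [^] n \<oplus> (y \<ominus> u) = (\<iota> r \<otimes> x [^] n \<oplus> y) \<ominus> u" using r yc uc by (simp add: a_minus_def a_assoc)
        then show ?thesis using uc by (simp flip: u_def)
      qed
      ultimately have "r = \<zero>\<^bsub>R\<^esub>" using uniq0 r by blast
      then show ?thesis using Q.zero_closed by simp
    qed
  qed
  then show ?thesis using e unfolding ext_def u_def by blast
qed

lemma contr_ext:
  assumes Q: "ideal Q R" shows "contr (ext Q) = Q"
proof (intro equalityI subsetI)
  fix r assume "r \<in> contr (ext Q)"
  then have r: "r \<in> carrier R" "\<iota> r \<otimes> x [^] (0::nat) \<oplus> \<zero> \<in> ext Q" unfolding contr_def by simp_all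
  show "r \<in> Q" by (rule ext_lead[OF Q r(1) spanR_zero r(2)])
qed (use ext_mem[OF Q] ideal.Icarr[OF Q] in \<open>simp add: contr_def\<close>)

lemma quotient_skew_prime:
  assumes Q: "prime_diff_ideal R \<delta> Q"
  shows "skew_prime R (A Quot ext Q) \<delta> (\<lambda>r. ext Q +> \<iota> r) (ext Q +> x) Q"
proof -
  have Qp: "primeideal Q R" "\<delta> ` Q \<subseteq> Q" using Q unfolding prime_diff_ideal_def by auto
  interpret Q: primeideal Q R by (rule Qp)
  have E: "ideal (ext Q) A" using ext_ideal Q.is_ideal Qp by blast
  interpret E: ideal "ext Q" A by (rule E)
  interpret h: ring_hom_ring A "A Quot ext Q" "(+>) (ext Q)" by (rule E.rcos_ring_hom_ring)
  show ?thesis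
  proof (intro skew_prime.intro skew_prime_axioms.intro quotient_skew_gen E Qp)
    show "ext Q +> \<iota> r = \<zero>\<^bsub>A Quot ext Q\<^esub>" if "r \<in> Q" for r
      using E.quot_zero_iff ext_mem[OF Q.is_ideal that] Q.Icarr[OF that] by auto
    fix r y n assume r: "r \<in> carrier R"
      and y: "y \<in> poly_span (A Quot ext Q) ((\<lambda>r. ext Q +> \<iota> r) ` carrier R) (ext Q +> x) n"
      and z: "(ext Q +> \<iota> r) \<otimes>\<^bsub>A Quot ext Q\<^esub> (ext Q +> x) [^]\<^bsub>A Quot ext Q\<^esub> n \<oplus>\<^bsub>A Quot ext Q\<^esub> y = \<zero>\<^bsub>A Quot ext Q\<^esub>"
    obtain v where v: "v \<in> spanR n" "y = ext Q +> v" using y unfolding quotient_spanR[OF E] by blast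
    have "ext Q +> (\<iota> r \<otimes> x [^] n \<oplus> v) = \<zero>\<^bsub>A Quot ext Q\<^esub>"
      using z r spanR_closed[OF v(1)] unfolding v by (simp add: h.hom_nat_pow)
    moreover have "\<iota> r \<otimes> x [^] n \<oplus> v \<in> carrier A" using r spanR_closed[OF v(1)] by simp
    ultimately have "\<iota> r \<otimes> x [^] n \<oplus> v \<in> ext Q" using E.quot_zero_iff by blast
    then show "r \<in> Q" using ext_lead[OF Q.is_ideal r v(1)] by blast
  qed
qed

lemma prime_diff_idealD:
  assumes "prime_diff_ideal R \<delta> Q"
  shows "primeideal Q R" "ideal Q R" "\<delta> ` Q \<subseteq> Q" "ideal (ext Q) A" "\<one>\<^bsub>R\<^esub> \<notin> Q"
proof -
  show Q: "primeideal Q R" "\<delta> ` Q \<subseteq> Q" using assms unfolding prime_diff_ideal_def by auto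
  interpret Q: primeideal Q R by (rule Q)
  show "ideal Q R" by (rule Q.is_ideal)
  show "ideal (ext Q) A" by (rule ext_ideal[OF Q.is_ideal Q(2)])
  show "\<one>\<^bsub>R\<^esub> \<notin> Q" using Q.one_imp_carrier Q.I_notcarr by blast
qed

lemma ext_prime:
  assumes Q: "prime_diff_ideal R \<delta> Q"
  shows "prime_ideal A (ext Q)"
proof -
  note D = prime_diff_idealD[OF Q]
  interpret E: ideal "ext Q" A by (rule D(4))
  interpret h: ring_hom_ring A "A Quot ext Q" "(+>) (ext Q)" by (rule E.rcos_ring_hom_ring)
  interpret SP: skew_prime R "A Quot ext Q" \<delta> "\<lambda>r. ext Q +> \<iota> r" "ext Q +> x" Q by (rule quotient_skew_prime[OF Q])
  show ?thesis
  proof (rule A.completely_prime_imp_prime[OF D(4)])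
    show "\<one> \<notin> ext Q"
    proof
      assume "\<one> \<in> ext Q"
      then have "\<one>\<^bsub>R\<^esub> \<in> contr (ext Q)" by (simp add: contr_def)
      then show False using contr_ext[OF D(2)] D(5) by simp
    qed
    fix a b assume ab: "a \<in> carrier A" "b \<in> carrier A" "a \<otimes> b \<in> ext Q"
    then have "(ext Q +> a) \<otimes>\<^bsub>A Quot ext Q\<^esub> (ext Q +> b) = \<zero>\<^bsub>A Quot ext Q\<^esub>"
      using E.quot_zero_iff[of "a \<otimes> b"] by simp
    then show "a \<in> ext Q \<or> b \<in> ext Q" using SP.A_integral[of "ext Q +> a" "ext Q +> b"] ab E.quot_zero_iff by auto
  qed
qed

lemma contr_prime_diff: "prime_ideal A P \<Longrightarrow> prime_diff_ideal R \<delta> (contr P)"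
  using contr_prime[OF nat acc] contr_delta unfolding prime_diff_ideal_def prime_ideal_def by blast

lemma ext_contr_subset: "ideal P A \<Longrightarrow> ext (contr P) \<subseteq> P"
  by (rule ext_minimal) (auto simp: contr_def)

text \<open>
  Otherwise the image of \<open>P\<close> in \<open>A / (P \<inter> R) A\<close> is a nonzero
  ideal, and by \<open>ideal_meets_R\<close> it contains the image of an element of
  \<open>R\<close> outside \<open>P\<close>.
\<close>

lemma noncomm_case:
  assumes P: "prime_ideal A P" and b0: "b0 \<in> carrier R" "\<delta> b0 \<notin> contr P"
  shows "P = ext (contr P)"
proof (rule ccontr)
  let ?Q = "contr P"
  have Pi: "ideal P A" using P by (simp add: prime_ideal_def)
  interpret P: ideal P A by (rule Pi)
  have Q: "prime_diff_ideal R \<delta> ?Q" by (rule contr_prime_diff[OF P])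
  note D = prime_diff_idealD[OF Q]
  interpret E: ideal "ext ?Q" A by (rule D(4))
  interpret h: ring_hom_ring A "A Quot ext ?Q" "(+>) (ext ?Q)" by (rule E.rcos_ring_hom_ring)
  interpret SP: skew_prime R "A Quot ext ?Q" \<delta> "\<lambda>r. ext ?Q +> \<iota> r" "ext ?Q +> x" ?Q by (rule quotient_skew_prime[OF Q])
  assume "P \<noteq> ext ?Q"
  then obtain u where u: "u \<in> P" "u \<notin> ext ?Q" using ext_contr_subset[OF Pi] by blast
  let ?J = "(+>) (ext ?Q) ` P"
  have J: "ideal ?J (A Quot ext ?Q)"
  proof (rule idealI[OF h.S.ring_axioms])
    show "subgroup ?J (add_monoid (A Quot ext ?Q))" by (rule h.img_is_add_subgroup[OF P.a_subgroup])
    fix a b assume "a \<in> ?J" "b \<in> carrier (A Quot ext ?Q)"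
    then obtain p c where pc: "p \<in> P" "a = ext ?Q +> p" "c \<in> carrier A" "b = ext ?Q +> c" unfolding E.quot_carrier by blast
    then have "b \<otimes>\<^bsub>A Quot ext ?Q\<^esub> a = ext ?Q +> (c \<otimes> p)" "a \<otimes>\<^bsub>A Quot ext ?Q\<^esub> b = ext ?Q +> (p \<otimes> c)"
      using P.Icarr by simp_all
    then show "b \<otimes>\<^bsub>A Quot ext ?Q\<^esub> a \<in> ?J" "a \<otimes>\<^bsub>A Quot ext ?Q\<^esub> b \<in> ?J"
      using P.I_l_closed P.I_r_closed pc by blast+
  qed
  have "ext ?Q +> u \<in> ?J" "ext ?Q +> u \<noteq> \<zero>\<^bsub>A Quot ext ?Q\<^esub>" using u E.quot_zero_iff P.Icarr by auto
  then have "\<exists>r \<in> carrier R. r \<notin> ?Q \<and> ext ?Q +> \<iota> r \<in> ?J" by (rule SP.ideal_meets_R[OF nat b0 J])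
  then obtain r where r: "r \<in> carrier R" "r \<notin> ?Q" "ext ?Q +> \<iota> r \<in> ?J" by blast
  then obtain p where p: "p \<in> P" "ext ?Q +> \<iota> r = ext ?Q +> p" by blast
  then have "\<iota> r \<in> ext ?Q +> p" using E.a_rcos_self[of "\<iota> r"] r by auto
  then obtain e where e: "e \<in> ext ?Q" "\<iota> r = e \<oplus> p" by (auto simp: a_r_coset_def r_coset_def)
  then have "\<iota> r \<in> P" using P.a_closed[OF subsetD[OF ext_contr_subset[OF Pi] e(1)] p(1)] by simp
  then show False using r unfolding contr_def by blast
qed

text \<open>
  An element of all \<open>Q' A\<close>, for the prime \<open>\<delta>\<close>-ideals
  \<open>Q'\<close> properly above \<open>Q\<close>, has all its coefficients in every
  \<open>Q'\<close>. Conversely, by \<open>noncomm_case\<close> a prime properly above \<open>Q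
  A\<close> contracts to a prime \<open>\<delta>\<close>-ideal properly above \<open>Q\<close>.
\<close>

lemma ext_locally_closed_iff:
  assumes Q: "prime_diff_ideal R \<delta> Q" and b0: "b0 \<in> carrier R" "\<delta> b0 \<notin> Q"
  shows "locally_closed A (ext Q) \<longleftrightarrow> diff_locally_closed R \<delta> Q"
proof
  note D = prime_diff_idealD[OF Q]
  interpret E: ideal "ext Q" A by (rule D(4))
  interpret Q: ideal Q R by (rule D(2))
  {
    assume "locally_closed A (ext Q)"
    then obtain g where g: "g \<in> carrier A \<inter> \<Inter>{P. prime_ideal A P \<and> ext Q \<subset> P} - ext Q"
      using psubset_imp_ex_mem unfolding locally_closed_def by blast
    define Z where "Z = carrier R \<inter> \<Inter>{Q'. prime_diff_ideal R \<delta> Q' \<and> Q \<subset> Q'}"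
    have QZ: "Q \<subseteq> Z" unfolding Z_def using Q.a_subset by blast
    have "Z \<noteq> Q"
    proof
      assume ZQ: "Z = Q"
      obtain n where n: "g \<in> spanR n" using g gen by blast
      have gQ: "g \<in> ext Q'" if Q': "prime_diff_ideal R \<delta> Q'" "Q \<subset> Q'" for Q'
      proof -
        have "ext Q \<subseteq> ext Q'" using ext_minimal[of "ext Q'" Q] prime_diff_idealD[OF Q'(1)] ext_mem[of Q'] Q'(2) by blast
        moreover have "ext Q \<noteq> ext Q'"
        proof
          assume e: "ext Q = ext Q'"
          have "Q = contr (ext Q)" by (rule contr_ext[OF D(2), symmetric])
          also have "\<dots> = Q'" unfolding e by (rule contr_ext[OF prime_diff_idealD(2)[OF Q'(1)]])
          finally have "Q = Q'" .
          then show False using Q'(2) by blast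
        qed
        ultimately show ?thesis using g ext_prime[OF Q'(1)] by blast
      qed
      have "v \<in> ext Q" if "v \<in> spanR n" "\<And>Q'. prime_diff_ideal R \<delta> Q' \<Longrightarrow> Q \<subset> Q' \<Longrightarrow> v \<in> ext Q'" for v n
        using that
      proof (induction n arbitrary: v)
        case 0
        then show ?case using E.zero_closed by simp
      next
        case (Suc n)
        obtain r y where 1: "r \<in> carrier R" "y \<in> spanR n" "v = \<iota> r \<otimes> x [^] n \<oplus> y" using Suc.prems by auto
        have yc: "y \<in> carrier A" using 1 by blast
        have rQ': "r \<in> Q'" if "prime_diff_ideal R \<delta> Q'" "Q \<subset> Q'" for Q'
          using ext_lead[OF prime_diff_idealD(2)[OF that(1)] 1(1,2)] Suc.prems(2)[OF that] 1(3) by blast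
        then have "r \<in> Z" using 1(1) unfolding Z_def by blast
        then have rm: "\<iota> r \<otimes> x [^] n \<in> ext Q" using ext_mem[OF D(2), of r] ZQ E.I_r_closed by simp
        have "y \<in> ext Q'" if Q': "prime_diff_ideal R \<delta> Q'" "Q \<subset> Q'" for Q'
        proof -
          interpret E': ideal "ext Q'" A by (rule prime_diff_idealD(4)[OF Q'(1)])
          have "\<iota> r \<otimes> x [^] n \<in> ext Q'" using ext_mem[OF prime_diff_idealD(2)[OF Q'(1)] rQ'[OF Q']] E'.I_r_closed by simp
          then have "\<ominus> (\<iota> r \<otimes> x [^] n) \<oplus> v \<in> ext Q'" using Suc.prems(2)[OF Q'] by (intro E'.a_closed E'.a_inv_closed)
          then show ?thesis unfolding 1 using 1(1) yc by (simp add: r_neg1 r_neg2 l_neg flip: a_assoc)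
        qed
        then have "y \<in> ext Q" using Suc.IH[OF 1(2)] by blast
        then show ?case unfolding 1 using rm E.a_closed by blast
      qed
      then have "g \<in> ext Q" using n gQ by blast
      then show False using g by blast
    qed
    then show "diff_locally_closed R \<delta> Q" unfolding diff_locally_closed_def using QZ unfolding Z_def by blast
  next
    assume "diff_locally_closed R \<delta> Q"
    then obtain f where f: "f \<in> carrier R \<inter> \<Inter>{Q'. prime_diff_ideal R \<delta> Q' \<and> Q \<subset> Q'} - Q"
      using psubset_imp_ex_mem unfolding diff_locally_closed_def by blast
    have "\<iota> f \<in> P" if P: "prime_ideal A P" "ext Q \<subset> P" for P
    proof -
      have Pi: "ideal P A" using P by (simp add: prime_ideal_def)
      have "Q \<subseteq> contr P" using contr_ext[OF D(2)] P(2) unfolding contr_def by blast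
      moreover have "contr P \<noteq> Q"
      proof
        assume e: "contr P = Q"
        then have "P = ext Q" using noncomm_case[OF P(1), of b0] b0 by simp
        then show False using P(2) by blast
      qed
      ultimately have "f \<in> contr P" using f contr_prime_diff[OF P(1)] by blast
      then show ?thesis unfolding contr_def by blast
    qed
    moreover have "\<iota> f \<notin> ext Q" using contr_ext[OF D(2)] f unfolding contr_def by blast
    moreover have "\<iota> f \<in> carrier A" using f by simp
    moreover have "ext Q \<subseteq> carrier A" by (rule E.a_subset)
    ultimately show "locally_closed A (ext Q)" unfolding locally_closed_def by blast
  }
qed

text \<open>
  The centre of the fractions of \<open>A / Q A\<close> is the image of the constants under an
  embedding that respects the base field.
\<close>

lemma ext_rational_iff:
  assumes Q: "prime_diff_ideal R \<delta> Q" and b0: "b0 \<in> carrier R" "\<delta> b0 \<notin> Q"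
  shows "rational K A (ext Q) \<longleftrightarrow> diff_rational K R \<delta> Q"
proof -
  note D = prime_diff_idealD[OF Q]
  interpret SP: skew_prime R "A Quot ext Q" \<delta> "\<lambda>r. ext Q +> \<iota> r" "ext Q +> x" Q by (rule quotient_skew_prime[OF Q])
  let ?A = "A Quot ext Q" and ?B = "R Quot Q"
  have fs: "frac_scalars K A (ext Q) = (\<lambda>c. left_frac ?A \<one>\<^bsub>?A\<^esub> (ext Q +> \<iota> c)) ` scalars K R"
    unfolding frac_scalars_def scal[symmetric] by (simp add: image_image)
  have c: "q \<in> carrier (Frac ?B)" if "q \<in> frac_constants R \<delta> Q" for q using that unfolding frac_constants_def by blast
  have "rational K A (ext Q) \<longleftrightarrow> (\<forall>q \<in> frac_constants R \<delta> Q.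
      ring.algebraic (Frac ?A) (frac_scalars K A (ext Q)) (frac_map SP.j ?A q))"
    unfolding rational_def SP.centre_eq_constants[OF nat b0, symmetric]
    using SP.A.centre_subfield SP.centre_eq_constants[OF nat b0] by auto
  also have "\<dots> \<longleftrightarrow> (\<forall>q \<in> frac_constants R \<delta> Q. ring.algebraic (Frac ?B) (frac_scalars K R Q) q)"
    unfolding fs using SP.algebraic_frac_map[OF scalars_R c] unfolding frac_scalars_def by simp
  also have "\<dots> \<longleftrightarrow> diff_rational K R \<delta> Q" unfolding diff_rational_def using c by blast
  finally show ?thesis .
qed

text \<open>
  Here the coefficients stand to the right of the powers of \<open>x\<close>: for an ideal
  \<open>I\<close> that is not a \<open>\<delta>\<close>-ideal, the union of these sets is the
  left ideal \<open>A I\<close>, while \<open>I A\<close> is only a right ideal.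
\<close>

primrec rspan :: "'a set \<Rightarrow> nat \<Rightarrow> 'b set" where
  "rspan I 0 = {\<zero>}"
| "rspan I (Suc n) = {x [^] n \<otimes> \<iota> r \<oplus> w | r w. r \<in> I \<and> w \<in> rspan I n}"

lemma rspan_span:
  assumes I: "ideal I R"
  shows "w \<in> rspan I n \<Longrightarrow> w \<in> spanR n"
proof (induction n arbitrary: w)
  case (Suc n)
  then obtain r w' where 1: "r \<in> I" "w' \<in> rspan I n" "w = x [^] n \<otimes> \<iota> r \<oplus> w'" by auto
  have r: "r \<in> carrier R" using 1 ideal.Icarr[OF I] by blast
  obtain y where y: "y \<in> spanR n" "x [^] n \<otimes> \<iota> r = \<iota> r \<otimes> x [^] n \<oplus> y" using pow_comm1[OF r] by blast
  have "w = \<iota> r \<otimes> x [^] n \<oplus> (y \<oplus> w')" unfolding 1 y(2) using r spanR_closed[OF y(1)] spanR_closed[OF Suc.IH[OF 1(2)]] by (simp add: a_assoc)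
  then show ?case using poly_span_SucI[of "\<iota> r" "\<iota> ` carrier R"] r spanR_add[OF y(1) Suc.IH[OF 1(2)]] by blast
qed simp

lemma rspan_zero: "ideal I R \<Longrightarrow> \<zero> \<in> rspan I n"
proof (induction n)
  case (Suc n)
  have "x [^] n \<otimes> \<iota> \<zero>\<^bsub>R\<^esub> \<oplus> \<zero> \<in> rspan I (Suc n)"
    unfolding rspan.simps(2) using Suc additive_subgroup.zero_closed[OF ideal.axioms(1)[OF Suc.prems]] by blast
  then show ?case by (simp del: rspan.simps)
qed simp

lemma rspan_Suc:
  assumes I: "ideal I R" and w: "w \<in> rspan I n" shows "w \<in> rspan I (Suc n)"
proof -
  have "x [^] n \<otimes> \<iota> \<zero>\<^bsub>R\<^esub> \<oplus> w \<in> rspan I (Suc n)"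
    unfolding rspan.simps(2) using w additive_subgroup.zero_closed[OF ideal.axioms(1)[OF I]] by blast
  then show ?thesis using spanR_closed[OF rspan_span[OF I w]] by (simp del: rspan.simps)
qed

lemma rspan_mono: "ideal I R \<Longrightarrow> n \<le> m \<Longrightarrow> rspan I n \<subseteq> rspan I m"
  by (rule lift_Suc_mono_le[of "rspan I"]) (use rspan_Suc in auto)

lemma rspan_add:
  assumes I: "ideal I R"
  shows "u \<in> rspan I n \<Longrightarrow> v \<in> rspan I n \<Longrightarrow> u \<oplus> v \<in> rspan I n"
proof (induction n arbitrary: u v)
  case (Suc n)
  obtain r w where 1: "r \<in> I" "w \<in> rspan I n" "u = x [^] n \<otimes> \<iota> r \<oplus> w" using Suc.prems by auto
  obtain s z where 2: "s \<in> I" "z \<in> rspan I n" "v = x [^] n \<otimes> \<iota> s \<oplus> z" using Suc.prems by auto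
  have c: "r \<in> carrier R" "s \<in> carrier R" "w \<in> carrier A" "z \<in> carrier A"
    using 1 2 ideal.Icarr[OF I] spanR_closed[OF rspan_span[OF I 1(2)]] spanR_closed[OF rspan_span[OF I 2(2)]] by auto
  have "u \<oplus> v = x [^] n \<otimes> \<iota> (r \<oplus>\<^bsub>R\<^esub> s) \<oplus> (w \<oplus> z)" unfolding 1 2 using c by (simp add: r_distr a_ac)
  then show ?case using Suc.IH[OF 1(2) 2(2)] additive_subgroup.a_closed[OF ideal.axioms(1)[OF I] 1(1) 2(1)] by auto
qed simp

lemma spanR_rspan: "u \<in> spanR n \<Longrightarrow> u \<in> rspan (carrier R) n"
proof (induction n arbitrary: u)
  case (Suc n)
  then obtain r y where 1: "r \<in> carrier R" "y \<in> spanR n" "u = \<iota> r \<otimes> x [^] n \<oplus> y" by auto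
  obtain z where z: "z \<in> spanR n" "x [^] n \<otimes> \<iota> r = \<iota> r \<otimes> x [^] n \<oplus> z" using pow_comm1[OF 1(1)] by blast
  have c: "y \<in> carrier A" "z \<in> carrier A" using 1 z by auto
  have "u = x [^] n \<otimes> \<iota> r \<oplus> (y \<ominus> z)" unfolding 1 z(2) using 1(1) c by (simp add: a_minus_def a_ac r_neg r_neg1 r_neg2)
  then show ?case using Suc.IH[OF spanR_minus[OF 1(2) z(1)]] 1(1) by auto
qed simp

lemma rspan_rmult:
  assumes I: "ideal I R" and i: "i \<in> I"
  shows "u \<in> rspan (carrier R) n \<Longrightarrow> u \<otimes> \<iota> i \<in> rspan I n"
proof (induction n arbitrary: u)
  case 0
  then show ?case using i ideal.Icarr[OF I] by simp
next
  case (Suc n)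
  then obtain r w where 1: "r \<in> carrier R" "w \<in> rspan (carrier R) n" "u = x [^] n \<otimes> \<iota> r \<oplus> w" by auto
  have c: "w \<in> carrier A" "i \<in> carrier R" using spanR_closed[OF rspan_span[OF R.oneideal 1(2)]] i ideal.Icarr[OF I] by auto
  have "u \<otimes> \<iota> i = x [^] n \<otimes> \<iota> (r \<otimes>\<^bsub>R\<^esub> i) \<oplus> w \<otimes> \<iota> i" unfolding 1 using c 1(1) by (simp add: l_distr m_assoc)
  then show ?case using Suc.IH[OF 1(2)] ideal.I_l_closed[OF I i 1(1)] by auto
qed

text \<open>
  The powers of \<open>x\<close> also form a basis on the other side, so \<open>1 \<in> A
  I\<close> would imply \<open>1 \<in> I\<close>.
\<close>

lemma left_ext_proper:
  assumes I: "ideal I R" and one: "\<one>\<^bsub>R\<^esub> \<notin> I"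
  obtains L where "left_ideal A L" "\<one> \<notin> L" "\<iota> ` I \<subseteq> L"
proof -
  define L where "L = (\<Union>n. rspan I n)"
  have mult: "a \<otimes> w \<in> L" if a: "a \<in> carrier A" and w: "w \<in> rspan I n" for a w n
    using w
  proof (induction n arbitrary: w)
    case 0
    then have az: "a \<otimes> w = \<zero>" using a by simp
    have "\<zero> \<in> L" unfolding L_def by (rule UN_I[of 0]) simp_all
    then show ?case unfolding az .
  next
    case (Suc n)
    obtain r v where 1: "r \<in> I" "v \<in> rspan I n" "w = x [^] n \<otimes> \<iota> r \<oplus> v" using Suc.prems by auto
    have c: "r \<in> carrier R" "v \<in> carrier A" using 1 ideal.Icarr[OF I] spanR_closed[OF rspan_span[OF I 1(2)]] by auto
    obtain N where "a \<otimes> x [^] n \<in> spanR N" using a gen by (metis UN_E m_closed nat_pow_closed x_closed)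
    then have p: "a \<otimes> x [^] n \<otimes> \<iota> r \<in> rspan I N" using rspan_rmult[OF I 1(1)] spanR_rspan by blast
    obtain N' where q: "a \<otimes> v \<in> rspan I N'" using Suc.IH[OF 1(2)] unfolding L_def by blast
    have "a \<otimes> x [^] n \<otimes> \<iota> r \<oplus> a \<otimes> v \<in> rspan I (max N N')"
      using p q rspan_mono[OF I, of N "max N N'"] rspan_mono[OF I, of N' "max N N'"] by (intro rspan_add[OF I]) auto
    moreover have "a \<otimes> w = a \<otimes> x [^] n \<otimes> \<iota> r \<oplus> a \<otimes> v" unfolding 1 using a c by (simp add: r_distr m_assoc)
    ultimately show ?case unfolding L_def by auto
  qed
  have 1: "left_ideal A L"
  proof (rule A.left_idealI)
    show "L \<subseteq> carrier A" unfolding L_def using spanR_closed[OF rspan_span[OF I]] by blast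
    show "\<zero> \<in> L" unfolding L_def using rspan_zero[OF I] by blast
    show "a \<oplus> b \<in> L" if ab: "a \<in> L" "b \<in> L" for a b
    proof -
      obtain n n' where "a \<in> rspan I n" "b \<in> rspan I n'" using ab unfolding L_def by blast
      then have "a \<in> rspan I (max n n')" "b \<in> rspan I (max n n')"
        using rspan_mono[OF I, of n "max n n'"] rspan_mono[OF I, of n' "max n n'"] by auto
      then show ?thesis using rspan_add[OF I] unfolding L_def by blast
    qed
    show "a \<otimes> l \<in> L" if "a \<in> carrier A" "l \<in> L" for a l using that mult unfolding L_def by blast
  qed
  have 2: "\<one> \<notin> rspan I n" for n
  proof (induction n)
    case 0
    have "\<one> \<noteq> \<zero>"
    proof
      assume "\<one> = \<zero>"
      then have "\<one>\<^bsub>R\<^esub> = \<zero>\<^bsub>R\<^esub>" using uniq0[of "\<one>\<^bsub>R\<^esub>" \<zero> 0] by simp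
      then show False using one additive_subgroup.zero_closed[OF ideal.axioms(1)[OF I]] by simp
    qed
    then show ?case by simp
  next
    case (Suc n)
    show ?case
    proof
      assume "\<one> \<in> rspan I (Suc n)"
      then obtain r w where 3: "r \<in> I" "w \<in> rspan I n" "\<one> = x [^] n \<otimes> \<iota> r \<oplus> w" by auto
      have r: "r \<in> carrier R" using 3 ideal.Icarr[OF I] by blast
      have wn: "w \<in> spanR n" by (rule rspan_span[OF I 3(2)])
      show False
      proof (cases n)
        case 0
        then have "\<one> = \<iota> r" using 3 r by simp
        then have "\<iota> (\<one>\<^bsub>R\<^esub> \<ominus>\<^bsub>R\<^esub> r) \<otimes> x [^] (0::nat) \<oplus> \<zero> = \<zero>" using r by (simp add: R.minus_eq r_neg)
        then have "\<one>\<^bsub>R\<^esub> \<ominus>\<^bsub>R\<^esub> r = \<zero>\<^bsub>R\<^esub>" using uniq0[OF _ spanR_zero, of "\<one>\<^bsub>R\<^esub> \<ominus>\<^bsub>R\<^esub> r" 0] r by blast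
        then show False using r 3(1) one by simp
      next
        case (Suc k)
        have one_s: "\<one> \<in> spanR n" using spanR_monom[OF R.one_closed, of 0] spanR_mono[of "Suc 0" n] Suc by (auto simp del: poly_span.simps)
        obtain y where y: "y \<in> spanR n" "x [^] n \<otimes> \<iota> r = \<iota> r \<otimes> x [^] n \<oplus> y" using pow_comm1[OF r] by blast
        have c: "y \<in> carrier A" "w \<in> carrier A" using y wn by auto
        have "\<iota> r \<otimes> x [^] n \<oplus> (y \<oplus> w \<ominus> \<one>) = (x [^] n \<otimes> \<iota> r \<oplus> w) \<ominus> \<one>"
          unfolding y(2) using r c by (simp add: a_minus_def a_assoc)
        also have "\<dots> = \<zero>" by (simp flip: 3(3))
        finally have "r = \<zero>\<^bsub>R\<^esub>" using uniq0[OF r spanR_minus[OF spanR_add[OF y(1) wn] one_s]] by simp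
        then have "\<one> = w" using 3(3) c by simp
        then show False using Suc.IH 3(2) by blast
      qed
    qed
  qed
  have "\<iota> ` I \<subseteq> L"
  proof clarify
    fix i assume i: "i \<in> I"
    have ic: "i \<in> carrier R" using i ideal.Icarr[OF I] by blast
    have "x [^] (0::nat) \<otimes> \<iota> i \<oplus> \<zero> \<in> rspan I (Suc 0)" using i rspan_zero[OF I, of 0] unfolding rspan.simps(2) by blast
    then have "\<iota> i \<in> rspan I (Suc 0)" using ic by (simp del: rspan.simps)
    then show "\<iota> i \<in> L" unfolding L_def by blast
  qed
  then show ?thesis using that 1 2 unfolding L_def by blast
qed

text \<open>
  From \<open>r x\<^sup>n\<^sup>+\<^sup>1 = x (r x\<^sup>n) - (\<delta> r) x\<^sup>n\<close> and
  induction on \<open>n\<close>, a left ideal that contains the \<open>\<delta>\<close>-ideal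
  \<open>I\<close> contains all \<open>I x\<^sup>n\<close>.
\<close>

lemma ext_in_left_ideal:
  assumes I: "ideal I R" "\<delta> ` I \<subseteq> I" and L: "left_ideal A L" "\<iota> ` I \<subseteq> L" and u: "u \<in> ext I"
  shows "u \<in> L"
proof -
  have La: "additive_subgroup L A" and Lm: "\<And>a l. a \<in> carrier A \<Longrightarrow> l \<in> L \<Longrightarrow> a \<otimes> l \<in> L" using L(1) unfolding left_ideal_def by auto
  have "\<forall>r \<in> I. \<iota> r \<otimes> x [^] n \<in> L" for n :: nat
  proof (induction n)
    case 0
    then show ?case using L(2) ideal.Icarr[OF I(1)] by auto
  next
    case (Suc n)
    show ?case
    proof
      fix r assume r: "r \<in> I"
      have rc: "r \<in> carrier R" using r ideal.Icarr[OF I(1)] by blast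
      have "\<delta> r \<in> I" using r I(2) by blast
      then have "\<ominus> (\<iota> (\<delta> r) \<otimes> x [^] n) \<in> L" using Suc additive_subgroup.a_inv_closed[OF La] by blast
      moreover have "x \<otimes> (\<iota> r \<otimes> x [^] n) \<in> L" using Suc r Lm by blast
      ultimately have "x \<otimes> (\<iota> r \<otimes> x [^] n) \<oplus> \<ominus> (\<iota> (\<delta> r) \<otimes> x [^] n) \<in> L" using additive_subgroup.a_closed[OF La] by blast
      moreover have "x \<otimes> (\<iota> r \<otimes> x [^] n) = \<iota> r \<otimes> (x \<otimes> x [^] n) \<oplus> \<iota> (\<delta> r) \<otimes> x [^] n"
        using rc by (simp add: x_comm l_distr m_assoc flip: m_assoc[of x "\<iota> r"])
      moreover have "x \<otimes> x [^] n = x [^] Suc n" by (metis x_closed nat_pow_Suc2)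
      ultimately show "\<iota> r \<otimes> x [^] Suc n \<in> L" using rc by (simp add: a_assoc r_neg del: nat_pow_Suc)
    qed
  qed
  then have "pspan I n \<subseteq> L" for n
    by (induction n) (use additive_subgroup.zero_closed[OF La] additive_subgroup.a_closed[OF La] in auto)
  then show ?thesis using u unfolding ext_def by blast
qed

text \<open>
  Let \<open>Q\<close> be maximal among the prime \<open>\<delta>\<close>-ideals in the maximal
  ideal \<open>m\<close>. The largest two-sided ideal \<open>P\<close> in a maximal left ideal
  above \<open>A m\<close> is primitive and contains \<open>Q A\<close>, and its contraction is
  a prime \<open>\<delta>\<close>-ideal between \<open>Q\<close> and \<open>m\<close>. So this
  contraction is \<open>Q\<close>, and \<open>P = Q A\<close>.
\<close>

lemma diff_primitive_imp_primitive:
  assumes Q: "prime_diff_ideal R \<delta> Q" and b0: "b0 \<in> carrier R" "\<delta> b0 \<notin> Q" and prim: "diff_primitive R \<delta> Q"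
  shows "primitive_ideal A (ext Q)"
proof -
  obtain m where m: "maximalideal m R" "Q \<subseteq> m" and
    max: "\<And>Q'. prime_diff_ideal R \<delta> Q' \<Longrightarrow> Q' \<subseteq> m \<Longrightarrow> Q \<subseteq> Q' \<Longrightarrow> Q' = Q"
    using prim unfolding diff_primitive_def by blast
  note D = prime_diff_idealD[OF Q]
  interpret m: maximalideal m R by (rule m)
  have one_m: "\<one>\<^bsub>R\<^esub> \<notin> m" using m.one_imp_carrier m.I_notcarr by blast
  obtain L where L: "left_ideal A L" "\<one> \<notin> L" "\<iota> ` m \<subseteq> L" using left_ext_proper[OF m.is_ideal one_m] by metis
  obtain M where M: "max_left_ideal A M" "L \<subseteq> M" using A.max_left_ideal_exists[OF L(1,2)] by metis
  define P where "P = {a \<in> carrier A. \<forall>b \<in> carrier A. a \<otimes> b \<in> M}"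
  have P: "prime_ideal A P" "P \<subseteq> M" and prP: "primitive_ideal A P"
    unfolding P_def using A.primitive_core[OF M(1)] A.max_left_ideal_primitive[OF M(1)] by auto
  have Ml: "left_ideal A M" "\<one> \<notin> M" using M unfolding max_left_ideal_def by auto
  have Msub: "additive_subgroup M A" and Mmul: "\<And>a l. a \<in> carrier A \<Longrightarrow> l \<in> M \<Longrightarrow> a \<otimes> l \<in> M"
    using Ml unfolding left_ideal_def by auto
  have "contr P \<subseteq> m"
  proof
    fix r assume r: "r \<in> contr P"
    show "r \<in> m"
    proof (rule ccontr)
      assume "r \<notin> m"
      have rc: "r \<in> carrier R" "\<iota> r \<in> M" using r P(2) unfolding contr_def by auto
      let ?I = "contr M"
      have mI: "m \<subseteq> ?I" using L(3) M(2) m.Icarr unfolding contr_def by blast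
      have I: "ideal ?I R"
      proof (rule idealI[OF R.ring_axioms])
        show "subgroup ?I (add_monoid R)"
        proof (rule R.add.subgroupI)
          show "?I \<noteq> {}" using rc unfolding contr_def by blast
        qed (use additive_subgroup.a_closed[OF Msub] additive_subgroup.a_inv_closed[OF Msub] in \<open>auto simp: contr_def\<close>)
        show "b \<otimes>\<^bsub>R\<^esub> a \<in> ?I" "a \<otimes>\<^bsub>R\<^esub> b \<in> ?I" if "a \<in> ?I" "b \<in> carrier R" for a b
          using that Mmul[of "\<iota> b" "\<iota> a"] R.m_comm[of a b] unfolding contr_def by auto
      qed
      have "?I = m \<or> ?I = carrier R" by (rule m.I_maximal[OF I mI]) (auto simp: contr_def)
      moreover have "r \<in> ?I" using rc unfolding contr_def by blast
      ultimately have "\<one>\<^bsub>R\<^esub> \<in> ?I" using \<open>r \<notin> m\<close> by auto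
      then show False using Ml unfolding contr_def by simp
    qed
  qed
  moreover have "Q \<subseteq> contr P"
  proof
    fix q assume q: "q \<in> Q"
    interpret E: ideal "ext Q" A by (rule D(4))
    have "\<iota> ` Q \<subseteq> M" using L(3) M(2) m(2) by blast
    then have EM: "ext Q \<subseteq> M" using ext_in_left_ideal[OF D(2,3) Ml(1)] by blast
    have "q \<in> carrier R" using q ideal.Icarr[OF D(2)] by blast
    moreover have "\<iota> q \<otimes> b \<in> M" if "b \<in> carrier A" for b
      using E.I_r_closed[OF ext_mem[OF D(2) q] that] EM by blast
    ultimately show "q \<in> contr P" unfolding contr_def P_def by simp
  qed
  ultimately have "contr P = Q" using max contr_prime_diff[OF P(1)] by blast
  then have "P = ext Q" using noncomm_case[OF P(1) b0(1)] b0 by simp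
  then show ?thesis using prP by simp
qed

end

section \<open>Simple modules and differentially primitive ideals\<close>

locale affine_skew_module = affine_skew K R A \<delta> \<iota> x S + SM: simple_module A M
  for K :: "('k, 'm) ring_scheme" and R :: "('k, 'a, 'n) module_scheme" and A :: "('k, 'b, 'p) module_scheme" (structure)
    and \<delta> \<iota> x S and M :: "('b, 'c, 'q) module_scheme" +
  fixes Q
  assumes Q: "prime_diff_ideal R \<delta> Q" and annih: "annihilator A M = ext Q"
begin

abbreviation act (infixl "\<bullet>" 75) where "a \<bullet> u \<equiv> a \<odot>\<^bsub>M\<^esub> u"

lemmas act_closed [simp, intro] = SM.lsmult_closed
lemmas act_zero [simp] = SM.smult_zero_left SM.smult_zero_right
lemmas act_minus = SM.smult_minus_left
lemmas act_ladd = SM.lsmult_l_distr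
lemmas act_radd = SM.lsmult_r_distr
lemmas act_assoc = SM.lsmult_assoc
lemmas act_one [simp] = SM.lsmult_one
lemmas QD = prime_diff_idealD[OF Q]

lemma ext_kills: "g \<in> ext Q \<Longrightarrow> v \<in> carrier M \<Longrightarrow> g \<bullet> v = \<zero>\<^bsub>M\<^esub>"
  unfolding annih[symmetric] annihilator_def by blast

lemma kills_imp_Q:
  assumes "r \<in> carrier R" "\<And>v. v \<in> carrier M \<Longrightarrow> \<iota> r \<bullet> v = \<zero>\<^bsub>M\<^esub>" shows "r \<in> Q"
proof -
  have "\<iota> r \<in> ext Q" unfolding annih[symmetric] annihilator_def using assms by simp
  then have "r \<in> contr (ext Q)" using assms(1) unfolding contr_def by simp
  then show ?thesis using contr_ext[OF QD(2)] by simp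
qed

definition "annR u = {r \<in> carrier R. \<iota> r \<bullet> u = \<zero>\<^bsub>M\<^esub>}"

lemma annR_D: "r \<in> annR u \<Longrightarrow> r \<in> carrier R \<and> \<iota> r \<bullet> u = \<zero>\<^bsub>M\<^esub>"
  and annR_I: "r \<in> carrier R \<Longrightarrow> \<iota> r \<bullet> u = \<zero>\<^bsub>M\<^esub> \<Longrightarrow> r \<in> annR u"
  unfolding annR_def by auto

lemma annR_ideal:
  assumes u: "u \<in> carrier M" shows "ideal (annR u) R"
proof (rule idealI[OF R.ring_axioms])
  show "subgroup (annR u) (add_monoid R)"
  proof (rule R.add.subgroupI)
    show "annR u \<noteq> {}" using u by (auto simp: annR_def intro!: exI[of _ "\<zero>\<^bsub>R\<^esub>"])
  qed (use u in \<open>auto simp: annR_def act_ladd act_minus\<close>)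
  show "b \<otimes>\<^bsub>R\<^esub> a \<in> annR u" "a \<otimes>\<^bsub>R\<^esub> b \<in> annR u" if "a \<in> annR u" "b \<in> carrier R" for a b
    using that u R.m_comm[of a b] by (auto simp: annR_def act_assoc)
qed

text \<open>
  The vectors killed by the \<open>\<delta>\<close>-ideal \<open>H\<close> form a submodule. If
  it contained \<open>v \<noteq> 0\<close> it would be all of \<open>M\<close>, and
  \<open>H\<close> would lie in the annihilator of \<open>M\<close>.
\<close>

lemma diff_ideal_acts:
  assumes H: "ideal H R" "\<delta> ` H \<subseteq> H" "\<not> H \<subseteq> Q" and v: "v \<in> carrier M" "v \<noteq> \<zero>\<^bsub>M\<^esub>"
  shows "\<exists>r \<in> H. \<iota> r \<bullet> v \<noteq> \<zero>\<^bsub>M\<^esub>"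
proof (rule ccontr)
  assume nex: "\<not> ?thesis"
  interpret H: ideal H R by (rule H)
  define N where "N = {m \<in> carrier M. \<forall>r \<in> H. \<iota> r \<bullet> m = \<zero>\<^bsub>M\<^esub>}"
  have R_stable: "\<iota> s \<bullet> m \<in> N" if s: "s \<in> carrier R" and m: "m \<in> N" for s m
  proof -
    have mc: "m \<in> carrier M" using m unfolding N_def by blast
    have "\<iota> r \<bullet> (\<iota> s \<bullet> m) = \<zero>\<^bsub>M\<^esub>" if r: "r \<in> H" for r
    proof -
      have "\<iota> r \<bullet> (\<iota> s \<bullet> m) = \<iota> (r \<otimes>\<^bsub>R\<^esub> s) \<bullet> m" using r s mc by (simp add: act_assoc)
      then show ?thesis using m H.I_r_closed[OF r s] unfolding N_def by simp
    qed
    then show ?thesis using s mc unfolding N_def by simp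
  qed
  have x_stable: "x \<bullet> m \<in> N" if m: "m \<in> N" for m
  proof -
    have mc: "m \<in> carrier M" using m unfolding N_def by blast
    have "\<iota> r \<bullet> (x \<bullet> m) = \<zero>\<^bsub>M\<^esub>" if r: "r \<in> H" for r
    proof -
      have rc: "r \<in> carrier R" by (rule H.Icarr[OF r])
      have z: "\<iota> r \<bullet> m = \<zero>\<^bsub>M\<^esub>" "\<iota> (\<delta> r) \<bullet> m = \<zero>\<^bsub>M\<^esub>" using m r H(2) unfolding N_def by auto
      have "x \<bullet> (\<iota> r \<bullet> m) = (x \<otimes> \<iota> r) \<bullet> m" using rc mc by (simp add: act_assoc)
      also have "\<dots> = \<iota> r \<bullet> (x \<bullet> m) \<oplus>\<^bsub>M\<^esub> \<iota> (\<delta> r) \<bullet> m" using rc mc by (simp add: x_comm act_ladd act_assoc)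
      finally show ?thesis unfolding z using rc mc by simp
    qed
    then show ?thesis using mc unfolding N_def by simp
  qed
  have add: "m \<oplus>\<^bsub>M\<^esub> m' \<in> N" if "m \<in> N" "m' \<in> N" for m m'
    using that H.Icarr unfolding N_def by (auto simp: act_radd)
  have zero: "\<zero>\<^bsub>M\<^esub> \<in> N" using H.Icarr unfolding N_def by auto
  have xn: "x [^] n \<bullet> m \<in> N" if m: "m \<in> N" for m and n :: nat
  proof (induction n)
    case 0
    have "m \<in> carrier M" using m unfolding N_def by blast
    then show ?case using m by simp
  next
    case (Suc n)
    have mc: "m \<in> carrier M" using m unfolding N_def by blast
    have "x [^] Suc n = x \<otimes> x [^] n" by (metis x_closed nat_pow_Suc2)
    then have "x [^] Suc n \<bullet> m = x \<bullet> (x [^] n \<bullet> m)" using mc by (simp add: act_assoc)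
    then show ?case using x_stable[OF Suc] by simp
  qed
  have span: "g \<bullet> m \<in> N" if m: "m \<in> N" and g: "g \<in> spanR n" for g m n
    using g
  proof (induction n arbitrary: g)
    case 0
    have "m \<in> carrier M" using m unfolding N_def by blast
    then show ?case using 0 zero by simp
  next
    case (Suc n)
    obtain r y where 1: "r \<in> carrier R" "y \<in> spanR n" "g = \<iota> r \<otimes> x [^] n \<oplus> y" using Suc.prems by auto
    have c: "y \<in> carrier A" "m \<in> carrier M" using 1 m unfolding N_def by auto
    have "g \<bullet> m = \<iota> r \<bullet> (x [^] n \<bullet> m) \<oplus>\<^bsub>M\<^esub> y \<bullet> m" unfolding 1 using 1(1) c by (simp add: act_ladd act_assoc)
    then show ?case using add[OF R_stable[OF 1(1) xn[OF m, of n]] Suc.IH[OF 1(2)]] by simp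
  qed
  have "submodule N A M"
  proof (rule SM.submoduleI)
    show "N \<subseteq> carrier M" unfolding N_def by blast
    show "a \<bullet> m \<in> N" if "a \<in> carrier A" "m \<in> N" for a m using that span gen by blast
  qed (use zero add in auto)
  moreover have "v \<in> N" using v(1) nex unfolding N_def by blast
  ultimately have "N = carrier M" using SM.simple_cases v(2) by blast
  then have "H \<subseteq> Q" using H.Icarr unfolding N_def by (auto intro!: kills_imp_Q)
  then show False using H(3) by blast
qed

text \<open>
  If \<open>w\<close> is the given operator of degree \<open>n + 1\<close>, then \<open>w a - a
  w\<close> kills \<open>u\<close> as well. Its leading coefficient is \<open>(n + 1) r
  (\<delta> a)\<close>, and \<open>\<delta> a\<close> is outside the prime \<open>p\<close>.
\<close>

lemma lead_annihilates:
  assumes p: "primeideal p R" "p = annR u" and u: "u \<in> carrier M"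
    and a: "a \<in> p" "\<delta> a \<notin> p"
  shows "r \<in> carrier R \<Longrightarrow> y \<in> spanR n \<Longrightarrow> (\<iota> r \<otimes> x [^] n \<oplus> y) \<bullet> u = \<zero>\<^bsub>M\<^esub> \<Longrightarrow> r \<in> p"
proof (induction n arbitrary: r y)
  case 0
  then show ?case using p(2) unfolding annR_def by simp
next
  case (Suc n)
  interpret p: primeideal p R by (rule p)
  define w where "w = \<iota> r \<otimes> x [^] Suc n \<oplus> y"
  have wc: "w \<in> carrier A" unfolding w_def using Suc.prems(1) spanR_closed[OF Suc.prems(2)] by simp
  have ac: "a \<in> carrier R" "\<iota> a \<bullet> u = \<zero>\<^bsub>M\<^esub>" using annR_D[OF a(1)[unfolded p(2)]] by blast+
  obtain z where z: "z \<in> spanR n" "w \<otimes> \<iota> a \<ominus> \<iota> a \<otimes> w = \<iota> (r \<otimes>\<^bsub>R\<^esub> (add_pow R (Suc n) (\<delta> a))) \<otimes> x [^] n \<oplus> z"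
    using commutator_lead[OF ac(1) Suc.prems(1,2)] unfolding w_def by blast
  have wu: "w \<bullet> u = \<zero>\<^bsub>M\<^esub>" using Suc.prems(3) unfolding w_def .
  have "(w \<otimes> \<iota> a \<ominus> \<iota> a \<otimes> w) \<bullet> u = w \<bullet> (\<iota> a \<bullet> u) \<oplus>\<^bsub>M\<^esub> \<ominus>\<^bsub>M\<^esub> (\<iota> a \<bullet> (w \<bullet> u))"
    using wc ac(1) u by (simp add: a_minus_def act_ladd act_minus act_assoc)
  also have "\<dots> = \<zero>\<^bsub>M\<^esub>" unfolding wu ac(2) using wc ac(1) by simp
  finally have "(\<iota> (r \<otimes>\<^bsub>R\<^esub> (add_pow R (Suc n) (\<delta> a))) \<otimes> x [^] n \<oplus> z) \<bullet> u = \<zero>\<^bsub>M\<^esub>" unfolding z(2) .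
  then have "r \<otimes>\<^bsub>R\<^esub> (add_pow R (Suc n) (\<delta> a)) \<in> p"
    using Suc.prems(1) ac(1) z(1) by (intro Suc.IH[OF _ z(1)]) (auto intro!: R.m_closed R.add.nat_pow_closed simp del: R.add.nat_pow_Suc)
  moreover have "add_pow R (Suc n) (\<delta> a) \<notin> p"
    using R.nat_mult_mem[OF nat p.is_ideal d_closed[OF ac(1)], of "Suc n"] a(2) by blast
  ultimately show ?case using p.I_prime[OF Suc.prems(1) R.add.nat_pow_closed[OF d_closed[OF ac(1)]]] by blast
qed

text \<open>
  For \<open>c \<notin> p\<close>, simplicity gives \<open>u = g c u\<close> with \<open>g \<in>
  A\<close>. If \<open>g\<close> has positive degree, its leading coefficient \<open>r\<close>
  satisfies \<open>r c \<in> p\<close> by \<open>lead_annihilates\<close> applied to \<open>g c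
  - 1\<close>, so \<open>r\<close> lies in \<open>p\<close> and kills \<open>c u\<close>, and
  the leading term of \<open>g\<close> can be traded for terms of lower degree. In degree zero,
  \<open>g\<close> is an inverse of \<open>c\<close> modulo \<open>p\<close>.
\<close>

lemma ann_field_ideal:
  assumes p: "primeideal p R" "p = annR u" and u: "u \<in> carrier M" "u \<noteq> \<zero>\<^bsub>M\<^esub>"
    and a: "a \<in> p" "\<delta> a \<notin> p"
  shows "field_ideal R p"
proof -
  interpret p: primeideal p R by (rule p)
  have "\<exists>e \<in> carrier R. \<one>\<^bsub>R\<^esub> \<ominus>\<^bsub>R\<^esub> c \<otimes>\<^bsub>R\<^esub> e \<in> p" if c: "c \<in> carrier R - p" for c
  proof -
    have cc: "c \<in> carrier R" "\<iota> c \<bullet> u \<noteq> \<zero>\<^bsub>M\<^esub>" using c annR_I[of c u, folded p(2)] by blast+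
    have reduce: "\<exists>e \<in> carrier R. \<iota> (e \<otimes>\<^bsub>R\<^esub> c) \<bullet> u = u" if "g \<in> spanR N" "g \<bullet> (\<iota> c \<bullet> u) = u" for g N
      using that
    proof (induction N arbitrary: g)
      case 0
      then show ?case using u cc by simp
    next
      case (Suc N)
      obtain r y where 1: "r \<in> carrier R" "y \<in> spanR N" "g = \<iota> r \<otimes> x [^] N \<oplus> y" using Suc.prems by auto
      have yc: "y \<in> carrier A" using 1 by blast
      show ?case
      proof (cases N)
        case 0
        then have "g = \<iota> r" using 1 by simp
        then have "\<iota> (r \<otimes>\<^bsub>R\<^esub> c) \<bullet> u = u" using Suc.prems(2) 1(1) cc(1) u(1) by (simp add: act_assoc)
        then show ?thesis using 1(1) by blast
      next
        case (Suc k)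
        obtain z where z: "z \<in> spanR N" "x [^] N \<otimes> \<iota> c = \<iota> c \<otimes> x [^] N \<oplus> z" using pow_comm1[OF cc(1)] by blast
        obtain z' where z': "z' \<in> spanR N" "x [^] N \<otimes> \<iota> r = \<iota> r \<otimes> x [^] N \<oplus> z'" using pow_comm1[OF 1(1)] by blast
        have zc: "z \<in> carrier A" "z' \<in> carrier A" using z z' by auto
        have one_s: "\<one> \<in> spanR N" using spanR_monom[OF R.one_closed, of 0] spanR_mono[of "Suc 0" N] Suc by (auto simp del: poly_span.simps)
        have "\<iota> (r \<otimes>\<^bsub>R\<^esub> c) \<otimes> x [^] N \<oplus> (\<iota> r \<otimes> z \<oplus> y \<otimes> \<iota> c \<ominus> \<one>) = \<iota> r \<otimes> (\<iota> c \<otimes> x [^] N \<oplus> z) \<oplus> y \<otimes> \<iota> c \<ominus> \<one>"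
          using 1(1) cc(1) yc zc by (simp add: r_distr m_assoc a_assoc a_minus_def)
        also have "\<dots> = g \<otimes> \<iota> c \<ominus> \<one>" unfolding z(2)[symmetric] 1(3) using 1(1) cc(1) yc by (simp add: l_distr m_assoc)
        finally have "(\<iota> (r \<otimes>\<^bsub>R\<^esub> c) \<otimes> x [^] N \<oplus> (\<iota> r \<otimes> z \<oplus> y \<otimes> \<iota> c \<ominus> \<one>)) \<bullet> u = (g \<otimes> \<iota> c \<ominus> \<one>) \<bullet> u" by simp
        also have "\<dots> = \<zero>\<^bsub>M\<^esub>"
        proof -
          have gc: "g \<in> carrier A" unfolding 1 using 1(1) yc by simp
          have "(g \<otimes> \<iota> c \<ominus> \<one>) \<bullet> u = g \<bullet> (\<iota> c \<bullet> u) \<oplus>\<^bsub>M\<^esub> \<ominus>\<^bsub>M\<^esub> u"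
            using gc cc(1) u(1) by (simp add: a_minus_def act_ladd act_minus act_assoc)
          then show ?thesis unfolding Suc.prems(2) using u(1) by (simp add: SM.M.r_neg)
        qed
        finally have "(\<iota> (r \<otimes>\<^bsub>R\<^esub> c) \<otimes> x [^] N \<oplus> (\<iota> r \<otimes> z \<oplus> y \<otimes> \<iota> c \<ominus> \<one>)) \<bullet> u = \<zero>\<^bsub>M\<^esub>" .
        moreover have "\<iota> r \<otimes> z \<oplus> y \<otimes> \<iota> c \<ominus> \<one> \<in> spanR N"
          by (intro spanR_minus spanR_add spanR_lmult[OF 1(1) z(1)] spanR_rmult[OF 1(2) cc(1)] one_s)
        ultimately have "r \<otimes>\<^bsub>R\<^esub> c \<in> p" using lead_annihilates[OF p u(1) a R.m_closed[OF 1(1) cc(1)]] by blast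
        then have rp: "r \<in> p" using p.I_prime[OF 1(1) cc(1)] c by blast
        have rcu: "\<iota> r \<bullet> (\<iota> c \<bullet> u) = \<zero>\<^bsub>M\<^esub>"
          using annR_D[OF p.I_r_closed[OF rp cc(1), unfolded p(2)]] 1(1) cc(1) u(1) by (simp add: act_assoc)
        have "x [^] N \<bullet> (\<iota> r \<bullet> (\<iota> c \<bullet> u)) = (\<iota> r \<otimes> x [^] N \<oplus> z') \<bullet> (\<iota> c \<bullet> u)"
          unfolding z'(2)[symmetric] using 1(1) cc(1) u(1) by (simp add: act_assoc)
        then have e: "(\<iota> r \<otimes> x [^] N) \<bullet> (\<iota> c \<bullet> u) \<oplus>\<^bsub>M\<^esub> z' \<bullet> (\<iota> c \<bullet> u) = \<zero>\<^bsub>M\<^esub>"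
          unfolding rcu using 1(1) cc(1) u(1) zc by (simp add: act_ladd)
        have "(y \<ominus> z') \<bullet> (\<iota> c \<bullet> u) = (g \<oplus> \<ominus> (\<iota> r \<otimes> x [^] N \<oplus> z')) \<bullet> (\<iota> c \<bullet> u)"
        proof -
          have "y \<ominus> z' = g \<oplus> \<ominus> (\<iota> r \<otimes> x [^] N \<oplus> z')"
            unfolding 1 using 1(1) yc zc by (simp add: a_minus_def minus_add a_ac r_neg r_neg1 r_neg2)
          then show ?thesis by simp
        qed
        also have "\<dots> = u \<oplus>\<^bsub>M\<^esub> \<ominus>\<^bsub>M\<^esub> ((\<iota> r \<otimes> x [^] N) \<bullet> (\<iota> c \<bullet> u) \<oplus>\<^bsub>M\<^esub> z' \<bullet> (\<iota> c \<bullet> u))"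
        proof -
          have gc: "g \<in> carrier A" unfolding 1 using 1(1) yc by simp
          have cu: "\<iota> c \<bullet> u \<in> carrier M" using cc(1) u(1) by simp
          have "(g \<oplus> \<ominus> (\<iota> r \<otimes> x [^] N \<oplus> z')) \<bullet> (\<iota> c \<bullet> u) = g \<bullet> (\<iota> c \<bullet> u) \<oplus>\<^bsub>M\<^esub> \<ominus>\<^bsub>M\<^esub> ((\<iota> r \<otimes> x [^] N \<oplus> z') \<bullet> (\<iota> c \<bullet> u))"
            using gc 1(1) zc by (simp only: act_ladd[OF _ _ cu] act_minus[OF _ cu] a_inv_closed a_closed m_closed \<iota>.hom_closed nat_pow_closed x_closed)
          then show ?thesis unfolding Suc.prems(2) using 1(1) zc cu by (simp add: act_ladd)
        qed
        finally have "(y \<ominus> z') \<bullet> (\<iota> c \<bullet> u) = u" unfolding e using u(1) by simp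
        then show ?thesis using Suc.IH[OF spanR_minus[OF 1(2) z'(1)]] by blast
      qed
    qed
    have cu: "\<iota> c \<bullet> u \<in> carrier M" using cc(1) u(1) by simp
    obtain g where g: "g \<in> carrier A" "u = g \<bullet> (\<iota> c \<bullet> u)" by (rule SM.cyclic[OF cu cc(2) u(1)])
    then obtain e where e: "e \<in> carrier R" "\<iota> (e \<otimes>\<^bsub>R\<^esub> c) \<bullet> u = u" using reduce[of g, OF _ g(2)[symmetric]] g(1)[unfolded gen] by blast
    have "\<iota> (\<one>\<^bsub>R\<^esub> \<ominus>\<^bsub>R\<^esub> c \<otimes>\<^bsub>R\<^esub> e) \<bullet> u = \<one> \<bullet> u \<oplus>\<^bsub>M\<^esub> \<ominus>\<^bsub>M\<^esub> (\<iota> (e \<otimes>\<^bsub>R\<^esub> c) \<bullet> u)"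
    proof -
      have "\<iota> (\<one>\<^bsub>R\<^esub> \<ominus>\<^bsub>R\<^esub> c \<otimes>\<^bsub>R\<^esub> e) = \<one> \<oplus> \<ominus> \<iota> (e \<otimes>\<^bsub>R\<^esub> c)"
        unfolding R.m_comm[OF e(1) cc(1)] using e(1) cc(1) by (simp add: R.minus_eq)
      then show ?thesis using e(1) cc(1) u(1) by (simp add: act_ladd act_minus)
    qed
    also have "\<dots> = \<zero>\<^bsub>M\<^esub>" unfolding e(2) using u(1) by (simp add: SM.M.r_neg)
    finally have "\<one>\<^bsub>R\<^esub> \<ominus>\<^bsub>R\<^esub> c \<otimes>\<^bsub>R\<^esub> e \<in> p" unfolding p(2) using e(1) cc(1) by (intro annR_I) simp
    then show ?thesis using e(1) by blast
  qed
  moreover have "\<one>\<^bsub>R\<^esub> \<notin> p" using p.one_imp_carrier p.I_notcarr by blast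
  ultimately show ?thesis unfolding field_ideal_def using p.is_ideal by blast
qed

text \<open>
  A maximal one among the annihilators not contained in \<open>Q\<close> is prime; it is not a
  \<open>\<delta>\<close>-ideal since a \<open>\<delta>\<close>-ideal outside \<open>Q\<close>
  acts nontrivially on every nonzero vector, so \<open>ann_field_ideal\<close> applies. For the
  same reason it contains no \<open>\<delta>\<close>-ideal that is larger than \<open>Q\<close>.
\<close>

lemma torsion_case:
  assumes u: "u \<in> carrier M" "u \<noteq> \<zero>\<^bsub>M\<^esub>" and s: "s \<in> carrier R" "s \<notin> Q" "\<iota> s \<bullet> u = \<zero>\<^bsub>M\<^esub>"
  shows "diff_primitive R \<delta> Q"
proof -
  define F where "F = {annR u | u. u \<in> carrier M \<and> u \<noteq> \<zero>\<^bsub>M\<^esub> \<and> \<not> annR u \<subseteq> Q}"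
  have "annR u \<in> F" using u s unfolding F_def annR_def by blast
  then have "\<exists>p \<in> F. \<forall>I \<in> F. p \<subseteq> I \<longrightarrow> I = p"
    by (intro acc_ideals_maximal[OF acc]) (auto simp: F_def intro: annR_ideal)
  then obtain p where p: "p \<in> F" "\<And>I. I \<in> F \<Longrightarrow> p \<subseteq> I \<Longrightarrow> I = p" by blast
  then obtain v where v: "v \<in> carrier M" "v \<noteq> \<zero>\<^bsub>M\<^esub>" "\<not> p \<subseteq> Q" "p = annR v" unfolding F_def by blast
  interpret p: ideal p R unfolding v(4) by (rule annR_ideal[OF v(1)])
  have prime: "primeideal p R"
  proof (rule primeidealI[OF p.is_ideal R.cring_axioms])
    have "\<one>\<^bsub>R\<^esub> \<notin> annR v" using v(1,2) by (simp add: annR_def)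
    then have "\<one>\<^bsub>R\<^esub> \<notin> p" unfolding v(4) .
    then show "carrier R \<noteq> p" by (metis R.one_closed)
    fix a b assume ab: "a \<in> carrier R" "b \<in> carrier R" "a \<otimes>\<^bsub>R\<^esub> b \<in> p"
    show "a \<in> p \<or> b \<in> p"
    proof (rule disjCI)
      assume "b \<notin> p"
      then have bv: "\<iota> b \<bullet> v \<in> carrier M" "\<iota> b \<bullet> v \<noteq> \<zero>\<^bsub>M\<^esub>" using v(1) ab(2) annR_I[of b v, folded v(4)] by auto
      have le: "p \<subseteq> annR (\<iota> b \<bullet> v)"
      proof
        fix r assume r: "r \<in> p"
        have rc: "r \<in> carrier R" by (rule p.Icarr[OF r])
        have "r \<otimes>\<^bsub>R\<^esub> b \<in> annR v" using p.I_r_closed[OF r ab(2)] v(4) by simp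
        then show "r \<in> annR (\<iota> b \<bullet> v)" using rc ab(2) v(1) unfolding annR_def by (simp add: act_assoc)
      qed
      have "annR (\<iota> b \<bullet> v) \<in> F" using bv le v(3) unfolding F_def by blast
      then have "annR (\<iota> b \<bullet> v) = p" using p(2) le by blast
      moreover have "a \<in> annR (\<iota> b \<bullet> v)" using ab v unfolding v(4) by (simp add: annR_def act_assoc)
      ultimately show "a \<in> p" by simp
    qed
  qed
  have "\<not> \<delta> ` p \<subseteq> p"
  proof
    assume "\<delta> ` p \<subseteq> p"
    then obtain r where "r \<in> p" "\<iota> r \<bullet> v \<noteq> \<zero>\<^bsub>M\<^esub>" using diff_ideal_acts[OF p.is_ideal _ v(3,1,2)] by blast
    then show False unfolding v(4) annR_def by blast
  qed
  then obtain a where a: "a \<in> p" "\<delta> a \<notin> p" by blast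
  have max: "maximalideal p R" by (rule field_ideal_maximal[OF ann_field_ideal[OF prime v(4,1,2) a]])
  have Qp: "Q \<subseteq> p"
  proof
    fix q assume q: "q \<in> Q"
    have "\<iota> q \<bullet> v = \<zero>\<^bsub>M\<^esub>" by (rule ext_kills[OF ext_mem[OF QD(2) q] v(1)])
    then show "q \<in> p" using ideal.Icarr[OF QD(2) q] unfolding v(4) annR_def by simp
  qed
  have "Q' = Q" if Q': "prime_diff_ideal R \<delta> Q'" "Q' \<subseteq> p" "Q \<subseteq> Q'" for Q'
  proof (rule ccontr)
    assume "Q' \<noteq> Q"
    then have "\<not> Q' \<subseteq> Q" using Q'(3) by blast
    then obtain r where "r \<in> Q'" "\<iota> r \<bullet> v \<noteq> \<zero>\<^bsub>M\<^esub>"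
      using diff_ideal_acts[OF prime_diff_idealD(2,3)[OF Q'(1)] _ v(1,2)] by blast
    then show False using Q'(2) unfolding v(4) annR_def by blast
  qed
  then show ?thesis unfolding diff_primitive_def using max Qp by blast
qed

lemma ext_cyclic:
  assumes H: "ideal H R" "\<delta> ` H \<subseteq> H" and r: "r \<in> H" "\<iota> r \<bullet> u \<noteq> \<zero>\<^bsub>M\<^esub>"
    and u: "u \<in> carrier M" and v: "v \<in> carrier M"
  obtains g where "g \<in> ext H" "v = g \<bullet> u"
proof -
  interpret E: ideal "ext H" A by (rule ext_ideal[OF H])
  let ?N = "(\<lambda>g. g \<bullet> u) ` ext H"
  have "submodule ?N A M"
  proof (rule SM.submoduleI)
    show "?N \<subseteq> carrier M" using u E.Icarr by auto
    show "\<zero>\<^bsub>M\<^esub> \<in> ?N" using u E.zero_closed by (auto intro!: image_eqI[of _ _ \<zero>])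
    show "a \<oplus>\<^bsub>M\<^esub> b \<in> ?N" if ab: "a \<in> ?N" "b \<in> ?N" for a b
    proof -
      obtain g h where g: "g \<in> ext H" "h \<in> ext H" "a = g \<bullet> u" "b = h \<bullet> u" using ab by blast
      have "a \<oplus>\<^bsub>M\<^esub> b = (g \<oplus> h) \<bullet> u" unfolding g using act_ladd[OF E.Icarr[OF g(1)] E.Icarr[OF g(2)] u] by simp
      then show ?thesis using E.a_closed[OF g(1,2)] by blast
    qed
    show "a \<bullet> n \<in> ?N" if an: "a \<in> carrier A" "n \<in> ?N" for a n
    proof -
      obtain g where g: "g \<in> ext H" "n = g \<bullet> u" using an by blast
      have "a \<bullet> n = (a \<otimes> g) \<bullet> u" unfolding g using act_assoc[OF an(1) E.Icarr[OF g(1)] u] by simp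
      then show ?thesis using E.I_l_closed[OF g(1) an(1)] by blast
    qed
  qed
  moreover have "\<iota> r \<bullet> u \<in> ?N" using ext_mem[OF H(1) r(1)] by blast
  ultimately have "?N = carrier M" using SM.simple_cases r(2) by blast
  then show ?thesis using that v by blast
qed

text \<open>
  Without relations on \<open>u\<close> whose leading coefficient is outside \<open>Q\<close>,
  the annihilator of \<open>u\<close> is \<open>Q A\<close>. But \<open>u = g u\<close> with
  \<open>g \<in> H A\<close>, so \<open>1 - g \<in> Q A \<subseteq> H A\<close> and \<open>1
  \<in> H\<close>.
\<close>

lemma free_case:
  assumes u: "u \<in> carrier M"
    and free: "\<And>r y n. r \<in> carrier R \<Longrightarrow> y \<in> spanR n \<Longrightarrow> (\<iota> r \<otimes> x [^] (n::nat) \<oplus> y) \<bullet> u = \<zero>\<^bsub>M\<^esub> \<Longrightarrow> r \<in> Q"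
    and H: "ideal H R" "\<delta> ` H \<subseteq> H" "Q \<subset> H" "\<one>\<^bsub>R\<^esub> \<notin> H"
  shows False
proof -
  interpret E: ideal "ext H" A by (rule ext_ideal[OF H(1,2)])
  interpret EQ: ideal "ext Q" A by (rule QD(4))
  have ann_u: "w \<in> ext Q" if "w \<in> spanR n" "w \<bullet> u = \<zero>\<^bsub>M\<^esub>" for w n
    using that
  proof (induction n arbitrary: w)
    case 0
    then show ?case using EQ.zero_closed by simp
  next
    case (Suc n)
    obtain r y where 1: "r \<in> carrier R" "y \<in> spanR n" "w = \<iota> r \<otimes> x [^] n \<oplus> y" using Suc.prems by auto
    have yc: "y \<in> carrier A" using 1 by blast
    have "r \<in> Q" using free[OF 1(1,2)] Suc.prems(2) unfolding 1 by blast
    then have e: "\<iota> r \<otimes> x [^] n \<in> ext Q" using EQ.I_r_closed[OF ext_mem[OF QD(2)]] by simp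
    have "w \<bullet> u = (\<iota> r \<otimes> x [^] n) \<bullet> u \<oplus>\<^bsub>M\<^esub> y \<bullet> u" unfolding 1 using 1(1) yc u by (simp add: act_ladd)
    then have "y \<bullet> u = \<zero>\<^bsub>M\<^esub>" using ext_kills[OF e u] Suc.prems(2) yc u by simp
    then have "y \<in> ext Q" by (rule Suc.IH[OF 1(2)])
    then show ?case unfolding 1 by (rule EQ.a_closed[OF e])
  qed
  obtain r where r: "r \<in> H" "r \<notin> Q" using H(3) by blast
  have rc: "r \<in> carrier R" by (rule ideal.Icarr[OF H(1) r(1)])
  have "\<iota> r \<bullet> u \<noteq> \<zero>\<^bsub>M\<^esub>"
  proof
    assume "\<iota> r \<bullet> u = \<zero>\<^bsub>M\<^esub>"
    then have "(\<iota> r \<otimes> x [^] (0::nat) \<oplus> \<zero>) \<bullet> u = \<zero>\<^bsub>M\<^esub>" using rc by simp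
    then show False using free[OF rc spanR_zero] r(2) by blast
  qed
  then obtain g where g: "g \<in> ext H" "u = g \<bullet> u" using ext_cyclic[OF H(1,2) r(1) _ u u] by blast
  have gc: "g \<in> carrier A" by (rule E.Icarr[OF g(1)])
  have "(\<one> \<ominus> g) \<bullet> u = u \<oplus>\<^bsub>M\<^esub> \<ominus>\<^bsub>M\<^esub> (g \<bullet> u)" using gc u by (simp add: a_minus_def act_ladd act_minus)
  also have "\<dots> = \<zero>\<^bsub>M\<^esub>" unfolding g(2)[symmetric] using u by (simp add: SM.M.r_neg)
  finally have z: "(\<one> \<ominus> g) \<bullet> u = \<zero>\<^bsub>M\<^esub>" .
  have "\<one> \<ominus> g \<in> carrier A" using gc by simp
  then obtain n where "\<one> \<ominus> g \<in> spanR n" unfolding gen by blast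
  then have "\<one> \<ominus> g \<in> ext Q" using ann_u z by blast
  moreover have "ext Q \<subseteq> ext H"
    by (rule ext_minimal[OF E.ideal_axioms]) (use ext_mem[OF H(1)] H(3) in blast)
  ultimately have "\<one> \<ominus> g \<oplus> g \<in> ext H" using E.a_closed g(1) by blast
  then have "\<iota> \<one>\<^bsub>R\<^esub> \<in> ext H" using gc by (simp add: a_minus_def a_assoc l_neg)
  then have "\<one>\<^bsub>R\<^esub> \<in> contr (ext H)" unfolding contr_def by simp
  then show False using contr_ext[OF H(1)] H(4) by simp
qed

text \<open>
  The \<open>R\<close>-submodule of \<open>M\<close> formed by the sums of \<open>r\<^sub>i
  x\<^sup>i u\<close> over \<open>i < n\<close> with \<open>r\<^sub>i \<in> I\<close>.
\<close>

definition "V I u n = (\<lambda>g. g \<bullet> u) ` pspan I n"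

context
  fixes I u
  assumes I: "ideal I R" and u: "u \<in> carrier M"
begin

lemma span_I_closed: "g \<in> pspan I n \<Longrightarrow> g \<in> carrier A"
  using span_in_spanR[of I n] ideal.Icarr[OF I] by blast

lemma V_closed: "v \<in> V I u n \<Longrightarrow> v \<in> carrier M"
  unfolding V_def using span_I_closed u by auto

lemma V_add: "v \<in> V I u n \<Longrightarrow> w \<in> V I u n \<Longrightarrow> v \<oplus>\<^bsub>M\<^esub> w \<in> V I u n"
proof -
  assume "v \<in> V I u n" "w \<in> V I u n"
  then obtain g h where g: "g \<in> pspan I n" "h \<in> pspan I n" "v = g \<bullet> u" "w = h \<bullet> u" unfolding V_def by blast
  have "v \<oplus>\<^bsub>M\<^esub> w = (g \<oplus> h) \<bullet> u" unfolding g(3,4) using act_ladd[OF span_I_closed[OF g(1)] span_I_closed[OF g(2)] u] by simp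
  then show ?thesis unfolding V_def using poly_span_add[OF img_subgroup[OF ideal_subgroup[OF I]] x_closed g(1,2)] by blast
qed

lemma V_scale: "r \<in> carrier R \<Longrightarrow> v \<in> V I u n \<Longrightarrow> \<iota> r \<bullet> v \<in> V I u n"
proof -
  assume r: "r \<in> carrier R" and "v \<in> V I u n"
  then obtain g where g: "g \<in> pspan I n" "v = g \<bullet> u" unfolding V_def by blast
  have "\<iota> r \<bullet> v = (\<iota> r \<otimes> g) \<bullet> u" unfolding g(2) using act_assoc[OF _ span_I_closed[OF g(1)] u] r by simp
  then show ?thesis unfolding V_def using span_ideal_lmult[OF I r g(1)] by blast
qed

lemma V_Suc:
  assumes "v \<in> V I u (Suc n)"
  obtains r w where "r \<in> I" "w \<in> V I u n" "v = \<iota> r \<bullet> (x [^] n \<bullet> u) \<oplus>\<^bsub>M\<^esub> w"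
proof -
  obtain g where g: "g \<in> pspan I (Suc n)" "v = g \<bullet> u" using assms unfolding V_def by blast
  obtain r y where 1: "r \<in> I" "y \<in> pspan I n" "g = \<iota> r \<otimes> x [^] n \<oplus> y" using g(1) by auto
  have c: "r \<in> carrier R" "y \<in> carrier A" using ideal.Icarr[OF I 1(1)] span_I_closed[OF 1(2)] by auto
  have "v = \<iota> r \<bullet> (x [^] n \<bullet> u) \<oplus>\<^bsub>M\<^esub> y \<bullet> u" unfolding g(2) 1(3) using c u by (simp add: act_ladd act_assoc)
  moreover have "y \<bullet> u \<in> V I u n" unfolding V_def using 1(2) by blast
  ultimately show ?thesis using that 1(1) by blast
qed

lemma V_mono: "n \<le> k \<Longrightarrow> V I u n \<subseteq> V I u k"
  unfolding V_def by (intro image_mono poly_span_mono[OF img_subgroup[OF ideal_subgroup[OF I]] x_closed])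

text \<open>
  The relation expresses \<open>f x\<^sup>n u\<close>, for \<open>n \<ge> N\<close>, by terms of
  lower degree; every factor \<open>f\<close> thus lowers the degree by one.
\<close>

lemma push_down:
  assumes f: "f \<in> carrier R" and y: "y \<in> spanR N" and z: "(\<iota> f \<otimes> x [^] N \<oplus> y) \<bullet> u = \<zero>\<^bsub>M\<^esub>"
  shows "v \<in> V I u n \<Longrightarrow> \<exists>k::nat. \<iota> (f [^]\<^bsub>R\<^esub> k) \<bullet> v \<in> V I u N"
proof (induction n arbitrary: v)
  case 0
  then have "v \<in> V I u N" using V_mono[of 0 N] by blast
  then show ?case using V_closed by (intro exI[of _ 0]) simp
next
  case (Suc n)
  have vc: "v \<in> carrier M" by (rule V_closed[OF Suc.prems])
  show ?case
  proof (cases "Suc n \<le> N")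
    case True
    then have "v \<in> V I u N" using V_mono[of "Suc n" N] Suc.prems by blast
    then show ?thesis using V_closed by (intro exI[of _ 0]) simp
  next
    case False
    then obtain j where j: "n = j + N" by (metis add.commute le_iff_add not_less_eq_eq)
    obtain r w where 1: "r \<in> I" "w \<in> V I u n" "v = \<iota> r \<bullet> (x [^] n \<bullet> u) \<oplus>\<^bsub>M\<^esub> w" by (rule V_Suc[OF Suc.prems])
    have rc: "r \<in> carrier R" "w \<in> carrier M" using ideal.Icarr[OF I 1(1)] V_closed[OF 1(2)] by auto
    have yc: "y \<in> carrier A" using y by blast
    obtain z' where z': "z' \<in> spanR j" "x [^] j \<otimes> \<iota> f = \<iota> f \<otimes> x [^] j \<oplus> z'" using pow_comm1[OF f] by blast
    have zc: "z' \<in> carrier A" using z' by blast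
    define h where "h = \<ominus> (x [^] j \<otimes> y \<oplus> z' \<otimes> x [^] N)"
    have hs: "h \<in> spanR n" unfolding h_def j
      by (intro spanR_neg spanR_add span_pow_mult[OF R.oneideal _ y] spanR_xpow[OF z'(1)]) auto
    have hc: "h \<in> carrier A" using hs by blast
    have "\<iota> f \<otimes> x [^] n = (\<iota> f \<otimes> x [^] j) \<otimes> x [^] N"
      unfolding j using f by (simp add: nat_pow_mult m_assoc)
    also have "\<dots> = (x [^] j \<otimes> \<iota> f \<ominus> z') \<otimes> x [^] N"
    proof -
      have "x [^] j \<otimes> \<iota> f \<ominus> z' = \<iota> f \<otimes> x [^] j" unfolding z'(2) using f zc by (simp add: a_minus_def a_assoc r_neg)
      then show ?thesis by simp
    qed
    also have "\<dots> = x [^] j \<otimes> (\<iota> f \<otimes> x [^] N \<oplus> y) \<oplus> h"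
    proof -
      have cl: "x [^] j \<in> carrier A" "x [^] N \<in> carrier A" "\<iota> f \<in> carrier A" using f by auto
      show ?thesis unfolding h_def using cl yc zc by algebra
    qed
    finally have fx: "\<iota> f \<otimes> x [^] n = x [^] j \<otimes> (\<iota> f \<otimes> x [^] N \<oplus> y) \<oplus> h" .
    have wc': "\<iota> f \<otimes> x [^] N \<oplus> y \<in> carrier A" using f yc by simp
    have "(\<iota> f \<otimes> x [^] n) \<bullet> u = x [^] j \<bullet> ((\<iota> f \<otimes> x [^] N \<oplus> y) \<bullet> u) \<oplus>\<^bsub>M\<^esub> h \<bullet> u"
      unfolding fx using act_ladd[OF _ hc u] act_assoc[OF _ wc' u] wc' by simp
    also have "\<dots> = h \<bullet> u" unfolding z using hc u by simp
    finally have hu: "(\<iota> f \<otimes> x [^] n) \<bullet> u = h \<bullet> u" .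
    have "\<iota> f \<bullet> v = \<iota> f \<bullet> (\<iota> r \<bullet> (x [^] n \<bullet> u)) \<oplus>\<^bsub>M\<^esub> \<iota> f \<bullet> w" unfolding 1(3) using f rc u by (simp add: act_radd)
    also have "\<iota> f \<bullet> (\<iota> r \<bullet> (x [^] n \<bullet> u)) = \<iota> r \<bullet> ((\<iota> f \<otimes> x [^] n) \<bullet> u)"
    proof -
      have "\<iota> f \<otimes> \<iota> r = \<iota> r \<otimes> \<iota> f" using f rc by (simp add: R.m_comm flip: \<iota>.hom_mult)
      then have "(\<iota> f \<otimes> \<iota> r) \<bullet> (x [^] n \<bullet> u) = (\<iota> r \<otimes> \<iota> f) \<bullet> (x [^] n \<bullet> u)" by simp
      then show ?thesis using f rc u by (simp add: act_assoc)
    qed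
    also have "\<dots> = (\<iota> r \<otimes> h) \<bullet> u" unfolding hu using rc hc u by (simp add: act_assoc)
    finally have fv: "\<iota> f \<bullet> v = (\<iota> r \<otimes> h) \<bullet> u \<oplus>\<^bsub>M\<^esub> \<iota> f \<bullet> w" .
    have "\<iota> f \<bullet> v \<in> V I u n" unfolding fv
      by (rule V_add[OF _ V_scale[OF f 1(2)]]) (unfold V_def, rule imageI, rule span_ideal_coeff[OF I 1(1) hs])
    then obtain k :: nat where k: "\<iota> (f [^]\<^bsub>R\<^esub> k) \<bullet> (\<iota> f \<bullet> v) \<in> V I u N" using Suc.IH by blast
    have "\<iota> (f [^]\<^bsub>R\<^esub> Suc k) \<bullet> v = \<iota> (f [^]\<^bsub>R\<^esub> k) \<bullet> (\<iota> f \<bullet> v)" using f vc by (simp add: act_assoc)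
    then show ?thesis using k by metis
  qed
qed

text \<open>
  Nakayama's lemma by Gaussian elimination: if \<open>s x\<^sup>j u = r x\<^sup>j u + v\<close>
  with \<open>r \<in> I\<close> and \<open>v\<close> of lower degree, then multiplication by
  \<open>s - r\<close>, which is outside \<open>I\<close>, removes \<open>x\<^sup>j u\<close>
  from all the other equations.
\<close>

lemma eliminate:
  assumes one: "\<one>\<^bsub>R\<^esub> \<notin> I" and prime: "\<And>a b. a \<in> carrier R \<Longrightarrow> b \<in> carrier R \<Longrightarrow> a \<otimes>\<^bsub>R\<^esub> b \<in> I \<Longrightarrow> a \<in> I \<or> b \<in> I"
  shows "j \<le> N \<Longrightarrow> s \<in> carrier R - I \<Longrightarrow> (\<And>i::nat. i < N \<Longrightarrow> \<iota> s \<bullet> (x [^] i \<bullet> u) \<in> V I u j) \<Longrightarrow>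
    \<exists>s \<in> carrier R - I. \<forall>i<N. \<iota> s \<bullet> (x [^] i \<bullet> u) = \<zero>\<^bsub>M\<^esub>"
proof (induction j arbitrary: s)
  case 0
  have "V I u 0 = {\<zero>\<^bsub>M\<^esub>}" unfolding V_def using u by simp
  then show ?case using 0 by blast
next
  case (Suc j)
  interpret I: ideal I R by (rule I)
  have s: "s \<in> carrier R" "s \<notin> I" using Suc.prems by auto
  have jN: "j < N" using Suc.prems by simp
  obtain r v where 1: "r \<in> I" "v \<in> V I u j" "\<iota> s \<bullet> (x [^] j \<bullet> u) = \<iota> r \<bullet> (x [^] j \<bullet> u) \<oplus>\<^bsub>M\<^esub> v"
    by (rule V_Suc[OF Suc.prems(3)[OF jN]])
  have c: "r \<in> carrier R" "v \<in> carrier M" "x [^] j \<bullet> u \<in> carrier M" using I.Icarr[OF 1(1)] V_closed[OF 1(2)] u by auto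
  define t where "t = s \<ominus>\<^bsub>R\<^esub> r"
  have tc: "t \<in> carrier R" unfolding t_def using s c by simp
  have tI: "t \<notin> I"
  proof
    assume "t \<in> I"
    then have "t \<oplus>\<^bsub>R\<^esub> r \<in> I" using 1(1) by (rule I.a_closed)
    moreover have "t \<oplus>\<^bsub>R\<^esub> r = s" unfolding t_def using s c by (simp add: R.minus_eq R.a_assoc R.l_neg)
    ultimately show False using s by simp
  qed
  have tv: "\<iota> t \<bullet> (x [^] j \<bullet> u) = v"
  proof -
    have "\<iota> t \<bullet> (x [^] j \<bullet> u) = \<iota> s \<bullet> (x [^] j \<bullet> u) \<oplus>\<^bsub>M\<^esub> \<ominus>\<^bsub>M\<^esub> (\<iota> r \<bullet> (x [^] j \<bullet> u))"
      unfolding t_def R.minus_eq using s c by (simp add: act_ladd act_minus)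
    then show ?thesis unfolding 1(3) using c by (simp add: SM.M.a_ac SM.M.r_neg SM.M.r_neg1 SM.M.r_neg2)
  qed
  show ?case
  proof (rule Suc.IH)
    show "j \<le> N" using jN by simp
    show "t \<otimes>\<^bsub>R\<^esub> s \<in> carrier R - I" using prime[OF tc s(1)] tI s tc by blast
    fix i assume i: "i < N"
    obtain q w where 2: "q \<in> I" "w \<in> V I u j" "\<iota> s \<bullet> (x [^] i \<bullet> u) = \<iota> q \<bullet> (x [^] j \<bullet> u) \<oplus>\<^bsub>M\<^esub> w"
      by (rule V_Suc[OF Suc.prems(3)[OF i]])
    have c2: "q \<in> carrier R" "w \<in> carrier M" "x [^] i \<bullet> u \<in> carrier M" using I.Icarr[OF 2(1)] V_closed[OF 2(2)] u by auto
    have tq: "\<iota> t \<otimes> \<iota> q = \<iota> q \<otimes> \<iota> t" using tc c2 by (simp add: R.m_comm flip: \<iota>.hom_mult)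
    have "\<iota> (t \<otimes>\<^bsub>R\<^esub> s) \<bullet> (x [^] i \<bullet> u) = \<iota> t \<bullet> (\<iota> s \<bullet> (x [^] i \<bullet> u))" using tc s c2 by (simp add: act_assoc)
    also have "\<dots> = (\<iota> t \<otimes> \<iota> q) \<bullet> (x [^] j \<bullet> u) \<oplus>\<^bsub>M\<^esub> \<iota> t \<bullet> w" unfolding 2(3) using tc c c2 by (simp add: act_radd act_assoc)
    also have "(\<iota> t \<otimes> \<iota> q) \<bullet> (x [^] j \<bullet> u) = \<iota> q \<bullet> v" unfolding tq tv[symmetric] using tc c c2 by (simp add: act_assoc)
    finally show "\<iota> (t \<otimes>\<^bsub>R\<^esub> s) \<bullet> (x [^] i \<bullet> u) \<in> V I u j"
      using V_add[OF V_scale[OF c2(1) 1(2)] V_scale[OF tc 2(2)]] by simp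
  qed
qed

end

text \<open>
  After inverting \<open>f\<close> the module is generated over \<open>R\<close> by \<open>u, x
  u, \<dots>, x\<^sup>N\<^sup>-\<^sup>1 u\<close>, and \<open>M = (H A) u\<close> makes it equal
  to \<open>I M\<close>. As \<open>f \<notin> I\<close>, Nakayama's lemma gives an element
  outside \<open>I\<close> that kills \<open>u\<close>.
\<close>

lemma finite_case:
  assumes u: "u \<in> carrier M" "u \<noteq> \<zero>\<^bsub>M\<^esub>"
    and tf: "\<And>s. s \<in> carrier R \<Longrightarrow> \<iota> s \<bullet> u = \<zero>\<^bsub>M\<^esub> \<Longrightarrow> s \<in> Q"
    and f: "f \<in> carrier R" "f \<notin> Q" and y: "y \<in> spanR N" and z: "(\<iota> f \<otimes> x [^] N \<oplus> y) \<bullet> u = \<zero>\<^bsub>M\<^esub>"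
    and I: "primeideal I R" "Q \<subseteq> I" "f \<notin> I" and H: "ideal H R" "\<delta> ` H \<subseteq> H" "Q \<subset> H" "H \<subseteq> I"
  shows False
proof -
  interpret I: primeideal I R by (rule I)
  note Ii = I.is_ideal
  have one: "\<one>\<^bsub>R\<^esub> \<notin> I" using I.one_imp_carrier I.I_notcarr by blast
  have Npos: "N > 0"
  proof (rule ccontr)
    assume "\<not> N > 0"
    then have "\<iota> f \<bullet> u = \<zero>\<^bsub>M\<^esub>" using z y f by simp
    then show False using tf f by blast
  qed
  have pow: "f [^]\<^bsub>R\<^esub> (k::nat) \<in> carrier R - I" for k
  proof (induction k)
    case (Suc k)
    have "f [^]\<^bsub>R\<^esub> k \<otimes>\<^bsub>R\<^esub> f \<notin> I" using I.I_prime[of "f [^]\<^bsub>R\<^esub> k" f] Suc f(1) I(3) by blast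
    then show ?case using f(1) by simp
  qed (use one in simp)
  obtain r where r: "r \<in> H" "r \<notin> Q" using H(3) by blast
  have ru: "\<iota> r \<bullet> u \<noteq> \<zero>\<^bsub>M\<^esub>" using tf[OF ideal.Icarr[OF H(1) r(1)]] r(2) by blast
  have each: "\<exists>k::nat. \<iota> (f [^]\<^bsub>R\<^esub> k) \<bullet> v \<in> V I u N" if v: "v \<in> carrier M" for v
  proof -
    obtain g where g: "g \<in> ext H" "v = g \<bullet> u" by (rule ext_cyclic[OF H(1,2) r(1) ru u(1) v])
    obtain n where "g \<in> pspan H n" using g(1) unfolding ext_def by blast
    then have "g \<in> pspan I n" using poly_span_mono_set[OF image_mono[OF H(4)]] by blast
    then have "v \<in> V I u n" unfolding V_def g(2) by (rule imageI)
    then show ?thesis by (rule push_down[OF Ii u(1) f(1) y z])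
  qed
  have all: "\<exists>k::nat. \<forall>i<n. \<iota> (f [^]\<^bsub>R\<^esub> k) \<bullet> (x [^] i \<bullet> u) \<in> V I u N" for n :: nat
  proof (induction n)
    case (Suc n)
    obtain k :: nat where k: "\<forall>i<n. \<iota> (f [^]\<^bsub>R\<^esub> k) \<bullet> (x [^] i \<bullet> u) \<in> V I u N" using Suc by blast
    obtain l :: nat where l: "\<iota> (f [^]\<^bsub>R\<^esub> l) \<bullet> (x [^] n \<bullet> u) \<in> V I u N" using each[OF act_closed[OF nat_pow_closed[OF x_closed] u(1)]] by blast
    have split1: "\<iota> (f [^]\<^bsub>R\<^esub> (k + l)) \<bullet> v = \<iota> (f [^]\<^bsub>R\<^esub> l) \<bullet> (\<iota> (f [^]\<^bsub>R\<^esub> k) \<bullet> v)"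
     and split2: "\<iota> (f [^]\<^bsub>R\<^esub> (k + l)) \<bullet> v = \<iota> (f [^]\<^bsub>R\<^esub> k) \<bullet> (\<iota> (f [^]\<^bsub>R\<^esub> l) \<bullet> v)" if v: "v \<in> carrier M" for v
    proof -
      have fc: "f [^]\<^bsub>R\<^esub> k \<in> carrier R" "f [^]\<^bsub>R\<^esub> l \<in> carrier R" using f by auto
      have e: "f [^]\<^bsub>R\<^esub> (k + l) = f [^]\<^bsub>R\<^esub> l \<otimes>\<^bsub>R\<^esub> f [^]\<^bsub>R\<^esub> k" "f [^]\<^bsub>R\<^esub> (k + l) = f [^]\<^bsub>R\<^esub> k \<otimes>\<^bsub>R\<^esub> f [^]\<^bsub>R\<^esub> l"
        using f(1) by (simp_all add: R.nat_pow_mult add.commute)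
      show "\<iota> (f [^]\<^bsub>R\<^esub> (k + l)) \<bullet> v = \<iota> (f [^]\<^bsub>R\<^esub> l) \<bullet> (\<iota> (f [^]\<^bsub>R\<^esub> k) \<bullet> v)"
        unfolding e(1) \<iota>.hom_mult[OF fc(2,1)] by (rule act_assoc[OF \<iota>.hom_closed[OF fc(2)] \<iota>.hom_closed[OF fc(1)] v])
      show "\<iota> (f [^]\<^bsub>R\<^esub> (k + l)) \<bullet> v = \<iota> (f [^]\<^bsub>R\<^esub> k) \<bullet> (\<iota> (f [^]\<^bsub>R\<^esub> l) \<bullet> v)"
        unfolding e(2) \<iota>.hom_mult[OF fc] by (rule act_assoc[OF \<iota>.hom_closed[OF fc(1)] \<iota>.hom_closed[OF fc(2)] v])
    qed
    have "\<iota> (f [^]\<^bsub>R\<^esub> (k + l)) \<bullet> (x [^] i \<bullet> u) \<in> V I u N" if i: "i < Suc n" for i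
    proof (cases "i = n")
      case True
      show ?thesis unfolding True split2[OF act_closed[OF nat_pow_closed[OF x_closed] u(1)]]
        by (rule V_scale[OF Ii u(1) R.nat_pow_closed[OF f(1)] l])
    next
      case False
      then have ki: "\<iota> (f [^]\<^bsub>R\<^esub> k) \<bullet> (x [^] i \<bullet> u) \<in> V I u N" using k i by simp
      show ?thesis unfolding split1[OF act_closed[OF nat_pow_closed[OF x_closed] u(1)]]
        by (rule V_scale[OF Ii u(1) R.nat_pow_closed[OF f(1)] ki])
    qed
    then show ?case by blast
  qed simp
  obtain k :: nat where k: "\<forall>i<N. \<iota> (f [^]\<^bsub>R\<^esub> k) \<bullet> (x [^] i \<bullet> u) \<in> V I u N" using all by blast
  obtain s where s: "s \<in> carrier R - I" "\<forall>i<N. \<iota> s \<bullet> (x [^] i \<bullet> u) = \<zero>\<^bsub>M\<^esub>"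
    using eliminate[OF Ii u(1) one I.I_prime order_refl pow, of N k] k by blast
  have "\<iota> s \<bullet> (x [^] (0::nat) \<bullet> u) = \<zero>\<^bsub>M\<^esub>" using s(2) Npos by blast
  then have "s \<in> Q" using tf s(1) u(1) by simp
  then show False using s(1) I(2) by blast
qed

text \<open>
  Without torsion the choice of the maximal ideal above \<open>Q\<close> depends on a nonzero
  vector \<open>u\<close>: it has to avoid the leading coefficient of a relation on
  \<open>u\<close>, if there is one with leading coefficient outside \<open>Q\<close>.
\<close>

theorem diff_primitive: "diff_primitive R \<delta> Q"
proof (cases "\<exists>u \<in> carrier M. \<exists>s \<in> carrier R. u \<noteq> \<zero>\<^bsub>M\<^esub> \<and> s \<notin> Q \<and> \<iota> s \<bullet> u = \<zero>\<^bsub>M\<^esub>")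
  case True
  then show ?thesis using torsion_case by blast
next
  case False
  obtain u where u: "u \<in> carrier M" "u \<noteq> \<zero>\<^bsub>M\<^esub>" using SM.nonzero_exists by blast
  have tf: "s \<in> Q" if "s \<in> carrier R" "\<iota> s \<bullet> u = \<zero>\<^bsub>M\<^esub>" for s using False u that by blast
  have dom: "domain (R Quot Q)" by (rule primeideal.quotient_is_domain[OF QD(1)])
  have nullst: thesis if "f \<in> carrier R" "f \<notin> Q" "\<And>m. Q \<subseteq> m \<Longrightarrow> field_ideal R m \<Longrightarrow> f \<notin> m \<Longrightarrow> thesis" for f thesis
    by (rule quotient_nullstellensatz[OF K R_alg QD(2) dom S that(1,2)]) (rule that(3))
  \<comment> \<open>\<open>field_ideal\<close> gives maximality, so only the larger prime \<open>\<delta>\<close>-ideals inside \<open>m\<close> have to be excluded\<close>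
  have criterion: "diff_primitive R \<delta> Q" if m: "Q \<subseteq> m" "field_ideal R m"
    and no: "\<And>Q'. prime_diff_ideal R \<delta> Q' \<Longrightarrow> Q' \<subseteq> m \<Longrightarrow> Q \<subset> Q' \<Longrightarrow> False" for m
    unfolding diff_primitive_def
  proof (intro exI[of _ m] conjI allI impI)
    show "Q' = Q" if "prime_diff_ideal R \<delta> Q' \<and> Q' \<subseteq> m \<and> Q \<subseteq> Q'" for Q'
      using no[of Q'] that by blast
  qed (rule field_ideal_maximal[OF m(2)], rule m(1))
  show ?thesis
  proof (cases "\<exists>f y N. f \<in> carrier R \<and> f \<notin> Q \<and> y \<in> spanR N \<and> (\<iota> f \<otimes> x [^] (N::nat) \<oplus> y) \<bullet> u = \<zero>\<^bsub>M\<^esub>")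
    case True
    then obtain f y and N :: nat where f: "f \<in> carrier R" "f \<notin> Q" and y: "y \<in> spanR N"
      and z: "(\<iota> f \<otimes> x [^] N \<oplus> y) \<bullet> u = \<zero>\<^bsub>M\<^esub>" by blast
    show ?thesis
    proof (rule nullst[OF f])
      fix m assume m: "Q \<subseteq> m" "field_ideal R m" "f \<notin> m"
      have mp: "primeideal m R" by (rule R.maximalideal_prime[OF field_ideal_maximal[OF m(2)]])
      show ?thesis
      proof (rule criterion[OF m(1,2)])
        fix Q' assume Q': "prime_diff_ideal R \<delta> Q'" "Q' \<subseteq> m" "Q \<subset> Q'"
        show False by (rule finite_case[OF u tf f y z mp m(1,3) prime_diff_idealD(2,3)[OF Q'(1)] Q'(3,2)])
      qed
    qed
  next
    case False
    show ?thesis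
    proof (rule nullst[OF R.one_closed QD(5)])
      fix m assume m: "Q \<subseteq> m" "field_ideal R m"
      show ?thesis
      proof (rule criterion[OF m])
        fix Q' assume Q': "prime_diff_ideal R \<delta> Q'" "Q' \<subseteq> m" "Q \<subset> Q'"
        show False by (rule free_case[OF u(1) _ prime_diff_idealD(2,3)[OF Q'(1)] Q'(3) prime_diff_idealD(5)[OF Q'(1)]]) (use False in blast)
      qed
    qed
  qed
qed

end

section \<open>The Dixmier-Moeglin equivalence\<close>

context skew_pre
begin

abbreviation "psum f n \<equiv> finsum A (\<lambda>i. \<iota> (f i) \<otimes> x [^] (i::nat)) {..<n}"

lemma psum_term: "f \<in> UNIV \<rightarrow> carrier R \<Longrightarrow> \<iota> (f i) \<otimes> x [^] (i::nat) \<in> carrier A"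
  using funcset_mem[of f UNIV "carrier R" i] by simp

lemma psum_Suc: "f \<in> UNIV \<rightarrow> carrier R \<Longrightarrow> psum f (Suc n) = \<iota> (f n) \<otimes> x [^] n \<oplus> psum f n"
  unfolding lessThan_Suc by (rule finsum_insert) (auto intro: psum_term)

lemma psum_spanR: "f \<in> UNIV \<rightarrow> carrier R \<Longrightarrow> psum f n \<in> spanR n"
proof (induction n)
  case (Suc n)
  have "f n \<in> carrier R" using Suc.prems by blast
  then show ?case unfolding psum_Suc[OF Suc.prems] by (intro poly_span_SucI Suc) blast
qed simp

lemma spanR_psum:
  "u \<in> spanR n \<Longrightarrow> \<exists>f \<in> UNIV \<rightarrow> carrier R. (\<forall>i \<ge> n. f i = \<zero>\<^bsub>R\<^esub>) \<and> u = psum f n"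
proof (induction n arbitrary: u)
  case 0
  then show ?case by (intro bexI[of _ "\<lambda>_. \<zero>\<^bsub>R\<^esub>"]) auto
next
  case (Suc n)
  obtain r y where 1: "r \<in> carrier R" "y \<in> spanR n" "u = \<iota> r \<otimes> x [^] n \<oplus> y" using Suc.prems by auto
  obtain f where f: "f \<in> UNIV \<rightarrow> carrier R" "\<forall>i \<ge> n. f i = \<zero>\<^bsub>R\<^esub>" "y = psum f n" using Suc.IH[OF 1(2)] by blast
  let ?g = "f(n := r)"
  have g: "?g \<in> UNIV \<rightarrow> carrier R" using f(1) 1(1) by auto
  have "psum ?g n = psum f n" using f(1) 1(1) by (intro finsum_cong') (auto intro: psum_term)
  then have "u = psum ?g (Suc n)" unfolding psum_Suc[OF g] 1(3) f(3) by simp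
  then show ?case using g f(2) by (intro bexI[of _ ?g]) auto
qed

text \<open>
  The finitely supported sequences are those that vanish from some index on, so the sum over the
  support is a sum over an initial segment.
\<close>

lemma basis_imp_span:
  assumes bij: "bij_betw (\<lambda>f. \<Oplus>n \<in> {n. f n \<noteq> \<zero>\<^bsub>R\<^esub>}. \<iota> (f n) \<otimes> x [^] n) (up R) (carrier A)"
  shows "carrier A = (\<Union>n. spanR n)"
    and "\<And>r y n. r \<in> carrier R \<Longrightarrow> y \<in> spanR n \<Longrightarrow> \<iota> r \<otimes> x [^] (n::nat) \<oplus> y = \<zero> \<Longrightarrow> r = \<zero>\<^bsub>R\<^esub>"
proof -
  let ?h = "\<lambda>f. \<Oplus>n \<in> {n. f n \<noteq> \<zero>\<^bsub>R\<^esub>}. \<iota> (f n) \<otimes> x [^] n"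
  have h: "?h f = psum f N" if "f \<in> UNIV \<rightarrow> carrier R" "\<forall>i \<ge> N. f i = \<zero>\<^bsub>R\<^esub>" for f N
    using that by (intro add.finprod_mono_neutral_cong_left) (auto simp: not_le[symmetric] intro: psum_term)
  have upI: "f \<in> up R" if "f \<in> UNIV \<rightarrow> carrier R" "\<forall>i \<ge> N. f i = \<zero>\<^bsub>R\<^esub>" for f N
    using that by (intro mem_upI) (auto simp: bound_def intro!: exI[of _ N])
  have upD: "f \<in> UNIV \<rightarrow> carrier R" "\<exists>N. \<forall>i \<ge> N. f i = \<zero>\<^bsub>R\<^esub>" if f: "f \<in> up R" for f
  proof -
    show "f \<in> UNIV \<rightarrow> carrier R" using f by (auto simp: up_def)
    obtain n where "bound \<zero>\<^bsub>R\<^esub> n f" using f by (auto simp: up_def)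
    then have "\<forall>i \<ge> Suc n. f i = \<zero>\<^bsub>R\<^esub>" by (auto simp: bound_def)
    then show "\<exists>N. \<forall>i \<ge> N. f i = \<zero>\<^bsub>R\<^esub>" by blast
  qed
  show "carrier A = (\<Union>n. spanR n)"
  proof
    show "carrier A \<subseteq> (\<Union>n. spanR n)"
    proof
      fix u assume "u \<in> carrier A"
      then obtain f where f: "f \<in> up R" "u = ?h f" using bij unfolding bij_betw_def by blast
      obtain N where N: "\<forall>i \<ge> N. f i = \<zero>\<^bsub>R\<^esub>" using upD(2)[OF f(1)] by blast
      have "u = psum f N" unfolding f(2) by (rule h[OF upD(1)[OF f(1)] N])
      then show "u \<in> (\<Union>n. spanR n)" using psum_spanR[OF upD(1)[OF f(1)]] by blast
    qed
  qed auto
  fix r y n assume r: "r \<in> carrier R" and y: "y \<in> spanR n" and z: "\<iota> r \<otimes> x [^] (n::nat) \<oplus> y = \<zero>"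
  obtain f where f: "f \<in> UNIV \<rightarrow> carrier R" "\<forall>i \<ge> n. f i = \<zero>\<^bsub>R\<^esub>" "y = psum f n" using spanR_psum[OF y] by blast
  let ?g = "f(n := r)" and ?o = "\<lambda>_::nat. \<zero>\<^bsub>R\<^esub>"
  have g: "?g \<in> UNIV \<rightarrow> carrier R" "\<forall>i \<ge> Suc n. ?g i = \<zero>\<^bsub>R\<^esub>" using f(1,2) r by auto
  have "psum ?g n = psum f n" using f(1) r by (intro finsum_cong') (auto intro: psum_term)
  then have "?h ?g = \<zero>" unfolding h[OF g] psum_Suc[OF g(1)] using z f(3) by simp
  moreover have "?h ?o = \<zero>" by simp
  ultimately have "?h ?g = ?h ?o" by (rule trans[OF _ sym])
  moreover have "?g \<in> up R" "?o \<in> up R" using upI[OF g] upI[of ?o 0] by (auto simp only: Pi_iff R.zero_closed)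
  ultimately have "?g = ?o" by (rule inj_onD[OF bij_betw_imp_inj_on[OF bij]])
  then show "r = \<zero>\<^bsub>R\<^esub>" by (metis fun_upd_same)
qed

end

lemma nat_units_algebra:
  assumes K: "field K" and char: "char_zero K" and h: "h \<in> ring_hom K R" and R: "ring R"
  shows "nat_units R"
  unfolding nat_units_def
proof (intro allI impI)
  fix n :: nat assume n: "n > 0"
  interpret K: field K by (rule K)
  interpret h: ring_hom_ring K R h by (rule ring_hom_ringI2[OF K.ring_axioms R h])
  have "h (add_pow K m \<one>\<^bsub>K\<^esub>) = add_pow R m \<one>\<^bsub>R\<^esub>" for m :: nat by (induction m) auto
  note hn = this
  have "add_pow K n \<one>\<^bsub>K\<^esub> \<in> carrier K - {\<zero>\<^bsub>K\<^esub>}" using char n unfolding char_zero_def by simp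
  then have "add_pow K n \<one>\<^bsub>K\<^esub> \<in> Units K" unfolding K.field_Units .
  then obtain c where c: "c \<in> carrier K" "c \<otimes>\<^bsub>K\<^esub> add_pow K n \<one>\<^bsub>K\<^esub> = \<one>\<^bsub>K\<^esub>" unfolding Units_def by blast
  have "h c \<otimes>\<^bsub>R\<^esub> h (add_pow K n \<one>\<^bsub>K\<^esub>) = \<one>\<^bsub>R\<^esub>" using c by (simp flip: h.hom_mult)
  then have "h c \<otimes>\<^bsub>R\<^esub> add_pow R n \<one>\<^bsub>R\<^esub> = \<one>\<^bsub>R\<^esub>" by (simp only: hn)
  then show "\<exists>c \<in> carrier R. c \<otimes>\<^bsub>R\<^esub> add_pow R n \<one>\<^bsub>R\<^esub> = \<one>\<^bsub>R\<^esub>" by (rule bexI[OF _ h.hom_closed[OF c(1)]])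
qed

lemma ore_extension_affine_skew:
  assumes K: "field K" and char: "char_zero K" and aff: "affine_algebra K R" and der: "derivation K R \<delta>"
    and ore: "ore_extension K R \<delta> A \<iota> x"
  obtains S where "affine_skew K R A \<delta> \<iota> x S"
proof -
  have alg: "algebra K R" and dom: "domain R" using aff unfolding affine_algebra_def by auto
  obtain S where S: "finite S" "S \<subseteq> carrier R" "generate_ring R (scalars K R \<union> S) = carrier R"
    using aff unfolding affine_algebra_def by blast
  have R: "assoc_algebra K R" by (rule algebra_assoc_algebra[OF alg])
  interpret R: domain R by (rule dom)
  note sf = scalars_subfield[OF K R R.one_not_zero]
  have A: "assoc_algebra K A" and hom: "\<iota> \<in> ring_hom R A" and x: "x \<in> carrier A"
    and lin: "\<And>c r. c \<in> carrier K \<Longrightarrow> r \<in> carrier R \<Longrightarrow> \<iota> (c \<odot>\<^bsub>R\<^esub> r) = c \<odot>\<^bsub>A\<^esub> \<iota> r"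
    and bij: "bij_betw (\<lambda>f. \<Oplus>\<^bsub>A\<^esub>n \<in> {n. f n \<noteq> \<zero>\<^bsub>R\<^esub>}. \<iota> (f n) \<otimes>\<^bsub>A\<^esub> x [^]\<^bsub>A\<^esub> n) (up R) (carrier A)"
    and comm: "\<And>r. r \<in> carrier R \<Longrightarrow> x \<otimes>\<^bsub>A\<^esub> \<iota> r = \<iota> r \<otimes>\<^bsub>A\<^esub> x \<oplus>\<^bsub>A\<^esub> \<iota> (\<delta> r)"
    using ore unfolding ore_extension_def by auto
  interpret A: assoc_algebra K A by (rule A)
  have pre: "skew_pre R A \<delta> \<iota> x"
    by (intro skew_pre.intro skew_pre_axioms.intro R.cring_axioms A.ring_axioms hom x comm)
      (use der in \<open>auto simp: derivation_def\<close>)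
  note basis = skew_pre.basis_imp_span[OF pre bij]
  have gen: "skew_gen R A \<delta> \<iota> x" by (intro skew_gen.intro skew_gen_axioms.intro pre basis(1))
  have acc: "acc_ideals R" using R.acc_ideals_generate_ring[OF sf(1) S(1,2)] unfolding S(3) by simp
  have scal: "\<iota> ` scalars K R = scalars K A"
    unfolding scalars_def image_image using lin[OF _ R.one_closed] ring_hom_one[OF hom] by (intro image_cong) auto
  have "affine_skew K R A \<delta> \<iota> x S"
    by (intro affine_skew.intro affine_skew_axioms.intro gen K R A scal acc S
        nat_units_algebra[OF K char sf(2) R.ring_axioms]) (rule basis(2))
  then show ?thesis by (rule that)
qed

context affine_skew
begin

lemma prime_cases:
  assumes P: "prime_ideal A P"
  obtains (commutative) "comm_quotient K A (insert x (\<iota> ` S)) P"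
    | (extended) b0 where "b0 \<in> carrier R" "\<delta> b0 \<notin> contr P" "prime_diff_ideal R \<delta> (contr P)" "P = ext (contr P)"
proof (cases "\<delta> ` carrier R \<subseteq> contr P")
  case True
  then show ?thesis using commutative comm_case[OF P] by blast
next
  case False
  then obtain b0 where b: "b0 \<in> carrier R" "\<delta> b0 \<notin> contr P" by blast
  show ?thesis by (rule extended[OF b contr_prime_diff[OF P] noncomm_case[OF P b]])
qed

lemma primitive_imp_diff_primitive:
  assumes Q: "prime_diff_ideal R \<delta> Q" and prim: "primitive_ideal A (ext Q)"
  shows "diff_primitive R \<delta> Q"
proof -
  obtain M :: "('b, 'b set) module" where M: "simple_left_module A M" "ext Q = annihilator A M"
    using prim unfolding primitive_ideal_def by blast
  show ?thesis
    by (rule affine_skew_module.diff_primitive[of K R A \<delta> \<iota> x S M])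
      (intro affine_skew_module.intro affine_skew_module_axioms.intro affine_skew_axioms simple_moduleI M(1) Q M(2)[symmetric])
qed

lemma rational_imp_locally_closed:
  assumes H: "\<And>Q. prime_diff_ideal R \<delta> Q \<Longrightarrow> diff_rational K R \<delta> Q \<Longrightarrow> diff_locally_closed R \<delta> Q"
    and P: "prime_ideal A P" "rational K A P"
  shows "locally_closed A P"
  using P(1)
proof (cases rule: prime_cases)
  case commutative
  then show ?thesis using comm_quotient.rational_imp_field comm_quotient.field_imp_locally_closed P(2) by blast
next
  case (extended b0)
  note Q = extended(3,1,2)
  have "diff_rational K R \<delta> (contr P)" using ext_rational_iff[OF Q] P(2) unfolding extended(4)[symmetric] by blast
  then have "locally_closed A (ext (contr P))" using ext_locally_closed_iff[OF Q] H[OF extended(3)] by blast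
  then show ?thesis unfolding extended(4)[symmetric] .
qed

lemma diff_DME_imp_DME:
  assumes H: "diff_DME K R \<delta>"
  shows "DME K A"
  unfolding DME_def
proof (intro allI impI)
  fix P assume P: "prime_ideal A P"
  then show "(primitive_ideal A P \<longleftrightarrow> locally_closed A P) \<and> (locally_closed A P \<longleftrightarrow> rational K A P)"
  proof (cases rule: prime_cases)
    case commutative
    interpret C: comm_quotient K A "insert x (\<iota> ` S)" P by (rule commutative)
    show ?thesis
      using C.field_imp_primitive C.primitive_imp_field C.field_imp_locally_closed C.locally_closed_imp_field
        C.field_imp_rational C.rational_imp_field by blast
  next
    case (extended b0)
    note Q = extended(3,1,2)
    have "primitive_ideal A (ext (contr P)) \<longleftrightarrow> diff_primitive R \<delta> (contr P)"
      using primitive_imp_diff_primitive[OF Q(1)] diff_primitive_imp_primitive[OF Q] by blast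
    moreover have "(diff_primitive R \<delta> (contr P) \<longleftrightarrow> diff_locally_closed R \<delta> (contr P)) \<and>
        (diff_locally_closed R \<delta> (contr P) \<longleftrightarrow> diff_rational K R \<delta> (contr P))"
      using H Q(1) unfolding diff_DME_def by blast
    ultimately have "(primitive_ideal A (ext (contr P)) \<longleftrightarrow> locally_closed A (ext (contr P))) \<and>
        (locally_closed A (ext (contr P)) \<longleftrightarrow> rational K A (ext (contr P)))"
      using ext_locally_closed_iff[OF Q] ext_rational_iff[OF Q] by blast
    then show ?thesis unfolding extended(4)[symmetric] .
  qed
qed

end

theorem proposition4p6:
  fixes K :: "'k ring" and R :: "('k, 'a) module" and \<delta> :: "'a \<Rightarrow> 'a"
    and A :: "('k, 'b) module" and \<iota> :: "'a \<Rightarrow> 'b" and x :: 'b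
  assumes "field K" and "char_zero K"
    and "affine_algebra K R" and "derivation K R \<delta>"
    and "ore_extension K R \<delta> A \<iota> x"
  shows "((\<forall>P. prime_diff_ideal R \<delta> P \<and> diff_rational K R \<delta> P \<longrightarrow> diff_locally_closed R \<delta> P)
            \<longrightarrow> (\<forall>P. prime_ideal A P \<and> rational K A P \<longrightarrow> locally_closed A P))
         \<and> (diff_DME K R \<delta> \<longrightarrow> DME K A)"
proof -
  obtain S where "affine_skew K R A \<delta> \<iota> x S" by (rule ore_extension_affine_skew[OF assms])
  then interpret affine_skew K R A \<delta> \<iota> x S .
  show ?thesis using rational_imp_locally_closed diff_DME_imp_DME by blast
qed

end
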